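(* Let $E$ be the infinite dimensional Grassmann algebra over a field of characteristic $0$ and $UT_3(E)$ the algebra of $3\times3$ upper triangular matrices over $E$. Let $\lambda$ be a partition with $\lambda\in H(1,1)$. The multiplicity $m_\lambda$ in the cocharacter sequence of $UT_3(E)$ is $$m_\lambda=\begin{cases} 1 & \text{if }\lambda=(n),\ n\ge0,\\ 1 & \text{if }\lambda=(1^m),\ m>1,\\ n & \text{if }\lambda=(n,1),\ n\ge2,\\ m+1 & \text{if }\lambda=(2,1^m),\ m\ge2,\\ \frac14\big(76-90m+26m^2-54n+68mn-20m^2n+10n^2-12mn^2+4m^2n^2\big) & \text{if }\lambda=(n,1^m),\ n\ge3,\ m\ge2. \end{cases}$$
   Context: $H(1,1)$ is the set of partitions $\lambda$ with $\lambda_2\le1$ (hook shapes, including the empty partition). For a PI-algebra $A$ over a field of characteristic $0$, $m_\lambda(A)$ denotes the multiplicity of the irreducible character $\chi_\lambda$ ($\lambda\vdash n$) in the $n$-th cocharacter of $A$, i.e. the $S_n$-character of $P_n/(P_n\cap T(A))$, where $P_n$ is the space of multilinear polynomials in $x_1,\dots,x_n$ (with the left $S_n$-action permuting variables) and $T(A)$ is the ideal of polynomial identities of $A$. *)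

theory Defs
  imports "HOL-Analysis.Analysis" "HOL-Combinatorics.Permutations"
begin

section \<open>The infinite dimensional Grassmann algebra\<close>

text \<open>
  The Grassmann algebra on generators \<open>e\<^sub>0, e\<^sub>1, \<dots>\<close> has as basis the monomials
  \<open>e\<^sub>S = e\<^bsub>i1\<^esub> \<cdots> e\<^bsub>ik\<^esub>\<close> for finite \<open>S = {i1 < \<dots> < ik}\<close>. An element is its coefficient function.
  One has \<open>e\<^sub>S e\<^sub>T = \<plusminus> e\<^bsub>S \<union> T\<^esub>\<close> for disjoint \<open>S, T\<close>, the sign counting the transpositions needed to
  sort the product, and \<open>e\<^sub>S e\<^sub>T = 0\<close> otherwise.
\<close>

typedef (overloaded) 'k grassmann =
  "{f :: nat set \<Rightarrow> 'k::zero. finite {S. f S \<noteq> 0} \<and> (\<forall>S. f S \<noteq> 0 \<longrightarrow> finite S)}"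
  morphisms gcoeff Abs_grassmann
  by (rule exI[of _ "\<lambda>_. 0"]) auto

setup_lifting type_definition_grassmann

definition gsign :: "nat set \<Rightarrow> nat set \<Rightarrow> 'k::comm_ring_1" where
  "gsign S T = (- 1) ^ card {(s, t). s \<in> S \<and> t \<in> T \<and> t < s}"

lemma finite_gcoeff: "finite {S. gcoeff x S \<noteq> 0}"
  using gcoeff[of x] by auto

lemma gcoeff_infinite: "infinite S \<Longrightarrow> gcoeff x S = 0"
  using gcoeff[of x] by auto

lemma gsign_Un_left:
  assumes "finite S" "finite T" "finite R" "S \<inter> T = {}"
  shows "gsign (S \<union> T) R = gsign S R * gsign T R"
proof -
  have "{(s, t). s \<in> S \<union> T \<and> t \<in> R \<and> t < s}
      = {(s, t). s \<in> S \<and> t \<in> R \<and> t < s} \<union> {(s, t). s \<in> T \<and> t \<in> R \<and> t < s}" by auto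
  moreover have "finite {(s, t). s \<in> S \<and> t \<in> R \<and> t < s}"
    by (rule finite_subset[of _ "S \<times> R"]) (use assms in auto)
  moreover have "finite {(s, t). s \<in> T \<and> t \<in> R \<and> t < s}"
    by (rule finite_subset[of _ "T \<times> R"]) (use assms in auto)
  moreover have "{(s, t). s \<in> S \<and> t \<in> R \<and> t < s} \<inter> {(s, t). s \<in> T \<and> t \<in> R \<and> t < s} = {}"
    using assms by auto
  ultimately show ?thesis
    unfolding gsign_def by (simp add: card_Un_disjoint power_add)
qed

lemma gsign_Un_right:
  assumes "finite S" "finite T" "finite R" "T \<inter> R = {}"
  shows "gsign S (T \<union> R) = gsign S T * gsign S R"
proof -
  have "{(s, t). s \<in> S \<and> t \<in> T \<union> R \<and> t < s}
      = {(s, t). s \<in> S \<and> t \<in> T \<and> t < s} \<union> {(s, t). s \<in> S \<and> t \<in> R \<and> t < s}" by auto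
  moreover have "finite {(s, t). s \<in> S \<and> t \<in> T \<and> t < s}"
    by (rule finite_subset[of _ "S \<times> T"]) (use assms in auto)
  moreover have "finite {(s, t). s \<in> S \<and> t \<in> R \<and> t < s}"
    by (rule finite_subset[of _ "S \<times> R"]) (use assms in auto)
  moreover have "{(s, t). s \<in> S \<and> t \<in> T \<and> t < s} \<inter> {(s, t). s \<in> S \<and> t \<in> R \<and> t < s} = {}"
    using assms by auto
  ultimately show ?thesis
    unfolding gsign_def by (simp add: card_Un_disjoint power_add)
qed

lemma gsign_empty [simp]: "gsign {} T = 1" "gsign S {} = 1"
  by (simp_all add: gsign_def)

instantiation grassmann :: (comm_ring_1) ring_1
begin

lift_definition zero_grassmann :: "'a grassmann" is "\<lambda>_. 0" by simp

lift_definition one_grassmann :: "'a grassmann" is "\<lambda>S. if S = {} then 1 else 0"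
  by (auto split: if_splits)

lift_definition plus_grassmann :: "'a grassmann \<Rightarrow> 'a grassmann \<Rightarrow> 'a grassmann"
  is "\<lambda>f g S. f S + g S"
proof -
  fix f g :: "nat set \<Rightarrow> 'a"
  assume f: "finite {S. f S \<noteq> 0} \<and> (\<forall>S. f S \<noteq> 0 \<longrightarrow> finite S)"
    and g: "finite {S. g S \<noteq> 0} \<and> (\<forall>S. g S \<noteq> 0 \<longrightarrow> finite S)"
  have "finite {S. f S + g S \<noteq> 0}"
    by (rule finite_subset[of _ "{S. f S \<noteq> 0} \<union> {S. g S \<noteq> 0}"]) (use f g in auto)
  moreover have "\<forall>S. f S + g S \<noteq> 0 \<longrightarrow> finite S"
    using f g by (metis add.right_neutral)
  ultimately show "finite {S. f S + g S \<noteq> 0} \<and> (\<forall>S. f S + g S \<noteq> 0 \<longrightarrow> finite S)" by blast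
qed

lift_definition uminus_grassmann :: "'a grassmann \<Rightarrow> 'a grassmann" is "\<lambda>f S. - f S" by simp

definition minus_grassmann :: "'a grassmann \<Rightarrow> 'a grassmann \<Rightarrow> 'a grassmann" where
  "minus_grassmann x y = x + (- y)"

lift_definition times_grassmann :: "'a grassmann \<Rightarrow> 'a grassmann \<Rightarrow> 'a grassmann"
  is "\<lambda>f g U. \<Sum>S\<in>Pow U. gsign S (U - S) * f S * g (U - S)"
proof -
  fix f g :: "nat set \<Rightarrow> 'a"
  assume f: "finite {S. f S \<noteq> 0} \<and> (\<forall>S. f S \<noteq> 0 \<longrightarrow> finite S)"
    and g: "finite {S. g S \<noteq> 0} \<and> (\<forall>S. g S \<noteq> 0 \<longrightarrow> finite S)"
  let ?h = "\<lambda>U. \<Sum>S\<in>Pow U. gsign S (U - S) * f S * g (U - S)"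
  have ex: "\<exists>S\<in>Pow U. f S \<noteq> 0 \<and> g (U - S) \<noteq> 0" if U: "?h U \<noteq> 0" for U
  proof (rule ccontr)
    assume "\<not> ?thesis"
    then have z: "f S = 0 \<or> g (U - S) = 0" if "S \<in> Pow U" for S using that by blast
    have "gsign S (U - S) * f S * g (U - S) = 0" if "S \<in> Pow U" for S using z[OF that] by auto
    then have "?h U = 0" by (intro sum.neutral ballI)
    with U show False by contradiction
  qed
  have "{U. ?h U \<noteq> 0} \<subseteq> (\<lambda>(S, T). S \<union> T) ` ({S. f S \<noteq> 0} \<times> {S. g S \<noteq> 0})"
  proof
    fix U assume "U \<in> {U. ?h U \<noteq> 0}"
    then obtain S where S: "S \<subseteq> U" "f S \<noteq> 0" "g (U - S) \<noteq> 0" using ex by blast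
    then show "U \<in> (\<lambda>(S, T). S \<union> T) ` ({S. f S \<noteq> 0} \<times> {S. g S \<noteq> 0})"
      by (intro image_eqI[of _ _ "(S, U - S)"]) auto
  qed
  then have "finite {U. ?h U \<noteq> 0}" using f g finite_subset by blast
  moreover have "\<forall>U. ?h U \<noteq> 0 \<longrightarrow> finite U"
  proof (intro allI impI)
    fix U assume "?h U \<noteq> 0"
    then obtain S where "S \<subseteq> U" "f S \<noteq> 0" "g (U - S) \<noteq> 0" using ex by blast
    then show "finite U" using f g by (metis Diff_infinite_finite)
  qed
  ultimately show "finite {U. ?h U \<noteq> 0} \<and> (\<forall>U. ?h U \<noteq> 0 \<longrightarrow> finite U)" by blast
qed

instance
proof
  fix a b c :: "'a grassmann"
  show "a + b + c = a + (b + c)" by transfer (simp add: add.assoc)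
  show "a + b = b + a" by transfer (simp add: add.commute)
  show "0 + a = a" by transfer simp
  show "- a + a = 0" by transfer simp
  show "a - b = a + - b" by (simp add: minus_grassmann_def)
  show "(a + b) * c = a * c + b * c"
    by transfer (simp add: distrib_left distrib_right sum.distrib)
  show "a * (b + c) = a * b + a * c"
    by transfer (simp add: distrib_left distrib_right sum.distrib)
  show "(0 :: 'a grassmann) \<noteq> 1" by transfer (metis zero_neq_one)
  show "1 * a = a"
  proof (transfer, rule ext)
    fix f :: "nat set \<Rightarrow> 'a" and U
    assume f: "finite {S. f S \<noteq> 0} \<and> (\<forall>S. f S \<noteq> 0 \<longrightarrow> finite S)"
    show "(\<Sum>S\<in>Pow U. gsign S (U - S) * (if S = {} then 1 else 0) * f (U - S)) = f U"
    proof (cases "finite U")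
      case True
      have "(\<Sum>S\<in>Pow U. gsign S (U - S) * (if S = {} then 1 else 0) * f (U - S))
          = (\<Sum>S\<in>Pow U. if S = {} then f U else 0)" by (rule sum.cong) auto
      then show ?thesis using True by simp
    qed (use f in auto)
  qed
  show "a * 1 = a"
  proof (transfer, rule ext)
    fix f :: "nat set \<Rightarrow> 'a" and U
    assume f: "finite {S. f S \<noteq> 0} \<and> (\<forall>S. f S \<noteq> 0 \<longrightarrow> finite S)"
    show "(\<Sum>S\<in>Pow U. gsign S (U - S) * f S * (if U - S = {} then 1 else 0)) = f U"
    proof (cases "finite U")
      case True
      have "(\<Sum>S\<in>Pow U. gsign S (U - S) * f S * (if U - S = {} then 1 else 0))
          = (\<Sum>S\<in>Pow U. if S = U then f U else 0)" by (rule sum.cong) auto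
      then show ?thesis using True by simp
    qed (use f in auto)
  qed
  show "a * b * c = a * (b * c)"
  proof (transfer, rule ext)
    fix f g h :: "nat set \<Rightarrow> 'a" and U
    let ?L = "\<Sum>V\<in>Pow U. gsign V (U - V) * (\<Sum>S\<in>Pow V. gsign S (V - S) * f S * g (V - S)) * h (U - V)"
    let ?R = "\<Sum>S\<in>Pow U. gsign S (U - S) * f S *
      (\<Sum>T\<in>Pow (U - S). gsign T (U - S - T) * g T * h (U - S - T))"
    show "?L = ?R"
    proof (cases "finite U")
      case True
      have fin: "finite V" if "V \<subseteq> U" for V using that True finite_subset by blast
      have "?L = (\<Sum>V\<in>Pow U. \<Sum>S\<in>Pow V. gsign V (U - V) * (gsign S (V - S) * f S * g (V - S)) * h (U - V))"
        by (simp add: sum_distrib_left sum_distrib_right)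
      also have "\<dots> = (\<Sum>(V, S)\<in>(SIGMA V:Pow U. Pow V).
          gsign V (U - V) * (gsign S (V - S) * f S * g (V - S)) * h (U - V))"
        by (rule sum.Sigma) (use True fin in auto)
      also have "\<dots> = (\<Sum>(S, T)\<in>(SIGMA S:Pow U. Pow (U - S)).
          gsign S (U - S) * f S * (gsign T (U - S - T) * g T * h (U - S - T)))"
      proof (rule sum.reindex_bij_witness[where j = "\<lambda>(V, S). (S, V - S)" and i = "\<lambda>(S, T). (S \<union> T, S)"],
          goal_cases)
        case (5 p)
        then obtain V S where p: "p = (V, S)" "V \<subseteq> U" "S \<subseteq> V" by auto
        have e1: "V = S \<union> (V - S)" and e2: "U - S = (V - S) \<union> (U - V)"
          and e3: "U - S - (V - S) = U - V" using p by auto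
        have "(gsign V (U - V) :: 'a) = gsign S (U - V) * gsign (V - S) (U - V)"
          by (subst e1, rule gsign_Un_left) (use p True fin in auto)
        moreover have "(gsign S (U - S) :: 'a) = gsign S (V - S) * gsign S (U - V)"
          by (subst e2, rule gsign_Un_right) (use p True fin in auto)
        ultimately show ?case unfolding p by (simp add: e3 ac_simps)
      qed auto
      also have "\<dots> = (\<Sum>S\<in>Pow U. \<Sum>T\<in>Pow (U - S).
          gsign S (U - S) * f S * (gsign T (U - S - T) * g T * h (U - S - T)))"
        by (rule sum.Sigma[symmetric]) (use True fin in auto)
      also have "\<dots> = ?R" by (simp add: sum_distrib_left)
      finally show ?thesis .
    qed simp
  qed
qed

end

lift_definition gscale :: "'k::comm_ring_1 \<Rightarrow> 'k grassmann \<Rightarrow> 'k grassmann" is "\<lambda>c f S. c * f S"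
proof -
  fix c and f :: "nat set \<Rightarrow> 'k"
  assume f: "finite {S. f S \<noteq> 0} \<and> (\<forall>S. f S \<noteq> 0 \<longrightarrow> finite S)"
  have "finite {S. c * f S \<noteq> 0}"
    by (rule finite_subset[of _ "{S. f S \<noteq> 0}"]) (use f in auto)
  with f show "finite {S. c * f S \<noteq> 0} \<and> (\<forall>S. c * f S \<noteq> 0 \<longrightarrow> finite S)" by (metis mult_zero_right)
qed

lift_definition ggen :: "nat \<Rightarrow> 'k::comm_ring_1 grassmann" is "\<lambda>i S. if S = {i} then 1 else 0"
  by (auto split: if_splits)

lemma ggen_anticommute: "ggen i * ggen j = - (ggen j * ggen i :: 'k::comm_ring_1 grassmann)"
  and ggen_square: "ggen i * ggen i = (0 :: 'k::comm_ring_1 grassmann)"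
proof -
  have expand: "(\<Sum>S\<in>Pow U. gsign S (U - S) * (if S = {i} then 1 else 0) * (if U - S = {j} then 1 else 0))
      = (if i \<noteq> j \<and> U = {i, j} then gsign {i} {j} else (0 :: 'k))" for U i j
  proof (cases "finite U")
    case True
    have "(\<Sum>S\<in>Pow U. gsign S (U - S) * (if S = {i} then 1 else 0) * (if U - S = {j} then 1 else 0))
        = (\<Sum>S\<in>Pow U. if S = {i} then gsign {i} (U - {i}) * (if U - {i} = {j} then 1 else (0 :: 'k)) else 0)"
      by (rule sum.cong) auto
    also have "\<dots> = (if i \<noteq> j \<and> U = {i, j} then gsign {i} {j} else (0 :: 'k))"
      using True by (auto simp: insert_Diff_if)
    finally show ?thesis .
  qed auto
  have sg: "gsign {i} {j} = (- gsign {j} {i} :: 'k)" if "i \<noteq> j" for i j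
  proof -
    have "{(s, t). s \<in> {a} \<and> t \<in> {b} \<and> t < s} = (if b < a then {(a, b)} else {})" for a b :: nat
      by auto
    then show ?thesis using that unfolding gsign_def by auto
  qed
  show "ggen i * ggen j = - (ggen j * ggen i :: 'k grassmann)"
  proof (transfer, rule ext, unfold expand)
    fix i j :: nat and U
    show "(if i \<noteq> j \<and> U = {i, j} then gsign {i} {j} else 0)
        = - (if j \<noteq> i \<and> U = {j, i} then gsign {j} {i} else (0 :: 'k))"
      using sg[of i j] by (simp add: insert_commute)
  qed
  show "ggen i * ggen i = (0 :: 'k grassmann)"
    by (transfer, rule ext, unfold expand) simp
qed

section \<open>Upper triangular matrices\<close>

typedef (overloaded) ('a, 'n) ut =
  "{A :: 'a::zero ^ 'n::{finite,linorder} ^ 'n::{finite,linorder}. \<forall>i j. j < i \<longrightarrow> A $ i $ j = 0}"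
  morphisms ut_mat Abs_ut
  by (rule exI[of _ "\<chi> i j. 0"]) simp

setup_lifting type_definition_ut

instantiation ut :: (ring_1, "{finite,linorder}") ring_1
begin

lift_definition zero_ut :: "('a, 'b) ut" is 0 by simp

lift_definition one_ut :: "('a, 'b) ut" is "mat 1" by (simp add: mat_def)

lift_definition plus_ut :: "('a, 'b) ut \<Rightarrow> ('a, 'b) ut \<Rightarrow> ('a, 'b) ut" is "(+)" by simp

lift_definition uminus_ut :: "('a, 'b) ut \<Rightarrow> ('a, 'b) ut" is uminus by simp

lift_definition minus_ut :: "('a, 'b) ut \<Rightarrow> ('a, 'b) ut \<Rightarrow> ('a, 'b) ut" is "(-)" by simp

lift_definition times_ut :: "('a, 'b) ut \<Rightarrow> ('a, 'b) ut \<Rightarrow> ('a, 'b) ut" is "(**)"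
proof -
  fix A B :: "'a ^ 'b::{finite,linorder} ^ 'b::{finite,linorder}" and i j :: 'b
  assume A: "\<And>i j. j < i \<Longrightarrow> A $ i $ j = 0" and B: "\<And>i j. j < i \<Longrightarrow> B $ i $ j = 0" and ji: "j < i"
  have "A $ i $ k * B $ k $ j = 0" for k
    using A B ji by (cases "k < i") (auto simp: not_less)
  then show "(A ** B) $ i $ j = 0" by (simp add: matrix_matrix_mult_def)
qed

instance
proof
  fix a b c :: "('a, 'b) ut"
  show "a * b * c = a * (b * c)" by transfer (simp add: matrix_mul_assoc)
  show "1 * a = a" by transfer simp
  show "a * 1 = a" by transfer simp
  show "(a + b) * c = a * c + b * c"
    by transfer (vector matrix_matrix_mult_def sum.distrib[symmetric] distrib_right)
  show "a * (b + c) = a * b + a * c" by transfer (simp add: matrix_add_ldistrib)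
  show "(0 :: ('a, 'b) ut) \<noteq> 1" by transfer (simp add: mat_def vec_eq_iff)
qed (transfer; simp)+

end

text \<open>
  Entrywise scalar multiplication. The case distinction is only there to make the result upper
  triangular for an arbitrary function \<open>s\<close>; it is vacuous when \<open>s c 0 = 0\<close>.
\<close>

lift_definition ut_scale ::
  "('k \<Rightarrow> 'a \<Rightarrow> 'a) \<Rightarrow> 'k \<Rightarrow> ('a::ring_1, 'n::{finite,linorder}) ut \<Rightarrow> ('a, 'n) ut"
  is "\<lambda>s c A. \<chi> i j. if j < i then 0 else s c (A $ i $ j)"
  by simp

section \<open>Polynomial identities\<close>

text \<open>
  The free unital algebra on variables indexed by \<open>nat\<close>: a polynomial is its finitely supported
  coefficient function on words. In \<open>multilinear n\<close> the variables are \<open>x\<^sub>0, \<dots>, x\<^bsub>n-1\<^esub>\<close>.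
  An algebra over \<open>'k\<close> is given by a ring type \<open>'a\<close> together with its scalar multiplication.
\<close>

definition free_algebra :: "(nat list \<Rightarrow> 'k::zero) set" where
  "free_algebra = {f. finite {w. f w \<noteq> 0}}"

definition evaluate :: "('k::zero \<Rightarrow> 'a::ring_1 \<Rightarrow> 'a) \<Rightarrow> (nat \<Rightarrow> 'a) \<Rightarrow> (nat list \<Rightarrow> 'k) \<Rightarrow> 'a" where
  "evaluate smul \<phi> f = (\<Sum>w | f w \<noteq> 0. smul (f w) (prod_list (map \<phi> w)))"

definition T_ideal :: "('k::zero \<Rightarrow> 'a::ring_1 \<Rightarrow> 'a) \<Rightarrow> (nat list \<Rightarrow> 'k) set" where
  "T_ideal smul = {f \<in> free_algebra. \<forall>\<phi>. evaluate smul \<phi> f = 0}"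

definition multilinear :: "nat \<Rightarrow> (nat list \<Rightarrow> 'k::zero) set" where
  "multilinear n = {f \<in> free_algebra. \<forall>w. f w \<noteq> 0 \<longrightarrow> distinct w \<and> set w = {..<n}}"

text \<open>The left action \<open>x\<^sub>i \<mapsto> x\<^bsub>\<sigma> i\<^esub>\<close>: it sends the word \<open>w\<close> to \<open>map \<sigma> w\<close>.\<close>

definition rename_vars :: "(nat \<Rightarrow> nat) \<Rightarrow> (nat list \<Rightarrow> 'k) \<Rightarrow> nat list \<Rightarrow> 'k" where
  "rename_vars \<sigma> f = (\<lambda>w. f (map (inv \<sigma>) w))"

section \<open>Traces on quotient spaces\<close>

text \<open>
  For subspaces \<open>W \<subseteq> V\<close> of a function space, \<open>basis_mod V W B\<close> says that the cosets of the elements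
  of \<open>B\<close> form a (finite) basis of \<open>V / W\<close>; \<open>trace_mod V W f\<close> is then the trace of the linear map that
  \<open>f\<close> induces on \<open>V / W\<close>, which does not depend on the chosen basis.
\<close>

definition represents_mod ::
  "('x \<Rightarrow> 'k::comm_ring_1) set \<Rightarrow> ('x \<Rightarrow> 'k) set \<Rightarrow> ('x \<Rightarrow> 'k) \<Rightarrow> (('x \<Rightarrow> 'k) \<Rightarrow> 'k) \<Rightarrow> bool" where
  "represents_mod W B v c \<longleftrightarrow>
     (\<forall>b. b \<notin> B \<longrightarrow> c b = 0) \<and> (\<lambda>x. v x - (\<Sum>b\<in>B. c b * b x)) \<in> W"

definition basis_mod ::
  "('x \<Rightarrow> 'k::comm_ring_1) set \<Rightarrow> ('x \<Rightarrow> 'k) set \<Rightarrow> ('x \<Rightarrow> 'k) set \<Rightarrow> bool" where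
  "basis_mod V W B \<longleftrightarrow> finite B \<and> B \<subseteq> V \<and> (\<forall>v\<in>V. \<exists>!c. represents_mod W B v c)"

definition trace_mod ::
  "('x \<Rightarrow> 'k::comm_ring_1) set \<Rightarrow> ('x \<Rightarrow> 'k) set \<Rightarrow> (('x \<Rightarrow> 'k) \<Rightarrow> 'x \<Rightarrow> 'k) \<Rightarrow> 'k" where
  "trace_mod V W f =
     (let B = (SOME B. basis_mod V W B) in \<Sum>b\<in>B. (THE c. represents_mod W B (f b) c) b)"

definition cocharacter ::
  "('k::comm_ring_1 \<Rightarrow> 'a::ring_1 \<Rightarrow> 'a) \<Rightarrow> nat \<Rightarrow> (nat \<Rightarrow> nat) \<Rightarrow> 'k" where
  "cocharacter smul n \<sigma> =
     trace_mod (multilinear n) (multilinear n \<inter> T_ideal smul) (rename_vars \<sigma>)"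

section \<open>Partitions and irreducible characters of symmetric groups\<close>

definition partitions_of :: "nat \<Rightarrow> nat list set" where
  "partitions_of n = {\<alpha>. sorted_wrt (\<ge>) \<alpha> \<and> (\<forall>p\<in>set \<alpha>. 1 \<le> p) \<and> sum_list \<alpha> = n}"

definition H11 :: "nat list set" where
  "H11 = {\<alpha>. \<alpha> \<in> partitions_of (sum_list \<alpha>) \<and> (2 \<le> length \<alpha> \<longrightarrow> \<alpha> ! 1 \<le> 1)}"

definition Sym :: "nat \<Rightarrow> (nat \<Rightarrow> nat) set" where
  "Sym n = {\<sigma>. \<sigma> permutes {..<n}}"

text \<open>
  The cells (row, column) of the diagram in reading order. Putting \<open>k\<close> into the cell \<open>cells \<alpha> ! k\<close>
  gives the tableau whose Young symmetrizer \<open>\<Sum>\<rho> \<gamma>. sign \<gamma> \<cdot> \<rho> \<gamma>\<close> (\<open>\<rho>\<close> preserving rows, \<open>\<gamma>\<close> preserving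
  columns) is used; elements of the group algebra of \<open>Sym n\<close> are functions supported on \<open>Sym n\<close>.
\<close>

definition cells :: "nat list \<Rightarrow> (nat \<times> nat) list" where
  "cells \<alpha> = concat (map (\<lambda>i. map (Pair i) [0..<\<alpha> ! i]) [0..<length \<alpha>])"

definition row_stabilizer :: "nat list \<Rightarrow> (nat \<Rightarrow> nat) set" where
  "row_stabilizer \<alpha> =
     {\<sigma> \<in> Sym (sum_list \<alpha>). \<forall>k<sum_list \<alpha>. fst (cells \<alpha> ! \<sigma> k) = fst (cells \<alpha> ! k)}"

definition column_stabilizer :: "nat list \<Rightarrow> (nat \<Rightarrow> nat) set" where
  "column_stabilizer \<alpha> =
     {\<sigma> \<in> Sym (sum_list \<alpha>). \<forall>k<sum_list \<alpha>. snd (cells \<alpha> ! \<sigma> k) = snd (cells \<alpha> ! k)}"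

definition group_algebra :: "nat \<Rightarrow> ((nat \<Rightarrow> nat) \<Rightarrow> 'k::zero) set" where
  "group_algebra n = {a. \<forall>\<sigma>. a \<sigma> \<noteq> 0 \<longrightarrow> \<sigma> \<in> Sym n}"

definition group_algebra_mult ::
  "nat \<Rightarrow> ((nat \<Rightarrow> nat) \<Rightarrow> 'k::comm_ring_1) \<Rightarrow> ((nat \<Rightarrow> nat) \<Rightarrow> 'k) \<Rightarrow> (nat \<Rightarrow> nat) \<Rightarrow> 'k" where
  "group_algebra_mult n a b = (\<lambda>\<pi>. \<Sum>\<sigma>\<in>Sym n. a \<sigma> * b (inv \<sigma> \<circ> \<pi>))"

definition young_symmetrizer :: "nat list \<Rightarrow> (nat \<Rightarrow> nat) \<Rightarrow> 'k::comm_ring_1" where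
  "young_symmetrizer \<alpha> = (\<lambda>\<pi>. \<Sum>\<rho>\<in>row_stabilizer \<alpha>. \<Sum>\<gamma>\<in>column_stabilizer \<alpha>.
     if \<pi> = \<rho> \<circ> \<gamma> then of_int (sign \<gamma>) else 0)"

text \<open>\<open>\<chi>\<^sub>\<alpha>\<close> is the character of the minimal left ideal generated by the Young symmetrizer.\<close>

definition specht_module :: "nat list \<Rightarrow> ((nat \<Rightarrow> nat) \<Rightarrow> 'k::comm_ring_1) set" where
  "specht_module \<alpha> =
     (\<lambda>a. group_algebra_mult (sum_list \<alpha>) a (young_symmetrizer \<alpha>)) ` group_algebra (sum_list \<alpha>)"

definition irr_char :: "nat list \<Rightarrow> (nat \<Rightarrow> nat) \<Rightarrow> 'k::comm_ring_1" where
  "irr_char \<alpha> \<sigma> = trace_mod (specht_module \<alpha>) {\<lambda>_. 0} (\<lambda>a \<pi>. a (inv \<sigma> \<circ> \<pi>))"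

text \<open>
  The multiplicity of \<open>\<chi>\<^sub>\<alpha>\<close> in a character \<open>\<psi>\<close> of \<open>Sym n\<close>: the coefficient \<open>c \<alpha>\<close> in the decomposition
  \<open>\<psi> = \<Sum>\<mu>. c \<mu> \<chi>\<^sub>\<mu>\<close> over the partitions \<open>\<mu>\<close> of \<open>n\<close>.
\<close>

definition char_multiplicity :: "nat \<Rightarrow> ((nat \<Rightarrow> nat) \<Rightarrow> 'k::comm_ring_1) \<Rightarrow> nat list \<Rightarrow> nat" where
  "char_multiplicity n \<psi> \<alpha> = (THE m. \<exists>c :: nat list \<Rightarrow> nat.
     (\<forall>\<sigma>\<in>Sym n. \<psi> \<sigma> = (\<Sum>\<mu>\<in>partitions_of n. of_nat (c \<mu>) * irr_char \<mu> \<sigma>)) \<and> c \<alpha> = m)"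

definition cocharacter_multiplicity ::
  "('k::comm_ring_1 \<Rightarrow> 'a::ring_1 \<Rightarrow> 'a) \<Rightarrow> nat list \<Rightarrow> nat" where
  "cocharacter_multiplicity smul \<alpha> =
     char_multiplicity (sum_list \<alpha>) (cocharacter smul (sum_list \<alpha>)) \<alpha>"

end

theory Submission
  imports Defs "HOL-Library.Function_Algebras" "HOL-Combinatorics.Orbits"
begin

text \<open>
  The multiplicities of hooks are read off from polynomials in an even variable \<open>x\<close> and an odd variable \<open>y\<close>.
  By Pieri's rule, the multilinear polynomials modulo identities that are symmetric in \<open>a\<close> variables and
  alternating in the other \<open>b\<close> variables form a space of dimension \<open>m(a, 1\<^sup>b) + m(a + 1, 1\<^bsup>b-1\<^esup>)\<close> (lemma
  \<open>hook_multiplicities\<close>), and they are the polarizations of the polynomials of degree \<open>(a, b)\<close> in \<open>x\<close> and \<open>y\<close>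
  (lemma \<open>equivariant_dimension\<close>). So the dimensions of these spaces of polynomials in \<open>x\<close> and \<open>y\<close> modulo the
  super-identities of \<open>UT\<^sub>3(E)\<close> determine the multiplicities, by induction on \<open>b\<close>.

  The commutator of \<open>x\<close> and \<open>y\<close> over \<open>E\<close> is twice the product of their Grassmann-odd parts. It commutes with \<open>x\<close>,
  anticommutes with \<open>y\<close> and has square zero, so that modulo the identities of \<open>E\<close> every polynomial is a combination
  of the normal words \<open>x\<^sup>iy\<^sup>j\<close> and \<open>yx\<^bsup>i+1\<^esup>y\<^sup>j\<close>. The ideal of the identities of \<open>E\<close> is a free right ideal on
  elements \<open>b\<^sub>p\<close>, one for each minimal word \<open>p\<close> that is not normal. A product of three identities of \<open>E\<close> vanishes
  on \<open>UT\<^sub>3(E)\<close>, since each factor takes strictly triangular values (lemma \<open>reductions_ut_zero\<close>). Therefore the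
  products \<open>b\<^bsub>p\<^sub>1\<^esub> \<cdots> b\<^bsub>p\<^sub>r\<^esub> u\<close> with \<open>r < 3\<close> and \<open>u\<close> normal span all polynomials modulo identities (lemma
  \<open>span_reductions\<close>). They are independent: the functionals that split a word at letters \<open>x\<close> and take
  coordinates with respect to the normal words in between separate them (lemma \<open>test_functionals_separate\<close>), and
  these functionals occur in the entries of evaluations at suitable bidiagonal matrices, whose diagonal
  entries involve disjoint sets of variables (lemma \<open>test_functional_vanishes\<close>). Counting the products of each
  degree gives the formula.

  That multiplicities can be computed from symmetric and alternating polynomials rests on the representation
  theory of the symmetric groups: products of Young symmetrizers of different shapes vanish, a Young
  symmetrizer is a nonzero multiple of an idempotent, and the irreducible characters form a basis of the class
  functions (lemmas \<open>young_mult_young_different\<close>, \<open>hook_factor_nonzero\<close>, \<open>class_function_expand\<close>). All traces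
  on quotient spaces reduce to one formula (lemma \<open>trace_mod_rank\<close>).
\<close>

section \<open>Traces on quotients of function spaces\<close>

definition fscale :: "'k::field \<Rightarrow> ('x \<Rightarrow> 'k) \<Rightarrow> 'x \<Rightarrow> 'k" where
  "fscale c f = (\<lambda>x. c * f x)"

lemma fscale_apply: "fscale c f x = c * f x"
  by (simp add: fscale_def)

text \<open>Pointwise evaluation is unfolded on request only: as rewrite rules these equations also
  fire below binders and destroy the vector notation.\<close>

declare plus_fun_apply [simp del] zero_fun_apply [simp del] minus_apply [simp del] uminus_apply [simp del]

lemmas pointwise = fscale_apply plus_fun_apply zero_fun_apply minus_apply uminus_apply

interpretation fs: vector_space "fscale :: 'k::field \<Rightarrow> ('x \<Rightarrow> 'k) \<Rightarrow> 'x \<Rightarrow> 'k"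
  by unfold_locales (auto simp: fun_eq_iff algebra_simps pointwise)

lemma sum_fun_apply: "(\<Sum>i\<in>I. f i) x = (\<Sum>i\<in>I. f i x)"
  by (induction I rule: infinite_finite_induct) (auto simp: pointwise)

text \<open>Linearity is only asked for on the subspace \<^term>\<open>V\<close>, since the maps of interest
  (coordinates, group elements) need not be linear on all functions.\<close>

definition lin_on :: "('x \<Rightarrow> 'k::field) set \<Rightarrow> (('x \<Rightarrow> 'k) \<Rightarrow> ('y \<Rightarrow> 'k)) \<Rightarrow> bool" where
  "lin_on V f \<longleftrightarrow> (\<forall>u\<in>V. \<forall>v\<in>V. f (u + v) = f u + f v) \<and> (\<forall>c. \<forall>v\<in>V. f (fscale c v) = fscale c (f v))"

definition functional_on :: "('x \<Rightarrow> 'k::field) set \<Rightarrow> (('x \<Rightarrow> 'k) \<Rightarrow> 'k) \<Rightarrow> bool" where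
  "functional_on V \<phi> \<longleftrightarrow> (\<forall>u\<in>V. \<forall>v\<in>V. \<phi> (u + v) = \<phi> u + \<phi> v) \<and> (\<forall>c. \<forall>v\<in>V. \<phi> (fscale c v) = c * \<phi> v)"

lemma functional_on_sum:
  assumes "functional_on V \<phi>" "fs.subspace V" "\<And>i. i \<in> I \<Longrightarrow> v i \<in> V"
  shows "\<phi> (\<Sum>i\<in>I. fscale (c i) (v i)) = (\<Sum>i\<in>I. c i * \<phi> (v i))"
proof -
  have z: "\<phi> 0 = 0"
  proof -
    have "0 \<in> V" using assms(2) by (simp add: fs.subspace_0)
    then have "\<phi> (fscale 0 0) = 0 * \<phi> 0" using assms(1) unfolding functional_on_def by blast
    then show ?thesis by simp
  qed
  show ?thesis using assms(3)
  proof (induction I rule: infinite_finite_induct)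
    case (insert x F)
    have "(\<Sum>i\<in>F. fscale (c i) (v i)) \<in> V"
      by (rule fs.subspace_sum[OF assms(2)]) (use insert assms(2) in \<open>auto intro: fs.subspace_scale\<close>)
    moreover have "fscale (c x) (v x) \<in> V" "v x \<in> V" using insert assms(2) by (auto intro: fs.subspace_scale)
    ultimately have "\<phi> (fscale (c x) (v x) + (\<Sum>i\<in>F. fscale (c i) (v i)))
        = c x * \<phi> (v x) + \<phi> (\<Sum>i\<in>F. fscale (c i) (v i))"
      using assms(1) unfolding functional_on_def by simp
    moreover have "\<phi> (\<Sum>i\<in>F. fscale (c i) (v i)) = (\<Sum>i\<in>F. c i * \<phi> (v i))"
      using insert by blast
    ultimately show ?case unfolding sum.insert[OF insert(1,2)] by simp
  qed (use z in auto)
qed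

lemma functional_on_congW:
  assumes "functional_on V \<phi>" "\<And>w. w \<in> W \<Longrightarrow> \<phi> w = 0" "W \<subseteq> V" "v \<in> V" "u - v \<in> W"
  shows "\<phi> u = \<phi> v"
proof -
  have "\<phi> (v + (u - v)) = \<phi> v + \<phi> (u - v)"
    using assms unfolding functional_on_def by blast
  then show ?thesis using assms(2)[OF assms(5)] by simp
qed

lemma represents_mod_alt:
  "represents_mod W B v c \<longleftrightarrow> (\<forall>b. b \<notin> B \<longrightarrow> c b = 0) \<and> v - (\<Sum>b\<in>B. fscale (c b) b) \<in> W"
proof -
  have "(\<lambda>x. v x - (\<Sum>b\<in>B. c b * b x)) = v - (\<Sum>b\<in>B. fscale (c b) b)"
    by (simp add: fun_eq_iff sum_fun_apply pointwise)
  then show ?thesis unfolding represents_mod_def by simp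
qed

lemma basis_mod_exists:
  fixes V W :: "('x \<Rightarrow> 'k::field) set"
  assumes V: "fs.subspace V" and W: "fs.subspace W" and WV: "W \<subseteq> V"
    and fin: "finite X" and supp: "\<And>v x. v \<in> V \<Longrightarrow> x \<notin> X \<Longrightarrow> v x = 0"
  shows "\<exists>B. basis_mod V W B"
proof -
  obtain BW where BW: "BW \<subseteq> W" "fs.independent BW" "W \<subseteq> fs.span BW"
    using fs.maximal_independent_subset by blast
  obtain BV where BV: "BW \<subseteq> BV" "BV \<subseteq> V" "fs.independent BV" "V \<subseteq> fs.span BV"
    using fs.maximal_independent_subset_extend[of BW V] BW(1,2) WV by blast
  define \<delta> :: "'x \<Rightarrow> 'x \<Rightarrow> 'k" where "\<delta> x = (\<lambda>y. if y = x then 1 else 0)" for x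
  have "V \<subseteq> fs.span (\<delta> ` X)"
  proof
    fix v assume v: "v \<in> V"
    have e: "v = (\<Sum>x\<in>X. fscale (v x) (\<delta> x))"
    proof
      fix y
      have "(\<Sum>x\<in>X. fscale (v x) (\<delta> x)) y = (\<Sum>x\<in>X. if x = y then v y else 0)"
        unfolding sum_fun_apply by (rule sum.cong) (auto simp: \<delta>_def pointwise)
      then show "v y = (\<Sum>x\<in>X. fscale (v x) (\<delta> x)) y" using supp[OF v, of y] fin by auto
    qed
    have m: "(\<Sum>x\<in>X. fscale (v x) (\<delta> x)) \<in> fs.span (\<delta> ` X)"
      by (intro fs.span_sum fs.span_scale fs.span_base imageI)
    show "v \<in> fs.span (\<delta> ` X)" using m unfolding e[symmetric] .
  qed
  then have finBV: "finite BV"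
    using fs.independent_span_bound[of "\<delta> ` X" BV] BV fin by blast
  define B where "B = BV - BW"
  have finB: "finite B" and finBW: "finite BW" using finBV BV(1) finite_subset by (auto simp: B_def)
  have spanW: "fs.span BW = W" using BW W fs.span_subspace by blast
  have uniq: "c1 = c2" if c: "represents_mod W B v c1" "represents_mod W B v c2" for v c1 c2
  proof -
    have "(v - (\<Sum>b\<in>B. fscale (c2 b) b)) - (v - (\<Sum>b\<in>B. fscale (c1 b) b)) \<in> W"
      using c unfolding represents_mod_alt by (elim conjE) (rule fs.subspace_diff[OF W])
    then have "(\<Sum>b\<in>B. fscale (c1 b) b) - (\<Sum>b\<in>B. fscale (c2 b) b) \<in> fs.span BW" using spanW by simp
    then have "(\<Sum>b\<in>B. fscale (c1 b - c2 b) b) \<in> fs.span BW"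
      by (simp add: fs.scale_left_diff_distrib sum_subtractf)
    then obtain u where u: "(\<Sum>b\<in>B. fscale (c1 b - c2 b) b) = (\<Sum>b\<in>BW. fscale (u b) b)"
      using fs.span_finite[OF finBW] by auto
    define t where "t b = (if b \<in> B then c1 b - c2 b else - u b)" for b
    have "(\<Sum>b\<in>BV. fscale (t b) b) = (\<Sum>b\<in>B. fscale (t b) b) + (\<Sum>b\<in>BW. fscale (t b) b)"
      using BV(1) finBV unfolding B_def by (intro sum.subset_diff)
    also have "(\<Sum>b\<in>BW. fscale (t b) b) = - (\<Sum>b\<in>BW. fscale (u b) b)"
      by (subst sum_negf[symmetric], rule sum.cong) (auto simp: t_def B_def fs.scale_minus_left)
    also have "(\<Sum>b\<in>B. fscale (t b) b) = (\<Sum>b\<in>B. fscale (c1 b - c2 b) b)"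
      by (rule sum.cong) (auto simp: t_def)
    finally have "(\<Sum>b\<in>BV. fscale (t b) b) = 0" using u by simp
    then have "t b = 0" if "b \<in> BV" for b
      using fs.independentD[OF BV(3) finBV order_refl] that by blast
    then have tz: "\<And>b. b \<in> BV \<Longrightarrow> t b = 0" .
    have "c1 b = c2 b" if "b \<in> B" for b
      using tz[of b] that by (simp add: t_def B_def)
    then have "c1 b = c2 b" for b using c unfolding represents_mod_def by (cases "b \<in> B") simp_all
    then show ?thesis by (rule ext)
  qed
  have ex: "\<exists>c. represents_mod W B v c" if v: "v \<in> V" for v
  proof -
    have "v \<in> fs.span BV" using v BV by blast
    then obtain u where u: "v = (\<Sum>b\<in>BV. fscale (u b) b)" using fs.span_finite[OF finBV] by auto
    have s: "(\<Sum>b\<in>BV. fscale (u b) b) = (\<Sum>b\<in>B. fscale (u b) b) + (\<Sum>b\<in>BW. fscale (u b) b)"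
      using BV(1) finBV unfolding B_def by (intro sum.subset_diff)
    have "(\<Sum>b\<in>BW. fscale (u b) b) \<in> W"
      using W BW by (intro fs.subspace_sum) (auto intro: fs.subspace_scale)
    moreover have "(\<Sum>b\<in>B. fscale (if b \<in> B then u b else 0) b) = (\<Sum>b\<in>B. fscale (u b) b)"
      by (rule sum.cong) auto
    ultimately have "represents_mod W B v (\<lambda>b. if b \<in> B then u b else 0)"
      unfolding represents_mod_alt using u s by simp
    then show ?thesis by blast
  qed
  have "basis_mod V W B" unfolding basis_mod_def
    using finB BV ex uniq by (auto simp: B_def)
  then show ?thesis by blast
qed

locale quotient_space =
  fixes V W :: "('x \<Rightarrow> 'k::field) set"
  assumes V: "fs.subspace V" and W: "fs.subspace W" and WV: "W \<subseteq> V"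
    and basis_ex: "\<exists>B. basis_mod V W B"
begin

definition some_basis :: "('x \<Rightarrow> 'k) set" where "some_basis = (SOME B. basis_mod V W B)"

definition coord :: "('x \<Rightarrow> 'k) \<Rightarrow> ('x \<Rightarrow> 'k) \<Rightarrow> 'k" where
  "coord b v = (THE c. represents_mod W some_basis v c) b"

lemma basis_mod_some: "basis_mod V W some_basis"
  unfolding some_basis_def using basis_ex by (rule someI_ex)

lemma some_basis_in: "b \<in> some_basis \<Longrightarrow> b \<in> V"
  using basis_mod_some unfolding basis_mod_def by auto

lemma coord_represents: "v \<in> V \<Longrightarrow> represents_mod W some_basis v (\<lambda>b. coord b v)"
  using basis_mod_some theI'[of "represents_mod W some_basis v"]
  unfolding basis_mod_def coord_def by simp

lemma coord_unique: "v \<in> V \<Longrightarrow> represents_mod W some_basis v c \<Longrightarrow> coord b v = c b"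
  using the1_equality[of "represents_mod W some_basis v" c] basis_mod_some
  unfolding basis_mod_def coord_def by simp

lemma coord_functional: "functional_on V (coord b)"
  unfolding functional_on_def
proof (intro conjI ballI allI)
  fix u v assume uv: "u \<in> V" "v \<in> V"
  note r = coord_represents[OF uv(1)] coord_represents[OF uv(2)]
  have e: "u + v - (\<Sum>b\<in>some_basis. fscale (coord b u + coord b v) b)
     = (u - (\<Sum>b\<in>some_basis. fscale (coord b u) b)) + (v - (\<Sum>b\<in>some_basis. fscale (coord b v) b))"
    by (simp add: fs.scale_left_distrib sum.distrib)
  have "represents_mod W some_basis (u + v) (\<lambda>b. coord b u + coord b v)"
    unfolding represents_mod_alt e
    using r fs.subspace_add[OF W] unfolding represents_mod_alt by simp
  then show "coord b (u + v) = coord b u + coord b v"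
    using coord_unique[of "u + v"] uv V by (simp add: fs.subspace_add)
next
  fix c v assume v: "v \<in> V"
  have e: "fscale c v - (\<Sum>b\<in>some_basis. fscale (c * coord b v) b)
     = fscale c (v - (\<Sum>b\<in>some_basis. fscale (coord b v) b))"
    by (simp add: fs.scale_right_diff_distrib fs.scale_sum_right)
  have "represents_mod W some_basis (fscale c v) (\<lambda>b. c * coord b v)"
    unfolding represents_mod_alt e
    using coord_represents[OF v] fs.subspace_scale[OF W] unfolding represents_mod_alt by simp
  then show "coord b (fscale c v) = c * coord b v"
    using coord_unique[of "fscale c v"] v V by (simp add: fs.subspace_scale)
qed

lemma coord_W: "w \<in> W \<Longrightarrow> coord b w = 0"
  by (rule coord_unique[of w "\<lambda>_. 0"]) (use WV in \<open>auto simp: represents_mod_alt\<close>)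

lemma coord_expand: "v \<in> V \<Longrightarrow> v - (\<Sum>b\<in>some_basis. fscale (coord b v) b) \<in> W"
  using coord_represents unfolding represents_mod_alt by blast

lemma trace_mod_coord: "trace_mod V W f = (\<Sum>b\<in>some_basis. coord b (f b))"
  unfolding trace_mod_def Let_def some_basis_def coord_def ..

lemma trace_mod_sum:
  assumes "\<And>b s. b \<in> V \<Longrightarrow> s \<in> S \<Longrightarrow> f s b \<in> V"
  shows "trace_mod V W (\<lambda>v. \<Sum>s\<in>S. fscale (a s) (f s v)) = (\<Sum>s\<in>S. a s * trace_mod V W (f s))"
proof -
  have "trace_mod V W (\<lambda>v. \<Sum>s\<in>S. fscale (a s) (f s v))
      = (\<Sum>b\<in>some_basis. \<Sum>s\<in>S. a s * coord b (f s b))"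
    unfolding trace_mod_coord
    by (rule sum.cong[OF refl], rule functional_on_sum[OF coord_functional V])
       (use assms some_basis_in in auto)
  also have "\<dots> = (\<Sum>s\<in>S. a s * trace_mod V W (f s))"
    unfolding trace_mod_coord sum_distrib_left by (rule sum.swap)
  finally show ?thesis .
qed

text \<open>The trace of \<open>\<Sum>\<^sub>i v\<^sub>i \<otimes> \<phi>\<^sub>i\<close> is \<open>\<Sum>\<^sub>i \<phi>\<^sub>i(v\<^sub>i)\<close>, whether or not the \<open>v\<^sub>i\<close> are independent. So a
  trace can be computed from any presentation of the map as a sum of maps of rank one.\<close>

lemma trace_mod_rank:
  assumes v: "\<And>i. i \<in> I \<Longrightarrow> v i \<in> V"
    and \<phi>: "\<And>i. i \<in> I \<Longrightarrow> functional_on V (\<phi> i)" "\<And>i w. i \<in> I \<Longrightarrow> w \<in> W \<Longrightarrow> \<phi> i w = 0"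
    and f: "\<And>u. u \<in> V \<Longrightarrow> f u - (\<Sum>i\<in>I. fscale (\<phi> i u) (v i)) \<in> W"
  shows "trace_mod V W f = (\<Sum>i\<in>I. \<phi> i (v i))"
proof -
  have vs: "(\<Sum>i\<in>I. fscale (d i) (v i)) \<in> V" for d
    using v V by (auto intro!: fs.subspace_sum fs.subspace_scale)
  have "trace_mod V W f = (\<Sum>b\<in>some_basis. \<Sum>i\<in>I. \<phi> i b * coord b (v i))"
    unfolding trace_mod_coord
  proof (rule sum.cong[OF refl])
    fix b assume b: "b \<in> some_basis"
    have "coord b (f b) = coord b (\<Sum>i\<in>I. fscale (\<phi> i b) (v i))"
      by (rule functional_on_congW[OF coord_functional coord_W WV vs f]) (use some_basis_in[OF b] in auto)
    then show "coord b (f b) = (\<Sum>i\<in>I. \<phi> i b * coord b (v i))"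
      using functional_on_sum[OF coord_functional V v] by simp
  qed
  also have "\<dots> = (\<Sum>i\<in>I. \<Sum>b\<in>some_basis. coord b (v i) * \<phi> i b)"
    by (subst sum.swap) (simp add: mult.commute)
  also have "\<dots> = (\<Sum>i\<in>I. \<phi> i (v i))"
  proof (rule sum.cong[OF refl])
    fix i assume i: "i \<in> I"
    have "(\<Sum>b\<in>some_basis. coord b (v i) * \<phi> i b) = \<phi> i (\<Sum>b\<in>some_basis. fscale (coord b (v i)) b)"
      by (rule functional_on_sum[OF \<phi>(1)[OF i] V some_basis_in, symmetric])
    also have "\<dots> = \<phi> i (v i)"
      by (rule functional_on_congW[OF \<phi>(1)[OF i] \<phi>(2)[OF i] WV, symmetric])
         (use coord_expand[OF v[OF i]] some_basis_in V in \<open>auto intro!: fs.subspace_sum fs.subspace_scale\<close>)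
    finally show "(\<Sum>b\<in>some_basis. coord b (v i) * \<phi> i b) = \<phi> i (v i)" .
  qed
  finally show ?thesis .
qed

lemma lin_on_sum:
  assumes "lin_on V f" "\<And>i. i \<in> I \<Longrightarrow> v i \<in> V"
  shows "f (\<Sum>i\<in>I. fscale (c i) (v i)) = (\<Sum>i\<in>I. fscale (c i) (f (v i)))"
proof -
  have "f 0 = 0"
  proof -
    have "0 \<in> V" using V by (simp add: fs.subspace_0)
    then have "f (fscale 0 0) = fscale 0 (f 0)" using assms(1) unfolding lin_on_def by blast
    then show ?thesis by simp
  qed
  then show ?thesis using assms(2)
  proof (induction I rule: infinite_finite_induct)
    case (insert x F)
    have "(\<Sum>i\<in>F. fscale (c i) (v i)) \<in> V"
      by (rule fs.subspace_sum[OF V]) (use insert V in \<open>auto intro: fs.subspace_scale\<close>)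
    moreover have "fscale (c x) (v x) \<in> V" "v x \<in> V" using insert V by (auto intro: fs.subspace_scale)
    ultimately have "f (fscale (c x) (v x) + (\<Sum>i\<in>F. fscale (c i) (v i)))
        = fscale (c x) (f (v x)) + f (\<Sum>i\<in>F. fscale (c i) (v i))"
      using assms(1) unfolding lin_on_def by simp
    moreover have "f (\<Sum>i\<in>F. fscale (c i) (v i)) = (\<Sum>i\<in>F. fscale (c i) (f (v i)))"
      using insert by blast
    ultimately show ?case unfolding sum.insert[OF insert(1,2)] by simp
  qed simp_all
qed

lemma lin_on_diff:
  assumes "lin_on V f" "u \<in> V" "v \<in> V"
  shows "f (u - v) = f u - f v"
proof -
  have "fscale (-1) v \<in> V" using V assms(3) by (rule fs.subspace_scale)
  then have "f (u + fscale (-1) v) = f u + fscale (-1) (f v)"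
    using assms unfolding lin_on_def by metis
  moreover have "u + fscale (-1) v = u - v" "f u + fscale (-1) (f v) = f u - f v" by (auto simp: fun_eq_iff pointwise)
  ultimately show ?thesis by simp
qed

lemma trace_mod_commute:
  assumes f: "lin_on V f" "\<And>v. v \<in> V \<Longrightarrow> f v \<in> V" "\<And>w. w \<in> W \<Longrightarrow> f w \<in> W"
    and g: "lin_on V g" "\<And>v. v \<in> V \<Longrightarrow> g v \<in> V" "\<And>w. w \<in> W \<Longrightarrow> g w \<in> W"
  shows "trace_mod V W (\<lambda>v. f (g v)) = trace_mod V W (\<lambda>v. g (f v))"
proof -
  have "trace_mod V W (\<lambda>v. f (g v)) = (\<Sum>b\<in>some_basis. coord b (g (f b)))"
  proof (rule trace_mod_rank[where \<phi> = "\<lambda>i u. coord i (g u)"])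
    show "functional_on V (\<lambda>v. coord i (g v))" if "i \<in> some_basis" for i
      using coord_functional[of i] g(1,2) unfolding functional_on_def lin_on_def by simp
    show "f (g u) - (\<Sum>i\<in>some_basis. fscale (coord i (g u)) (f i)) \<in> W" if u: "u \<in> V" for u
    proof -
      have "f (g u) - (\<Sum>i\<in>some_basis. fscale (coord i (g u)) (f i))
          = f (g u - (\<Sum>i\<in>some_basis. fscale (coord i (g u)) i))"
        using lin_on_sum[OF f(1), of some_basis "\<lambda>i. i" "\<lambda>i. coord i (g u)"]
          some_basis_in
        by (subst lin_on_diff[OF f(1) g(2)[OF u]])
           (simp_all add: fs.subspace_sum[OF V] fs.subspace_scale[OF V])
      then show ?thesis using f(3) coord_expand[OF g(2)[OF u]] by simp
    qed
    show "f i \<in> V" if "i \<in> some_basis" for i using f(2) some_basis_in that by blast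
    show "coord i (g w) = 0" if "w \<in> W" for i w using coord_W g(3) that by blast
  qed
  then show ?thesis unfolding trace_mod_coord .
qed

lemma trace_mod_projection:
  fixes v :: "'i \<Rightarrow> 'x \<Rightarrow> 'k"
  assumes fin: "finite I" and v: "\<And>i. i \<in> I \<Longrightarrow> v i \<in> V"
    and f: "lin_on V f" "\<And>w. w \<in> W \<Longrightarrow> f w \<in> W"
    and span: "\<And>u. u \<in> V \<Longrightarrow> \<exists>c. f u - (\<Sum>i\<in>I. fscale (c i) (v i)) \<in> W"
    and fix_v: "\<And>i. i \<in> I \<Longrightarrow> f (v i) - v i \<in> W"
    and indep: "\<And>c i. (\<Sum>i\<in>I. fscale (c i) (v i)) \<in> W \<Longrightarrow> i \<in> I \<Longrightarrow> c i = 0"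
  shows "trace_mod V W f = of_nat (card I)"
proof -
  define \<phi> where "\<phi> i u = (SOME c. f u - (\<Sum>i\<in>I. fscale (c i) (v i)) \<in> W) i" for i u
  have \<phi>: "f u - (\<Sum>i\<in>I. fscale (\<phi> i u) (v i)) \<in> W" if "u \<in> V" for u
    using someI_ex[OF span[OF that]] unfolding \<phi>_def .
  have uniq: "\<phi> i u = c i" if "u \<in> V" "f u - (\<Sum>i\<in>I. fscale (c i) (v i)) \<in> W" "i \<in> I" for u c i
  proof -
    have "(f u - (\<Sum>i\<in>I. fscale (c i) (v i))) - (f u - (\<Sum>i\<in>I. fscale (\<phi> i u) (v i))) \<in> W"
      by (rule fs.subspace_diff[OF W that(2) \<phi>[OF that(1)]])
    then have "(\<Sum>i\<in>I. fscale (\<phi> i u - c i) (v i)) \<in> W"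
      by (simp add: fs.scale_left_diff_distrib sum_subtractf)
    from indep[OF this that(3)] show ?thesis by simp
  qed
  have "trace_mod V W f = (\<Sum>i\<in>I. \<phi> i (v i))"
  proof (rule trace_mod_rank[OF v _ _ \<phi>])
    fix i assume i: "i \<in> I"
    show "functional_on V (\<phi> i)" unfolding functional_on_def
    proof (intro conjI ballI allI)
      fix x y assume xy: "x \<in> V" "y \<in> V"
      have "f (x + y) = f x + f y" using f xy unfolding lin_on_def by blast
      then have "f (x + y) - (\<Sum>i\<in>I. fscale (\<phi> i x + \<phi> i y) (v i))
          = (f x - (\<Sum>i\<in>I. fscale (\<phi> i x) (v i))) + (f y - (\<Sum>i\<in>I. fscale (\<phi> i y) (v i)))"
        by (simp add: fs.scale_left_distrib sum.distrib)
      then show "\<phi> i (x + y) = \<phi> i x + \<phi> i y"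
        using fs.subspace_add[OF W \<phi>[OF xy(1)] \<phi>[OF xy(2)]] fs.subspace_add[OF V xy] i
        by (intro uniq[where c = "\<lambda>i. \<phi> i x + \<phi> i y"]) simp_all
    next
      fix c x assume x: "x \<in> V"
      have "f (fscale c x) = fscale c (f x)" using f x unfolding lin_on_def by blast
      then have "f (fscale c x) - (\<Sum>i\<in>I. fscale (c * \<phi> i x) (v i))
          = fscale c (f x - (\<Sum>i\<in>I. fscale (\<phi> i x) (v i)))"
        by (simp add: fs.scale_right_diff_distrib fs.scale_sum_right)
      then show "\<phi> i (fscale c x) = c * \<phi> i x"
        using fs.subspace_scale[OF W \<phi>[OF x]] fs.subspace_scale[OF V x] i
        by (intro uniq[where c = "\<lambda>i. c * \<phi> i x"]) simp_all
    qed
    show "\<phi> i w = 0" if "w \<in> W" for w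
      by (rule uniq[where c = "\<lambda>_. 0"]) (use that f WV i in auto)
  qed
  also have "\<dots> = (\<Sum>i\<in>I. 1)"
  proof (rule sum.cong[OF refl])
    fix i assume i: "i \<in> I"
    have "(\<Sum>j\<in>I. fscale (if j = i then 1 else 0) (v j)) = (\<Sum>j\<in>I. if j = i then v i else 0)"
      by (rule sum.cong) (auto simp: fun_eq_iff pointwise)
    also have "\<dots> = v i" using fin i by simp
    finally have "\<phi> i (v i) = (if i = i then 1 else 0)"
      using fix_v[OF i] by (intro uniq[where c = "\<lambda>j. if j = i then 1 else 0"] v i) simp
    then show "\<phi> i (v i) = 1" by simp
  qed
  finally show ?thesis by simp
qed

text \<open>An idempotent is a projection onto the subspace of vectors that it fixes modulo
  \<^term>\<open>W\<close>; a basis of the latter modulo \<^term>\<open>W\<close> turns the trace into a dimension.\<close>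

lemma trace_mod_idempotent:
  assumes f: "lin_on V f" "\<And>v. v \<in> V \<Longrightarrow> f v \<in> V" "\<And>w. w \<in> W \<Longrightarrow> f w \<in> W"
    and idem: "\<And>v. v \<in> V \<Longrightarrow> f (f v) - f v \<in> W"
    and fin: "finite X" and supp: "\<And>v x. v \<in> V \<Longrightarrow> x \<notin> X \<Longrightarrow> v x = 0"
  shows "\<exists>m :: nat. trace_mod V W f = of_nat m"
proof -
  define U where "U = {v \<in> V. f v - v \<in> W}"
  have Usub: "fs.subspace U"
    unfolding U_def
  proof (rule fs.subspaceI)
    have "f 0 \<in> W" using f(3) W by (simp add: fs.subspace_0)
    then show "0 \<in> {v \<in> V. f v - v \<in> W}" using V by (simp add: fs.subspace_0)
    show "x + y \<in> {v \<in> V. f v - v \<in> W}" if "x \<in> {v \<in> V. f v - v \<in> W}" "y \<in> {v \<in> V. f v - v \<in> W}" for x y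
    proof -
      have e: "f (x + y) - (x + y) = (f x - x) + (f y - y)" using f that unfolding lin_on_def by simp
      have "f (x + y) - (x + y) \<in> W" unfolding e using that by (intro fs.subspace_add[OF W]) auto
      then show ?thesis using that fs.subspace_add[OF V, of x y] by simp
    qed
    show "fscale c x \<in> {v \<in> V. f v - v \<in> W}" if "x \<in> {v \<in> V. f v - v \<in> W}" for c x
    proof -
      have e: "f (fscale c x) - fscale c x = fscale c (f x - x)"
        using f that unfolding lin_on_def by (simp add: fs.scale_right_diff_distrib)
      have "f (fscale c x) - fscale c x \<in> W" unfolding e using that by (intro fs.subspace_scale[OF W]) auto
      then show ?thesis using that fs.subspace_scale[OF V, of x c] by simp
    qed
  qed
  have WU: "W \<subseteq> U" using f WV W unfolding U_def by (auto intro: fs.subspace_diff)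
  obtain B where B: "basis_mod U W B"
    using basis_mod_exists[OF Usub W WU fin] supp unfolding U_def by blast
  have "trace_mod V W f = of_nat (card B)"
  proof (rule trace_mod_projection[where v = "\<lambda>b. b"])
    show "finite B" using B unfolding basis_mod_def by simp
    show "i \<in> V" if "i \<in> B" for i using B that unfolding basis_mod_def U_def by auto
    show "f i - i \<in> W" if "i \<in> B" for i using B that unfolding basis_mod_def U_def by auto
    show "\<exists>c. f u - (\<Sum>i\<in>B. fscale (c i) i) \<in> W" if "u \<in> V" for u
    proof -
      have "f u \<in> U" using f idem that unfolding U_def by simp
      then show ?thesis using B unfolding basis_mod_def represents_mod_alt by blast
    qed
    show "c i = 0" if c: "(\<Sum>i\<in>B. fscale (c i) i) \<in> W" and i: "i \<in> B" for c i
    proof -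
      have z: "0 \<in> U" using Usub by (simp add: fs.subspace_0)
      have "(\<Sum>b\<in>B. fscale (if b \<in> B then c b else 0) b) = (\<Sum>b\<in>B. fscale (c b) b)"
        by (rule sum.cong) auto
      then have "represents_mod W B 0 (\<lambda>b. if b \<in> B then c b else 0)"
        unfolding represents_mod_alt using fs.subspace_neg[OF W c] by simp
      moreover have "represents_mod W B 0 (\<lambda>b. 0)"
        unfolding represents_mod_alt using W by (simp add: fs.subspace_0)
      ultimately have "(\<lambda>b. if b \<in> B then c b else 0) = (\<lambda>b. 0)"
        using B z unfolding basis_mod_def by blast
      from fun_cong[OF this, of i] show ?thesis using i by simp
    qed
  qed (fact f(1), fact f(3))
  then show ?thesis by blast
qed

end

section \<open>Permutation groups\<close>

definition perm_group :: "nat \<Rightarrow> (nat \<Rightarrow> nat) set \<Rightarrow> bool" where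
  "perm_group n H \<longleftrightarrow> H \<subseteq> Sym n \<and> id \<in> H \<and> (\<forall>g\<in>H. \<forall>h\<in>H. g \<circ> h \<in> H) \<and> (\<forall>g\<in>H. inv g \<in> H)"

lemma finite_Sym [simp]: "finite (Sym n)"
  unfolding Sym_def by (simp add: finite_permutations)

lemma Sym_bij: "\<sigma> \<in> Sym n \<Longrightarrow> bij \<sigma>"
  unfolding Sym_def by (auto dest: permutes_bij)

lemma Sym_permutes: "\<sigma> \<in> Sym n \<Longrightarrow> \<sigma> permutes {..<n}"
  unfolding Sym_def by simp

lemma Sym_less [simp]: "\<sigma> \<in> Sym n \<Longrightarrow> \<sigma> k < n \<longleftrightarrow> k < n"
  using permutes_in_image[OF Sym_permutes, of \<sigma> n k] by simp

lemma Sym_inject: "\<sigma> \<in> Sym n \<Longrightarrow> \<sigma> x = \<sigma> y \<longleftrightarrow> x = y"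
  by (meson Sym_bij bij_is_inj inj_eq)

lemma id_Sym [simp]: "id \<in> Sym n"
  unfolding Sym_def by (simp add: permutes_id)

lemma comp_Sym: "\<sigma> \<in> Sym n \<Longrightarrow> \<tau> \<in> Sym n \<Longrightarrow> \<sigma> \<circ> \<tau> \<in> Sym n"
  unfolding Sym_def by (simp add: permutes_compose)

lemma inv_Sym: "\<sigma> \<in> Sym n \<Longrightarrow> inv \<sigma> \<in> Sym n"
  unfolding Sym_def by (simp add: permutes_inv)

lemma transpose_Sym: "i < n \<Longrightarrow> j < n \<Longrightarrow> Transposition.transpose i j \<in> Sym n"
  unfolding Sym_def by (simp add: permutes_swap_id)

lemma perm_group_Sym: "perm_group n (Sym n)"
  unfolding perm_group_def by (simp add: comp_Sym inv_Sym)

lemma Sym_cancel: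
  assumes "\<sigma> \<in> Sym n"
  shows "inv \<sigma> \<circ> (\<sigma> \<circ> \<pi>) = \<pi>" "\<sigma> \<circ> (inv \<sigma> \<circ> \<pi>) = \<pi>" "inv \<sigma> \<circ> \<sigma> = id" "\<sigma> \<circ> inv \<sigma> = id" "inv (inv \<sigma>) = \<sigma>"
    "inv \<sigma> (\<sigma> x) = x" "\<sigma> (inv \<sigma> x) = x"
  using permutes_inv_o[OF Sym_permutes[OF assms]] permutes_inv_inv[OF Sym_permutes[OF assms]]
    permutes_inverses[OF Sym_permutes[OF assms]]
  by (simp_all add: comp_assoc[symmetric])

lemma Sym_inv_comp: "\<sigma> \<in> Sym n \<Longrightarrow> \<tau> \<in> Sym n \<Longrightarrow> inv (\<sigma> \<circ> \<tau>) = inv \<tau> \<circ> inv \<sigma>"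
  by (simp add: Sym_bij o_inv_distrib)

lemma Sym_comp_iff: "\<sigma> \<in> Sym n \<Longrightarrow> \<sigma> \<circ> \<pi> \<in> Sym n \<longleftrightarrow> \<pi> \<in> Sym n"
  by (metis Sym_cancel(1) comp_Sym inv_Sym)

lemma Sym_sign_comp: "\<sigma> \<in> Sym n \<Longrightarrow> \<tau> \<in> Sym n \<Longrightarrow> sign (\<sigma> \<circ> \<tau>) = sign \<sigma> * sign \<tau>"
  by (rule sign_compose) (auto intro: permutes_imp_permutation[OF finite_lessThan] Sym_permutes)

lemma Sym_sign_inv: "\<sigma> \<in> Sym n \<Longrightarrow> sign (inv \<sigma>) = sign \<sigma>"
  by (rule sign_inverse) (auto intro: permutes_imp_permutation[OF finite_lessThan] Sym_permutes)

lemma perm_groupD: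
  assumes "perm_group n H"
  shows "h \<in> H \<Longrightarrow> h \<in> Sym n" "id \<in> H" "g \<in> H \<Longrightarrow> h \<in> H \<Longrightarrow> g \<circ> h \<in> H" "g \<in> H \<Longrightarrow> inv g \<in> H" "finite H"
  using assms unfolding perm_group_def by (auto intro: finite_subset[OF _ finite_Sym])

lemma sum_group_left:
  assumes "perm_group n H" "g \<in> H"
  shows "(\<Sum>h\<in>H. f (g \<circ> h)) = (\<Sum>h\<in>H. f h)"
  by (rule sum.reindex_bij_witness[where i = "\<lambda>h. inv g \<circ> h" and j = "\<lambda>h. g \<circ> h"])
     (use assms perm_groupD[OF assms(1)] Sym_cancel[of g n] in auto)

lemma sum_group_right:
  assumes "perm_group n H" "g \<in> H"
  shows "(\<Sum>h\<in>H. f (h \<circ> g)) = (\<Sum>h\<in>H. f h)"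
  by (rule sum.reindex_bij_witness[where i = "\<lambda>h. h \<circ> inv g" and j = "\<lambda>h. h \<circ> g"])
     (use assms perm_groupD[OF assms(1)] Sym_cancel[of g n] in \<open>auto simp: comp_assoc\<close>)

lemma sum_group_inv:
  assumes "perm_group n H"
  shows "(\<Sum>h\<in>H. f (inv h)) = (\<Sum>h\<in>H. f h)"
  by (rule sum.reindex_bij_witness[where i = inv and j = inv])
     (use assms perm_groupD[OF assms(1)] Sym_cancel(5)[of _ n] in auto)

section \<open>Young diagrams and the combinatorics of clashing tableaux\<close>

definition diagram :: "nat list \<Rightarrow> (nat \<times> nat) set" where
  "diagram \<alpha> = {(i, j). i < length \<alpha> \<and> j < \<alpha> ! i}"

abbreviation row :: "nat list \<Rightarrow> nat \<Rightarrow> nat" where "row \<alpha> k \<equiv> fst (cells \<alpha> ! k)"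
abbreviation col :: "nat list \<Rightarrow> nat \<Rightarrow> nat" where "col \<alpha> k \<equiv> snd (cells \<alpha> ! k)"

lemma length_cells: "length (cells \<alpha>) = sum_list \<alpha>"
  by (simp add: cells_def length_concat comp_def map_nth)

lemma set_cells: "set (cells \<alpha>) = diagram \<alpha>"
  by (auto simp: cells_def diagram_def)

lemma distinct_cells: "distinct (cells \<alpha>)"
proof -
  have "distinct (concat (map (\<lambda>i. map (Pair i) [0..<\<alpha> ! i]) [0..<m]))" for m
  proof (induction m)
    case (Suc m)
    then show ?case by (auto simp: distinct_map inj_on_def)
  qed simp
  then show ?thesis unfolding cells_def .
qed

context
  fixes n :: nat and \<alpha> :: "nat list"
  assumes part: "\<alpha> \<in> partitions_of n"
begin

lemma sum_list_part: "sum_list \<alpha> = n" using part by (simp add: partitions_of_def)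

lemma cell_in: "k < n \<Longrightarrow> (row \<alpha> k, col \<alpha> k) \<in> diagram \<alpha>"
  using nth_mem[of k "cells \<alpha>"] by (simp add: length_cells sum_list_part set_cells)

lemma cell_ex: "(i, j) \<in> diagram \<alpha> \<Longrightarrow> \<exists>k<n. row \<alpha> k = i \<and> col \<alpha> k = j"
  by (metis (no_types, lifting) set_cells in_set_conv_nth length_cells sum_list_part fst_conv snd_conv)

lemma cell_inj: "k < n \<Longrightarrow> k' < n \<Longrightarrow> row \<alpha> k = row \<alpha> k' \<Longrightarrow> col \<alpha> k = col \<alpha> k' \<Longrightarrow> k = k'"
  by (metis distinct_cells length_cells nth_eq_iff_index_eq prod_eq_iff sum_list_part)

lemma diagram_up: "(i, j) \<in> diagram \<alpha> \<Longrightarrow> i' \<le> i \<Longrightarrow> (i', j) \<in> diagram \<alpha>"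
  using part sorted_wrt_nth_less[of "(\<ge>)" \<alpha> i' i]
  by (cases "i' = i") (auto simp: diagram_def partitions_of_def)

lemma card_row: "card {k. k < n \<and> row \<alpha> k = i} = (if i < length \<alpha> then \<alpha> ! i else 0)"
proof -
  have "bij_betw (col \<alpha>) {k. k < n \<and> row \<alpha> k = i} {j. (i, j) \<in> diagram \<alpha>}"
    by (rule bij_betw_imageI) (use cell_in cell_ex cell_inj in \<open>auto simp: inj_on_def image_iff, metis+\<close>)
  then have "card {k. k < n \<and> row \<alpha> k = i} = card {j. (i, j) \<in> diagram \<alpha>}" by (rule bij_betw_same_card)
  also have "{j. (i, j) \<in> diagram \<alpha>} = (if i < length \<alpha> then {..<\<alpha> ! i} else {})" by (auto simp: diagram_def)
  finally show ?thesis by simp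
qed

lemma nat_initial_segment:
  fixes S :: "nat set"
  assumes "finite S" "\<And>r r'. r \<in> S \<Longrightarrow> r' < r \<Longrightarrow> r' \<in> S"
  shows "S = {..<card S}"
proof (cases "S = {}")
  case False
  have "S = {..Max S}" using assms(2)[OF Max_in[OF assms(1) False]] Max_ge[OF assms(1)] Max_in[OF assms(1) False]
    by (auto simp: le_less)
  then show ?thesis by (metis card_atMost lessThan_Suc_atMost)
qed simp

lemma column_rows:
  defines "C \<equiv> \<lambda>j. {k. k < n \<and> col \<alpha> k = j}"
  shows "row \<alpha> ` C j = {..<card (C j)}" "card {k \<in> C j. row \<alpha> k < i} = min i (card (C j))"
proof -
  have fin: "finite (C j)" and inj: "inj_on (row \<alpha>) (C j)"
    using cell_inj by (auto simp: C_def inj_on_def)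
  have "row \<alpha> ` C j = {..<card (row \<alpha> ` C j)}"
  proof (rule nat_initial_segment)
    fix r r' assume "r \<in> row \<alpha> ` C j" "r' < r"
    then have "(r', j) \<in> diagram \<alpha>" using cell_in diagram_up[of r j r'] by (auto simp: C_def)
    then show "r' \<in> row \<alpha> ` C j" using cell_ex by (fastforce simp: C_def)
  qed (use fin in simp)
  then show im: "row \<alpha> ` C j = {..<card (C j)}" using card_image[OF inj] by simp
  have "card {k \<in> C j. row \<alpha> k < i} = card (row \<alpha> ` {k \<in> C j. row \<alpha> k < i})"
    by (rule card_image[symmetric]) (use inj in \<open>auto simp: inj_on_def\<close>)
  also have "row \<alpha> ` {k \<in> C j. row \<alpha> k < i} = row \<alpha> ` C j \<inter> {..<i}" by auto
  also have "\<dots> = {..<min i (card (C j))}" unfolding im by auto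
  finally show "card {k \<in> C j. row \<alpha> k < i} = min i (card (C j))" by simp
qed

end

definition below :: "nat \<Rightarrow> nat list \<Rightarrow> nat \<Rightarrow> nat" where
  "below n \<alpha> i = card {k. k < n \<and> row \<alpha> k < i}"

lemma below_antisym:
  assumes "\<alpha> \<in> partitions_of n" "\<beta> \<in> partitions_of n" "\<And>i. below n \<alpha> i = below n \<beta> i"
  shows "\<alpha> = \<beta>"
proof -
  have "card {k. k < n \<and> row \<gamma> k = i} = below n \<gamma> (Suc i) - below n \<gamma> i" for \<gamma> i
  proof -
    have "{k. k < n \<and> row \<gamma> k = i} = {k. k < n \<and> row \<gamma> k < Suc i} - {k. k < n \<and> row \<gamma> k < i}" by auto
    then show ?thesis unfolding below_def by (simp add: card_Diff_subset Collect_mono)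
  qed
  then have eq: "(if i < length \<alpha> then \<alpha> ! i else 0) = (if i < length \<beta> then \<beta> ! i else 0)" for i
    using card_row[OF assms(1), of i] card_row[OF assms(2), of i] assms(3) by simp
  have pos: "\<gamma> ! i \<ge> 1" if "\<gamma> \<in> partitions_of n" "i < length \<gamma>" for \<gamma> i
    using that by (auto simp: partitions_of_def)
  have "length \<alpha> = length \<beta>"
    using eq[of "length \<alpha>"] eq[of "length \<beta>"] pos[OF assms(1), of "length \<beta>"] pos[OF assms(2), of "length \<alpha>"]
    by (metis less_irrefl linorder_neqE_nat not_one_le_zero)
  then show ?thesis using eq by (metis nth_equalityI)
qed

text \<open>If the entries of each column of \<open>\<beta>\<close> are sent by \<open>g\<close> to distinct rows of \<open>\<alpha>\<close>, then each column
  contributes at most \<open>min i h\<close> cells to the first \<open>i\<close> rows of \<open>\<alpha>\<close>, where \<open>h\<close> is its height, and these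
  numbers add up to the size of the first \<open>i\<close> rows of \<open>\<beta>\<close>. Hence \<open>\<beta>\<close> dominates \<open>\<alpha>\<close>; for \<open>\<alpha> = \<beta>\<close> all the
  estimates are equalities.\<close>

definition no_clash :: "nat \<Rightarrow> nat list \<Rightarrow> nat list \<Rightarrow> (nat \<Rightarrow> nat) \<Rightarrow> bool" where
  "no_clash n \<alpha> \<beta> g \<longleftrightarrow>
     (\<forall>u<n. \<forall>u'<n. u \<noteq> u' \<longrightarrow> col \<beta> u = col \<beta> u' \<longrightarrow> row \<alpha> (g u) \<noteq> row \<alpha> (g u'))"

lemma no_clash_dominance:
  assumes a: "\<alpha> \<in> partitions_of n" and b: "\<beta> \<in> partitions_of n" and g: "g \<in> Sym n"
    and nc: "no_clash n \<alpha> \<beta> g"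
  shows "below n \<alpha> i \<le> below n \<beta> i"
    "\<alpha> = \<beta> \<Longrightarrow> u < n \<Longrightarrow> (row \<alpha> (g u), col \<alpha> u) \<in> diagram \<alpha>"
proof -
  define C where "C j = {k. k < n \<and> col \<beta> k = j}" for j
  define J where "J = col \<beta> ` {..<n}"
  have fin: "finite (C j)" for j by (simp add: C_def)
  have sumJ: "(\<Sum>j\<in>J. card {u \<in> C j. P u}) = card {u. u < n \<and> P u}" for P
  proof -
    have "(\<Sum>j\<in>J. \<Sum>u\<in>{u \<in> {u. u < n \<and> P u}. col \<beta> u = j}. 1) = (\<Sum>u\<in>{u. u < n \<and> P u}. 1::nat)"
      by (rule sum.group) (auto simp: J_def)
    moreover have "{u \<in> {u. u < n \<and> P u}. col \<beta> u = j} = {u \<in> C j. P u}" for j by (auto simp: C_def)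
    ultimately show ?thesis by simp
  qed
  have le: "card {u \<in> C j. row \<alpha> (g u) < i} \<le> card {u \<in> C j. row \<beta> u < i}" for i j
  proof -
    have "inj_on (\<lambda>u. row \<alpha> (g u)) {u \<in> C j. row \<alpha> (g u) < i}"
      using nc unfolding no_clash_def C_def inj_on_def by force
    then have "card {u \<in> C j. row \<alpha> (g u) < i} \<le> card {..<i}"
      by (rule card_inj_on_le) auto
    moreover have "card {u \<in> C j. row \<alpha> (g u) < i} \<le> card (C j)"
      by (rule card_mono) (use fin in auto)
    ultimately show ?thesis using column_rows(2)[OF b, of j i] unfolding C_def by simp
  qed
  have shift: "card {u. u < n \<and> row \<alpha> (g u) < i} = below n \<alpha> i" for i
  proof -
    have "bij_betw g {u. u < n \<and> row \<alpha> (g u) < i} {k. k < n \<and> row \<alpha> k < i}"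
      by (rule bij_betwI[where g = "inv g"]) (use g inv_Sym[OF g] in \<open>auto simp: Sym_cancel[OF g]\<close>)
    then show ?thesis unfolding below_def by (rule bij_betw_same_card)
  qed
  show "below n \<alpha> i \<le> below n \<beta> i"
  proof -
    have "below n \<alpha> i = (\<Sum>j\<in>J. card {u \<in> C j. row \<alpha> (g u) < i})" using sumJ shift by simp
    also have "\<dots> \<le> (\<Sum>j\<in>J. card {u \<in> C j. row \<beta> u < i})" by (rule sum_mono) (rule le)
    also have "\<dots> = below n \<beta> i" unfolding below_def by (rule sumJ)
    finally show ?thesis .
  qed
  show "(row \<alpha> (g u), col \<alpha> u) \<in> diagram \<alpha>" if ab: "\<alpha> = \<beta>" and u: "u < n"
  proof -
    define j where "j = col \<beta> u"
    define h where "h = card (C j)"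
    have j: "j \<in> J" using u by (auto simp: j_def J_def)
    have "(\<Sum>j\<in>J. card {u \<in> C j. row \<alpha> (g u) < h}) = (\<Sum>j\<in>J. card {u \<in> C j. row \<beta> u < h})"
      using sumJ shift[of h] unfolding ab below_def by simp
    then have "card {u \<in> C j. row \<alpha> (g u) < h} = card {u \<in> C j. row \<beta> u < h}"
      using sum_mono_inv[OF _ le j] by (simp add: J_def)
    also have "\<dots> = card (C j)" using column_rows(2)[OF b, of j h] unfolding C_def h_def by simp
    finally have "{u \<in> C j. row \<alpha> (g u) < h} = C j" by (intro card_subset_eq fin) auto
    then have "row \<alpha> (g u) < h" using u by (auto simp: C_def j_def)
    then obtain k where "k \<in> C j" "row \<beta> k = row \<alpha> (g u)"
      using column_rows(1)[OF b, of j] unfolding C_def h_def by (metis (no_types, lifting) imageE lessThan_iff)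
    then show ?thesis using cell_in[OF b, of k] ab by (auto simp: C_def j_def)
  qed
qed

section \<open>Young symmetrizers\<close>

lemma perm_group_row: "perm_group (sum_list \<alpha>) (row_stabilizer \<alpha>)"
  unfolding perm_group_def row_stabilizer_def
proof (safe)
  fix g assume g: "g \<in> Sym (sum_list \<alpha>)" "\<forall>k<sum_list \<alpha>. row \<alpha> (g k) = row \<alpha> k"
  show "inv g \<in> Sym (sum_list \<alpha>)" using g by (simp add: inv_Sym)
  fix k assume "k < sum_list \<alpha>"
  then show "row \<alpha> (inv g k) = row \<alpha> k"
    using g by (metis Sym_cancel(7) Sym_less inv_Sym)
qed (auto simp: comp_Sym)

lemma perm_group_column: "perm_group (sum_list \<alpha>) (column_stabilizer \<alpha>)"
  unfolding perm_group_def column_stabilizer_def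
proof (safe)
  fix g assume g: "g \<in> Sym (sum_list \<alpha>)" "\<forall>k<sum_list \<alpha>. col \<alpha> (g k) = col \<alpha> k"
  show "inv g \<in> Sym (sum_list \<alpha>)" using g by (simp add: inv_Sym)
  fix k assume "k < sum_list \<alpha>"
  then show "col \<alpha> (inv g k) = col \<alpha> k"
    using g by (metis Sym_cancel(7) Sym_less inv_Sym)
qed (auto simp: comp_Sym)

lemma transpose_row:
  "i < sum_list \<alpha> \<Longrightarrow> j < sum_list \<alpha> \<Longrightarrow> row \<alpha> i = row \<alpha> j \<Longrightarrow> Transposition.transpose i j \<in> row_stabilizer \<alpha>"
  unfolding row_stabilizer_def by (auto simp: transpose_Sym Transposition.transpose_def)

lemma transpose_column:
  "i < sum_list \<alpha> \<Longrightarrow> j < sum_list \<alpha> \<Longrightarrow> col \<alpha> i = col \<alpha> j \<Longrightarrow> Transposition.transpose i j \<in> column_stabilizer \<alpha>"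
  unfolding column_stabilizer_def by (auto simp: transpose_Sym Transposition.transpose_def)

lemma transpose_conj:
  assumes "g \<in> Sym n"
  shows "Transposition.transpose (g u) (g u') \<circ> g = g \<circ> Transposition.transpose u u'"
  using Sym_inject[OF assms] by (auto simp: fun_eq_iff Transposition.transpose_def)

context
  fixes n :: nat
begin

abbreviation gmult :: "((nat \<Rightarrow> nat) \<Rightarrow> 'k::comm_ring_1) \<Rightarrow> ((nat \<Rightarrow> nat) \<Rightarrow> 'k) \<Rightarrow> (nat \<Rightarrow> nat) \<Rightarrow> 'k" where
  "gmult \<equiv> group_algebra_mult n"

lemma gmult_assoc: "gmult (gmult a b) c = gmult a (gmult b c)"
proof
  fix \<pi>
  have "gmult (gmult a b) c \<pi> = (\<Sum>\<sigma>\<in>Sym n. \<Sum>\<tau>\<in>Sym n. a \<tau> * b (inv \<tau> \<circ> \<sigma>) * c (inv \<sigma> \<circ> \<pi>))"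
    unfolding group_algebra_mult_def by (simp add: sum_distrib_right)
  also have "\<dots> = (\<Sum>\<tau>\<in>Sym n. \<Sum>\<sigma>\<in>Sym n. a \<tau> * b (inv \<tau> \<circ> \<sigma>) * c (inv \<sigma> \<circ> \<pi>))" by (rule sum.swap)
  also have "\<dots> = (\<Sum>\<tau>\<in>Sym n. \<Sum>\<sigma>\<in>Sym n. a \<tau> * (b \<sigma> * c (inv \<sigma> \<circ> (inv \<tau> \<circ> \<pi>))))"
  proof (rule sum.cong[OF refl])
    fix \<tau> assume t: "\<tau> \<in> Sym n"
    have "(\<Sum>\<sigma>\<in>Sym n. a \<tau> * b (inv \<tau> \<circ> \<sigma>) * c (inv \<sigma> \<circ> \<pi>))
        = (\<Sum>\<sigma>\<in>Sym n. a \<tau> * b (inv \<tau> \<circ> (\<tau> \<circ> \<sigma>)) * c (inv (\<tau> \<circ> \<sigma>) \<circ> \<pi>))"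
      by (rule sum_group_left[OF perm_group_Sym t, symmetric])
    also have "\<dots> = (\<Sum>\<sigma>\<in>Sym n. a \<tau> * (b \<sigma> * c (inv \<sigma> \<circ> (inv \<tau> \<circ> \<pi>))))"
      by (rule sum.cong) (use t in \<open>auto simp: Sym_cancel[OF t] Sym_inv_comp[OF t] comp_assoc mult.assoc\<close>)
    finally show "(\<Sum>\<sigma>\<in>Sym n. a \<tau> * b (inv \<tau> \<circ> \<sigma>) * c (inv \<sigma> \<circ> \<pi>))
        = (\<Sum>\<sigma>\<in>Sym n. a \<tau> * (b \<sigma> * c (inv \<sigma> \<circ> (inv \<tau> \<circ> \<pi>))))" .
  qed
  also have "\<dots> = gmult a (gmult b c) \<pi>"
    unfolding group_algebra_mult_def by (simp add: sum_distrib_left)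
  finally show "gmult (gmult a b) c \<pi> = gmult a (gmult b c) \<pi>" .
qed

lemma gmult_in_group_algebra:
  assumes "b \<in> group_algebra n"
  shows "gmult a b \<in> group_algebra n"
proof -
  have "\<pi> \<in> Sym n" if nz: "gmult a b \<pi> \<noteq> 0" for \<pi>
  proof -
    have "\<exists>\<sigma>\<in>Sym n. a \<sigma> * b (inv \<sigma> \<circ> \<pi>) \<noteq> 0"
      using nz unfolding group_algebra_mult_def by (meson sum.neutral)
    then obtain \<sigma> where s: "\<sigma> \<in> Sym n" "b (inv \<sigma> \<circ> \<pi>) \<noteq> 0" by force
    then have "inv \<sigma> \<circ> \<pi> \<in> Sym n" using assms unfolding group_algebra_def by blast
    then show ?thesis using s Sym_comp_iff[OF inv_Sym] by blast
  qed
  then show ?thesis unfolding group_algebra_def by blast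
qed

lemma gmult_delta_left:
  assumes "\<tau> \<in> Sym n"
  shows "gmult (\<lambda>\<sigma>. if \<sigma> = \<tau> then 1 else 0) b = (\<lambda>\<pi>. b (inv \<tau> \<circ> \<pi>))"
proof
  fix \<pi>
  have "gmult (\<lambda>\<sigma>. if \<sigma> = \<tau> then 1 else 0) b \<pi> = (\<Sum>\<sigma>\<in>Sym n. if \<sigma> = \<tau> then b (inv \<tau> \<circ> \<pi>) else 0)"
    unfolding group_algebra_mult_def by (rule sum.cong) auto
  then show "gmult (\<lambda>\<sigma>. if \<sigma> = \<tau> then 1 else 0) b \<pi> = b (inv \<tau> \<circ> \<pi>)" using assms by simp
qed

end

context
  fixes n :: nat and \<alpha> :: "nat list"
  assumes part: "\<alpha> \<in> partitions_of n"
begin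

lemma row_group: "perm_group n (row_stabilizer \<alpha>)" and column_group: "perm_group n (column_stabilizer \<alpha>)"
  using perm_group_row[of \<alpha>] perm_group_column[of \<alpha>] sum_list_part[OF part] by simp_all

lemma row_Sym: "\<rho> \<in> row_stabilizer \<alpha> \<Longrightarrow> \<rho> \<in> Sym n" and column_Sym: "\<gamma> \<in> column_stabilizer \<alpha> \<Longrightarrow> \<gamma> \<in> Sym n"
  using perm_groupD(1)[OF row_group] perm_groupD(1)[OF column_group] by auto

lemma row_column_id:
  assumes "\<rho> \<in> row_stabilizer \<alpha>" "\<rho> \<in> column_stabilizer \<alpha>"
  shows "\<rho> = id"
proof
  fix k
  show "\<rho> k = id k"
  proof (cases "k < n")
    case True
    then show ?thesis
      using assms cell_inj[OF part, of "\<rho> k" k] row_Sym[OF assms(1)]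
      unfolding row_stabilizer_def column_stabilizer_def sum_list_part[OF part] by simp
  next
    case False
    then show ?thesis using Sym_permutes[OF row_Sym[OF assms(1)]] by (simp add: permutes_def)
  qed
qed

lemma young_row:
  assumes "\<rho> \<in> row_stabilizer \<alpha>"
  shows "young_symmetrizer \<alpha> (\<rho> \<circ> \<pi>) = young_symmetrizer \<alpha> \<pi>"
proof -
  note r = row_Sym[OF assms]
  have "young_symmetrizer \<alpha> (\<rho> \<circ> \<pi>) = (\<Sum>\<rho>'\<in>row_stabilizer \<alpha>. \<Sum>\<gamma>\<in>column_stabilizer \<alpha>.
     if \<rho> \<circ> \<pi> = (\<rho> \<circ> \<rho>') \<circ> \<gamma> then of_int (sign \<gamma>) else 0)"
    unfolding young_symmetrizer_def by (rule sum_group_left[OF row_group assms, symmetric])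
  also have "\<dots> = young_symmetrizer \<alpha> \<pi>"
    unfolding young_symmetrizer_def
    by (intro sum.cong refl if_cong) (metis Sym_cancel(1)[OF r] comp_assoc)
  finally show ?thesis .
qed

lemma young_column:
  assumes "\<gamma> \<in> column_stabilizer \<alpha>"
  shows "young_symmetrizer \<alpha> (\<pi> \<circ> \<gamma>) = of_int (sign \<gamma>) * young_symmetrizer \<alpha> \<pi>"
proof -
  note g = column_Sym[OF assms]
  have "young_symmetrizer \<alpha> (\<pi> \<circ> \<gamma>) = (\<Sum>\<rho>\<in>row_stabilizer \<alpha>. \<Sum>\<gamma>'\<in>column_stabilizer \<alpha>.
     if \<pi> \<circ> \<gamma> = \<rho> \<circ> (\<gamma>' \<circ> \<gamma>) then of_int (sign (\<gamma>' \<circ> \<gamma>)) else 0)"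
    unfolding young_symmetrizer_def
    by (rule sum.cong[OF refl]) (rule sum_group_right[OF column_group assms, symmetric])
  also have "\<dots> = (\<Sum>\<rho>\<in>row_stabilizer \<alpha>. \<Sum>\<gamma>'\<in>column_stabilizer \<alpha>.
     of_int (sign \<gamma>) * (if \<pi> = \<rho> \<circ> \<gamma>' then of_int (sign \<gamma>') else 0))"
  proof (intro sum.cong refl)
    fix \<rho> \<gamma>' assume "\<gamma>' \<in> column_stabilizer \<alpha>"
    then have s: "sign (\<gamma>' \<circ> \<gamma>) = sign \<gamma>' * sign \<gamma>" by (intro Sym_sign_comp[of _ n] column_Sym g)
    have "\<pi> \<circ> \<gamma> = \<rho> \<circ> (\<gamma>' \<circ> \<gamma>) \<longleftrightarrow> \<pi> = \<rho> \<circ> \<gamma>'"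
      by (metis Sym_cancel(4)[OF g] comp_assoc comp_id)
    then show "(if \<pi> \<circ> \<gamma> = \<rho> \<circ> (\<gamma>' \<circ> \<gamma>) then of_int (sign (\<gamma>' \<circ> \<gamma>)) else 0) =
       of_int (sign \<gamma>) * (if \<pi> = \<rho> \<circ> \<gamma>' then of_int (sign \<gamma>') else (0::'b::comm_ring_1))"
      using s by (simp add: mult.commute)
  qed
  finally show ?thesis unfolding young_symmetrizer_def by (simp add: sum_distrib_left)
qed

lemma young_nonzero:
  assumes "young_symmetrizer \<alpha> \<pi> \<noteq> 0"
  shows "\<exists>\<rho>\<in>row_stabilizer \<alpha>. \<exists>\<gamma>\<in>column_stabilizer \<alpha>. \<pi> = \<rho> \<circ> \<gamma>"
proof (rule ccontr)
  assume "\<not> ?thesis"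
  then have "young_symmetrizer \<alpha> \<pi> = 0"
    unfolding young_symmetrizer_def by (intro sum.neutral ballI) auto
  with assms show False by contradiction
qed

lemma young_id: "young_symmetrizer \<alpha> id = 1"
proof -
  have "(if id = \<rho> \<circ> \<gamma> then of_int (sign \<gamma>) else 0) = (if \<rho> = id then if \<gamma> = id then 1 else 0 else (0::'a))"
    if r: "\<rho> \<in> row_stabilizer \<alpha>" and g: "\<gamma> \<in> column_stabilizer \<alpha>" for \<rho> \<gamma>
  proof -
    have "\<gamma> = id \<and> \<rho> = id" if "id = \<rho> \<circ> \<gamma>"
    proof -
      have "\<gamma> = inv \<rho>" using that Sym_cancel(1)[OF row_Sym[OF r], of \<gamma>] by (metis comp_id)
      then have "\<gamma> \<in> row_stabilizer \<alpha>" using perm_groupD(4)[OF row_group r] by simp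
      from row_column_id[OF this g] show ?thesis using that by simp
    qed
    then show ?thesis by auto
  qed
  then have "young_symmetrizer \<alpha> id = (\<Sum>\<rho>\<in>row_stabilizer \<alpha>. \<Sum>\<gamma>\<in>column_stabilizer \<alpha>.
      (if \<rho> = id then if \<gamma> = id then 1 else 0 else (0::'a)))"
    unfolding young_symmetrizer_def by (intro sum.cong refl) simp
  also have "\<dots> = (\<Sum>\<rho>\<in>row_stabilizer \<alpha>. if \<rho> = id then 1 else 0)"
    using perm_groupD[OF column_group] by (intro sum.cong refl) simp
  finally show ?thesis using perm_groupD[OF row_group] by simp
qed

lemma young_Sym: "young_symmetrizer \<alpha> \<in> group_algebra n"
  unfolding group_algebra_def using young_nonzero comp_Sym[OF row_Sym column_Sym] by blast

lemma young_mult: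
  fixes v :: "(nat \<Rightarrow> nat) \<Rightarrow> 'k::comm_ring_1"
  shows "group_algebra_mult n (young_symmetrizer \<alpha>) v \<pi> =
    (\<Sum>\<rho>\<in>row_stabilizer \<alpha>. \<Sum>\<gamma>\<in>column_stabilizer \<alpha>. of_int (sign \<gamma>) * v (inv \<gamma> \<circ> (inv \<rho> \<circ> \<pi>)))"
proof -
  have "group_algebra_mult n (young_symmetrizer \<alpha>) v \<pi> = (\<Sum>\<sigma>\<in>Sym n. \<Sum>\<rho>\<in>row_stabilizer \<alpha>. \<Sum>\<gamma>\<in>column_stabilizer \<alpha>.
      if \<sigma> = \<rho> \<circ> \<gamma> then of_int (sign \<gamma>) * v (inv \<sigma> \<circ> \<pi>) else 0)"
    unfolding group_algebra_mult_def young_symmetrizer_def sum_distrib_right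
    by (intro sum.cong refl) simp
  also have "\<dots> = (\<Sum>\<rho>\<in>row_stabilizer \<alpha>. \<Sum>\<gamma>\<in>column_stabilizer \<alpha>. \<Sum>\<sigma>\<in>Sym n.
      if \<sigma> = \<rho> \<circ> \<gamma> then of_int (sign \<gamma>) * v (inv \<sigma> \<circ> \<pi>) else 0)"
    by (subst sum.swap) (simp add: sum.swap[of _ "Sym n"])
  also have "\<dots> = (\<Sum>\<rho>\<in>row_stabilizer \<alpha>. \<Sum>\<gamma>\<in>column_stabilizer \<alpha>. of_int (sign \<gamma>) * v (inv \<gamma> \<circ> (inv \<rho> \<circ> \<pi>)))"
  proof (intro sum.cong refl)
    fix \<rho> \<gamma> assume rg: "\<rho> \<in> row_stabilizer \<alpha>" "\<gamma> \<in> column_stabilizer \<alpha>"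
    have "(\<Sum>\<sigma>\<in>Sym n. if \<sigma> = \<rho> \<circ> \<gamma> then of_int (sign \<gamma>) * v (inv \<sigma> \<circ> \<pi>) else 0)
        = of_int (sign \<gamma>) * v (inv (\<rho> \<circ> \<gamma>) \<circ> \<pi>)"
      using comp_Sym[OF row_Sym[OF rg(1)] column_Sym[OF rg(2)]] by simp
    then show "(\<Sum>\<sigma>\<in>Sym n. if \<sigma> = \<rho> \<circ> \<gamma> then of_int (sign \<gamma>) * v (inv \<sigma> \<circ> \<pi>) else 0)
        = of_int (sign \<gamma>) * v (inv \<gamma> \<circ> (inv \<rho> \<circ> \<pi>))"
      using Sym_inv_comp[OF row_Sym[OF rg(1)] column_Sym[OF rg(2)]] by (simp add: comp_assoc)
  qed
  finally show ?thesis .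
qed

lemma mult_young:
  fixes a :: "(nat \<Rightarrow> nat) \<Rightarrow> 'k::comm_ring_1"
  assumes p: "\<pi> \<in> Sym n"
  shows "group_algebra_mult n a (young_symmetrizer \<alpha>) \<pi> =
    (\<Sum>\<rho>\<in>row_stabilizer \<alpha>. \<Sum>\<gamma>\<in>column_stabilizer \<alpha>. of_int (sign \<gamma>) * a (\<pi> \<circ> inv \<gamma> \<circ> inv \<rho>))"
proof -
  have "group_algebra_mult n a (young_symmetrizer \<alpha>) \<pi> = (\<Sum>\<sigma>\<in>Sym n. \<Sum>\<rho>\<in>row_stabilizer \<alpha>. \<Sum>\<gamma>\<in>column_stabilizer \<alpha>.
      if inv \<sigma> \<circ> \<pi> = \<rho> \<circ> \<gamma> then of_int (sign \<gamma>) * a \<sigma> else 0)"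
    unfolding group_algebra_mult_def young_symmetrizer_def sum_distrib_left
    by (intro sum.cong refl) simp
  also have "\<dots> = (\<Sum>\<rho>\<in>row_stabilizer \<alpha>. \<Sum>\<gamma>\<in>column_stabilizer \<alpha>. \<Sum>\<sigma>\<in>Sym n.
      if inv \<sigma> \<circ> \<pi> = \<rho> \<circ> \<gamma> then of_int (sign \<gamma>) * a \<sigma> else 0)"
    by (subst sum.swap) (simp add: sum.swap[of _ "Sym n"])
  also have "\<dots> = (\<Sum>\<rho>\<in>row_stabilizer \<alpha>. \<Sum>\<gamma>\<in>column_stabilizer \<alpha>. of_int (sign \<gamma>) * a (\<pi> \<circ> inv \<gamma> \<circ> inv \<rho>))"
  proof (intro sum.cong refl)
    fix \<rho> \<gamma> assume rg: "\<rho> \<in> row_stabilizer \<alpha>" "\<gamma> \<in> column_stabilizer \<alpha>"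
    note r = row_Sym[OF rg(1)] and g = column_Sym[OF rg(2)]
    have "inv \<sigma> \<circ> \<pi> = \<rho> \<circ> \<gamma> \<longleftrightarrow> \<sigma> = \<pi> \<circ> inv \<gamma> \<circ> inv \<rho>" if s: "\<sigma> \<in> Sym n" for \<sigma>
    proof
      assume "inv \<sigma> \<circ> \<pi> = \<rho> \<circ> \<gamma>"
      then have "\<pi> = \<sigma> \<circ> \<rho> \<circ> \<gamma>" using Sym_cancel(2)[OF s, of \<pi>] by (simp add: comp_assoc)
      then show "\<sigma> = \<pi> \<circ> inv \<gamma> \<circ> inv \<rho>" by (simp add: comp_assoc Sym_cancel[OF r] Sym_cancel[OF g])
    next
      assume sig: "\<sigma> = \<pi> \<circ> inv \<gamma> \<circ> inv \<rho>"
      have "\<sigma> \<circ> (\<rho> \<circ> \<gamma>) = \<pi>" unfolding sig by (simp add: comp_assoc Sym_cancel[OF r] Sym_cancel[OF g])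
      then show "inv \<sigma> \<circ> \<pi> = \<rho> \<circ> \<gamma>" using Sym_cancel(1)[OF s] by metis
    qed
    then have "(\<Sum>\<sigma>\<in>Sym n. if inv \<sigma> \<circ> \<pi> = \<rho> \<circ> \<gamma> then of_int (sign \<gamma>) * a \<sigma> else 0)
        = (\<Sum>\<sigma>\<in>Sym n. if \<sigma> = \<pi> \<circ> inv \<gamma> \<circ> inv \<rho> then of_int (sign \<gamma>) * a \<sigma> else 0)"
      by (intro sum.cong) auto
    also have "\<dots> = of_int (sign \<gamma>) * a (\<pi> \<circ> inv \<gamma> \<circ> inv \<rho>)"
      using comp_Sym[OF comp_Sym[OF p inv_Sym[OF g]] inv_Sym[OF r]] by simp
    finally show "(\<Sum>\<sigma>\<in>Sym n. if inv \<sigma> \<circ> \<pi> = \<rho> \<circ> \<gamma> then of_int (sign \<gamma>) * a \<sigma> else 0)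
        = of_int (sign \<gamma>) * a (\<pi> \<circ> inv \<gamma> \<circ> inv \<rho>)" .
  qed
  finally show ?thesis .
qed

lemma young_mult_row:
  assumes "\<rho> \<in> row_stabilizer \<alpha>"
  shows "group_algebra_mult n (young_symmetrizer \<alpha>) v (\<rho> \<circ> \<pi>) = group_algebra_mult n (young_symmetrizer \<alpha>) v \<pi>"
proof -
  note r = row_Sym[OF assms]
  have "group_algebra_mult n (young_symmetrizer \<alpha>) v (\<rho> \<circ> \<pi>)
     = (\<Sum>\<sigma>\<in>Sym n. young_symmetrizer \<alpha> (\<rho> \<circ> \<sigma>) * v (inv (\<rho> \<circ> \<sigma>) \<circ> (\<rho> \<circ> \<pi>)))"
    unfolding group_algebra_mult_def by (rule sum_group_left[OF perm_group_Sym r, symmetric])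
  also have "\<dots> = group_algebra_mult n (young_symmetrizer \<alpha>) v \<pi>"
    unfolding group_algebra_mult_def
    by (rule sum.cong) (simp_all add: young_row[OF assms] Sym_inv_comp[OF r] Sym_cancel[OF r] comp_assoc)
  finally show ?thesis .
qed

end

lemma mult_young_column:
  assumes "\<beta> \<in> partitions_of n" "\<gamma> \<in> column_stabilizer \<beta>"
  shows "group_algebra_mult n a (young_symmetrizer \<beta>) (\<pi> \<circ> \<gamma>)
       = of_int (sign \<gamma>) * group_algebra_mult n a (young_symmetrizer \<beta>) \<pi>"
  unfolding group_algebra_mult_def sum_distrib_left
  by (rule sum.cong) (simp_all add: young_column[OF assms] comp_assoc[symmetric] mult_ac)

lemma gmult_column:
  assumes "\<And>\<pi>. v (\<pi> \<circ> \<gamma>) = c * v \<pi>"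
  shows "group_algebra_mult n a v (\<pi> \<circ> \<gamma>) = c * group_algebra_mult n a v \<pi>"
  unfolding group_algebra_mult_def sum_distrib_left
  by (rule sum.cong) (use assms in \<open>auto simp: comp_assoc[symmetric] mult_ac\<close>)

lemma mult_mult_young_column:
  assumes "\<beta> \<in> partitions_of n" "\<gamma> \<in> column_stabilizer \<beta>"
  shows "group_algebra_mult n b (group_algebra_mult n a (young_symmetrizer \<beta>)) (\<pi> \<circ> \<gamma>)
       = of_int (sign \<gamma>) * group_algebra_mult n b (group_algebra_mult n a (young_symmetrizer \<beta>)) \<pi>"
  by (rule gmult_column) (rule mult_young_column[OF assms])

text \<open>The classical argument for the vanishing of coefficients: if two entries lie in a common column
  of \<open>\<beta>\<close> and their images in a common row of \<open>\<alpha>\<close>, one transposition moves from the one side to the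
  other and changes the sign.\<close>

lemma clash_zero:
  fixes x :: "(nat \<Rightarrow> nat) \<Rightarrow> 'k::field_char_0"
  assumes a: "\<alpha> \<in> partitions_of n" and b: "\<beta> \<in> partitions_of n" and g: "g \<in> Sym n"
    and row: "\<And>\<rho> \<pi>. \<rho> \<in> row_stabilizer \<alpha> \<Longrightarrow> \<pi> \<in> Sym n \<Longrightarrow> x (\<rho> \<circ> \<pi>) = x \<pi>"
    and col: "\<And>\<gamma> \<pi>. \<gamma> \<in> column_stabilizer \<beta> \<Longrightarrow> \<pi> \<in> Sym n \<Longrightarrow> x (\<pi> \<circ> \<gamma>) = of_int (sign \<gamma>) * x \<pi>"
    and clash: "\<not> no_clash n \<alpha> \<beta> g"
  shows "x g = 0"
proof -
  obtain u u' where u: "u < n" "u' < n" "u \<noteq> u'" "col \<beta> u = col \<beta> u'" "row \<alpha> (g u) = row \<alpha> (g u')"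
    using clash unfolding no_clash_def by blast
  have "x g = x (Transposition.transpose (g u) (g u') \<circ> g)"
    using row[OF transpose_row g, of "g u" "g u'"] u g sum_list_part[OF a] by simp
  also have "\<dots> = - x g"
    unfolding transpose_conj[OF g] using col[OF transpose_column g, of u u'] u sum_list_part[OF b]
    by (simp add: sign_swap_id)
  finally show ?thesis by simp
qed

lemma clash_zero_inv:
  fixes y :: "(nat \<Rightarrow> nat) \<Rightarrow> 'k::field_char_0"
  assumes a: "\<alpha> \<in> partitions_of n" and b: "\<beta> \<in> partitions_of n" and g: "g \<in> Sym n"
    and col: "\<And>\<gamma> \<pi>. \<gamma> \<in> column_stabilizer \<alpha> \<Longrightarrow> \<pi> \<in> Sym n \<Longrightarrow> y (\<gamma> \<circ> \<pi>) = of_int (sign \<gamma>) * y \<pi>"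
    and row: "\<And>\<rho> \<pi>. \<rho> \<in> row_stabilizer \<beta> \<Longrightarrow> \<pi> \<in> Sym n \<Longrightarrow> y (\<pi> \<circ> \<rho>) = y \<pi>"
    and clash: "\<not> no_clash n \<beta> \<alpha> (inv g)"
  shows "y g = 0"
proof -
  have inv_in: "inv \<gamma> \<in> column_stabilizer \<alpha>" "sign (inv \<gamma>) = sign \<gamma>" if "\<gamma> \<in> column_stabilizer \<alpha>" for \<gamma>
    using perm_groupD(4)[OF column_group[OF a] that] Sym_sign_inv[OF column_Sym[OF a that]] by auto
  have "y (inv (inv g)) = 0"
  proof (rule clash_zero[OF b a inv_Sym[OF g], where x = "\<lambda>\<pi>. y (inv \<pi>)"])
    show "y (inv (\<rho> \<circ> \<pi>)) = y (inv \<pi>)" if "\<rho> \<in> row_stabilizer \<beta>" "\<pi> \<in> Sym n" for \<rho> \<pi>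
      using row[OF perm_groupD(4)[OF row_group[OF b] that(1)] inv_Sym[OF that(2)]]
        Sym_inv_comp[OF row_Sym[OF b that(1)] that(2)] by simp
    show "y (inv (\<pi> \<circ> \<gamma>)) = of_int (sign \<gamma>) * y (inv \<pi>)" if "\<gamma> \<in> column_stabilizer \<alpha>" "\<pi> \<in> Sym n" for \<gamma> \<pi>
      using col[OF inv_in(1)[OF that(1)] inv_Sym[OF that(2)]] inv_in(2)[OF that(1)]
        Sym_inv_comp[OF that(2) column_Sym[OF a that(1)]] by simp
  qed (rule clash)
  then show ?thesis using Sym_cancel(5)[OF g] by simp
qed

lemma no_clash_factor:
  assumes a: "\<alpha> \<in> partitions_of n" and g: "g \<in> Sym n" and nc: "no_clash n \<alpha> \<alpha> g"
  shows "\<exists>\<rho>\<in>row_stabilizer \<alpha>. \<exists>\<gamma>\<in>column_stabilizer \<alpha>. g = \<rho> \<circ> \<gamma>"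
proof -
  have "\<exists>k. (u < n \<longrightarrow> k < n \<and> row \<alpha> k = row \<alpha> (g u) \<and> col \<alpha> k = col \<alpha> u) \<and> (\<not> u < n \<longrightarrow> k = u)" for u
    using cell_ex[OF a no_clash_dominance(2)[OF a a g nc refl, of u]] by (cases "u < n") auto
  then obtain \<gamma> where \<gamma>: "\<And>u. u < n \<Longrightarrow> \<gamma> u < n \<and> row \<alpha> (\<gamma> u) = row \<alpha> (g u) \<and> col \<alpha> (\<gamma> u) = col \<alpha> u"
    "\<And>u. \<not> u < n \<Longrightarrow> \<gamma> u = u" by metis
  have "inj_on \<gamma> {..<n}"
  proof (rule inj_onI)
    fix u u' assume u: "u \<in> {..<n}" "u' \<in> {..<n}" "\<gamma> u = \<gamma> u'"
    then have "col \<alpha> u = col \<alpha> u'" "row \<alpha> (g u) = row \<alpha> (g u')" using \<gamma>(1) by (metis lessThan_iff)+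
    then show "u = u'" using nc u unfolding no_clash_def by blast
  qed
  moreover have "\<gamma> ` {..<n} = {..<n}" by (rule endo_inj_surj) (use \<gamma>(1) calculation in auto)
  ultimately have "\<gamma> permutes {..<n}"
    by (intro bij_imp_permutes) (use \<gamma> in \<open>auto simp: bij_betw_def\<close>)
  then have gs: "\<gamma> \<in> Sym n" by (simp add: Sym_def)
  then have gc: "\<gamma> \<in> column_stabilizer \<alpha>" using \<gamma> unfolding column_stabilizer_def sum_list_part[OF a] by simp
  have "g \<circ> inv \<gamma> \<in> row_stabilizer \<alpha>"
    unfolding row_stabilizer_def sum_list_part[OF a]
  proof (safe)
    show "g \<circ> inv \<gamma> \<in> Sym n" by (intro comp_Sym g inv_Sym gs)
    fix k assume "k < n"
    then have "inv \<gamma> k < n" using inv_Sym[OF gs] by simp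
    from \<gamma>(1)[OF this] show "row \<alpha> ((g \<circ> inv \<gamma>) k) = row \<alpha> k" by (simp add: Sym_cancel[OF gs])
  qed
  moreover have "g = (g \<circ> inv \<gamma>) \<circ> \<gamma>" by (simp add: comp_assoc Sym_cancel[OF gs])
  ultimately show ?thesis using gc by blast
qed

text \<open>The Young symmetrizer is determined up to a scalar by its behaviour under row and column
  permutations: at a permutation that is not of the form \<open>\<rho>\<gamma>\<close> two entries clash.\<close>

lemma von_Neumann:
  fixes x :: "(nat \<Rightarrow> nat) \<Rightarrow> 'k::field_char_0"
  assumes a: "\<alpha> \<in> partitions_of n" and x: "x \<in> group_algebra n"
    and row: "\<And>\<rho> \<pi>. \<rho> \<in> row_stabilizer \<alpha> \<Longrightarrow> \<pi> \<in> Sym n \<Longrightarrow> x (\<rho> \<circ> \<pi>) = x \<pi>"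
    and col: "\<And>\<gamma> \<pi>. \<gamma> \<in> column_stabilizer \<alpha> \<Longrightarrow> \<pi> \<in> Sym n \<Longrightarrow> x (\<pi> \<circ> \<gamma>) = of_int (sign \<gamma>) * x \<pi>"
  shows "x \<pi> = x id * young_symmetrizer \<alpha> \<pi>"
proof (cases "\<pi> \<in> Sym n")
  case False
  have "young_symmetrizer \<alpha> \<in> (group_algebra n :: ((nat \<Rightarrow> nat) \<Rightarrow> 'k) set)" by (rule young_Sym[OF a])
  then have "young_symmetrizer \<alpha> \<pi> = (0::'k)" "x \<pi> = 0" using x False unfolding group_algebra_def by blast+
  then show ?thesis by simp
next
  case True
  show ?thesis
  proof (cases "no_clash n \<alpha> \<alpha> \<pi>")
    case False
    have "x \<pi> = 0" by (rule clash_zero[OF a a True row col False])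
    moreover have "young_symmetrizer \<alpha> \<pi> = (0::'k)"
      by (rule clash_zero[OF a a True young_row[OF a] young_column[OF a] False])
    ultimately show ?thesis by simp
  next
    case nc: True
    then obtain \<rho> \<gamma> where rg: "\<rho> \<in> row_stabilizer \<alpha>" "\<gamma> \<in> column_stabilizer \<alpha>" "\<pi> = \<rho> \<circ> \<gamma>"
      using no_clash_factor[OF a True] by blast
    have "x \<pi> = of_int (sign \<gamma>) * x id"
      using row[OF rg(1) column_Sym[OF a rg(2)]] col[OF rg(2), of id] rg(3) by simp
    moreover have "young_symmetrizer \<alpha> \<pi> = (of_int (sign \<gamma>) :: 'k)"
      by (simp add: rg(3) young_row[OF a rg(1)] young_column[OF a rg(2), of id, simplified] young_id[OF a])
    ultimately show ?thesis by simp
  qed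
qed

definition hook_factor :: "nat list \<Rightarrow> 'k::comm_ring_1" where
  "hook_factor \<alpha> = group_algebra_mult (sum_list \<alpha>) (young_symmetrizer \<alpha>) (young_symmetrizer \<alpha>) id"

lemma young_mult_young_same:
  fixes a :: "(nat \<Rightarrow> nat) \<Rightarrow> 'k::field_char_0"
  assumes p: "\<alpha> \<in> partitions_of n"
  defines "c \<equiv> young_symmetrizer \<alpha>"
  shows "group_algebra_mult n c (group_algebra_mult n a c)
     = fscale (group_algebra_mult n c (group_algebra_mult n a c) id) c"
    "group_algebra_mult n c c = fscale (hook_factor \<alpha>) c"
proof -
  have A: "group_algebra_mult n c (group_algebra_mult n a c) \<pi>
     = group_algebra_mult n c (group_algebra_mult n a c) id * c \<pi>" for \<pi>
    unfolding c_def
    by (rule von_Neumann[OF p])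
       (rule gmult_in_group_algebra[OF gmult_in_group_algebra[OF young_Sym[OF p]]] young_mult_row[OF p]
          mult_mult_young_column[OF p], assumption?)+
  show "group_algebra_mult n c (group_algebra_mult n a c)
     = fscale (group_algebra_mult n c (group_algebra_mult n a c) id) c"
    by (rule ext) (unfold fscale_apply, rule A)
  have B: "group_algebra_mult n c c \<pi> = group_algebra_mult n c c id * c \<pi>" for \<pi>
    unfolding c_def
    by (rule von_Neumann[OF p])
       (rule gmult_in_group_algebra[OF young_Sym[OF p]] young_mult_row[OF p]
          mult_young_column[OF p], assumption?)+
  have k: "hook_factor \<alpha> = group_algebra_mult n c c id"
    by (simp add: hook_factor_def c_def sum_list_part[OF p])
  show "group_algebra_mult n c c = fscale (hook_factor \<alpha>) c"
    by (rule ext) (unfold fscale_apply k, rule B)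
qed

lemma young_mult_young_different:
  fixes a :: "(nat \<Rightarrow> nat) \<Rightarrow> 'k::field_char_0"
  assumes p: "\<alpha> \<in> partitions_of n" and q: "\<beta> \<in> partitions_of n" and ne: "\<alpha> \<noteq> \<beta>"
  shows "group_algebra_mult n (young_symmetrizer \<alpha>) (group_algebra_mult n a (young_symmetrizer \<beta>)) = 0"
proof
  fix \<pi>
  let ?x = "group_algebra_mult n (young_symmetrizer \<alpha>) (group_algebra_mult n a (young_symmetrizer \<beta>))"
  have "?x \<pi> = 0" if g: "\<pi> \<in> Sym n"
  proof (cases "\<forall>i. below n \<alpha> i \<le> below n \<beta> i")
    case False
    then have "\<not> no_clash n \<alpha> \<beta> \<pi>" using no_clash_dominance(1)[OF p q g] by blast
    then show ?thesis
      by (intro clash_zero[OF p q g, where x = ?x])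
         (rule young_mult_row[OF p] mult_mult_young_column[OF q], assumption)+
  next
    case True
    then obtain i where i: "\<not> below n \<beta> i \<le> below n \<alpha> i" using below_antisym[OF p q] ne by (meson le_antisym)
    define y where "y g = (\<Sum>\<gamma>\<in>column_stabilizer \<alpha>. \<Sum>\<rho>\<in>row_stabilizer \<beta>.
       of_int (sign \<gamma>) * a (inv \<gamma> \<circ> (g \<circ> inv \<rho>)))" for g
    have y0: "y g = 0" if g: "g \<in> Sym n" for g
    proof (rule clash_zero_inv[OF p q g])
      show "\<not> no_clash n \<beta> \<alpha> (inv g)" using no_clash_dominance(1)[OF q p inv_Sym[OF g]] i by blast
      show "y (\<gamma> \<circ> h) = of_int (sign \<gamma>) * y h" if c: "\<gamma> \<in> column_stabilizer \<alpha>" for \<gamma> h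
      proof -
        note cs = column_Sym[OF p c]
        have "y (\<gamma> \<circ> h) = (\<Sum>\<gamma>'\<in>column_stabilizer \<alpha>. \<Sum>\<rho>\<in>row_stabilizer \<beta>.
           of_int (sign (\<gamma> \<circ> \<gamma>')) * a (inv (\<gamma> \<circ> \<gamma>') \<circ> ((\<gamma> \<circ> h) \<circ> inv \<rho>)))"
          unfolding y_def by (rule sum_group_left[OF column_group[OF p] c, symmetric])
        also have "\<dots> = of_int (sign \<gamma>) * y h"
          unfolding y_def sum_distrib_left
          by (intro sum.cong refl)
             (simp add: Sym_sign_comp[OF cs column_Sym[OF p]] Sym_inv_comp[OF cs column_Sym[OF p]] Sym_cancel[OF cs] comp_assoc)
        finally show ?thesis .
      qed
      show "y (h \<circ> \<rho>) = y h" if r: "\<rho> \<in> row_stabilizer \<beta>" for \<rho> h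
      proof -
        note rs = row_Sym[OF q r]
        have "y (h \<circ> \<rho>) = (\<Sum>\<gamma>\<in>column_stabilizer \<alpha>. \<Sum>\<rho>'\<in>row_stabilizer \<beta>.
           of_int (sign \<gamma>) * a (inv \<gamma> \<circ> ((h \<circ> \<rho>) \<circ> inv (\<rho>' \<circ> \<rho>))))"
          unfolding y_def by (rule sum.cong[OF refl], rule sum_group_right[OF row_group[OF q] r, symmetric])
        also have "\<dots> = y h"
          unfolding y_def
          by (intro sum.cong refl)
             (simp add: Sym_inv_comp[OF row_Sym[OF q] rs] Sym_cancel[OF rs] comp_assoc)
        finally show ?thesis .
      qed
    qed
    have "(\<Sum>\<gamma>\<in>column_stabilizer \<alpha>. of_int (sign \<gamma>) * group_algebra_mult n a (young_symmetrizer \<beta>) (inv \<gamma> \<circ> g)) = 0"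
      if g: "g \<in> Sym n" for g
    proof -
      have "(\<Sum>\<gamma>\<in>column_stabilizer \<alpha>. of_int (sign \<gamma>) * group_algebra_mult n a (young_symmetrizer \<beta>) (inv \<gamma> \<circ> g))
         = (\<Sum>\<gamma>\<in>column_stabilizer \<alpha>. \<Sum>\<rho>\<in>row_stabilizer \<beta>. \<Sum>\<gamma>'\<in>column_stabilizer \<beta>.
             of_int (sign \<gamma>') * (of_int (sign \<gamma>) * a (inv \<gamma> \<circ> ((g \<circ> inv \<gamma>') \<circ> inv \<rho>))))"
        by (intro sum.cong refl)
           (simp add: mult_young[OF q comp_Sym[OF inv_Sym[OF column_Sym[OF p]] g]] sum_distrib_left comp_assoc mult_ac)
      also have "\<dots> = (\<Sum>\<gamma>\<in>column_stabilizer \<alpha>. \<Sum>\<gamma>'\<in>column_stabilizer \<beta>. \<Sum>\<rho>\<in>row_stabilizer \<beta>.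
             of_int (sign \<gamma>') * (of_int (sign \<gamma>) * a (inv \<gamma> \<circ> ((g \<circ> inv \<gamma>') \<circ> inv \<rho>))))"
        by (rule sum.cong[OF refl], rule sum.swap)
      also have "\<dots> = (\<Sum>\<gamma>'\<in>column_stabilizer \<beta>. \<Sum>\<gamma>\<in>column_stabilizer \<alpha>. \<Sum>\<rho>\<in>row_stabilizer \<beta>.
             of_int (sign \<gamma>') * (of_int (sign \<gamma>) * a (inv \<gamma> \<circ> ((g \<circ> inv \<gamma>') \<circ> inv \<rho>))))"
        by (rule sum.swap)
      also have "\<dots> = (\<Sum>\<gamma>'\<in>column_stabilizer \<beta>. of_int (sign \<gamma>') * y (g \<circ> inv \<gamma>'))"
        unfolding y_def sum_distrib_left ..
      also have "\<dots> = 0"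
        using y0[OF comp_Sym[OF g inv_Sym[OF column_Sym[OF q]]]] by (intro sum.neutral ballI) simp
      finally show ?thesis .
    qed
    then show ?thesis
      unfolding young_mult[OF p] using comp_Sym[OF inv_Sym[OF row_Sym[OF p]] g]
      by - (rule sum.neutral, intro ballI, simp)
  qed
  moreover have "?x \<in> group_algebra n"
    by (rule gmult_in_group_algebra[OF gmult_in_group_algebra[OF young_Sym[OF q]]])
  then have "?x \<pi> = 0" if "\<pi> \<notin> Sym n" using that unfolding group_algebra_def by blast
  ultimately show "?x \<pi> = 0 \<pi>" by (cases "\<pi> \<in> Sym n") (auto simp: zero_fun_apply)
qed

section \<open>Characters\<close>

definition class_function :: "nat \<Rightarrow> ((nat \<Rightarrow> nat) \<Rightarrow> 'k) \<Rightarrow> bool" where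
  "class_function n \<theta> \<longleftrightarrow> (\<forall>\<sigma>\<in>Sym n. \<forall>\<tau>\<in>Sym n. \<theta> (\<tau> \<circ> (\<sigma> \<circ> inv \<tau>)) = \<theta> \<sigma>)"

text \<open>The linear extension of a class function to the group algebra, at a Young symmetrizer.\<close>

definition young_value :: "nat \<Rightarrow> ((nat \<Rightarrow> nat) \<Rightarrow> 'k::comm_ring_1) \<Rightarrow> nat list \<Rightarrow> 'k" where
  "young_value n \<theta> \<alpha> = (\<Sum>\<sigma>\<in>Sym n. young_symmetrizer \<alpha> \<sigma> * \<theta> \<sigma>)"

lemma trace_mod_cong:
  assumes "quotient_space V W" "\<And>v. v \<in> V \<Longrightarrow> f v = g v"
  shows "trace_mod V W f = trace_mod V W g"
proof -
  interpret quotient_space V W by fact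
  show ?thesis unfolding trace_mod_coord by (rule sum.cong) (use assms(2) some_basis_in in auto)
qed

locale sym_rep = quotient_space V W for V W :: "('x \<Rightarrow> 'k::field_char_0) set" +
  fixes n :: nat and act :: "(nat \<Rightarrow> nat) \<Rightarrow> ('x \<Rightarrow> 'k) \<Rightarrow> ('x \<Rightarrow> 'k)"
  assumes act_lin: "\<sigma> \<in> Sym n \<Longrightarrow> lin_on V (act \<sigma>)"
    and act_V: "\<sigma> \<in> Sym n \<Longrightarrow> v \<in> V \<Longrightarrow> act \<sigma> v \<in> V"
    and act_W: "\<sigma> \<in> Sym n \<Longrightarrow> w \<in> W \<Longrightarrow> act \<sigma> w \<in> W"
    and act_comp: "\<sigma> \<in> Sym n \<Longrightarrow> \<tau> \<in> Sym n \<Longrightarrow> v \<in> V \<Longrightarrow> act (\<sigma> \<circ> \<tau>) v = act \<sigma> (act \<tau> v)"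
    and support: "\<exists>X. finite X \<and> (\<forall>v\<in>V. \<forall>x. x \<notin> X \<longrightarrow> v x = 0)"
begin

definition character :: "(nat \<Rightarrow> nat) \<Rightarrow> 'k" where
  "character \<sigma> = trace_mod V W (act \<sigma>)"

definition algebra_act :: "((nat \<Rightarrow> nat) \<Rightarrow> 'k) \<Rightarrow> ('x \<Rightarrow> 'k) \<Rightarrow> ('x \<Rightarrow> 'k)" where
  "algebra_act a v = (\<Sum>\<sigma>\<in>Sym n. fscale (a \<sigma>) (act \<sigma> v))"

lemma character_class: "class_function n character"
  unfolding class_function_def character_def
proof (intro ballI)
  fix \<sigma> \<tau> assume s: "\<sigma> \<in> Sym n" and t: "\<tau> \<in> Sym n"
  have g: "\<sigma> \<circ> inv \<tau> \<in> Sym n" by (intro comp_Sym s inv_Sym t)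
  have "trace_mod V W (act (\<tau> \<circ> (\<sigma> \<circ> inv \<tau>))) = trace_mod V W (\<lambda>v. act \<tau> (act (\<sigma> \<circ> inv \<tau>) v))"
    by (rule trace_mod_cong[OF quotient_space_axioms]) (rule act_comp[OF t g])
  also have "\<dots> = trace_mod V W (\<lambda>v. act (\<sigma> \<circ> inv \<tau>) (act \<tau> v))"
    by (rule trace_mod_commute[OF act_lin[OF t] act_V[OF t] act_W[OF t] act_lin[OF g] act_V[OF g] act_W[OF g]])
  also have "\<dots> = trace_mod V W (act ((\<sigma> \<circ> inv \<tau>) \<circ> \<tau>))"
    by (rule trace_mod_cong[OF quotient_space_axioms]) (rule act_comp[OF g t, symmetric])
  also have "(\<sigma> \<circ> inv \<tau>) \<circ> \<tau> = \<sigma>" by (simp add: comp_assoc Sym_cancel[OF t])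
  finally show "trace_mod V W (act (\<tau> \<circ> (\<sigma> \<circ> inv \<tau>))) = trace_mod V W (act \<sigma>)" .
qed

lemma trace_algebra_act: "trace_mod V W (algebra_act a) = (\<Sum>\<sigma>\<in>Sym n. a \<sigma> * character \<sigma>)"
  unfolding algebra_act_def character_def by (rule trace_mod_sum) (rule act_V)

lemma algebra_act_V: "v \<in> V \<Longrightarrow> algebra_act a v \<in> V"
  unfolding algebra_act_def by (rule fs.subspace_sum[OF V], rule fs.subspace_scale[OF V], rule act_V)

lemma algebra_act_W: "w \<in> W \<Longrightarrow> algebra_act a w \<in> W"
  unfolding algebra_act_def by (rule fs.subspace_sum[OF W], rule fs.subspace_scale[OF W], rule act_W)

lemma algebra_act_lin: "lin_on V (algebra_act a)"
proof -
  have "act \<sigma> (u + v) = act \<sigma> u + act \<sigma> v" "act \<sigma> (fscale d v) = fscale d (act \<sigma> v)"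
    if "\<sigma> \<in> Sym n" "u \<in> V" "v \<in> V" for \<sigma> u v d
    using act_lin[OF that(1)] that unfolding lin_on_def by auto
  then show ?thesis
    unfolding lin_on_def algebra_act_def
    by (auto simp: fs.scale_right_distrib sum.distrib fs.scale_sum_right mult.commute intro!: sum.cong)
qed

lemma algebra_act_mult:
  assumes v: "v \<in> V"
  shows "algebra_act a (algebra_act b v) = algebra_act (group_algebra_mult n a b) v"
proof -
  have "algebra_act a (algebra_act b v)
      = (\<Sum>\<sigma>\<in>Sym n. \<Sum>\<tau>\<in>Sym n. fscale (a \<sigma>) (fscale (b \<tau>) (act (\<sigma> \<circ> \<tau>) v)))"
    unfolding algebra_act_def
  proof (rule sum.cong[OF refl])
    fix \<sigma> assume s: "\<sigma> \<in> Sym n"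
    have "act \<sigma> (\<Sum>\<tau>\<in>Sym n. fscale (b \<tau>) (act \<tau> v)) = (\<Sum>\<tau>\<in>Sym n. fscale (b \<tau>) (act \<sigma> (act \<tau> v)))"
      by (rule lin_on_sum[OF act_lin[OF s]]) (rule act_V[OF _ v])
    also have "\<dots> = (\<Sum>\<tau>\<in>Sym n. fscale (b \<tau>) (act (\<sigma> \<circ> \<tau>) v))"
      by (rule sum.cong[OF refl]) (simp add: act_comp[OF s _ v])
    finally show "fscale (a \<sigma>) (act \<sigma> (\<Sum>\<tau>\<in>Sym n. fscale (b \<tau>) (act \<tau> v)))
       = (\<Sum>\<tau>\<in>Sym n. fscale (a \<sigma>) (fscale (b \<tau>) (act (\<sigma> \<circ> \<tau>) v)))"
      by (simp add: fs.scale_sum_right)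
  qed
  also have "\<dots> = (\<Sum>\<sigma>\<in>Sym n. \<Sum>\<tau>\<in>Sym n. fscale (a \<sigma> * b (inv \<sigma> \<circ> \<tau>)) (act \<tau> v))"
  proof (rule sum.cong[OF refl])
    fix \<sigma> assume s: "\<sigma> \<in> Sym n"
    have "(\<Sum>\<tau>\<in>Sym n. fscale (a \<sigma> * b (inv \<sigma> \<circ> \<tau>)) (act \<tau> v))
        = (\<Sum>\<tau>\<in>Sym n. fscale (a \<sigma> * b (inv \<sigma> \<circ> (\<sigma> \<circ> \<tau>))) (act (\<sigma> \<circ> \<tau>) v))"
      by (rule sum_group_left[OF perm_group_Sym s, symmetric])
    then show "(\<Sum>\<tau>\<in>Sym n. fscale (a \<sigma>) (fscale (b \<tau>) (act (\<sigma> \<circ> \<tau>) v)))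
        = (\<Sum>\<tau>\<in>Sym n. fscale (a \<sigma> * b (inv \<sigma> \<circ> \<tau>)) (act \<tau> v))"
      by (simp add: Sym_cancel[OF s])
  qed
  also have "\<dots> = (\<Sum>\<tau>\<in>Sym n. \<Sum>\<sigma>\<in>Sym n. fscale (a \<sigma> * b (inv \<sigma> \<circ> \<tau>)) (act \<tau> v))" by (rule sum.swap)
  also have "\<dots> = algebra_act (group_algebra_mult n a b) v"
    unfolding algebra_act_def group_algebra_mult_def by (simp add: fs.scale_sum_left)
  finally show ?thesis .
qed

end

subsection \<open>Specht modules\<close>

lemma gmult_add_left: "group_algebra_mult n (a + b) c = group_algebra_mult n a c + group_algebra_mult n b c"
  by (simp add: group_algebra_mult_def fun_eq_iff pointwise distrib_right sum.distrib)

lemma gmult_scale_left: "group_algebra_mult n (fscale d a) c = fscale d (group_algebra_mult n a c)"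
  by (simp add: group_algebra_mult_def fun_eq_iff pointwise sum_distrib_left mult.assoc)

lemma gmult_scale_right: "group_algebra_mult n a (fscale d c) = fscale d (group_algebra_mult n a c)"
  by (simp add: group_algebra_mult_def fun_eq_iff pointwise sum_distrib_left mult_ac)

lemma gmult_translate:
  "\<sigma> \<in> Sym n \<Longrightarrow> group_algebra_mult n a c (inv \<sigma> \<circ> \<pi>) = group_algebra_mult n (\<lambda>\<tau>. a (inv \<sigma> \<circ> \<tau>)) c \<pi>"
  unfolding group_algebra_mult_def
  by (subst (2) sum_group_left[OF perm_group_Sym, of \<sigma>, symmetric])
     (auto simp: Sym_cancel[of \<sigma> n] Sym_inv_comp[of \<sigma> n] comp_assoc intro!: sum.cong)

lemma subspace_group_algebra: "fs.subspace (group_algebra n :: ((nat \<Rightarrow> nat) \<Rightarrow> 'k::field) set)"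
  by (rule fs.subspaceI) (auto simp: group_algebra_def pointwise, metis add.right_neutral)

lemma subspace_specht: "fs.subspace (specht_module \<alpha> :: ((nat \<Rightarrow> nat) \<Rightarrow> 'k::field) set)"
proof (rule fs.subspaceI)
  show "(0 :: (nat \<Rightarrow> nat) \<Rightarrow> 'k) \<in> specht_module \<alpha>"
    unfolding specht_module_def
    by (rule image_eqI[where x = 0]) (auto simp: group_algebra_mult_def group_algebra_def pointwise fun_eq_iff)
  fix x y :: "(nat \<Rightarrow> nat) \<Rightarrow> 'k" and c
  assume "x \<in> specht_module \<alpha>"
  then obtain a where a: "a \<in> group_algebra (sum_list \<alpha>)"
      "x = group_algebra_mult (sum_list \<alpha>) a (young_symmetrizer \<alpha>)"
    unfolding specht_module_def by blast
  show "fscale c x \<in> specht_module \<alpha>"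
    unfolding specht_module_def
    by (rule image_eqI[where x = "fscale c a"])
       (use a fs.subspace_scale[OF subspace_group_algebra] in \<open>simp_all add: gmult_scale_left\<close>)
  assume "y \<in> specht_module \<alpha>"
  then obtain b where b: "b \<in> group_algebra (sum_list \<alpha>)"
      "y = group_algebra_mult (sum_list \<alpha>) b (young_symmetrizer \<alpha>)"
    unfolding specht_module_def by blast
  show "x + y \<in> specht_module \<alpha>"
    unfolding specht_module_def
    by (rule image_eqI[where x = "a + b"])
       (use a b fs.subspace_add[OF subspace_group_algebra] in \<open>simp_all add: gmult_add_left\<close>)
qed

lemma subspace_zero: "fs.subspace {\<lambda>_. 0}"
  using fs.subspace_single_0 by (simp add: zero_fun_def)

lemma specht_sym_rep:
  assumes p: "\<alpha> \<in> partitions_of n"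
  shows "sym_rep (specht_module \<alpha> :: ((nat \<Rightarrow> nat) \<Rightarrow> 'k::field_char_0) set) {\<lambda>_. 0} n (\<lambda>\<sigma> a \<pi>. a (inv \<sigma> \<circ> \<pi>))"
proof
  let ?S = "specht_module \<alpha> :: ((nat \<Rightarrow> nat) \<Rightarrow> 'k) set"
  have supp: "v x = 0" if "v \<in> ?S" "x \<notin> Sym n" for v x
    using that gmult_in_group_algebra[OF young_Sym[OF p]] sum_list_part[OF p]
    unfolding specht_module_def group_algebra_def by blast
  show "fs.subspace ?S" by (rule subspace_specht)
  show "fs.subspace {\<lambda>_. 0}" by (rule subspace_zero)
  show sub: "{\<lambda>_. 0} \<subseteq> ?S" using fs.subspace_0[OF subspace_specht] by (simp add: zero_fun_def)
  show "\<exists>B. basis_mod ?S {\<lambda>_. 0} B"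
  proof (rule basis_mod_exists[OF subspace_specht subspace_zero sub finite_Sym])
    fix v x assume "v \<in> ?S" "x \<notin> Sym n"
    then show "v x = 0" by (rule supp)
  qed
  show "\<exists>X. finite X \<and> (\<forall>v\<in>?S. \<forall>x. x \<notin> X \<longrightarrow> v x = 0)"
    by (intro exI[of _ "Sym n"] conjI finite_Sym ballI allI impI) (rule supp)
  fix \<sigma> assume s: "\<sigma> \<in> Sym n"
  show "lin_on ?S (\<lambda>a \<pi>. a (inv \<sigma> \<circ> \<pi>))" unfolding lin_on_def by (auto simp: fun_eq_iff pointwise)
  show "(\<lambda>\<pi>. w (inv \<sigma> \<circ> \<pi>)) \<in> {\<lambda>_. 0}" if "w \<in> {\<lambda>_. 0}" for w :: "(nat \<Rightarrow> nat) \<Rightarrow> 'k" using that by simp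
  show "(\<lambda>\<pi>. v (inv \<sigma> \<circ> \<pi>)) \<in> ?S" if v: "v \<in> ?S" for v
  proof -
    obtain a where a: "a \<in> group_algebra n" "v = group_algebra_mult n a (young_symmetrizer \<alpha>)"
      using v unfolding specht_module_def sum_list_part[OF p] by blast
    have "(\<lambda>\<tau>. a (inv \<sigma> \<circ> \<tau>)) \<in> group_algebra n"
      using a(1) Sym_comp_iff[OF inv_Sym[OF s]] unfolding group_algebra_def by blast
    moreover have "(\<lambda>\<pi>. v (inv \<sigma> \<circ> \<pi>)) = group_algebra_mult n (\<lambda>\<tau>. a (inv \<sigma> \<circ> \<tau>)) (young_symmetrizer \<alpha>)"
      unfolding a(2) by (rule ext) (rule gmult_translate[OF s])
    ultimately show ?thesis unfolding specht_module_def sum_list_part[OF p] by blast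
  qed
  fix \<tau> assume t: "\<tau> \<in> Sym n"
  show "(\<lambda>\<pi>. v (inv (\<sigma> \<circ> \<tau>) \<circ> \<pi>)) = (\<lambda>\<pi>. v (inv \<tau> \<circ> (inv \<sigma> \<circ> \<pi>)))" for v :: "(nat \<Rightarrow> nat) \<Rightarrow> 'k"
    by (simp add: Sym_inv_comp[OF s t] comp_assoc)
qed

text \<open>A Young symmetrizer kills the Specht modules of the other shapes and has rank one on its own,
  which determines the traces.\<close>

lemma young_value_irr_char:
  assumes p: "\<alpha> \<in> partitions_of n" and q: "\<beta> \<in> partitions_of n"
  shows "young_value n (irr_char \<beta>) \<alpha> = (if \<alpha> = \<beta> then hook_factor \<alpha> else (0::'k::field_char_0))"
proof -
  define c where "c = (young_symmetrizer \<alpha> :: (nat \<Rightarrow> nat) \<Rightarrow> 'k)"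
  let ?S = "specht_module \<beta> :: ((nat \<Rightarrow> nat) \<Rightarrow> 'k) set"
  interpret S: sym_rep ?S "{\<lambda>_. 0}" n "\<lambda>\<sigma> a \<pi>. a (inv \<sigma> \<circ> \<pi>)" by (rule specht_sym_rep[OF q])
  have act: "S.algebra_act c = group_algebra_mult n c"
    by (simp add: S.algebra_act_def group_algebra_mult_def fun_eq_iff sum_fun_apply pointwise)
  have tr: "young_value n (irr_char \<beta>) \<alpha> = trace_mod ?S {\<lambda>_. 0} (group_algebra_mult n c)"
    unfolding act[symmetric] S.trace_algebra_act
    unfolding young_value_def S.character_def irr_char_def c_def ..
  have form: "\<exists>a. v = group_algebra_mult n a (young_symmetrizer \<beta>)" if "v \<in> ?S" for v
    using that sum_list_part[OF q] unfolding specht_module_def by auto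
  show ?thesis
  proof (cases "\<alpha> = \<beta>")
    case False
    have "trace_mod ?S {\<lambda>_. 0} (group_algebra_mult n c) = (\<Sum>i\<in>({} :: nat set). 0)"
    proof (rule S.trace_mod_rank[where v = "\<lambda>_. 0" and \<phi> = "\<lambda>_ _. 0"])
      fix u assume "u \<in> ?S"
      then obtain a where a: "u = group_algebra_mult n a (young_symmetrizer \<beta>)" using form by blast
      have "group_algebra_mult n c u = 0"
        unfolding a c_def by (rule young_mult_young_different[OF p q False])
      then show "group_algebra_mult n c u - (\<Sum>i\<in>{}. fscale 0 0) \<in> {\<lambda>_. 0}" by (simp add: fun_eq_iff pointwise)
    qed auto
    then show ?thesis using tr False by simp
  next
    case True
    have cS: "c \<in> ?S"
      unfolding specht_module_def sum_list_part[OF q]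
    proof (rule image_eqI)
      show "c = group_algebra_mult n (\<lambda>\<sigma>. if \<sigma> = id then 1 else 0) (young_symmetrizer \<beta>)"
        unfolding gmult_delta_left[OF id_Sym] c_def True by simp
      show "(\<lambda>\<sigma>. if \<sigma> = id then 1 else 0) \<in> group_algebra n" by (simp add: group_algebra_def)
    qed
    have "trace_mod ?S {\<lambda>_. 0} (group_algebra_mult n c) = (\<Sum>i\<in>{0::nat}. group_algebra_mult n c c id)"
    proof (rule S.trace_mod_rank[where v = "\<lambda>_. c" and \<phi> = "\<lambda>_ v. group_algebra_mult n c v id"])
      fix u assume "u \<in> ?S"
      then obtain a where a: "u = group_algebra_mult n a c" using form True c_def by blast
      have "group_algebra_mult n c u = fscale (group_algebra_mult n c u id) c"
        unfolding a c_def by (rule young_mult_young_same(1)[OF p])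
      then have "group_algebra_mult n c u - (\<Sum>i\<in>{0::nat}. fscale (group_algebra_mult n c u id) c) = 0"
        by (simp only: sum.insert finite.emptyI sum.empty empty_iff not_False_eq_True add_0_right right_minus_eq)
      then show "group_algebra_mult n c u - (\<Sum>i\<in>{0::nat}. fscale (group_algebra_mult n c u id) c) \<in> {\<lambda>_. 0}"
        by (simp only: zero_fun_def singleton_iff)
    qed (auto simp: functional_on_def cS group_algebra_mult_def pointwise distrib_left sum.distrib sum_distrib_left mult_ac)
    then show ?thesis using tr True unfolding hook_factor_def c_def sum_list_part[OF p] by simp
  qed
qed

text \<open>Right multiplication by the Young symmetrizer \<open>c\<close> has trace \<open>n!\<close> on the group algebra, because \<open>c\<close>
  has coefficient 1 at the identity; on the image it is multiplication by the hook factor.\<close>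

lemma hook_factor_nonzero:
  assumes p: "\<alpha> \<in> partitions_of n"
  shows "hook_factor \<alpha> \<noteq> (0::'k::field_char_0)"
proof
  assume z: "hook_factor \<alpha> = (0::'k)"
  define c where "c = (young_symmetrizer \<alpha> :: (nat \<Rightarrow> nat) \<Rightarrow> 'k)"
  let ?A = "group_algebra n :: ((nat \<Rightarrow> nat) \<Rightarrow> 'k) set"
  let ?S = "specht_module \<alpha> :: ((nat \<Rightarrow> nat) \<Rightarrow> 'k) set"
  let ?f = "\<lambda>x. group_algebra_mult n x c"
  have supp: "v x = 0" if "v \<in> ?A" "x \<notin> Sym n" for v x using that unfolding group_algebra_def by blast
  have A0: "{\<lambda>_. 0} \<subseteq> ?A" by (simp add: group_algebra_def)
  interpret A: quotient_space ?A "{\<lambda>_. 0}"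
  proof
    show "\<exists>B. basis_mod ?A {\<lambda>_. 0} B"
    proof (rule basis_mod_exists[OF subspace_group_algebra subspace_zero A0 finite_Sym])
      fix v x assume "v \<in> ?A" "x \<notin> Sym n"
      then show "v x = 0" by (rule supp)
    qed
  qed (rule subspace_group_algebra subspace_zero A0)+
  interpret S: sym_rep ?S "{\<lambda>_. 0}" n "\<lambda>\<sigma> a \<pi>. a (inv \<sigma> \<circ> \<pi>)" by (rule specht_sym_rep[OF p])
  have cA: "c \<in> ?A" unfolding c_def by (rule young_Sym[OF p])
  have fS: "?f x \<in> ?S" if "x \<in> ?A" for x
    using that unfolding specht_module_def c_def sum_list_part[OF p] by blast
  have SA: "x \<in> ?A" if "x \<in> ?S" for x
    using that gmult_in_group_algebra[OF cA] unfolding specht_module_def c_def sum_list_part[OF p] by blast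
  have ff: "?f v = 0" if v: "v \<in> ?S" for v
  proof -
    obtain a where a: "v = group_algebra_mult n a c"
      using v unfolding specht_module_def c_def sum_list_part[OF p] by blast
    have "?f v = group_algebra_mult n a (fscale (hook_factor \<alpha>) c)"
      unfolding a gmult_assoc c_def young_mult_young_same(2)[OF p] ..
    then show ?thesis using z unfolding gmult_scale_right by simp
  qed
  have f_lin: "lin_on ?A ?f" unfolding lin_on_def by (simp add: gmult_add_left gmult_scale_left)
  have "trace_mod ?A {\<lambda>_. 0} ?f = (\<Sum>b\<in>S.some_basis. S.coord b (?f b))"
  proof (rule A.trace_mod_rank[where \<phi> = "\<lambda>b v. S.coord b (?f v)" and v = "\<lambda>b. b"])
    show "i \<in> ?A" if "i \<in> S.some_basis" for i using S.some_basis_in SA that by blast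
    show "functional_on ?A (\<lambda>v. S.coord i (?f v))" if "i \<in> S.some_basis" for i
      using f_lin S.coord_functional[of i] fS unfolding functional_on_def lin_on_def by simp
    show "S.coord i (?f w) = 0" if "w \<in> {\<lambda>_. 0}" for i w
    proof -
      have "?f w \<in> {\<lambda>_. 0}" using that by (simp add: group_algebra_mult_def)
      then show ?thesis by (rule S.coord_W)
    qed
    show "?f u - (\<Sum>i\<in>S.some_basis. fscale (S.coord i (?f u)) i) \<in> {\<lambda>_. 0}" if "u \<in> ?A" for u
      by (rule S.coord_expand[OF fS[OF that]])
  qed
  also have "\<dots> = 0"
  proof (rule sum.neutral, rule ballI)
    fix b assume "b \<in> S.some_basis"
    then have "?f b = 0" using ff S.some_basis_in by blast
    then show "S.coord b (?f b) = 0" using S.coord_W[of 0 b] by (simp add: zero_fun_def)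
  qed
  finally have tr0: "trace_mod ?A {\<lambda>_. 0} ?f = 0" .
  define \<delta> :: "(nat \<Rightarrow> nat) \<Rightarrow> (nat \<Rightarrow> nat) \<Rightarrow> 'k" where "\<delta> \<tau> = (\<lambda>\<sigma>. if \<sigma> = \<tau> then 1 else 0)" for \<tau>
  have "trace_mod ?A {\<lambda>_. 0} ?f = (\<Sum>\<tau>\<in>Sym n. ?f (\<delta> \<tau>) \<tau>)"
  proof (rule A.trace_mod_rank[where \<phi> = "\<lambda>\<tau> v. ?f v \<tau>" and v = \<delta>])
    show "\<delta> \<tau> \<in> ?A" if "\<tau> \<in> Sym n" for \<tau> using that by (simp add: \<delta>_def group_algebra_def)
    show "functional_on ?A (\<lambda>v. ?f v \<tau>)" for \<tau>
      using f_lin unfolding functional_on_def lin_on_def by (simp add: pointwise)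
    show "?f w \<tau> = 0" if "w \<in> {\<lambda>_. 0}" for w \<tau> using that by (simp add: group_algebra_mult_def)
    show "?f u - (\<Sum>\<tau>\<in>Sym n. fscale (?f u \<tau>) (\<delta> \<tau>)) \<in> {\<lambda>_. 0}" if "u \<in> ?A" for u
    proof -
      have "?f u \<pi> = (\<Sum>\<tau>\<in>Sym n. fscale (?f u \<tau>) (\<delta> \<tau>)) \<pi>" for \<pi>
      proof -
        have "(\<Sum>\<tau>\<in>Sym n. fscale (?f u \<tau>) (\<delta> \<tau>)) \<pi> = (\<Sum>\<tau>\<in>Sym n. if \<tau> = \<pi> then ?f u \<pi> else 0)"
          unfolding sum_fun_apply by (rule sum.cong) (auto simp: \<delta>_def pointwise)
        then show ?thesis using supp[OF gmult_in_group_algebra[OF cA]] by simp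
      qed
      then have "?f u = (\<Sum>\<tau>\<in>Sym n. fscale (?f u \<tau>) (\<delta> \<tau>))" by (rule ext)
      then have "?f u - (\<Sum>\<tau>\<in>Sym n. fscale (?f u \<tau>) (\<delta> \<tau>)) = 0" by (simp only: right_minus_eq)
      then show ?thesis by (simp add: zero_fun_def)
    qed
  qed
  also have "\<dots> = (\<Sum>\<tau>\<in>Sym n. 1)"
  proof (rule sum.cong[OF refl])
    fix \<tau> assume t: "\<tau> \<in> Sym n"
    show "?f (\<delta> \<tau>) \<tau> = 1"
      unfolding \<delta>_def gmult_delta_left[OF t] by (simp add: Sym_cancel[OF t] c_def young_id[OF p])
  qed
  finally have "(of_nat (card (Sym n)) :: 'k) = 0" using tr0 by simp
  moreover have "card (Sym n) \<noteq> 0" using id_Sym[of n] finite_Sym[of n] by (metis card_eq_0_iff empty_iff)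
  ultimately show False by simp
qed

subsection \<open>Conjugacy classes and partitions\<close>

text \<open>Listing the cycles of a permutation by decreasing length puts its domain in bijection with a
  Young diagram whose rows it rotates. The diagram determines the conjugacy class.\<close>

definition rotates :: "nat \<Rightarrow> nat list \<Rightarrow> (nat \<times> nat \<Rightarrow> nat) \<Rightarrow> (nat \<Rightarrow> nat) \<Rightarrow> bool" where
  "rotates n \<alpha> B \<sigma> \<longleftrightarrow> bij_betw B (diagram \<alpha>) {..<n} \<and>
     (\<forall>i j. (i, j) \<in> diagram \<alpha> \<longrightarrow> \<sigma> (B (i, j)) = B (i, Suc j mod \<alpha> ! i))"

lemma rotates_exists:
  assumes s: "\<sigma> \<in> Sym n"
  shows "\<exists>\<alpha>\<in>partitions_of n. \<exists>B. rotates n \<alpha> B \<sigma>"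
proof -
  have perm: "permutation \<sigma>" using permutes_imp_permutation[OF _ Sym_permutes[OF s]] by simp
  define Orb where "Orb = orbit \<sigma> ` {..<n}"
  obtain xs where xs: "set xs = Orb" "distinct xs"
    using finite_distinct_list[of Orb] unfolding Orb_def by auto
  define os where "os = rev (sort_key card xs)"
  have os: "set os = Orb" "distinct os" using xs by (simp_all add: os_def)
  define \<alpha> where "\<alpha> = map card os"
  define r where "r i = (SOME x. x \<in> os ! i)" for i
  define B where "B = (\<lambda>(i, j). (\<sigma> ^^ j) (r i))"
  have orb: "os ! i = orbit \<sigma> (r i)" "r i < n" if i: "i < length os" for i
  proof -
    obtain x where x: "x < n" "os ! i = orbit \<sigma> x"
      using os(1) nth_mem[OF i] unfolding Orb_def by (auto simp del: nth_mem)
    have "r i \<in> os ! i" unfolding r_def using orbit_nonempty[of \<sigma> x] x(2) by (metis all_not_in_conv someI_ex)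
    then show "os ! i = orbit \<sigma> (r i)" "r i < n"
      using x orbit_cyclic_eq3[OF cyclic_on_orbit'[OF perm]] permutes_orbit_subset[OF Sym_permutes[OF s], of x] by auto
  qed
  define d where "d i = funpow_dist1 \<sigma> (r i) (r i)" for i
  have self: "x \<in> orbit \<sigma> x" for x by (rule permutation_self_in_orbit[OF perm])
  have inj: "inj_on (\<lambda>j. (\<sigma> ^^ j) (r i)) {0..<d i}" for i
    unfolding d_def by (rule inj_on_funpow_dist1[OF self])
  have im: "orbit \<sigma> (r i) = (\<lambda>j. (\<sigma> ^^ j) (r i)) ` {0..<d i}" for i
    unfolding d_def by (rule orbit_conv_funpow_dist1[OF self])
  have card: "card (orbit \<sigma> (r i)) = d i" for i using card_image[OF inj[of i]] im[of i] by simp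
  have per: "(\<sigma> ^^ d i) (r i) = r i" for i unfolding d_def by (rule funpow_dist1_prop[OF self])
  have diag: "(i, j) \<in> diagram \<alpha> \<longleftrightarrow> i < length os \<and> j < d i" for i j
    using orb(1)[of i] card[of i] by (auto simp: diagram_def \<alpha>_def)
  have Bin: "B (i, j) \<in> os ! i" if "(i, j) \<in> diagram \<alpha>" for i j
    using that im[of i] orb(1)[of i] unfolding diag B_def by auto
  have bij: "bij_betw B (diagram \<alpha>) {..<n}"
  proof (rule bij_betw_imageI)
    show "inj_on B (diagram \<alpha>)"
    proof (rule inj_onI, clarify)
      fix i j i' j' assume ij: "(i, j) \<in> diagram \<alpha>" "(i', j') \<in> diagram \<alpha>" and eq: "B (i, j) = B (i', j')"
      have i: "i < length os" "i' < length os" using ij diag by auto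
      have "os ! i = orbit \<sigma> (B (i, j))" "os ! i' = orbit \<sigma> (B (i', j'))"
        using Bin[OF ij(1)] Bin[OF ij(2)] orb(1)[OF i(1)] orb(1)[OF i(2)] orbit_cyclic_eq3[OF cyclic_on_orbit'[OF perm]]
        by (metis (no_types))+
      then have "i = i'" using eq os(2) i nth_eq_iff_index_eq by metis
      moreover have "j = j'" using eq inj[of i] ij diag \<open>i = i'\<close> unfolding B_def inj_on_def by auto
      ultimately show "i = i' \<and> j = j'" ..
    qed
    show "B ` diagram \<alpha> = {..<n}"
    proof
      show "B ` diagram \<alpha> \<subseteq> {..<n}"
      proof clarify
        fix i j assume ij: "(i, j) \<in> diagram \<alpha>"
        then have i: "i < length os" using diag by blast
        show "B (i, j) < n"
          using Bin[OF ij] orb[OF i] permutes_orbit_subset[OF Sym_permutes[OF s], of "r i"] by auto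
      qed
      show "{..<n} \<subseteq> B ` diagram \<alpha>"
      proof
        fix x assume "x \<in> {..<n}"
        then obtain i where i: "i < length os" "os ! i = orbit \<sigma> x"
          using os(1) unfolding Orb_def by (metis imageI in_set_conv_nth)
        then have "x \<in> (\<lambda>j. (\<sigma> ^^ j) (r i)) ` {0..<d i}" using self[of x] orb(1)[OF i(1)] im[of i] by simp
        then obtain j where "j < d i" "x = (\<sigma> ^^ j) (r i)" by auto
        then show "x \<in> B ` diagram \<alpha>"
          using i(1) diag[of i j] unfolding B_def by (intro image_eqI[of _ _ "(i, j)"]) auto
      qed
    qed
  qed
  have "sum_list \<alpha> = card (diagram \<alpha>)"
    using distinct_card[OF distinct_cells, of \<alpha>] by (simp add: set_cells length_cells)
  also have "\<dots> = n" using bij_betw_same_card[OF bij] by simp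
  finally have "sum_list \<alpha> = n" .
  moreover have "sorted_wrt (\<ge>) \<alpha>"
    unfolding \<alpha>_def os_def rev_map[symmetric] sorted_wrt_rev using sorted_sort_key[of card xs] by simp
  moreover have "\<forall>p\<in>set \<alpha>. 1 \<le> p"
    using orb card by (auto simp: \<alpha>_def in_set_conv_nth d_def)
  ultimately have "\<alpha> \<in> partitions_of n" unfolding partitions_of_def by blast
  moreover have "rotates n \<alpha> B \<sigma>"
    unfolding rotates_def
  proof (intro conjI allI impI bij)
    fix i j assume ij: "(i, j) \<in> diagram \<alpha>"
    then have d: "\<alpha> ! i = d i" "j < d i" using diag[of i j] orb(1)[of i] card[of i] by (auto simp: \<alpha>_def)
    show "\<sigma> (B (i, j)) = B (i, Suc j mod \<alpha> ! i)"
    proof (cases "Suc j = d i")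
      case True
      have "\<sigma> ((\<sigma> ^^ j) (r i)) = r i" using per[of i] unfolding True[symmetric] by simp
      then show ?thesis using d True by (simp add: B_def)
    qed (use d in \<open>simp add: B_def\<close>)
  qed
  ultimately show ?thesis by blast
qed

lemma rotates_conjugate:
  assumes s: "\<sigma> \<in> Sym n" and t: "\<tau> \<in> Sym n" and B: "rotates n \<alpha> B \<sigma>" and C: "rotates n \<alpha> C \<tau>"
  shows "\<exists>h\<in>Sym n. \<tau> = h \<circ> (\<sigma> \<circ> inv h)"
proof -
  define g where "g = C \<circ> inv_into (diagram \<alpha>) B"
  have "bij_betw g {..<n} {..<n}"
    unfolding g_def using B C bij_betw_trans bij_betw_inv_into unfolding rotates_def by blast
  then have "restrict_id g {..<n} permutes {..<n}" by (rule permutes_restrict_id)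
  then obtain h where h: "h \<in> Sym n" "\<And>x. x < n \<Longrightarrow> h x = g x" unfolding Sym_def by fastforce
  have gB: "h (B p) = C p" if "p \<in> diagram \<alpha>" for p
  proof -
    have "B p < n" using B that unfolding rotates_def bij_betw_def by auto
    moreover have "inv_into (diagram \<alpha>) B (B p) = p" using B that unfolding rotates_def bij_betw_def by simp
    ultimately show ?thesis using h(2) by (simp add: g_def)
  qed
  have "h (\<sigma> x) = \<tau> (h x)" for x
  proof (cases "x < n")
    case True
    then obtain i j where ij: "(i, j) \<in> diagram \<alpha>" "x = B (i, j)"
      using B unfolding rotates_def bij_betw_def by (metis imageE lessThan_iff surj_pair)
    have "(i, Suc j mod \<alpha> ! i) \<in> diagram \<alpha>" using ij(1) by (auto simp: diagram_def)
    then show ?thesis using ij gB B C unfolding rotates_def by simp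
  next
    case False
    then show ?thesis
      using Sym_permutes[OF h(1)] Sym_permutes[OF s] Sym_permutes[OF t] by (simp add: permutes_def)
  qed
  then have "h \<circ> \<sigma> = \<tau> \<circ> h" by auto
  then have "\<tau> = h \<circ> \<sigma> \<circ> inv h" by (simp add: comp_assoc Sym_cancel[OF h(1)])
  then show ?thesis using h(1) by (auto simp: comp_assoc)
qed

lemma finite_partitions_of: "finite (partitions_of n)"
proof (rule finite_subset)
  show "partitions_of n \<subseteq> {xs. set xs \<subseteq> {..n} \<and> length xs \<le> n}"
  proof safe
    fix \<alpha> x assume a: "\<alpha> \<in> partitions_of n"
    show "x \<le> n" if "x \<in> set \<alpha>"
      using member_le_sum_list[OF that] a by (simp add: partitions_of_def)
    have "(\<forall>p\<in>set \<alpha>. 1 \<le> p) \<Longrightarrow> length \<alpha> \<le> sum_list \<alpha>" by (induction \<alpha>) auto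
    then show "length \<alpha> \<le> n" using a by (simp add: partitions_of_def)
  qed
qed (rule finite_lists_length_le, simp)

text \<open>The irreducible characters are as many independent class functions as there are partitions, hence
  a basis of the class functions, whose space is spanned by as many indicator functions.\<close>

lemma class_function_expand:
  fixes \<theta> :: "(nat \<Rightarrow> nat) \<Rightarrow> 'k::field_char_0"
  assumes cf: "class_function n \<theta>"
  shows "\<exists>d. \<forall>\<sigma>\<in>Sym n. \<theta> \<sigma> = (\<Sum>\<mu>\<in>partitions_of n. d \<mu> * irr_char \<mu> \<sigma>)"
proof -
  define cut :: "((nat \<Rightarrow> nat) \<Rightarrow> 'k) \<Rightarrow> (nat \<Rightarrow> nat) \<Rightarrow> 'k" where
    "cut f = (\<lambda>\<sigma>. if \<sigma> \<in> Sym n then f \<sigma> else 0)" for f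
  define ct where "ct \<sigma> = (SOME \<alpha>. \<alpha> \<in> partitions_of n \<and> (\<exists>B. rotates n \<alpha> B \<sigma>))" for \<sigma>
  define E where "E \<alpha> = cut (\<lambda>\<sigma>. if ct \<sigma> = \<alpha> then 1 else 0)" for \<alpha>
  have ct: "ct \<sigma> \<in> partitions_of n" "\<exists>B. rotates n (ct \<sigma>) B \<sigma>" if "\<sigma> \<in> Sym n" for \<sigma>
    using someI_ex[OF rotates_exists[OF that, unfolded Bex_def]] unfolding ct_def by auto
  have same: "f \<sigma> = f \<tau>" if f: "class_function n f" and st: "\<sigma> \<in> Sym n" "\<tau> \<in> Sym n" "ct \<sigma> = ct \<tau>"
    for f :: "(nat \<Rightarrow> nat) \<Rightarrow> 'k" and \<sigma> \<tau>
  proof -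
    obtain B C where "rotates n (ct \<sigma>) B \<sigma>" "rotates n (ct \<sigma>) C \<tau>"
      using ct(2)[OF st(1)] ct(2)[OF st(2)] st(3) by auto
    then obtain h where "h \<in> Sym n" "\<tau> = h \<circ> (\<sigma> \<circ> inv h)" using rotates_conjugate[OF st(1,2)] by blast
    then show ?thesis using f st(1) unfolding class_function_def by simp
  qed
  have spanE: "cut f \<in> fs.span (E ` partitions_of n)" if f: "class_function n f" for f
  proof -
    define val where "val \<alpha> = f (SOME \<tau>. \<tau> \<in> Sym n \<and> ct \<tau> = \<alpha>)" for \<alpha>
    have val: "val (ct \<sigma>) = f \<sigma>" if s: "\<sigma> \<in> Sym n" for \<sigma>
    proof -
      have "\<exists>\<tau>. \<tau> \<in> Sym n \<and> ct \<tau> = ct \<sigma>" using s by blast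
      from someI_ex[OF this] show ?thesis unfolding val_def using same[OF f _ s] by blast
    qed
    have "cut f \<sigma> = (\<Sum>\<alpha>\<in>partitions_of n. fscale (val \<alpha>) (E \<alpha>)) \<sigma>" for \<sigma>
    proof (cases "\<sigma> \<in> Sym n")
      case True
      have "(\<Sum>\<alpha>\<in>partitions_of n. fscale (val \<alpha>) (E \<alpha>)) \<sigma> = (\<Sum>\<alpha>\<in>partitions_of n. if \<alpha> = ct \<sigma> then f \<sigma> else 0)"
        unfolding sum_fun_apply by (rule sum.cong) (use True val in \<open>auto simp: E_def cut_def pointwise\<close>)
      then show ?thesis using True ct(1)[OF True] finite_partitions_of by (simp add: cut_def)
    qed (simp add: cut_def E_def sum_fun_apply pointwise)
    then have "cut f = (\<Sum>\<alpha>\<in>partitions_of n. fscale (val \<alpha>) (E \<alpha>))" by (rule ext)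
    moreover have "(\<Sum>\<alpha>\<in>partitions_of n. fscale (val \<alpha>) (E \<alpha>)) \<in> fs.span (E ` partitions_of n)"
      by (intro fs.span_sum fs.span_scale fs.span_base imageI)
    ultimately show ?thesis by simp
  qed
  define ch where "ch \<mu> = cut (irr_char \<mu>)" for \<mu>
  have chi_cf: "class_function n (irr_char \<mu> :: (nat \<Rightarrow> nat) \<Rightarrow> 'k)" if "\<mu> \<in> partitions_of n" for \<mu>
    using sym_rep.character_class[OF specht_sym_rep[OF that]]
    unfolding sym_rep.character_def[OF specht_sym_rep[OF that]] irr_char_def .
  have val_cut: "young_value n (cut f) \<alpha> = young_value n f \<alpha>" for f \<alpha>
    unfolding young_value_def cut_def by (rule sum.cong) auto
  have val_sum: "young_value n (\<Sum>\<mu>\<in>M. fscale (u \<mu>) (g \<mu>)) \<alpha> = (\<Sum>\<mu>\<in>M. u \<mu> * young_value n (g \<mu>) \<alpha>)"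
    for M :: "nat list set" and u :: "nat list \<Rightarrow> 'k" and g \<alpha>
  proof -
    have "young_value n (\<Sum>\<mu>\<in>M. fscale (u \<mu>) (g \<mu>)) \<alpha>
        = (\<Sum>\<sigma>\<in>Sym n. \<Sum>\<mu>\<in>M. u \<mu> * (young_symmetrizer \<alpha> \<sigma> * g \<mu> \<sigma>))"
      unfolding young_value_def sum_fun_apply by (simp add: sum_distrib_left pointwise mult_ac)
    also have "\<dots> = (\<Sum>\<mu>\<in>M. \<Sum>\<sigma>\<in>Sym n. u \<mu> * (young_symmetrizer \<alpha> \<sigma> * g \<mu> \<sigma>))" by (rule sum.swap)
    finally show ?thesis unfolding young_value_def sum_distrib_left .
  qed
  have chi_val: "young_value n (ch \<mu>) \<alpha> = (if \<alpha> = \<mu> then hook_factor \<alpha> else 0)"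
    if "\<alpha> \<in> partitions_of n" "\<mu> \<in> partitions_of n" for \<alpha> \<mu>
    unfolding ch_def val_cut by (rule young_value_irr_char[OF that])
  have inj: "inj_on ch (partitions_of n)"
  proof (rule inj_onI)
    fix \<alpha> \<mu> assume am: "\<alpha> \<in> partitions_of n" "\<mu> \<in> partitions_of n" "ch \<alpha> = ch \<mu>"
    have "young_value n (ch \<alpha>) \<alpha> \<noteq> 0" using chi_val[OF am(1,1)] hook_factor_nonzero[OF am(1)] by simp
    then show "\<alpha> = \<mu>" using chi_val[OF am(1,2)] am(3) by (cases "\<alpha> = \<mu>") simp_all
  qed
  have indep: "fs.independent (ch ` partitions_of n)"
  proof (rule fs.independent_if_scalars_zero)
    show "finite (ch ` partitions_of n)" using finite_partitions_of by simp
    fix f x assume z: "(\<Sum>x\<in>ch ` partitions_of n. fscale (f x) x) = 0" and x: "x \<in> ch ` partitions_of n"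
    then obtain \<alpha> where a: "\<alpha> \<in> partitions_of n" "x = ch \<alpha>" by blast
    have "(\<Sum>\<mu>\<in>partitions_of n. fscale (f (ch \<mu>)) (ch \<mu>)) = 0" 
      using z unfolding sum.reindex[OF inj] comp_def .
    then have "(\<Sum>\<mu>\<in>partitions_of n. f (ch \<mu>) * young_value n (ch \<mu>) \<alpha>) = 0"
      using val_sum[of "\<lambda>\<mu>. f (ch \<mu>)" ch "partitions_of n" \<alpha>] by (simp add: young_value_def pointwise)
    moreover have "(\<Sum>\<mu>\<in>partitions_of n. f (ch \<mu>) * young_value n (ch \<mu>) \<alpha>)
        = (\<Sum>\<mu>\<in>partitions_of n. if \<mu> = \<alpha> then f (ch \<alpha>) * hook_factor \<alpha> else 0)"
      by (rule sum.cong) (use chi_val[OF a(1)] in auto)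
    ultimately have "f (ch \<alpha>) * hook_factor \<alpha> = 0" using a finite_partitions_of by simp
    then show "f x = 0" using hook_factor_nonzero[OF a(1), where 'k = 'k] a(2) by simp
  qed
  have "cut \<theta> \<in> fs.span (ch ` partitions_of n)"
  proof (rule ccontr)
    assume n: "cut \<theta> \<notin> fs.span (ch ` partitions_of n)"
    then have ind: "fs.independent (insert (cut \<theta>) (ch ` partitions_of n))" by (rule fs.independent_insertI[OF _ indep])
    have sub: "insert (cut \<theta>) (ch ` partitions_of n) \<subseteq> fs.span (E ` partitions_of n)"
      using spanE[OF cf] spanE[OF chi_cf] unfolding ch_def by auto
    have "card (insert (cut \<theta>) (ch ` partitions_of n)) \<le> card (E ` partitions_of n)"
      using fs.independent_span_bound[OF _ ind sub] finite_partitions_of by blast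
    also have "\<dots> \<le> card (partitions_of n)" by (rule card_image_le[OF finite_partitions_of])
    finally have "card (insert (cut \<theta>) (ch ` partitions_of n)) \<le> card (partitions_of n)" .
    moreover have "cut \<theta> \<notin> ch ` partitions_of n" using n fs.span_base by blast
    ultimately show False using card_image[OF inj] finite_partitions_of by simp
  qed
  then obtain u where u: "cut \<theta> = (\<Sum>x\<in>ch ` partitions_of n. fscale (u x) x)"
    using fs.span_finite[of "ch ` partitions_of n"] finite_partitions_of by auto
  have "\<theta> \<sigma> = (\<Sum>\<mu>\<in>partitions_of n. u (ch \<mu>) * irr_char \<mu> \<sigma>)" if s: "\<sigma> \<in> Sym n" for \<sigma>
  proof -
    have "\<theta> \<sigma> = cut \<theta> \<sigma>" using s by (simp add: cut_def)
    also have "\<dots> = (\<Sum>\<mu>\<in>partitions_of n. fscale (u (ch \<mu>)) (ch \<mu>)) \<sigma>" unfolding u sum.reindex[OF inj] by simp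
    also have "\<dots> = (\<Sum>\<mu>\<in>partitions_of n. u (ch \<mu>) * irr_char \<mu> \<sigma>)"
      unfolding sum_fun_apply by (rule sum.cong) (use s in \<open>auto simp: ch_def cut_def pointwise\<close>)
    finally show ?thesis .
  qed
  then show ?thesis by (intro exI[of _ "\<lambda>\<mu>. u (ch \<mu>)"]) blast
qed

lemma young_value_expand:
  assumes a: "\<alpha> \<in> partitions_of n"
    and d: "\<And>\<sigma>. \<sigma> \<in> Sym n \<Longrightarrow> \<theta> \<sigma> = (\<Sum>\<mu>\<in>partitions_of n. d \<mu> * irr_char \<mu> \<sigma>)"
  shows "young_value n \<theta> \<alpha> = (hook_factor \<alpha> :: 'k::field_char_0) * d \<alpha>"
proof -
  have "young_value n \<theta> \<alpha> = (\<Sum>\<sigma>\<in>Sym n. \<Sum>\<mu>\<in>partitions_of n. d \<mu> * (young_symmetrizer \<alpha> \<sigma> * irr_char \<mu> \<sigma>))"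
    unfolding young_value_def using d by (simp add: sum_distrib_left mult_ac)
  also have "\<dots> = (\<Sum>\<mu>\<in>partitions_of n. d \<mu> * young_value n (irr_char \<mu>) \<alpha>)"
    unfolding young_value_def sum_distrib_left by (rule sum.swap)
  also have "\<dots> = (\<Sum>\<mu>\<in>partitions_of n. if \<mu> = \<alpha> then d \<alpha> * hook_factor \<alpha> else 0)"
    by (rule sum.cong) (simp_all add: young_value_irr_char[OF a])
  finally show ?thesis using a finite_partitions_of by (simp add: mult.commute)
qed

context sym_rep
begin

lemma young_value_nat:
  assumes p: "\<alpha> \<in> partitions_of n"
  shows "\<exists>m :: nat. young_value n character \<alpha> = hook_factor \<alpha> * of_nat m"
proof -
  let ?k = "hook_factor \<alpha> :: 'k"
  define e where "e = fscale (1 / ?k) (young_symmetrizer \<alpha>)"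
  have k: "?k \<noteq> 0" by (rule hook_factor_nonzero[OF p])
  have "group_algebra_mult n e e = e"
    unfolding e_def gmult_scale_left gmult_scale_right young_mult_young_same(2)[OF p]
    using k by (simp add: fun_eq_iff pointwise)
  then have idem: "algebra_act e (algebra_act e v) = algebra_act e v" if "v \<in> V" for v
    using algebra_act_mult[OF that, of e e] by simp
  obtain X where X: "finite X" "\<And>v x. v \<in> V \<Longrightarrow> x \<notin> X \<Longrightarrow> v x = 0" using support by blast
  have "\<exists>m :: nat. trace_mod V W (algebra_act e) = of_nat m"
  proof (rule trace_mod_idempotent[where f = "algebra_act e" and X = X])
    show "algebra_act e (algebra_act e v) - algebra_act e v \<in> W" if "v \<in> V" for v
      using idem[OF that] fs.subspace_0[OF W] by simp
    show "v x = 0" if "v \<in> V" "x \<notin> X" for v x using X(2) that by blast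
  qed (rule algebra_act_lin X(1) algebra_act_V algebra_act_W, assumption?)+
  then obtain m :: nat where m: "trace_mod V W (algebra_act e) = of_nat m" by blast
  have "young_value n character \<alpha> = ?k * trace_mod V W (algebra_act e)"
    unfolding trace_algebra_act young_value_def e_def sum_distrib_left using k by (simp add: pointwise)
  then show ?thesis using m by auto
qed

text \<open>Evaluating the decomposition of the character at a Young symmetrizer isolates one multiplicity; the
  hook factor is invertible in characteristic \<open>0\<close>.\<close>

lemma multiplicity_young_value:
  assumes p: "\<alpha> \<in> partitions_of n"
  shows "young_value n character \<alpha> = hook_factor \<alpha> * of_nat (char_multiplicity n character \<alpha>)"
proof -
  obtain d where d: "\<And>\<sigma>. \<sigma> \<in> Sym n \<Longrightarrow> character \<sigma> = (\<Sum>\<mu>\<in>partitions_of n. d \<mu> * irr_char \<mu> \<sigma>)"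
    using class_function_expand[OF character_class] by blast
  have nat: "\<exists>m :: nat. d \<mu> = of_nat m" if mu: "\<mu> \<in> partitions_of n" for \<mu>
  proof -
    obtain m :: nat where "young_value n character \<mu> = hook_factor \<mu> * of_nat m"
      using young_value_nat[OF mu] by blast
    moreover have "young_value n character \<mu> = hook_factor \<mu> * d \<mu>" by (rule young_value_expand[OF mu d])
    moreover have "hook_factor \<mu> \<noteq> (0::'k)" by (rule hook_factor_nonzero[OF mu])
    ultimately have "d \<mu> = of_nat m" by simp
    then show ?thesis by blast
  qed
  then obtain c :: "nat list \<Rightarrow> nat" where c: "\<And>\<mu>. \<mu> \<in> partitions_of n \<Longrightarrow> d \<mu> = of_nat (c \<mu>)" by metis
  have dec: "\<forall>\<sigma>\<in>Sym n. character \<sigma> = (\<Sum>\<mu>\<in>partitions_of n. of_nat (c \<mu>) * irr_char \<mu> \<sigma>)"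
    using d c by simp
  have val: "young_value n character \<alpha> = hook_factor \<alpha> * of_nat (c' \<alpha>)"
    if "\<forall>\<sigma>\<in>Sym n. character \<sigma> = (\<Sum>\<mu>\<in>partitions_of n. of_nat (c' \<mu>) * irr_char \<mu> \<sigma>)" for c' :: "nat list \<Rightarrow> nat"
    by (rule young_value_expand[OF p]) (use that in blast)
  have "char_multiplicity n character \<alpha> = c \<alpha>"
    unfolding char_multiplicity_def
  proof (rule the_equality)
    fix m assume "\<exists>c' :: nat list \<Rightarrow> nat. (\<forall>\<sigma>\<in>Sym n. character \<sigma> = (\<Sum>\<mu>\<in>partitions_of n. of_nat (c' \<mu>) * irr_char \<mu> \<sigma>)) \<and> c' \<alpha> = m"
    then obtain c' :: "nat list \<Rightarrow> nat" where c': "\<forall>\<sigma>\<in>Sym n. character \<sigma> = (\<Sum>\<mu>\<in>partitions_of n. of_nat (c' \<mu>) * irr_char \<mu> \<sigma>)"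
      "c' \<alpha> = m" by blast
    have "hook_factor \<alpha> * of_nat m = (hook_factor \<alpha> * of_nat (c \<alpha>) :: 'k)"
      using val[OF c'(1)] unfolding val[OF dec] c'(2) by (rule sym)
    moreover have "hook_factor \<alpha> \<noteq> (0::'k)" by (rule hook_factor_nonzero[OF p])
    ultimately show "m = c \<alpha>" by simp
  qed (use dec in blast)
  then show ?thesis using val[OF dec] by simp
qed

end

section \<open>Hooks\<close>

definition Perms :: "nat set \<Rightarrow> (nat \<Rightarrow> nat) set" where
  "Perms A = {\<rho>. \<rho> permutes A}"

lemma perm_group_Perms: "A \<subseteq> {..<n} \<Longrightarrow> perm_group n (Perms A)"
  unfolding perm_group_def Perms_def Sym_def
  by (auto simp: permutes_id permutes_compose permutes_inv intro: permutes_subset)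

lemma Perms_Sym: "\<rho> \<in> Perms A \<Longrightarrow> A \<subseteq> {..<n} \<Longrightarrow> \<rho> \<in> Sym n"
  using perm_groupD(1)[OF perm_group_Perms] by blast

lemma Perms_not_in: "\<rho> \<in> Perms A \<Longrightarrow> x \<notin> A \<Longrightarrow> \<rho> x = x"
  unfolding Perms_def by (auto simp: permutes_def)

lemma Perms_in: "\<rho> \<in> Perms A \<Longrightarrow> \<rho> x \<in> A \<longleftrightarrow> x \<in> A"
  unfolding Perms_def by (simp add: permutes_in_image)

lemma transpose_Perms: "i \<in> A \<Longrightarrow> j \<in> A \<Longrightarrow> Transposition.transpose i j \<in> Perms A"
  unfolding Perms_def by (auto intro: permutes_swap_id)

lemma Perms_commute:
  assumes "\<rho> \<in> Perms A" "\<gamma> \<in> Perms B" "A \<inter> B = {}"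
  shows "\<gamma> \<circ> \<rho> = \<rho> \<circ> \<gamma>"
proof
  fix x
  consider "x \<in> A" | "x \<in> B" | "x \<notin> A" "x \<notin> B" by blast
  then show "(\<gamma> \<circ> \<rho>) x = (\<rho> \<circ> \<gamma>) x"
  proof cases
    case 1
    then have "x \<notin> B" "\<rho> x \<notin> B" using Perms_in[OF assms(1), of x] assms(3) by auto
    then show ?thesis using Perms_not_in[OF assms(2)] by simp
  next
    case 2
    then have "x \<notin> A" "\<gamma> x \<notin> A" using Perms_in[OF assms(2), of x] assms(3) by auto
    then show ?thesis using Perms_not_in[OF assms(1)] by simp
  qed (use Perms_not_in[OF assms(1), of x] Perms_not_in[OF assms(2), of x] in simp)
qed

lemma card_Perms: "finite A \<Longrightarrow> card (Perms A) = fact (card A)"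
  unfolding Perms_def by (rule card_permutations[OF refl])

text \<open>Class functions are invariant under cyclic shifts of the factors.\<close>

lemma class_function_swap:
  assumes "class_function n \<theta>" "\<sigma> \<in> Sym n" "\<tau> \<in> Sym n"
  shows "\<theta> (\<sigma> \<circ> \<tau>) = \<theta> (\<tau> \<circ> \<sigma>)"
proof -
  have "\<theta> (\<sigma> \<circ> ((\<tau> \<circ> \<sigma>) \<circ> inv \<sigma>)) = \<theta> (\<tau> \<circ> \<sigma>)"
    using assms comp_Sym[OF assms(3,2)] unfolding class_function_def by blast
  then show ?thesis by (simp add: comp_assoc Sym_cancel[OF assms(2)])
qed

text \<open>The linear extension of \<open>\<theta>\<close> to the group algebra, at the product of the sum over the permutations
  of \<open>A\<close> and the signed sum over the permutations of \<open>B\<close>.\<close>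

definition sym_alt_value :: "((nat \<Rightarrow> nat) \<Rightarrow> 'k::comm_ring_1) \<Rightarrow> nat set \<Rightarrow> nat set \<Rightarrow> 'k" where
  "sym_alt_value \<theta> A B = (\<Sum>\<rho>\<in>Perms A. \<Sum>\<gamma>\<in>Perms B. of_int (sign \<gamma>) * \<theta> (\<rho> \<circ> \<gamma>))"

lemma sym_alt_value_conj:
  assumes cf: "class_function n \<theta>" and g: "g \<in> Sym n" and A: "A \<subseteq> {..<n}" and B: "B \<subseteq> {..<n}"
  shows "sym_alt_value \<theta> (g ` A) (g ` B) = sym_alt_value \<theta> A B"
proof -
  have mem: "h \<circ> (\<rho> \<circ> inv h) \<in> Perms (h ` S)" if h: "h \<in> Sym n" and r: "\<rho> \<in> Perms S" for h \<rho> S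
  proof -
    have "bij \<rho>" using r unfolding Perms_def by (auto intro: permutes_bij)
    then have "bij (h \<circ> (\<rho> \<circ> inv h))" using Sym_bij[OF h] by (intro bij_comp bij_imp_bij_inv)
    moreover have "(h \<circ> (\<rho> \<circ> inv h)) x = x" if "x \<notin> h ` S" for x
    proof -
      have "inv h x \<notin> S" using that Sym_cancel(7)[OF h, of x] by (metis image_eqI)
      then show ?thesis using Perms_not_in[OF r] by (simp add: Sym_cancel[OF h])
    qed
    ultimately show ?thesis unfolding Perms_def permutes_def by (simp add: bij_iff)
  qed
  have img: "inv g ` g ` S = S" for S by (simp add: image_image Sym_cancel[OF g])
  have bij: "(\<Sum>\<rho>\<in>Perms (g ` S). f \<rho>) = (\<Sum>\<rho>\<in>Perms S. f (g \<circ> (\<rho> \<circ> inv g)))" for S and f :: "(nat \<Rightarrow> nat) \<Rightarrow> 'a"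
  proof (rule sum.reindex_bij_witness[where j = "\<lambda>\<rho>. inv g \<circ> (\<rho> \<circ> g)" and i = "\<lambda>\<rho>. g \<circ> (\<rho> \<circ> inv g)"])
    show "inv g \<circ> (\<rho> \<circ> g) \<in> Perms S" if "\<rho> \<in> Perms (g ` S)" for \<rho>
      using mem[OF inv_Sym[OF g] that] img[of S] by (simp add: Sym_cancel[OF g])
  qed (simp_all add: mem[OF g] comp_assoc Sym_cancel[OF g])
  have sgn: "sign (g \<circ> (\<gamma> \<circ> inv g)) = sign \<gamma>" if "\<gamma> \<in> Sym n" for \<gamma>
    using Sym_sign_comp[OF g comp_Sym[OF that inv_Sym[OF g]]] Sym_sign_comp[OF that inv_Sym[OF g]] Sym_sign_inv[OF g]
    by (simp add: mult.commute mult.left_commute)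
  show ?thesis
    unfolding sym_alt_value_def bij
  proof (intro sum.cong refl)
    fix \<rho> \<gamma> assume "\<rho> \<in> Perms A" "\<gamma> \<in> Perms B"
    then have rs: "\<rho> \<in> Sym n" and gs: "\<gamma> \<in> Sym n" using Perms_Sym A B by blast+
    have "\<theta> (g \<circ> ((\<rho> \<circ> \<gamma>) \<circ> inv g)) = \<theta> (\<rho> \<circ> \<gamma>)"
      using cf g comp_Sym[OF rs gs] unfolding class_function_def by blast
    moreover have "g \<circ> (\<rho> \<circ> inv g) \<circ> (g \<circ> (\<gamma> \<circ> inv g)) = g \<circ> ((\<rho> \<circ> \<gamma>) \<circ> inv g)"
      by (simp add: comp_assoc Sym_cancel[OF g])
    ultimately show "of_int (sign (g \<circ> (\<gamma> \<circ> inv g))) * \<theta> (g \<circ> (\<rho> \<circ> inv g) \<circ> (g \<circ> (\<gamma> \<circ> inv g)))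
        = of_int (sign \<gamma>) * \<theta> (\<rho> \<circ> \<gamma>)" using sgn[OF gs] by simp
  qed
qed

text \<open>Pieri's rule for hooks, in terms of class functions. Enlarging \<open>A\<close> by a point of \<open>B\<close>, or \<open>B\<close> by a
  point of \<open>A\<close>, adds multiples of the value \<open>\<omega>\<close> at the product with a transposition that moves a point of
  \<open>A\<close> to a point of \<open>B\<close>; by conjugation \<open>\<omega>\<close> does not depend on these points, and it cancels.\<close>

lemma sym_alt_value_enlarge:
  fixes \<theta> :: "(nat \<Rightarrow> nat) \<Rightarrow> 'k::comm_ring_1"
  assumes cf: "class_function n \<theta>" and AB: "A \<inter> B = {}" "A \<union> B = {..<n}" and p: "p \<in> A" and q: "q \<in> B"
  shows "of_nat (card A) * sym_alt_value \<theta> A (insert p B) + of_nat (card B) * sym_alt_value \<theta> (insert q A) B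
    = of_nat n * sym_alt_value \<theta> A B"
proof -
  define tr :: "nat \<Rightarrow> nat \<Rightarrow> nat \<Rightarrow> nat" where "tr = Transposition.transpose"
  have sub: "A \<subseteq> {..<n}" "B \<subseteq> {..<n}" using AB by auto
  have fin: "finite A" "finite B" using sub finite_subset by blast+
  have trS: "tr i j \<in> Sym n" if "i < n" "j < n" for i j unfolding tr_def by (rule transpose_Sym[OF that])
  have PS: "\<rho> \<in> Perms A \<Longrightarrow> \<rho> \<in> Sym n" "\<gamma> \<in> Perms B \<Longrightarrow> \<gamma> \<in> Sym n" for \<rho> \<gamma> using Perms_Sym sub by blast+
  define \<omega> where "\<omega> i j = (\<Sum>\<rho>\<in>Perms A. \<Sum>\<gamma>\<in>Perms B. of_int (sign \<gamma>) * \<theta> (tr i j \<circ> (\<rho> \<circ> \<gamma>)))" for i j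
  have move: "\<theta> ((g \<circ> (t \<circ> g)) \<circ> x) = \<theta> (t \<circ> (g \<circ> x \<circ> g))" if "g \<in> Sym n" "t \<in> Sym n" "x \<in> Sym n" for g t x
    using class_function_swap[OF cf that(1) comp_Sym[OF that(2) comp_Sym[OF that(1) that(3)]]] by (simp add: comp_assoc)
  have om1: "\<omega> i' j = \<omega> i j" if "i \<in> A" "i' \<in> A" "j \<in> B" for i i' j
  proof (cases "i = i'")
    case False
    define g where "g = tr i i'"
    have gA: "g \<in> Perms A" unfolding g_def tr_def by (rule transpose_Perms[OF that(1,2)])
    have gg: "g \<circ> g = id" unfolding g_def tr_def by (simp add: fun_eq_iff)
    have ne: "j \<noteq> i" "j \<noteq> i'" using that AB by auto
    have tr': "tr i' j = g \<circ> (tr i j \<circ> g)"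
      unfolding g_def tr_def using ne False by (auto simp: fun_eq_iff Transposition.transpose_def)
    have ij: "tr i j \<in> Sym n" using that sub by (intro trS) auto
    have "\<omega> i' j = (\<Sum>\<rho>\<in>Perms A. \<Sum>\<gamma>\<in>Perms B. of_int (sign \<gamma>) * \<theta> (tr i j \<circ> ((g \<circ> \<rho> \<circ> g) \<circ> \<gamma>)))"
      unfolding \<omega>_def
    proof (intro sum.cong refl)
      fix \<rho> \<gamma> assume rg: "\<rho> \<in> Perms A" "\<gamma> \<in> Perms B"
      have "\<theta> (tr i' j \<circ> (\<rho> \<circ> \<gamma>)) = \<theta> (tr i j \<circ> (g \<circ> (\<rho> \<circ> \<gamma>) \<circ> g))"
        unfolding tr' by (rule move[OF PS(1)[OF gA] ij comp_Sym[OF PS(1)[OF rg(1)] PS(2)[OF rg(2)]]])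
      also have "g \<circ> (\<rho> \<circ> \<gamma>) \<circ> g = (g \<circ> \<rho> \<circ> g) \<circ> \<gamma>"
        using Perms_commute[OF gA rg(2) AB(1)] by (simp add: comp_assoc)
      finally show "of_int (sign \<gamma>) * \<theta> (tr i' j \<circ> (\<rho> \<circ> \<gamma>)) = of_int (sign \<gamma>) * \<theta> (tr i j \<circ> ((g \<circ> \<rho> \<circ> g) \<circ> \<gamma>))"
        by (simp only:)
    qed
    also have "\<dots> = (\<Sum>\<rho>\<in>Perms A. \<Sum>\<gamma>\<in>Perms B. of_int (sign \<gamma>) * \<theta> (tr i j \<circ> ((g \<circ> \<rho>) \<circ> \<gamma>)))"
      using sum_group_right[OF perm_group_Perms[OF sub(1)] gA,
            of "\<lambda>\<rho>. \<Sum>\<gamma>\<in>Perms B. of_int (sign \<gamma>) * \<theta> (tr i j \<circ> ((g \<circ> \<rho>) \<circ> \<gamma>))"]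
      by (simp only: comp_assoc)
    also have "\<dots> = \<omega> i j"
      unfolding \<omega>_def
      by (rule sum_group_left[OF perm_group_Perms[OF sub(1)] gA,
            where f = "\<lambda>\<rho>. \<Sum>\<gamma>\<in>Perms B. of_int (sign \<gamma>) * \<theta> (tr i j \<circ> (\<rho> \<circ> \<gamma>))"])
    finally show ?thesis .
  qed simp
  have om2: "\<omega> i j' = \<omega> i j" if "j \<in> B" "j' \<in> B" "i \<in> A" for i j j'
  proof (cases "j = j'")
    case False
    define g where "g = tr j j'"
    have gB: "g \<in> Perms B" unfolding g_def tr_def by (rule transpose_Perms[OF that(1,2)])
    have ne: "i \<noteq> j" "i \<noteq> j'" using that AB by auto
    have tr': "tr i j' = g \<circ> (tr i j \<circ> g)"
      unfolding g_def tr_def using ne False by (auto simp: fun_eq_iff Transposition.transpose_def)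
    have ij: "tr i j \<in> Sym n" using that sub by (intro trS) auto
    have gs: "sign g = -1" unfolding g_def tr_def using False by (simp add: sign_swap_id)
    have "\<omega> i j' = (\<Sum>\<rho>\<in>Perms A. \<Sum>\<gamma>\<in>Perms B. of_int (sign (g \<circ> \<gamma> \<circ> g)) * \<theta> (tr i j \<circ> (\<rho> \<circ> (g \<circ> \<gamma> \<circ> g))))"
      unfolding \<omega>_def
    proof (intro sum.cong refl)
      fix \<rho> \<gamma> assume rg: "\<rho> \<in> Perms A" "\<gamma> \<in> Perms B"
      note S = PS(2)[OF gB] PS(2)[OF rg(2)] PS(1)[OF rg(1)]
      have "\<theta> (tr i j' \<circ> (\<rho> \<circ> \<gamma>)) = \<theta> (tr i j \<circ> (g \<circ> (\<rho> \<circ> \<gamma>) \<circ> g))"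
        unfolding tr' by (rule move[OF S(1) ij comp_Sym[OF S(3,2)]])
      also have "g \<circ> (\<rho> \<circ> \<gamma>) \<circ> g = \<rho> \<circ> (g \<circ> \<gamma> \<circ> g)"
        using Perms_commute[OF rg(1) gB AB(1)] by (simp add: comp_assoc[symmetric])
      finally have e: "\<theta> (tr i j' \<circ> (\<rho> \<circ> \<gamma>)) = \<theta> (tr i j \<circ> (\<rho> \<circ> (g \<circ> \<gamma> \<circ> g)))" .
      have "sign (g \<circ> \<gamma> \<circ> g) = sign \<gamma>"
        using Sym_sign_comp[OF comp_Sym[OF S(1,2)] S(1)] Sym_sign_comp[OF S(1,2)] gs by simp
      then show "of_int (sign \<gamma>) * \<theta> (tr i j' \<circ> (\<rho> \<circ> \<gamma>))
          = of_int (sign (g \<circ> \<gamma> \<circ> g)) * \<theta> (tr i j \<circ> (\<rho> \<circ> (g \<circ> \<gamma> \<circ> g)))"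
        by (simp only: e)
    qed
    also have "\<dots> = (\<Sum>\<rho>\<in>Perms A. \<Sum>\<gamma>\<in>Perms B. of_int (sign (g \<circ> \<gamma>)) * \<theta> (tr i j \<circ> (\<rho> \<circ> (g \<circ> \<gamma>))))"
    proof (rule sum.cong[OF refl])
      fix \<rho>
      show "(\<Sum>\<gamma>\<in>Perms B. of_int (sign (g \<circ> \<gamma> \<circ> g)) * \<theta> (tr i j \<circ> (\<rho> \<circ> (g \<circ> \<gamma> \<circ> g))))
          = (\<Sum>\<gamma>\<in>Perms B. of_int (sign (g \<circ> \<gamma>)) * \<theta> (tr i j \<circ> (\<rho> \<circ> (g \<circ> \<gamma>))))"
        using sum_group_right[OF perm_group_Perms[OF sub(2)] gB,
            of "\<lambda>\<gamma>. of_int (sign (g \<circ> \<gamma>)) * \<theta> (tr i j \<circ> (\<rho> \<circ> (g \<circ> \<gamma>)))"]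
        by (simp only: comp_assoc)
    qed
    also have "\<dots> = \<omega> i j"
      unfolding \<omega>_def
      by (rule sum.cong[OF refl], rule sum_group_left[OF perm_group_Perms[OF sub(2)] gB,
            where f = "\<lambda>\<gamma>. of_int (sign \<gamma>) * \<theta> (tr i j \<circ> (_ \<circ> \<gamma>))"])
    finally show ?thesis .
  qed simp
  have om: "\<omega> i j = \<omega> p q" if "i \<in> A" "j \<in> B" for i j using om1[OF p that] om2[OF q that(2) p] by simp
  have om_sym: "\<omega> j i = \<omega> i j" for i j unfolding \<omega>_def tr_def by (simp add: Transposition.transpose_commute)
  have pB: "p \<notin> B" and qA: "q \<notin> A" using p q AB by auto
  have tr_same: "tr i i = id" for i unfolding tr_def by simp
  have "sym_alt_value \<theta> (insert q A) B = (\<Sum>b\<in>insert q A. \<omega> q b)"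
    unfolding sym_alt_value_def \<omega>_def tr_def
    by (simp only: Perms_def sum_over_permutations_insert[OF fin(1) qA] comp_assoc)
  also have "\<dots> = \<omega> q q + (\<Sum>b\<in>A. \<omega> q b)" using fin qA by simp
  also have "\<omega> q q = sym_alt_value \<theta> A B" unfolding \<omega>_def sym_alt_value_def tr_same by simp
  also have "(\<Sum>b\<in>A. \<omega> q b) = of_nat (card A) * \<omega> p q"
    using om[OF _ q] om_sym by (simp add: sum_constant[symmetric] del: sum_constant)
  finally have e1: "sym_alt_value \<theta> (insert q A) B = sym_alt_value \<theta> A B + of_nat (card A) * \<omega> p q" .
  have "sym_alt_value \<theta> A (insert p B) = (\<Sum>\<rho>\<in>Perms A. \<Sum>b\<in>insert p B. \<Sum>\<gamma>\<in>Perms B.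
      of_int (sign (tr p b \<circ> \<gamma>)) * \<theta> (\<rho> \<circ> (tr p b \<circ> \<gamma>)))"
    unfolding sym_alt_value_def tr_def
    by (simp only: Perms_def sum_over_permutations_insert[OF fin(2) pB])
  also have "\<dots> = (\<Sum>\<rho>\<in>Perms A. \<Sum>b\<in>insert p B. \<Sum>\<gamma>\<in>Perms B.
      (if b = p then 1 else -1) * (of_int (sign \<gamma>) * \<theta> (tr p b \<circ> (\<rho> \<circ> \<gamma>))))"
  proof (intro sum.cong refl)
    fix \<rho> b \<gamma> assume rg: "\<rho> \<in> Perms A" "\<gamma> \<in> Perms B" and b: "b \<in> insert p B"
    note S = PS(2)[OF rg(2)] PS(1)[OF rg(1)]
    have t: "tr p b \<in> Sym n" using p b sub by (intro trS) auto
    have "\<theta> (\<rho> \<circ> (tr p b \<circ> \<gamma>)) = \<theta> ((tr p b \<circ> \<gamma>) \<circ> \<rho>)"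
      by (rule class_function_swap[OF cf S(2) comp_Sym[OF t S(1)]])
    also have "(tr p b \<circ> \<gamma>) \<circ> \<rho> = tr p b \<circ> (\<rho> \<circ> \<gamma>)"
      using Perms_commute[OF rg AB(1)] by (simp add: comp_assoc)
    moreover have "sign (tr p b \<circ> \<gamma>) = (if b = p then 1 else -1) * sign \<gamma>"
      using Sym_sign_comp[OF t S(1)] by (simp add: tr_def sign_swap_id)
    ultimately show "of_int (sign (tr p b \<circ> \<gamma>)) * \<theta> (\<rho> \<circ> (tr p b \<circ> \<gamma>))
        = (if b = p then 1 else -1) * (of_int (sign \<gamma>) * \<theta> (tr p b \<circ> (\<rho> \<circ> \<gamma>)))" by simp
  qed
  also have "\<dots> = (\<Sum>b\<in>insert p B. (if b = p then 1 else -1) * \<omega> p b)"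
    unfolding \<omega>_def sum_distrib_left by (rule sum.swap)
  also have "\<dots> = \<omega> p p + (\<Sum>b\<in>B. (if b = p then 1 else -1) * \<omega> p b)" using fin pB by simp
  also have "(\<Sum>b\<in>B. (if b = p then 1 else -1) * \<omega> p b) = (\<Sum>b\<in>B. - \<omega> p q)"
    by (rule sum.cong) (use om[OF p] pB in auto)
  also have "\<omega> p p = sym_alt_value \<theta> A B" unfolding \<omega>_def sym_alt_value_def tr_same by simp
  finally have e2: "sym_alt_value \<theta> A (insert p B) = sym_alt_value \<theta> A B - of_nat (card B) * \<omega> p q" by simp
  have "n = card A + card B" using card_Un_disjoint[OF fin AB(1)] AB(2) by simp
  then show ?thesis unfolding e1 e2 by (simp add: algebra_simps)
qed

lemma hook_partition: "1 \<le> a \<Longrightarrow> a # replicate b 1 \<in> partitions_of (a + b)"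
proof -
  have "sorted_wrt (\<ge>) (replicate b (1::nat))" by (induction b) auto
  then show "1 \<le> a \<Longrightarrow> a # replicate b 1 \<in> partitions_of (a + b)"
    by (auto simp: partitions_of_def sum_list_replicate)
qed

lemma cells_hook: "cells (a # replicate b 1) = map (Pair 0) [0..<a] @ map (\<lambda>i. (Suc i, 0)) [0..<b]"
proof -
  have e: "[0..<Suc b] = 0 # map Suc [0..<b]" by (simp add: upt_conv_Cons map_Suc_upt del: upt_Suc)
  have "cells (a # replicate b 1) = concat (map (\<lambda>i. map (Pair i) [0..<(a # replicate b 1) ! i]) (0 # map Suc [0..<b]))"
    unfolding cells_def length_Cons length_replicate e ..
  also have "\<dots> = map (Pair 0) [0..<a] @ concat (map (\<lambda>i. map (Pair (Suc i)) [0..<replicate b 1 ! i]) [0..<b])"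
    by (simp only: list.map concat.simps map_map comp_def nth_Cons_0 nth_Cons_Suc)
  also have "map (\<lambda>i. map (Pair (Suc i)) [0..<replicate b 1 ! i]) [0..<b] = map (\<lambda>i. [(Suc i, 0)]) [0..<b]"
    by (rule map_cong) auto
  also have "concat (map (\<lambda>i. [(Suc i, 0::nat)]) [0..<b]) = map (\<lambda>i. (Suc i, 0)) [0..<b]" by (induction b) auto
  finally show ?thesis .
qed

lemma hook_row: "k < a + b \<Longrightarrow> row (a # replicate b 1) k = (if k < a then 0 else Suc (k - a))"
  and hook_col: "k < a + b \<Longrightarrow> col (a # replicate b 1) k = (if k < a then k else 0)"
  unfolding cells_hook by (auto simp: nth_append)

lemma hook_row_stabilizer: "row_stabilizer (a # replicate b 1) = Perms {..<a}"
proof -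
  have s: "sum_list (a # replicate b 1) = a + b" by (simp add: sum_list_replicate)
  show ?thesis
  proof (intro equalityI subsetI)
    fix \<sigma> assume "\<sigma> \<in> row_stabilizer (a # replicate b 1)"
    then have st: "\<sigma> \<in> Sym (a + b)" "\<And>k. k < a + b \<Longrightarrow> row (a # replicate b 1) (\<sigma> k) = row (a # replicate b 1) k"
      unfolding row_stabilizer_def s by auto
    have "\<sigma> k = k" if "k \<in> {..<a + b} - {..<a}" for k
      using st(2)[of k] that hook_row[of k a b] hook_row[of "\<sigma> k" a b] st(1) by (auto split: if_splits)
    then show "\<sigma> \<in> Perms {..<a}"
      unfolding Perms_def using permutes_superset[OF Sym_permutes[OF st(1)]] by blast
  next
    fix \<sigma> assume r: "\<sigma> \<in> Perms {..<a}"
    then have S: "\<sigma> \<in> Sym (a + b)" by (rule Perms_Sym) auto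
    have "row (a # replicate b 1) (\<sigma> k) = row (a # replicate b 1) k" if "k < a + b" for k
      using that S Perms_in[OF r, of k] Perms_not_in[OF r, of k] hook_row[of k a b] hook_row[of "\<sigma> k" a b] by auto
    then show "\<sigma> \<in> row_stabilizer (a # replicate b 1)" using S unfolding row_stabilizer_def s by blast
  qed
qed

lemma hook_column_stabilizer:
  assumes a: "1 \<le> a"
  shows "column_stabilizer (a # replicate b 1) = Perms (insert 0 {a..<a + b})"
proof -
  have s: "sum_list (a # replicate b 1) = a + b" by (simp add: sum_list_replicate)
  show ?thesis
  proof (intro equalityI subsetI)
    fix \<sigma> assume "\<sigma> \<in> column_stabilizer (a # replicate b 1)"
    then have st: "\<sigma> \<in> Sym (a + b)" "\<And>k. k < a + b \<Longrightarrow> col (a # replicate b 1) (\<sigma> k) = col (a # replicate b 1) k"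
      unfolding column_stabilizer_def s by auto
    have "\<sigma> k = k" if "k \<in> {..<a + b} - insert 0 {a..<a + b}" for k
      using st(2)[of k] that hook_col[of k a b] hook_col[of "\<sigma> k" a b] st(1) by (auto split: if_splits)
    then show "\<sigma> \<in> Perms (insert 0 {a..<a + b})"
      unfolding Perms_def using permutes_superset[OF Sym_permutes[OF st(1)]] by blast
  next
    fix \<sigma> assume r: "\<sigma> \<in> Perms (insert 0 {a..<a + b})"
    then have S: "\<sigma> \<in> Sym (a + b)" by (rule Perms_Sym) (use a in auto)
    have "col (a # replicate b 1) (\<sigma> k) = col (a # replicate b 1) k" if "k < a + b" for k
      using that S Perms_in[OF r, of k] Perms_not_in[OF r, of k] hook_col[of k a b] hook_col[of "\<sigma> k" a b]
      by (auto split: if_splits)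
    then show "\<sigma> \<in> column_stabilizer (a # replicate b 1)" using S unfolding column_stabilizer_def s by blast
  qed
qed

lemma young_value_sum:
  assumes p: "\<alpha> \<in> partitions_of n"
  shows "young_value n \<theta> \<alpha> = (\<Sum>\<rho>\<in>row_stabilizer \<alpha>. \<Sum>\<gamma>\<in>column_stabilizer \<alpha>. of_int (sign \<gamma>) * \<theta> (\<rho> \<circ> \<gamma>))"
proof -
  have "young_value n \<theta> \<alpha> = (\<Sum>\<sigma>\<in>Sym n. \<Sum>\<rho>\<in>row_stabilizer \<alpha>. \<Sum>\<gamma>\<in>column_stabilizer \<alpha>.
      if \<sigma> = \<rho> \<circ> \<gamma> then of_int (sign \<gamma>) * \<theta> \<sigma> else 0)"
    unfolding young_value_def young_symmetrizer_def sum_distrib_right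
    by (intro sum.cong refl) simp
  also have "\<dots> = (\<Sum>\<rho>\<in>row_stabilizer \<alpha>. \<Sum>\<gamma>\<in>column_stabilizer \<alpha>. \<Sum>\<sigma>\<in>Sym n.
      if \<sigma> = \<rho> \<circ> \<gamma> then of_int (sign \<gamma>) * \<theta> \<sigma> else 0)"
    by (subst sum.swap) (simp add: sum.swap[of _ "Sym n"])
  also have "\<dots> = (\<Sum>\<rho>\<in>row_stabilizer \<alpha>. \<Sum>\<gamma>\<in>column_stabilizer \<alpha>. of_int (sign \<gamma>) * \<theta> (\<rho> \<circ> \<gamma>))"
    by (intro sum.cong refl) (simp add: comp_Sym[OF row_Sym[OF p] column_Sym[OF p]])
  finally show ?thesis .
qed

lemma young_value_hook:
  "1 \<le> a \<Longrightarrow> young_value (a + b) \<theta> (a # replicate b 1) = sym_alt_value \<theta> {..<a} (insert 0 {a..<a + b})"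
  unfolding young_value_sum[OF hook_partition] sym_alt_value_def
  by (simp only: hook_row_stabilizer hook_column_stabilizer)

text \<open>The product \<open>\<gamma>\<rho>\<close> of a column and a row permutation lies in the support of the Young symmetrizer
  only if one of them fixes the corner of the hook, in which case they commute.\<close>

lemma hook_factor_hook:
  assumes a: "1 \<le> a"
  shows "hook_factor (a # replicate b 1) = (of_nat ((a + b) * fact (a - 1) * fact b) :: 'k::field_char_0)"
proof -
  define \<alpha> where "\<alpha> = a # replicate b 1"
  define R where "R = Perms {..<a}"
  define C where "C = Perms (insert 0 {a..<a + b})"
  have p: "\<alpha> \<in> partitions_of (a + b)" unfolding \<alpha>_def by (rule hook_partition[OF a])
  have R: "row_stabilizer \<alpha> = R" and C: "column_stabilizer \<alpha> = C"
    unfolding \<alpha>_def R_def C_def by (rule hook_row_stabilizer, rule hook_column_stabilizer[OF a])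
  note RS = row_Sym[OF p, unfolded R] and CS = column_Sym[OF p, unfolded C]
  have finR: "finite R" and finC: "finite C"
    using perm_groupD(5)[OF row_group[OF p]] perm_groupD(5)[OF column_group[OF p]] R C by auto
  have val: "young_symmetrizer \<alpha> (\<gamma> \<circ> \<rho>) = (if \<gamma> 0 = 0 \<or> \<rho> 0 = 0 then of_int (sign \<gamma>) else (0::'k))"
    if r: "\<rho> \<in> R" and g: "\<gamma> \<in> C" for \<rho> \<gamma>
  proof (cases "\<gamma> 0 = 0 \<or> \<rho> 0 = 0")
    case True
    have "\<gamma> \<circ> \<rho> = \<rho> \<circ> \<gamma>"
      using True
    proof
      assume "\<gamma> 0 = 0"
      then have "\<gamma> \<in> Perms {a..<a + b}"
        using g permutes_superset[of \<gamma> "insert 0 {a..<a + b}" "{a..<a + b}"] unfolding C_def Perms_def by auto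
      with r show ?thesis unfolding R_def by (intro Perms_commute) auto
    next
      assume "\<rho> 0 = 0"
      then have "\<rho> \<in> Perms {1..<a}"
        using r permutes_superset[of \<rho> "{..<a}" "{1..<a}"] unfolding R_def Perms_def by (auto simp: Suc_le_eq)
      with g show ?thesis unfolding C_def by (intro Perms_commute) auto
    qed
    then show ?thesis
      using True r g unfolding R[symmetric] C[symmetric]
      by (simp add: young_row[OF p] young_column[OF p, of \<gamma> id, simplified] young_id[OF p])
  next
    case False
    have "young_symmetrizer \<alpha> (\<gamma> \<circ> \<rho>) = (0::'k)"
    proof (rule ccontr)
      assume "young_symmetrizer \<alpha> (\<gamma> \<circ> \<rho>) \<noteq> (0::'k)"
      then obtain \<rho>' \<gamma>' where e: "\<rho>' \<in> R" "\<gamma>' \<in> C" "\<gamma> \<circ> \<rho> = \<rho>' \<circ> \<gamma>'" using young_nonzero[OF p] R C by blast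
      define i where "i = inv \<rho> 0"
      have i0: "\<rho> i = 0" unfolding i_def using Sym_cancel(7)[OF RS[OF r]] .
      have ia: "i < a" using Perms_in[OF r[unfolded R_def], of i] i0 a by auto
      have ine: "i \<noteq> 0" using i0 False by metis
      have "\<gamma> 0 \<in> insert 0 {a..<a + b}" using Perms_in[OF g[unfolded C_def], of 0] by simp
      then have "a \<le> \<gamma> 0" using False by auto
      moreover have "\<gamma> 0 = \<rho>' (\<gamma>' i)" using fun_cong[OF e(3), of i] i0 by simp
      moreover have "\<gamma>' i = i" using Perms_not_in[OF e(2)[unfolded C_def], of i] ia ine by auto
      moreover have "\<rho>' i < a" using Perms_in[OF e(1)[unfolded R_def], of i] ia by auto
      ultimately show False by simp
    qed
    then show ?thesis using False by simp
  qed
  have "hook_factor \<alpha> = (\<Sum>\<rho>\<in>R. \<Sum>\<gamma>\<in>C. of_int (sign \<gamma>) * young_symmetrizer \<alpha> (inv \<gamma> \<circ> (inv \<rho> \<circ> id)) :: 'k)"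
    unfolding hook_factor_def sum_list_part[OF p] young_mult[OF p] R C ..
  also have "\<dots> = (\<Sum>\<rho>\<in>R. \<Sum>\<gamma>\<in>C. of_int (sign (inv \<gamma>)) * young_symmetrizer \<alpha> (inv \<gamma> \<circ> inv \<rho>))"
    by (intro sum.cong refl) (simp add: Sym_sign_inv[OF CS])
  also have "\<dots> = (\<Sum>\<rho>\<in>R. \<Sum>\<gamma>\<in>C. of_int (sign \<gamma>) * young_symmetrizer \<alpha> (\<gamma> \<circ> inv \<rho>))"
    by (rule sum.cong[OF refl])
       (rule sum_group_inv[OF column_group[OF p, unfolded C], of "\<lambda>\<gamma>. of_int (sign \<gamma>) * young_symmetrizer \<alpha> (\<gamma> \<circ> inv _)"])
  also have "\<dots> = (\<Sum>\<rho>\<in>R. \<Sum>\<gamma>\<in>C. of_int (sign \<gamma>) * young_symmetrizer \<alpha> (\<gamma> \<circ> \<rho>))"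
    by (rule sum_group_inv[OF row_group[OF p, unfolded R], of "\<lambda>\<rho>. \<Sum>\<gamma>\<in>C. of_int (sign \<gamma>) * young_symmetrizer \<alpha> (\<gamma> \<circ> \<rho>)"])
  also have "\<dots> = (\<Sum>\<rho>\<in>R. \<Sum>\<gamma>\<in>C. if \<gamma> 0 = 0 \<or> \<rho> 0 = 0 then 1 else 0)"
    by (intro sum.cong refl) (simp add: val of_int_mult[symmetric] del: of_int_mult)
  also have "\<dots> = (\<Sum>x\<in>R \<times> C. if x \<in> {(\<rho>, \<gamma>). \<gamma> 0 = 0 \<or> \<rho> 0 = 0} then 1 else 0)"
    unfolding sum.cartesian_product by (rule sum.cong) (auto split: if_splits)
  also have "\<dots> = of_nat (card (R \<times> C \<inter> {(\<rho>, \<gamma>). \<gamma> 0 = 0 \<or> \<rho> 0 = 0}))"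
    using finR finC by (simp add: sum.If_cases)
  finally have hf: "hook_factor \<alpha> = (of_nat (card (R \<times> C \<inter> {(\<rho>, \<gamma>). \<gamma> 0 = 0 \<or> \<rho> 0 = 0})) :: 'k)" .
  define R0 where "R0 = Perms {1..<a}"
  define C0 where "C0 = Perms {a..<a + b}"
  have R0: "\<rho> \<in> R0 \<longleftrightarrow> \<rho> \<in> R \<and> \<rho> 0 = 0" for \<rho>
  proof
    assume "\<rho> \<in> R0" then show "\<rho> \<in> R \<and> \<rho> 0 = 0"
      using Perms_not_in[of \<rho> "{1..<a}" 0] permutes_subset[of \<rho> "{1..<a}" "{..<a}"]
      unfolding R0_def R_def Perms_def by (simp add: subset_iff)
  next
    assume "\<rho> \<in> R \<and> \<rho> 0 = 0" then show "\<rho> \<in> R0"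
      using permutes_superset[of \<rho> "{..<a}" "{1..<a}"] unfolding R0_def R_def Perms_def by (auto simp: Suc_le_eq)
  qed
  have C0: "\<gamma> \<in> C0 \<longleftrightarrow> \<gamma> \<in> C \<and> \<gamma> 0 = 0" for \<gamma>
  proof
    assume "\<gamma> \<in> C0" then show "\<gamma> \<in> C \<and> \<gamma> 0 = 0"
      using a Perms_not_in[of \<gamma> "{a..<a + b}" 0] permutes_subset[of \<gamma> "{a..<a + b}" "insert 0 {a..<a + b}"]
      unfolding C0_def C_def Perms_def by (simp add: subset_iff)
  next
    assume "\<gamma> \<in> C \<and> \<gamma> 0 = 0" then show "\<gamma> \<in> C0"
      using permutes_superset[of \<gamma> "insert 0 {a..<a + b}" "{a..<a + b}"] unfolding C0_def C_def Perms_def by auto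
  qed
  have fin0: "finite R0" "finite C0" using R0 C0 finR finC by (auto intro: finite_subset[of R0 R] finite_subset[of C0 C])
  have cards: "card R = fact a" "card R0 = fact (a - 1)" "card C0 = fact b" "card C = fact (Suc b)"
    using a unfolding R_def R0_def C_def C0_def by (auto simp: card_Perms)
  have "R \<times> C \<inter> {(\<rho>, \<gamma>). \<gamma> 0 = 0 \<or> \<rho> 0 = 0} = R \<times> C0 \<union> R0 \<times> C"
  proof (rule set_eqI)
    fix x :: "(nat \<Rightarrow> nat) \<times> (nat \<Rightarrow> nat)"
    show "x \<in> R \<times> C \<inter> {(\<rho>, \<gamma>). \<gamma> 0 = 0 \<or> \<rho> 0 = 0} \<longleftrightarrow> x \<in> R \<times> C0 \<union> R0 \<times> C"
      unfolding Int_iff Un_iff mem_Times_iff R0 C0 mem_Collect_eq split_beta by argo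
  qed
  then have "card (R \<times> C \<inter> {(\<rho>, \<gamma>). \<gamma> 0 = 0 \<or> \<rho> 0 = 0}) + card (R \<times> C0 \<inter> R0 \<times> C) = card (R \<times> C0) + card (R0 \<times> C)"
    using card_Un_Int[of "R \<times> C0" "R0 \<times> C"] finR finC fin0 by simp
  moreover have "R \<times> C0 \<inter> R0 \<times> C = R0 \<times> C0"
  proof (rule set_eqI)
    fix x :: "(nat \<Rightarrow> nat) \<times> (nat \<Rightarrow> nat)"
    show "x \<in> R \<times> C0 \<inter> R0 \<times> C \<longleftrightarrow> x \<in> R0 \<times> C0"
      unfolding Int_iff mem_Times_iff R0 C0 by argo
  qed
  ultimately have eq: "card (R \<times> C \<inter> {(\<rho>, \<gamma>). \<gamma> 0 = 0 \<or> \<rho> 0 = 0}) + fact (a - 1) * fact b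
      = fact a * fact b + fact (a - 1) * fact (Suc b)" by (simp add: card_cartesian_product cards del: fact_Suc)
  have fa: "fact a = a * (fact (a - 1) :: nat)" using a fact_reduce[of a, where 'a = nat] by simp
  have "card (R \<times> C \<inter> {(\<rho>, \<gamma>). \<gamma> 0 = 0 \<or> \<rho> 0 = 0}) = (a + b) * fact (a - 1) * fact b"
    using eq unfolding fa by (simp add: algebra_simps)
  then show ?thesis using hf unfolding \<alpha>_def by simp
qed

text \<open>Hence the dimension of the space of vectors that are invariant under the symmetric group of the
  first \<open>a\<close> points and change by the sign under that of the other \<open>b\<close> points is the sum of the
  multiplicities of the two hooks that arise by joining a row of length \<open>a\<close> and a column of length \<open>b\<close>.\<close>

lemma (in sym_rep) hook_multiplicities:
  assumes a: "1 \<le> a" and n: "n = a + b"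
  shows "sym_alt_value character {..<a} {a..<a + b} = of_nat (fact a * fact b *
     (char_multiplicity n character (a # replicate b 1)
       + (if b = 0 then 0 else char_multiplicity n character (Suc a # replicate (b - 1) 1))))"
proof (cases "b = 0")
  case True
  have "Perms (insert 0 {a..<a + b}) = Perms {a..<a + b}" using True by (auto simp: Perms_def)
  then have "sym_alt_value character {..<a} {a..<a + b} = young_value n character (a # replicate b 1)"
    unfolding n young_value_hook[OF a] sym_alt_value_def by simp
  also have "\<dots> = hook_factor (a # replicate b 1) * of_nat (char_multiplicity n character (a # replicate b 1))"
    by (rule multiplicity_young_value) (use hook_partition[OF a] n in simp)
  also have "hook_factor (a # replicate b 1) = (of_nat (fact a) :: 'k)"
    unfolding hook_factor_hook[OF a] using a True fact_reduce[of a, where 'a = nat] by simp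
  finally show ?thesis using True by simp
next
  case False
  define \<alpha> where "\<alpha> = a # replicate b 1"
  define \<beta> where "\<beta> = Suc a # replicate (b - 1) 1"
  have b1: "Suc a + (b - 1) = n" using False n by simp
  have pa: "\<alpha> \<in> partitions_of n" unfolding \<alpha>_def n by (rule hook_partition[OF a])
  have pb: "\<beta> \<in> partitions_of n" unfolding \<beta>_def b1[symmetric] by (rule hook_partition) simp
  have va: "sym_alt_value character {..<a} (insert 0 {a..<a + b}) = hook_factor \<alpha> * of_nat (char_multiplicity n character \<alpha>)"
    using multiplicity_young_value[OF pa] young_value_hook[OF a, of b character] unfolding \<alpha>_def n by simp
  let ?t = "Transposition.transpose 0 a"
  have img: "?t ` {..<Suc a} = insert a {..<a}" "?t ` insert 0 {Suc a..<n} = {a..<a + b}"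
    using a n False by (auto simp: Transposition.transpose_def image_iff)
  have "sym_alt_value character (insert a {..<a}) {a..<a + b} = sym_alt_value character {..<Suc a} (insert 0 {Suc a..<n})"
    unfolding img[symmetric]
    by (rule sym_alt_value_conj[OF character_class transpose_Sym]) (use a n False in auto)
  also have "\<dots> = young_value n character \<beta>"
    using young_value_hook[of "Suc a" "b - 1" character] unfolding \<beta>_def b1 by simp
  also have "\<dots> = hook_factor \<beta> * of_nat (char_multiplicity n character \<beta>)" by (rule multiplicity_young_value[OF pb])
  finally have vb: "sym_alt_value character (insert a {..<a}) {a..<a + b} = hook_factor \<beta> * of_nat (char_multiplicity n character \<beta>)" .
  have "of_nat (card {..<a}) * sym_alt_value character {..<a} (insert 0 {a..<a + b})
      + of_nat (card {a..<a + b}) * sym_alt_value character (insert a {..<a}) {a..<a + b}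
      = of_nat n * sym_alt_value character {..<a} {a..<a + b}"
    by (rule sym_alt_value_enlarge[OF character_class]) (use a n False in auto)
  then have main: "of_nat a * (hook_factor \<alpha> * of_nat (char_multiplicity n character \<alpha>))
      + of_nat b * (hook_factor \<beta> * of_nat (char_multiplicity n character \<beta>))
      = of_nat n * sym_alt_value character {..<a} {a..<a + b}"
    unfolding va vb by simp
  have fa: "fact a = a * (fact (a - 1) :: nat)" using a fact_reduce[of a, where 'a = nat] by simp
  have fb: "fact b = b * (fact (b - 1) :: nat)" using False fact_reduce[of b, where 'a = nat] by simp
  have ha: "of_nat a * hook_factor \<alpha> = (of_nat (n * (fact a * fact b)) :: 'k)"
    unfolding \<alpha>_def hook_factor_hook[OF a] n fa by (simp add: algebra_simps)
  have "hook_factor \<beta> = (of_nat (n * fact a * fact (b - 1)) :: 'k)"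
    using hook_factor_hook[of "Suc a" "b - 1", where 'k = 'k] unfolding \<beta>_def b1 by simp
  then have hb: "of_nat b * hook_factor \<beta> = (of_nat (n * (fact a * fact b)) :: 'k)"
    unfolding fb by (simp add: algebra_simps)
  have "of_nat n * sym_alt_value character {..<a} {a..<a + b}
      = of_nat n * of_nat (fact a * fact b * (char_multiplicity n character \<alpha> + char_multiplicity n character \<beta>))"
    unfolding main[symmetric] mult.assoc[symmetric] ha hb by (simp add: algebra_simps)
  moreover have "n \<noteq> 0" using a n by simp
  then have "of_nat n \<noteq> (0::'k)" by simp
  ultimately have "sym_alt_value character {..<a} {a..<a + b}
      = of_nat (fact a * fact b * (char_multiplicity n character \<alpha> + char_multiplicity n character \<beta>))" by simp
  then show ?thesis using False unfolding \<alpha>_def \<beta>_def by simp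
qed

section \<open>Even and odd elements of the Grassmann algebra\<close>

lemma gsign_swap:
  assumes "finite S" "finite T" "S \<inter> T = {}"
  shows "gsign S T = (- 1) ^ (card S * card T) * (gsign T S :: 'k::comm_ring_1)"
proof -
  let ?A = "{(s, t). s \<in> S \<and> t \<in> T \<and> t < s}" and ?B = "{(t, s). t \<in> T \<and> s \<in> S \<and> s < t}"
  have "card ?B = card (prod.swap ` ?B)" by (rule card_image[symmetric]) simp
  also have "prod.swap ` ?B = S \<times> T - ?A" using assms by (auto simp: image_iff)
  finally have B: "card ?B = card (S \<times> T - ?A)" .
  have sub: "?A \<subseteq> S \<times> T" and fin: "finite (S \<times> T)" using assms by auto
  have "card ?A + card (S \<times> T - ?A) = card (S \<times> T)"
    using card_Diff_subset[OF finite_subset[OF sub fin] sub] card_mono[OF fin sub] by simp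
  then have "card S * card T = card ?A + card ?B" using B by (simp add: card_cartesian_product)
  then show ?thesis unfolding gsign_def by (simp add: power_add mult.assoc flip: power_mult_distrib)
qed

lemma gcoeff_simps:
  "gcoeff (x + y) S = gcoeff x S + gcoeff y S" "gcoeff (- x) S = - gcoeff x S" "gcoeff (x - y) S = gcoeff x S - gcoeff y S"
  "gcoeff 0 S = 0" "gcoeff (gscale c x) S = c * gcoeff x S"
proof -
  show "gcoeff (x - y) S = gcoeff x S - gcoeff y S"
    unfolding minus_grassmann_def plus_grassmann.rep_eq uminus_grassmann.rep_eq by simp
qed (simp_all add: plus_grassmann.rep_eq uminus_grassmann.rep_eq zero_grassmann.rep_eq gscale.rep_eq)

lemma gcoeff_mult: "gcoeff (x * y) U = (\<Sum>S\<in>Pow U. gsign S (U - S) * gcoeff x S * gcoeff y (U - S))"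
  by (simp add: times_grassmann.rep_eq)

lemma grassmann_eqI: "(\<And>S. gcoeff x S = gcoeff y S) \<Longrightarrow> x = y"
  by (metis ext gcoeff_inject)

lift_definition parity_part :: "bool \<Rightarrow> 'k::comm_ring_1 grassmann \<Rightarrow> 'k grassmann" is
  "\<lambda>p f S. if even (card S) = p then f S else 0"
proof -
  fix p and f :: "nat set \<Rightarrow> 'k"
  assume f: "finite {S. f S \<noteq> 0} \<and> (\<forall>S. f S \<noteq> 0 \<longrightarrow> finite S)"
  have "finite {S. (if even (card S) = p then f S else 0) \<noteq> 0}"
    by (rule finite_subset[of _ "{S. f S \<noteq> 0}"]) (use f in auto)
  then show "finite {S. (if even (card S) = p then f S else 0) \<noteq> 0} \<and>
      (\<forall>S. (if even (card S) = p then f S else 0) \<noteq> 0 \<longrightarrow> finite S)"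
    using f by simp
qed

lemma parity_part_split: "x = parity_part True x + parity_part False x"
  by (rule grassmann_eqI) (simp add: gcoeff_simps parity_part.rep_eq)

lemma parity_part_commute:
  "parity_part p x * parity_part q y
    = (if p \<or> q then parity_part q y * parity_part p x else - (parity_part q y * parity_part p x))"
proof (rule grassmann_eqI)
  fix U
  let ?X = "parity_part p x" and ?Y = "parity_part q y"
  have "gcoeff (?X * ?Y) U = (if p \<or> q then 1 else - 1) * gcoeff (?Y * ?X) U"
  proof (cases "finite U")
    case True
    have "gcoeff (?X * ?Y) U = (\<Sum>S\<in>Pow U. gsign (U - S) S * gcoeff ?X (U - S) * gcoeff ?Y S)"
      unfolding gcoeff_mult
      by (rule sum.reindex_bij_witness[where i = "\<lambda>S. U - S" and j = "\<lambda>S. U - S"])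
         (auto simp: double_diff)
    also have "\<dots> = (\<Sum>S\<in>Pow U. (if p \<or> q then 1 else - 1) * (gsign S (U - S) * gcoeff ?Y S * gcoeff ?X (U - S)))"
    proof (rule sum.cong[OF refl])
      fix S assume "S \<in> Pow U"
      then have fin: "finite S" "finite (U - S)" using True finite_subset by auto
      have gs: "gsign (U - S) S = (- 1) ^ (card (U - S) * card S) * (gsign S (U - S) :: 'a)"
        by (rule gsign_swap) (use fin in auto)
      show "gsign (U - S) S * gcoeff ?X (U - S) * gcoeff ?Y S
          = (if p \<or> q then 1 else - 1) * (gsign S (U - S) * gcoeff ?Y S * gcoeff ?X (U - S))"
        unfolding gs parity_part.rep_eq by (auto simp: mult_ac)
    qed
    finally show ?thesis unfolding gcoeff_mult by (simp add: sum_distrib_left)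
  qed (simp add: gcoeff_infinite)
  then show "gcoeff (?X * ?Y) U = gcoeff (if p \<or> q then ?Y * ?X else - (?Y * ?X)) U"
    by (auto simp: gcoeff_simps)
qed

lemma grassmann_double_zero:
  fixes x :: "'k::field_char_0 grassmann"
  assumes "x = - x"
  shows "x = 0"
proof (rule grassmann_eqI)
  fix S
  have "gcoeff x S = - gcoeff x S" using arg_cong[OF assms, of "\<lambda>x. gcoeff x S"] by (simp add: gcoeff_simps)
  then show "gcoeff x S = gcoeff 0 S" by (simp add: gcoeff_simps)
qed

section \<open>Evaluating words in an even and an odd variable\<close>

text \<open>
  The multilinear variables with index below \<open>a\<close> are regarded as polarizations of an even variable \<open>x\<close>,
  the others as polarizations of an odd variable \<open>y\<close>. A word in \<open>x\<close> (\<^term>\<open>True\<close>) and \<open>y\<close> (\<^term>\<open>False\<close>)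
  is evaluated by letting its letters act from the right on functions \<open>F\<close> of finite sets of indices:
  think of \<open>F\<close> as \<open>\<Sum>\<^sub>U F(U) t\<^sub>U\<close> with \<open>t\<^sub>i\<close> commuting for \<open>i < a\<close>, anticommuting for \<open>i \<ge> a\<close>, and of square
  zero, and of the letters as multiplication by \<open>\<Sum>\<^sub>i c\<^sub>i t\<^sub>i\<close> over the indices of the respective kind.
\<close>

lemma of_int_left: "x * (of_int e * y) = of_int e * (x * y :: 'a::ring_1)"
  by (simp only: mult.assoc[symmetric] mult_of_int_commute[of e x])

lemma of_nat_left: "x * (of_nat e * y) = of_nat e * (x * y :: 'a::ring_1)"
  using of_int_left[of x "int e" y] by simp

definition place_sign :: "nat \<Rightarrow> nat set \<Rightarrow> nat \<Rightarrow> int" where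
  "place_sign a U i = (if a \<le> i then (- 1) ^ card {j \<in> U. i < j} else 1)"

definition letter :: "nat \<Rightarrow> (nat \<Rightarrow> 'a::ring_1) \<Rightarrow> bool \<Rightarrow> (nat set \<Rightarrow> 'a) \<Rightarrow> nat set \<Rightarrow> 'a" where
  "letter a c l F U = (if finite U
     then \<Sum>i\<in>{i \<in> U. (i < a) = l}. of_int (place_sign a U i) * F (U - {i}) * c i else 0)"

definition act :: "nat \<Rightarrow> (nat \<Rightarrow> 'a::ring_1) \<Rightarrow> (nat set \<Rightarrow> 'a) \<Rightarrow> bool list \<Rightarrow> nat set \<Rightarrow> 'a" where
  "act a c F w = foldl (\<lambda>F l. letter a c l F) F w"

lemma act_Nil [simp]: "act a c F [] = F"
  and act_snoc [simp]: "act a c F (w @ [l]) = letter a c l (act a c F w)"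
  and act_append: "act a c F (u @ v) = act a c (act a c F u) v"
  and act_Cons: "act a c F (l # v) = act a c (letter a c l F) v"
  by (simp_all add: act_def)

lemma place_sign_swap:
  assumes "i \<in> U" "j \<in> U" "i \<noteq> j" "finite U"
  shows "place_sign a U i * place_sign a (U - {i}) j
    = (if a \<le> i \<and> a \<le> j then - 1 else 1) * (place_sign a U j * place_sign a (U - {j}) i)"
proof -
  have key: "place_sign a U i * place_sign a (U - {i}) j
      = (if a \<le> i \<and> a \<le> j then - 1 else 1) * (place_sign a U j * place_sign a (U - {j}) i)"
    if ij: "i < j" and ij_in: "i \<in> U" "j \<in> U" for i j
  proof -
    have e: "{k \<in> U - {i}. j < k} = {k \<in> U. j < k}" using ij by auto
    have d: "{k \<in> U. i < k} = insert j {k \<in> U - {j}. i < k}" using ij ij_in by auto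
    have cd: "card {k \<in> U. i < k} = Suc (card {k \<in> U - {j}. i < k})"
      unfolding d using assms(4) by simp
    show ?thesis
      using ij unfolding place_sign_def e cd by (auto simp: mult_ac)
  qed
  show ?thesis
  proof (cases "i < j")
    case True
    then show ?thesis using key assms by blast
  next
    case False
    then have "j < i" using assms(3) by simp
    from key[OF this assms(2,1)] show ?thesis by (auto split: if_splits)
  qed
qed

lemma letter_swap:
  fixes c d :: "nat \<Rightarrow> 'a::ring_1"
  assumes comm: "\<And>i j. d j * c i = of_int e * (c i * d j)"
  shows "letter a c k (letter a d l F) U
    = of_int (e * (if k \<or> l then 1 else - 1)) * letter a d l (letter a c k F) U"
proof (cases "finite U")
  case fin: True
  have expand: "letter a c k (letter a d l F) U = (\<Sum>i\<in>U. \<Sum>j\<in>U.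
      if (i < a) = k \<and> (j < a) = l \<and> i \<noteq> j
      then of_int (place_sign a U i * place_sign a (U - {i}) j) * F (U - {i} - {j}) * (d j * c i) else 0)"
    for c d :: "nat \<Rightarrow> 'a" and k l
  proof -
    have "of_int (place_sign a U i) * letter a d l F (U - {i}) * c i
        = (\<Sum>j\<in>U. if (j < a) = l \<and> i \<noteq> j
            then of_int (place_sign a U i * place_sign a (U - {i}) j) * F (U - {i} - {j}) * (d j * c i) else 0)"
      for i
    proof -
      have "of_int (place_sign a U i) * letter a d l F (U - {i}) * c i
        = (\<Sum>j\<in>{j \<in> U. (j < a) = l \<and> i \<noteq> j}.
            of_int (place_sign a U i) * (of_int (place_sign a (U - {i}) j) * F (U - {i} - {j}) * d j) * c i)"
        unfolding letter_def using fin
        by (simp add: sum_distrib_left sum_distrib_right) (rule sum.cong, auto)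
      also have "\<dots> = (\<Sum>j\<in>{j \<in> U. (j < a) = l \<and> i \<noteq> j}.
            of_int (place_sign a U i * place_sign a (U - {i}) j) * F (U - {i} - {j}) * (d j * c i))"
        by (simp add: mult.assoc)
      finally show ?thesis unfolding sum.inter_filter[OF fin] .
    qed
    then have "letter a c k (letter a d l F) U = (\<Sum>i\<in>{i \<in> U. (i < a) = k}. \<Sum>j\<in>U. if (j < a) = l \<and> i \<noteq> j
            then of_int (place_sign a U i * place_sign a (U - {i}) j) * F (U - {i} - {j}) * (d j * c i) else 0)"
      unfolding letter_def[of a c] using fin by simp
    also have "\<dots> = (\<Sum>i\<in>U. \<Sum>j\<in>U. if (i < a) = k \<and> (j < a) = l \<and> i \<noteq> j
      then of_int (place_sign a U i * place_sign a (U - {i}) j) * F (U - {i} - {j}) * (d j * c i) else 0)"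
      using fin by (simp add: sum.inter_filter) (intro sum.cong refl, auto)
    finally show ?thesis .
  qed
  have "letter a c k (letter a d l F) U = (\<Sum>j\<in>U. \<Sum>i\<in>U.
      if (i < a) = k \<and> (j < a) = l \<and> i \<noteq> j
      then of_int (place_sign a U i * place_sign a (U - {i}) j) * F (U - {i} - {j}) * (d j * c i) else 0)"
    unfolding expand by (rule sum.swap)
  also have "\<dots> = (\<Sum>j\<in>U. \<Sum>i\<in>U. of_int (e * (if k \<or> l then 1 else - 1)) * (if (j < a) = l \<and> (i < a) = k \<and> j \<noteq> i
      then of_int (place_sign a U j * place_sign a (U - {j}) i) * F (U - {j} - {i}) * (c i * d j) else 0))"
  proof (intro sum.cong refl)
    fix i j assume ij: "j \<in> U" "i \<in> U"
    have Uij: "U - {i} - {j} = U - {j} - {i}" by auto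
    show "(if (i < a) = k \<and> (j < a) = l \<and> i \<noteq> j
        then of_int (place_sign a U i * place_sign a (U - {i}) j) * F (U - {i} - {j}) * (d j * c i) else 0)
      = of_int (e * (if k \<or> l then 1 else - 1)) * (if (j < a) = l \<and> (i < a) = k \<and> j \<noteq> i
        then of_int (place_sign a U j * place_sign a (U - {j}) i) * F (U - {j} - {i}) * (c i * d j) else 0)"
    proof (cases "(i < a) = k \<and> (j < a) = l \<and> i \<noteq> j")
      case True
      define s where "s = place_sign a U j * place_sign a (U - {j}) i"
      have "place_sign a U i * place_sign a (U - {i}) j = (if k \<or> l then 1 else - 1) * s"
        using place_sign_swap[OF ij(2,1) _ fin, of a] True unfolding s_def by (auto split: if_splits)
      then have "of_int (place_sign a U i * place_sign a (U - {i}) j) * F (U - {i} - {j}) * (d j * c i)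
          = of_int ((if k \<or> l then 1 else - 1) * s) * F (U - {j} - {i}) * (of_int e * (c i * d j))"
        unfolding Uij comm by simp
      also have "\<dots> = of_int (e * (if k \<or> l then 1 else - 1)) * (of_int s * F (U - {j} - {i}) * (c i * d j))"
        unfolding mult.assoc of_int_left[of "F _" e] by (simp add: mult.assoc of_int_left[of "of_int s" e])
      finally show ?thesis using True unfolding s_def by simp
    qed auto
  qed
  also have "\<dots> = of_int (e * (if k \<or> l then 1 else - 1)) * letter a d l (letter a c k F) U"
    unfolding expand sum_distrib_left ..
  finally show ?thesis .
qed (simp add: letter_def)

lemma letter_linear:
  "letter a c l (\<lambda>U. F U - of_nat m * G U) = (\<lambda>U. letter a c l F U - of_nat m * letter a c l G U)"
proof
  fix U
  have "of_int (place_sign a U i) * (F (U - {i}) - of_nat m * G (U - {i})) * c i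
     = of_int (place_sign a U i) * F (U - {i}) * c i - of_nat m * (of_int (place_sign a U i) * G (U - {i}) * c i)" for i
    by (simp add: left_diff_distrib right_diff_distrib mult.assoc of_nat_left)
  then show "letter a c l (\<lambda>U. F U - of_nat m * G U) U = letter a c l F U - of_nat m * letter a c l G U"
    unfolding letter_def by (simp add: sum_subtractf sum_distrib_left)
qed

lemma letter_add: "letter a c l (\<lambda>U. F U + G U) = (\<lambda>U. letter a c l F U + letter a c l G U)"
  by (rule ext) (simp add: letter_def algebra_simps sum.distrib)

lemma letter_diff: "letter a c l (\<lambda>U. F U - G U) = (\<lambda>U. letter a c l F U - letter a c l G U)"
  using letter_linear[of a c l F 1 G] by simp

lemma letter_of_int: "letter a c l (\<lambda>U. of_int e * F U) = (\<lambda>U. of_int e * letter a c l F U)"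
proof
  fix U
  have "of_int (place_sign a U i) * (of_int e * F (U - {i})) * c i
     = of_int e * (of_int (place_sign a U i) * F (U - {i}) * c i)" for i
    by (simp only: mult.assoc of_int_left[of "of_int (place_sign a U i)" e])
  then show "letter a c l (\<lambda>U. of_int e * F U) U = of_int e * letter a c l F U"
    unfolding letter_def by (simp add: sum_distrib_left)
qed

lemma letter_zero: "letter a c l (\<lambda>_. 0) = (\<lambda>_. 0)"
  by (simp add: letter_def fun_eq_iff)

lemma letter_coeff_add: "letter a (\<lambda>i. c i + d i) l F U = letter a c l F U + letter a d l F U"
  by (simp add: letter_def algebra_simps sum.distrib)

lemma act_combination:
  "act a c (\<lambda>U. of_nat k * F U - of_nat l * G U - of_nat m * H U) w
    = (\<lambda>U. of_nat k * act a c F w U - of_nat l * act a c G w U - of_nat m * act a c H w U)"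
proof (induction w rule: rev_induct)
  case (snoc x w)
  show ?case
    unfolding act_snoc snoc letter_linear
    using letter_of_int[of a c x "int k"] by simp
qed simp

section \<open>The super-identities of the Grassmann algebra\<close>

text \<open>The number of letters \<open>x\<close> of a word that are preceded by an odd number of letters \<open>y\<close>; the flag
  tells the parity of the letters \<open>y\<close> in front of the word.\<close>

fun odd_x :: "bool \<Rightarrow> bool list \<Rightarrow> nat" where
  "odd_x p [] = 0"
| "odd_x p (True # w) = (if p then 1 else 0) + odd_x p w"
| "odd_x p (False # w) = odd_x (\<not> p) w"

abbreviation nx :: "bool list \<Rightarrow> nat" where "nx w \<equiv> count_list w True"
abbreviation ny :: "bool list \<Rightarrow> nat" where "ny w \<equiv> count_list w False"

abbreviation mx :: "bool list \<Rightarrow> nat" where "mx w \<equiv> odd_x False w"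

lemma odd_x_append: "odd_x p (u @ v) = odd_x p u + odd_x (p \<noteq> odd (ny u)) v"
proof (induction p u rule: odd_x.induct)
  case (3 p w)
  have "((\<not> p) \<noteq> odd (ny w)) = (p \<noteq> odd (ny (False # w)))" by auto
  then show ?case using 3 by simp
qed auto

lemma odd_x_neg: "odd_x (\<not> p) w + odd_x p w = nx w"
proof (induction w arbitrary: p)
  case (Cons l w)
  show ?case using Cons[of p] Cons[of "\<not> p"] by (cases l; cases p) auto
qed simp

lemma mx_le: "mx w \<le> nx w" using odd_x_neg[of False w] by simp

lemma mx_zero: "nx w = 0 \<or> ny w = 0 \<Longrightarrow> mx w = 0"
proof (elim disjE)
  show "nx w = 0 \<Longrightarrow> mx w = 0" using mx_le[of w] by simp
  show "ny w = 0 \<Longrightarrow> mx w = 0" by (induction w) (auto split: if_splits)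
qed

lemma mx_snoc: "mx (w @ [True]) = mx w + (if odd (ny w) then 1 else 0)" "mx (w @ [False]) = mx w"
  by (simp_all add: odd_x_append)

definition xy :: "nat \<Rightarrow> nat \<Rightarrow> bool list" where "xy i j = replicate i True @ replicate j False"

lemma count_xy [simp]: "nx (xy i j) = i" "ny (xy i j) = j"
proof -
  have "count_list (replicate n l) l' = (if l = l' then n else 0)" for n and l l' :: bool by (induction n) auto
  then show "nx (xy i j) = i" "ny (xy i j) = j" by (simp_all add: xy_def)
qed

lemma mx_xy [simp]: "mx (xy i j) = 0"
proof -
  have "mx (replicate i True) = 0" by (induction i) auto
  moreover have "odd_x p (replicate j False) = 0" for p by (induction j arbitrary: p) auto
  ultimately show ?thesis by (simp add: xy_def odd_x_append)
qed

lemma mx_yxy [simp]: "mx (False # xy i j) = i"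
  using odd_x_neg[of False "xy i j"] by simp

context
  fixes a :: nat and c :: "nat \<Rightarrow> 'k::field_char_0 grassmann"
begin

abbreviation X :: "(nat set \<Rightarrow> 'k grassmann) \<Rightarrow> nat set \<Rightarrow> 'k grassmann" where "X \<equiv> letter a c True"
abbreviation Y :: "(nat set \<Rightarrow> 'k grassmann) \<Rightarrow> nat set \<Rightarrow> 'k grassmann" where "Y \<equiv> letter a c False"
abbreviation part :: "bool \<Rightarrow> bool \<Rightarrow> (nat set \<Rightarrow> 'k grassmann) \<Rightarrow> nat set \<Rightarrow> 'k grassmann" where
  "part p l \<equiv> letter a (\<lambda>i. parity_part p (c i)) l"

definition Z :: "(nat set \<Rightarrow> 'k grassmann) \<Rightarrow> nat set \<Rightarrow> 'k grassmann" where
  "Z F = (\<lambda>U. Y (X F) U - X (Y F) U)"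

lemma letter_parts: "letter a c l F = (\<lambda>U. part True l F U + part False l F U)"
  using letter_coeff_add[of a "\<lambda>i. parity_part True (c i)" "\<lambda>i. parity_part False (c i)" l F]
    parity_part_split[of "c _", symmetric] by (simp add: fun_eq_iff)

lemma part_swap:
  "part p k (part q l F) = (\<lambda>U. of_int ((if p \<or> q then 1 else - 1) * (if k \<or> l then 1 else - 1)) * part q l (part p k F) U)"
  by (rule ext, rule letter_swap) (use parity_part_commute[of q _ p _] in auto)

lemma odd_x_square: "part False True (part False True F) = (\<lambda>_. 0)"
proof
  fix U
  have "part False True (part False True F) U = - part False True (part False True F) U"
    using fun_cong[OF part_swap[of False True False True F], of U] by simp
  then show "part False True (part False True F) U = 0" by (rule grassmann_double_zero)
qed

text \<open>The commutator of \<open>x\<close> and \<open>y\<close> is twice the product of their Grassmann-odd parts. This gives the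
  relations of the relatively free superalgebra of \<open>E\<close> in \<open>x\<close> and \<open>y\<close>: the commutator commutes with \<open>x\<close>,
  anticommutes with \<open>y\<close> and has square zero.\<close>

lemma Z_parts: "Z F = (\<lambda>U. of_int 2 * part False False (part False True F) U)"
proof
  fix U
  note s = part_swap[of True True True False F] part_swap[of True True False False F]
    part_swap[of False True True False F] part_swap[of False True False False F]
  have "X (Y F) U = part True False (part True True F) U + part False False (part True True F) U
     + (part True False (part False True F) U - part False False (part False True F) U)"
    using s by (simp add: letter_parts[of True] letter_parts[of False] letter_add)
  moreover have "Y (X F) U = part True False (part True True F) U + part True False (part False True F) U
     + (part False False (part True True F) U + part False False (part False True F) U)"
    by (simp add: letter_parts[of True] letter_parts[of False] letter_add)
  ultimately show "Z F U = of_int 2 * part False False (part False True F) U" unfolding Z_def by (simp add: mult_2)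
qed

lemma X_Z: "X (Z F) = Z (X F)"
proof
  fix U
  have 1: "part True True (part False False (part False True F)) = part False False (part False True (part True True F))"
    using part_swap[of True True False False "part False True F"] part_swap[of True True False True F]
    by simp
  have 2: "part False True (part False False (part False True F)) = (\<lambda>_. 0)"
    using part_swap[of False True False False "part False True F"] by (simp add: odd_x_square letter_zero)
  have "X (Z F) U = of_int 2 * part False False (part False True (part True True F)) U"
    unfolding Z_parts letter_of_int letter_parts[of True "part False False _"] 1 2 by simp
  also have "\<dots> = Z (X F) U"
    unfolding Z_parts by (simp add: letter_parts[of True] letter_add odd_x_square letter_zero)
  finally show "X (Z F) U = Z (X F) U" .
qed

lemma Y_Z: "Y (Z F) = (\<lambda>U. - Z (Y F) U)"
proof
  fix U
  have n: "letter a d l (\<lambda>U. - G U) = (\<lambda>U. - letter a d l G U)" for d l and G :: "nat set \<Rightarrow> 'k grassmann"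
    using letter_of_int[of a d l "-1" G] by simp
  have 1: "part True False (part False False (part False True F)) = (\<lambda>U. - part False False (part False True (part True False F)) U)"
    using part_swap[of True False False False "part False True F"] part_swap[of True False False True F] by simp
  have 2: "part False False (part False True (part False False F)) = (\<lambda>U. - part False False (part False False (part False True F)) U)"
    using part_swap[of False True False False F] by (simp add: n)
  have "Y (Z F) U = of_int 2 * (- part False False (part False True (part True False F)) U
      + part False False (part False False (part False True F)) U)"
    unfolding Z_parts letter_of_int letter_parts[of False "part False False _"] 1 by simp
  also have "\<dots> = - Z (Y F) U"
    unfolding Z_parts by (simp add: letter_parts[of False] letter_add 2)
  finally show "Y (Z F) U = - Z (Y F) U" .
qed

lemma Z_Z: "Z (Z F) = (\<lambda>_. 0)"
proof -
  have "part False True (part False False (part False True F)) = (\<lambda>_. 0)"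
    using part_swap[of False True False False "part False True F"] by (simp add: odd_x_square letter_zero)
  then show ?thesis unfolding Z_parts letter_of_int by (simp add: letter_zero)
qed

lemma Y_pow_zero: "(Y ^^ b) (\<lambda>_. 0) = (\<lambda>_. 0)"
  by (induction b) (simp_all add: letter_zero)

lemma Z_Y_pow: "Z ((Y ^^ b) F) = (\<lambda>U. (if odd b then - 1 else 1) * (Y ^^ b) (Z F) U)"
proof (induction b)
  case (Suc b)
  have "Z (Y ((Y ^^ b) F)) = (\<lambda>U. - Y (Z ((Y ^^ b) F)) U)" using Y_Z[of "(Y ^^ b) F"] by simp
  then show ?case unfolding Suc using letter_of_int[of a c False "if odd b then -1 else 1" "(Y ^^ b) (Z F)"]
    by (simp split: if_splits)
qed simp

lemma X_Y_pow:
  "X ((Y ^^ b) F) = (\<lambda>U. (Y ^^ b) (X F) U - (if odd b then (Y ^^ (b - 1)) (Z F) U else 0))"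
proof (induction b)
  case (Suc b)
  have "X (Y ((Y ^^ b) F)) = (\<lambda>U. Y (X ((Y ^^ b) F)) U - Z ((Y ^^ b) F) U)" by (simp add: Z_def)
  also have "\<dots> = (\<lambda>U. (Y ^^ Suc b) (X F) U - (if odd (Suc b) then (Y ^^ b) (Z F) U else 0))"
  proof (cases "odd b")
    case True
    then obtain b' where b': "b = Suc b'" by (cases b) auto
    show ?thesis unfolding Suc Z_Y_pow using True b' by (simp add: letter_diff)
  qed (simp add: Suc Z_Y_pow letter_diff)
  finally have r: "X (Y ((Y ^^ b) F)) = (\<lambda>U. (Y ^^ Suc b) (X F) U - (if odd (Suc b) then (Y ^^ b) (Z F) U else 0))" .
  have e: "(Y ^^ Suc b) F = Y ((Y ^^ b) F)" by simp
  show ?case unfolding diff_Suc_1 e by (rule r)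
qed simp

lemma act_xy: "act a c F (xy i j) = (Y ^^ j) ((X ^^ i) F)"
proof -
  have "act a c G (replicate n l) = (letter a c l ^^ n) G" for G n l
    by (induction n arbitrary: G) (simp_all add: act_Cons funpow_swap1)
  then show ?thesis by (simp add: xy_def act_append)
qed

lemma act_word:
  "act a c F w = (\<lambda>U. act a c F (xy (nx w) (ny w)) U - of_nat (mx w) * (Y ^^ (ny w - 1)) (Z ((X ^^ (nx w - 1)) F)) U)"
proof (induction w rule: rev_induct)
  case (snoc l w)
  define i where "i = nx w"
  define j where "j = ny w"
  define m where "m = mx w"
  have D: "letter a c l ((Y ^^ (j - 1)) (Z ((X ^^ (i - 1)) F)))
      = (Y ^^ (ny (w @ [l]) - 1)) (Z ((X ^^ (nx (w @ [l]) - 1)) F))" if m: "m \<noteq> 0"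
  proof -
    have "\<not> (nx w = 0 \<or> ny w = 0)" using m unfolding m_def by (rule contrapos_nn) (rule mx_zero)
    then have ij: "i \<noteq> 0" "j \<noteq> 0" unfolding i_def j_def by simp_all
    obtain i' j' where s: "i = Suc i'" "j = Suc j'" using ij by (meson not0_implies_Suc)
    show ?thesis
    proof (cases l)
      case True
      have "X ((Y ^^ j') (Z ((X ^^ i') F))) = (Y ^^ j') (X (Z ((X ^^ i') F)))"
        unfolding X_Y_pow Z_Z Y_pow_zero by simp
      then show ?thesis using True s unfolding X_Z by (simp add: i_def[symmetric] j_def[symmetric])
    next
      case False
      then show ?thesis using s by (simp add: i_def[symmetric] j_def[symmetric])
    qed
  qed
  have "act a c F (w @ [l]) = (\<lambda>U. letter a c l (act a c F (xy i j)) U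
      - of_nat m * letter a c l ((Y ^^ (j - 1)) (Z ((X ^^ (i - 1)) F))) U)"
    unfolding act_snoc by (subst snoc) (simp add: letter_linear i_def j_def m_def)
  also have "\<dots> = (\<lambda>U. letter a c l (act a c F (xy i j)) U
      - of_nat m * (Y ^^ (ny (w @ [l]) - 1)) (Z ((X ^^ (nx (w @ [l]) - 1)) F)) U)"
    using D by (cases "m = 0") auto
  also have "\<dots> = (\<lambda>U. act a c F (xy (nx (w @ [l])) (ny (w @ [l]))) U
      - of_nat (mx (w @ [l])) * (Y ^^ (ny (w @ [l]) - 1)) (Z ((X ^^ (nx (w @ [l]) - 1)) F)) U)"
  proof (cases l)
    case True
    then have l: "l = True" by simp
    show ?thesis
      unfolding l act_xy X_Y_pow
      by (auto simp: mx_snoc i_def[symmetric] j_def[symmetric] m_def[symmetric] algebra_simps fun_eq_iff)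
  next
    case False
    then show ?thesis
      unfolding act_xy by (simp add: mx_snoc i_def[symmetric] j_def[symmetric] m_def[symmetric])
  qed
  finally show ?case .
qed (simp add: xy_def)

end

text \<open>Modulo the identities of \<open>E\<close>, a word with \<open>a\<close> letters \<open>x\<close> and \<open>b \<ge> 1\<close> letters \<open>y\<close> is a combination
  of \<open>x\<^sup>ay\<^sup>b\<close> and \<open>yx\<^sup>ay\<^bsup>b-1\<^esup>\<close>. For a function \<open>h\<close> of words, \<open>reduction p h q\<close> is the value of
  its linear extension at \<open>b\<^sub>pq\<close>, where \<open>b\<^sub>p\<close> is \<open>a\<close>, the number of letters \<open>x\<close> of \<open>p\<close>, times the difference of \<open>p\<close> and that combination.\<close>

definition reduction :: "bool list \<Rightarrow> (bool list \<Rightarrow> 'v::ring_1) \<Rightarrow> bool list \<Rightarrow> 'v" where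
  "reduction p h q = of_nat (nx p) * h (p @ q) - of_nat (nx p - mx p) * h (xy (nx p) (ny p) @ q)
     - of_nat (mx p) * h (False # xy (nx p) (ny p - 1) @ q)"

text \<open>Moving the letters of \<open>p\<close> into the order \<open>x\<^sup>ay\<^sup>b\<close> produces one commutator for each letter \<open>x\<close> behind an odd
  number of letters \<open>y\<close>, the others cancel in pairs. So the value of \<open>p\<close> is an affine function of \<open>mx p\<close>, and
  it is interpolated from the words with \<open>mx = 0\<close> and \<open>mx = a\<close>.\<close>

lemma reduction_grassmann:
  fixes c :: "nat \<Rightarrow> 'k::field_char_0 grassmann"
  assumes "ny p \<ge> 1"
  shows "reduction p (\<lambda>w. act a c F w U) [] = 0"
proof -
  define P where "P = act a c F (xy (nx p) (ny p)) U"
  define Q where "Q = (letter a c False ^^ (ny p - 1)) (Z a c ((letter a c True ^^ (nx p - 1)) F)) U"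
  have n: "nx (False # xy (nx p) (ny p - 1)) = nx p" "ny (False # xy (nx p) (ny p - 1)) = ny p"
    using assms by simp_all
  have 1: "act a c F p U = P - of_nat (mx p) * Q"
    unfolding P_def Q_def by (subst act_word) simp
  have 2: "act a c F (False # xy (nx p) (ny p - 1)) U = P - of_nat (nx p) * Q"
    unfolding P_def Q_def by (subst act_word) (simp only: n mx_yxy)
  have "(of_nat (nx p - mx p) :: 'k grassmann) = of_nat (nx p) - of_nat (mx p)"
    using mx_le by (simp add: of_nat_diff)
  then show ?thesis
    unfolding reduction_def append_Nil2 1 2 P_def[symmetric]
    by (simp add: left_diff_distrib right_diff_distrib of_nat_left[of "of_nat (mx p)" "nx p"])
qed

fun reductions :: "bool list list \<Rightarrow> (bool list \<Rightarrow> 'v::ring_1) \<Rightarrow> bool list \<Rightarrow> 'v" where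
  "reductions [] h = h"
| "reductions (p # ps) h = reductions ps (reduction p h)"

section \<open>Products of identities vanish on triangular matrices\<close>

abbreviation entry :: "'n \<Rightarrow> 'n \<Rightarrow> ('a::ring_1, 'n::{finite,linorder}) ut \<Rightarrow> 'a" where
  "entry i j A \<equiv> ut_mat A $ i $ j"

lemma entry_lower: "j < i \<Longrightarrow> entry i j A = 0"
  using ut_mat[of A] by simp

lemma entry_simps:
  "entry i j (A + B) = entry i j A + entry i j B" "entry i j (A - B) = entry i j A - entry i j B"
  "entry i j (- A) = - entry i j A" "entry i j 0 = 0" "entry i j (A * B) = (\<Sum>k\<in>UNIV. entry i k A * entry k j B)"
  "entry i j 1 = (if i = j then 1 else 0)"
  by (simp_all add: plus_ut.rep_eq minus_ut.rep_eq uminus_ut.rep_eq zero_ut.rep_eq times_ut.rep_eq one_ut.rep_eq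
      matrix_matrix_mult_def mat_def)

lemma entry_sum: "entry i j (\<Sum>x\<in>S. f x) = (\<Sum>x\<in>S. entry i j (f x))"
  by (induction S rule: infinite_finite_induct) (simp_all add: entry_simps)

lemma entry_of_nat: "entry i j (of_nat m * A) = of_nat m * entry i j A"
  by (induction m) (simp_all add: entry_simps distrib_right)

lemma entry_of_int: "entry i j (of_int m * A) = of_int m * entry i j A"
proof (cases m)
  case (nonneg n)
  then show ?thesis by (simp only: of_int_of_nat_eq entry_of_nat)
next
  case (neg n)
  then show ?thesis by (simp only: of_int_minus of_int_of_nat_eq mult_minus_left entry_simps(3) entry_of_nat)
qed

lemma ut_eqI: "(\<And>i j. entry i j A = entry i j B) \<Longrightarrow> A = B"
  by (simp add: ut_mat_inject[symmetric] vec_eq_iff)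

definition rank_of :: "'n::{finite,linorder} \<Rightarrow> nat" where "rank_of i = card {k. k < i}"

lemma rank_of_mono: "rank_of (i::'n::{finite,linorder}) < rank_of j \<longleftrightarrow> i < j"
proof -
  have "rank_of i < rank_of j" if "i < j" for i j :: 'n
    unfolding rank_of_def by (rule psubset_card_mono) (use that in auto)
  then show ?thesis by (metis linorder_neqE order_less_asym order_less_irrefl)
qed

lemma rank_of_less: "rank_of (i::'n::{finite,linorder}) < CARD('n)"
  unfolding rank_of_def by (rule psubset_card_mono) auto

definition diag_order :: "nat \<Rightarrow> ('a::ring_1, 'n::{finite,linorder}) ut \<Rightarrow> bool" where
  "diag_order m A \<longleftrightarrow> (\<forall>i j. rank_of j < rank_of i + m \<longrightarrow> entry i j A = 0)"

lemma entry_mult_diag_order: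
  fixes A B :: "('a::ring_1, 'n::{finite,linorder}) ut"
  assumes "diag_order m A" "rank_of j \<le> rank_of i + m"
  shows "entry i j (A * B) = entry i j A * entry j j B"
proof -
  have "entry i k A * entry k j B = 0" if "k \<noteq> j" for k
  proof (cases "k < j")
    case True
    then have "rank_of k < rank_of i + m" using rank_of_mono[of k j] assms(2) by simp
    then show ?thesis using assms(1) unfolding diag_order_def by simp
  next
    case False
    then have "j < k" using that by simp
    then show ?thesis using entry_lower[of j k B] by simp
  qed
  then have "(\<Sum>k\<in>UNIV. entry i k A * entry k j B) = (\<Sum>k\<in>UNIV. if k = j then entry i j A * entry j j B else 0)"
    by (intro sum.cong) auto
  then show ?thesis by (simp add: entry_simps)
qed

lemma act_diag_order:
  fixes \<phi> :: "nat \<Rightarrow> ('a::ring_1, 'n::{finite,linorder}) ut"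
  assumes F: "\<And>U. diag_order m (F U)"
  shows "diag_order m (act a \<phi> F w U)"
    "rank_of j \<le> rank_of i + m \<Longrightarrow> entry i j (act a \<phi> F w U) = act a (\<lambda>k. entry j j (\<phi> k)) (\<lambda>U. entry i j (F U)) w U"
proof -
  have step: "entry i j (letter a \<phi> l G U) = letter a (\<lambda>k. entry j j (\<phi> k)) l (\<lambda>U. entry i j (G U)) U"
    if G: "\<And>U. diag_order m (G U)" and ij: "rank_of j \<le> rank_of i + m" for i j l U and G :: "nat set \<Rightarrow> ('a, 'n) ut"
  proof -
    have "entry i j (of_int s * G V * B) = of_int s * entry i j (G V) * entry j j B" for s V B
      by (simp only: mult.assoc entry_of_int entry_mult_diag_order[OF G ij])
    then show ?thesis unfolding letter_def by (simp add: entry_sum entry_simps(4))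
  qed
  have main: "(\<forall>U. diag_order m (act a \<phi> F w U)) \<and> (\<forall>i j. rank_of j \<le> rank_of i + m \<longrightarrow>
      (\<lambda>U. entry i j (act a \<phi> F w U)) = act a (\<lambda>k. entry j j (\<phi> k)) (\<lambda>U. entry i j (F U)) w)"
  proof (induction w rule: rev_induct)
    case (snoc l w)
    then have G: "\<And>U. diag_order m (act a \<phi> F w U)" by blast
    have "entry i j (letter a \<phi> l (act a \<phi> F w) U) = 0" if "rank_of j < rank_of i + m" for i j U
    proof -
      have "(\<lambda>U. entry i j (act a \<phi> F w U)) = (\<lambda>_. 0)" using G that unfolding diag_order_def by blast
      then show ?thesis using step[OF G, where j = j and i = i and l = l and U = U] that by (simp add: letter_zero)
    qed
    then show ?case using snoc step[OF G] by (auto simp: diag_order_def fun_eq_iff)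
  qed (use F in auto)
  show "diag_order m (act a \<phi> F w U)" using main by blast
  show "rank_of j \<le> rank_of i + m \<Longrightarrow> entry i j (act a \<phi> F w U) = act a (\<lambda>k. entry j j (\<phi> k)) (\<lambda>U. entry i j (F U)) w U"
    using main by (metis (no_types, lifting))
qed

text \<open>An identity of \<open>E\<close> takes strictly triangular values on triangular matrices over \<open>E\<close>, so that a
  product of as many identities as there are rows vanishes.\<close>

lemma reductions_ut_zero:
  fixes \<phi> :: "nat \<Rightarrow> ('k::field_char_0 grassmann, 'n::{finite,linorder}) ut"
  assumes F: "\<And>U. diag_order m (F U)" and ps: "\<And>p. p \<in> set ps \<Longrightarrow> ny p \<ge> 1" and len: "CARD('n) \<le> m + length ps"
  shows "reductions ps (\<lambda>w. act a \<phi> F w U) q = 0"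
  using F ps len
proof (induction ps arbitrary: F m)
  case Nil
  have "act a \<phi> F q U = 0"
  proof (rule ut_eqI)
    fix i j :: 'n
    have "rank_of j < rank_of i + m" using rank_of_less[of j] Nil(3) by simp
    moreover have "diag_order m (act a \<phi> F q U)" by (rule act_diag_order(1)) (rule Nil(1))
    ultimately show "entry i j (act a \<phi> F q U) = entry i j 0"
      unfolding diag_order_def by (simp add: entry_simps)
  qed
  then show ?case by simp
next
  case (Cons p ps)
  define G where "G U = reduction p (\<lambda>w. act a \<phi> F w U) []" for U
  have red: "reduction p (\<lambda>w. act a \<phi> F w U) = (\<lambda>w. act a \<phi> G w U)"
  proof
    fix w
    show "reduction p (\<lambda>w. act a \<phi> F w U) w = act a \<phi> G w U"
      unfolding G_def[abs_def] reduction_def append_Nil2 act_combination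
      by (simp add: act_append[symmetric])
  qed
  have "diag_order (Suc m) (G U)" for U
    unfolding diag_order_def
  proof (intro allI impI)
    fix i j :: 'n
    assume "rank_of j < rank_of i + Suc m"
    then have ij: "rank_of j \<le> rank_of i + m" by simp
    have "entry i j (G U) = reduction p (\<lambda>w. act a (\<lambda>k. entry j j (\<phi> k)) (\<lambda>U. entry i j (F U)) w U) []"
      unfolding G_def reduction_def
      by (simp only: entry_simps(1-4) entry_of_nat act_diag_order(2)[OF Cons(2) ij])
    also have "\<dots> = 0" by (rule reduction_grassmann) (use Cons(3)[of p] in simp)
    finally show "entry i j (G U) = 0" .
  qed
  from Cons(1)[OF this] show ?case using Cons(3,4) unfolding reductions.simps red by simp
qed

section \<open>The multilinear polynomials as a representation\<close>

definition mwords :: "nat \<Rightarrow> nat list set" where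
  "mwords n = {v. distinct v \<and> set v = {..<n}}"

abbreviation kind :: "nat \<Rightarrow> nat list \<Rightarrow> bool list" where "kind a v \<equiv> map (\<lambda>i. i < a) v"

lemma finite_distinct_words: "finite U \<Longrightarrow> finite {v. distinct v \<and> set v = U}"
  by (rule finite_subset[OF _ finite_lists_length_eq[of U "card U"]]) (auto simp: distinct_card)

lemma finite_mwords [simp]: "finite (mwords n)"
  unfolding mwords_def by (rule finite_distinct_words) simp

lemma length_mwords: "v \<in> mwords n \<Longrightarrow> length v = n"
  unfolding mwords_def using distinct_card by fastforce

lemma mwords_map: "\<sigma> \<in> Sym n \<Longrightarrow> v \<in> mwords n \<Longrightarrow> map \<sigma> v \<in> mwords n"
  unfolding mwords_def using permutes_image[OF Sym_permutes, of \<sigma> n]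
  by (auto simp: distinct_map intro: inj_on_subset[OF bij_is_inj[OF Sym_bij]])

lemma map_cancel: "\<sigma> \<in> Sym n \<Longrightarrow> map \<sigma> (map (inv \<sigma>) v) = v" "\<sigma> \<in> Sym n \<Longrightarrow> map (inv \<sigma>) (map \<sigma> v) = v"
  by (simp_all add: comp_def Sym_cancel)

lemma mwords_map_iff: "\<sigma> \<in> Sym n \<Longrightarrow> map \<sigma> v \<in> mwords n \<longleftrightarrow> v \<in> mwords n"
  using mwords_map[of \<sigma> n v] mwords_map[OF inv_Sym, of \<sigma> n "map \<sigma> v"] map_cancel(2)[of \<sigma> n v] by auto

lemma multilinear_iff: "f \<in> multilinear n \<longleftrightarrow> (\<forall>v. f v \<noteq> 0 \<longrightarrow> v \<in> mwords n)"
proof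
  assume "f \<in> multilinear n"
  then show "\<forall>v. f v \<noteq> 0 \<longrightarrow> v \<in> mwords n" unfolding multilinear_def mwords_def by blast
next
  assume h: "\<forall>v. f v \<noteq> 0 \<longrightarrow> v \<in> mwords n"
  have "finite {v. f v \<noteq> 0}" by (rule finite_subset[OF _ finite_mwords[of n]]) (use h in auto)
  then show "f \<in> multilinear n" using h unfolding multilinear_def free_algebra_def mwords_def by blast
qed

lemma subspace_multilinear: "fs.subspace (multilinear n :: (nat list \<Rightarrow> 'k::field) set)"
  by (rule fs.subspaceI) (auto simp: multilinear_iff pointwise, metis add.right_neutral)

abbreviation ut_gscale :: "'k::field_char_0 \<Rightarrow> ('k grassmann, 'n::{finite,linorder}) ut \<Rightarrow> ('k grassmann, 'n) ut" where
  "ut_gscale \<equiv> ut_scale gscale"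

lemma entry_ut_gscale: "entry i j (ut_gscale c A) = gscale c (entry i j A)"
proof (cases "j < i")
  case True
  then show ?thesis by (simp add: entry_lower) (rule grassmann_eqI, simp add: gcoeff_simps)
qed (simp add: ut_scale.rep_eq)

lemma gcoeff_of_int: "gcoeff (of_int k * x) S = of_int k * gcoeff x S"
proof -
  have n: "gcoeff (of_nat m * x) S = of_nat m * gcoeff x S" for m
    by (induction m) (simp_all add: gcoeff_simps distrib_right)
  show ?thesis
  proof (cases k)
    case (nonneg m)
    then show ?thesis by (simp only: of_int_of_nat_eq n)
  next
    case (neg m)
    then show ?thesis by (simp only: of_int_minus of_int_of_nat_eq mult_minus_left gcoeff_simps n)
  qed
qed

lemma ut_gscale_simps:
  "ut_gscale 0 A = 0" "ut_gscale (c + d) A = ut_gscale c A + ut_gscale d A" "ut_gscale c (A + B) = ut_gscale c A + ut_gscale c B" "ut_gscale (c * d) A = ut_gscale c (ut_gscale d A)"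
  "ut_gscale c 0 = 0" "ut_gscale (of_int k) A = of_int k * A"
  by (rule ut_eqI; simp add: entry_ut_gscale entry_simps(1-4) entry_of_int; rule grassmann_eqI;
      simp add: gcoeff_simps algebra_simps gcoeff_of_int)+

lemma ut_gscale_sum: "ut_gscale c (\<Sum>i\<in>I. A i) = (\<Sum>i\<in>I. ut_gscale c (A i))"
  by (induction I rule: infinite_finite_induct) (simp_all add: ut_gscale_simps)

lemma evaluate_multilinear:
  assumes "f \<in> multilinear n"
  shows "evaluate ut_gscale \<phi> f = (\<Sum>v\<in>mwords n. ut_gscale (f v) (prod_list (map \<phi> v)))"
  unfolding evaluate_def
  by (rule sum.mono_neutral_left) (use assms in \<open>auto simp: multilinear_iff ut_gscale_simps\<close>)

definition identities :: "'n::{finite,linorder} itself \<Rightarrow> nat \<Rightarrow> (nat list \<Rightarrow> 'k::field_char_0) set" where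
  "identities _ n = multilinear n \<inter> T_ideal (ut_gscale :: 'k \<Rightarrow> ('k grassmann, 'n) ut \<Rightarrow> ('k grassmann, 'n) ut)"

lemma identities_iff:
  "f \<in> identities TYPE('n::{finite,linorder}) n \<longleftrightarrow> f \<in> multilinear n \<and>
     (\<forall>\<phi> :: nat \<Rightarrow> ('k::field_char_0 grassmann, 'n) ut. evaluate ut_gscale \<phi> f = 0)"
  unfolding identities_def T_ideal_def multilinear_def by blast

lemma subspace_identities: "fs.subspace (identities TYPE('n::{finite,linorder}) n :: (nat list \<Rightarrow> 'k::field_char_0) set)"
proof (rule fs.subspaceI)
  show "0 \<in> identities TYPE('n) n"
    using fs.subspace_0[OF subspace_multilinear] by (simp add: identities_iff evaluate_def pointwise)
next
  fix f g :: "nat list \<Rightarrow> 'k" assume fg: "f \<in> identities TYPE('n) n" "g \<in> identities TYPE('n) n"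
  then have m: "f \<in> multilinear n" "g \<in> multilinear n" by (simp_all add: identities_iff)
  have s: "f + g \<in> multilinear n" by (rule fs.subspace_add[OF subspace_multilinear m])
  have "evaluate ut_gscale \<phi> (f + g) = evaluate ut_gscale \<phi> f + evaluate ut_gscale \<phi> g" for \<phi> :: "nat \<Rightarrow> ('k grassmann, 'n) ut"
    unfolding evaluate_multilinear[OF s] evaluate_multilinear[OF m(1)] evaluate_multilinear[OF m(2)]
    by (simp add: pointwise ut_gscale_simps sum.distrib)
  then show "f + g \<in> identities TYPE('n) n" using fg s by (simp add: identities_iff)
next
  fix c and f :: "nat list \<Rightarrow> 'k" assume f: "f \<in> identities TYPE('n) n"
  then have m: "f \<in> multilinear n" by (simp add: identities_iff)
  have s: "fscale c f \<in> multilinear n" by (rule fs.subspace_scale[OF subspace_multilinear m])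
  have "evaluate ut_gscale \<phi> (fscale c f) = ut_gscale c (evaluate ut_gscale \<phi> f)" for \<phi> :: "nat \<Rightarrow> ('k grassmann, 'n) ut"
    unfolding evaluate_multilinear[OF s] evaluate_multilinear[OF m] ut_gscale_sum
    by (simp add: pointwise ut_gscale_simps)
  then show "fscale c f \<in> identities TYPE('n) n" using f s by (simp add: identities_iff ut_gscale_simps)
qed

lemma rename_multilinear:
  assumes "\<sigma> \<in> Sym n" "f \<in> multilinear n"
  shows "rename_vars \<sigma> f \<in> multilinear n"
  using assms mwords_map_iff[OF inv_Sym[OF assms(1)]] by (auto simp: multilinear_iff rename_vars_def)

lemma evaluate_rename:
  fixes \<phi> :: "nat \<Rightarrow> ('k::field_char_0 grassmann, 'n::{finite,linorder}) ut"
  assumes s: "\<sigma> \<in> Sym n" and f: "f \<in> multilinear n"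
  shows "evaluate ut_gscale \<phi> (rename_vars \<sigma> f) = evaluate ut_gscale (\<phi> \<circ> \<sigma>) f"
  unfolding evaluate_multilinear[OF rename_multilinear[OF s f]] evaluate_multilinear[OF f]
  unfolding rename_vars_def
  by (rule sum.reindex_bij_witness[where i = "map \<sigma>" and j = "map (inv \<sigma>)"])
     (use mwords_map[OF s] mwords_map[OF inv_Sym[OF s]] in \<open>simp_all add: comp_def Sym_cancel[OF s]\<close>)

lemma multilinear_sym_rep:
  "sym_rep (multilinear n :: (nat list \<Rightarrow> 'k::field_char_0) set) (identities TYPE('n::{finite,linorder}) n) n rename_vars"
proof
  let ?V = "multilinear n :: (nat list \<Rightarrow> 'k) set" and ?W = "identities TYPE('n) n :: (nat list \<Rightarrow> 'k) set"
  show "fs.subspace ?V" by (rule subspace_multilinear)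
  show "fs.subspace ?W" by (rule subspace_identities)
  show WV: "?W \<subseteq> ?V" unfolding identities_def by blast
  have supp: "v x = 0" if "v \<in> ?V" "x \<notin> mwords n" for v x using that multilinear_iff by blast
  show "\<exists>B. basis_mod ?V ?W B"
  proof (rule basis_mod_exists[OF subspace_multilinear subspace_identities WV finite_mwords])
    fix v x assume "v \<in> ?V" "x \<notin> mwords n"
    then show "v x = 0" by (rule supp)
  qed
  show "\<exists>X. finite X \<and> (\<forall>v\<in>?V. \<forall>x. x \<notin> X \<longrightarrow> v x = 0)"
    by (intro exI[of _ "mwords n"] conjI finite_mwords ballI allI impI) (rule supp)
  fix \<sigma> assume s: "\<sigma> \<in> Sym n"
  show "lin_on ?V (rename_vars \<sigma>)" unfolding lin_on_def rename_vars_def by (auto simp: fun_eq_iff pointwise)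
  show V: "rename_vars \<sigma> v \<in> ?V" if "v \<in> ?V" for v by (rule rename_multilinear[OF s that])
  show "rename_vars \<sigma> w \<in> ?W" if w: "w \<in> ?W" for w
  proof -
    have m: "w \<in> multilinear n" using w by (simp add: identities_iff)
    have "evaluate ut_gscale \<phi> (rename_vars \<sigma> w) = 0" for \<phi> :: "nat \<Rightarrow> ('k grassmann, 'n) ut"
      unfolding evaluate_rename[OF s m] using w by (simp add: identities_iff)
    then show ?thesis using V[OF m] by (simp add: identities_iff)
  qed
  fix \<tau> assume t: "\<tau> \<in> Sym n"
  show "rename_vars (\<sigma> \<circ> \<tau>) v = rename_vars \<sigma> (rename_vars \<tau> v)" for v :: "nat list \<Rightarrow> 'k"
    unfolding rename_vars_def Sym_inv_comp[OF s t] by simp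
qed

lemma cocharacter_character:
  "cocharacter (ut_gscale :: 'k \<Rightarrow> ('k::field_char_0 grassmann, 'n::{finite,linorder}) ut \<Rightarrow> ('k grassmann, 'n) ut) n
     = sym_rep.character (multilinear n) (identities TYPE('n) n) rename_vars"
proof
  show "cocharacter (ut_gscale :: 'k \<Rightarrow> ('k grassmann, 'n) ut \<Rightarrow> ('k grassmann, 'n) ut) n \<sigma>
     = sym_rep.character (multilinear n) (identities TYPE('n) n) rename_vars \<sigma>" for \<sigma>
    unfolding cocharacter_def sym_rep.character_def[OF multilinear_sym_rep]
    unfolding identities_def ..
qed

section \<open>Superization of multilinear polynomials\<close>

text \<open>The sign of the permutation that sorts the odd indices of a word; the even ones are ignored.\<close>

definition order_sign :: "nat \<Rightarrow> nat list \<Rightarrow> int" where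
  "order_sign a v = (\<Prod>q<length v. \<Prod>p<q. if a \<le> v ! q \<and> v ! q < v ! p then - 1 else 1)"

lemma prod_sign: "finite A \<Longrightarrow> (\<Prod>x\<in>A. if P x then - 1 else 1 :: int) = (- 1) ^ card {x \<in> A. P x}"
  by (simp add: prod.inter_filter[symmetric])

lemma order_sign_snoc:
  assumes "distinct v"
  shows "order_sign a (v @ [i]) = order_sign a v * place_sign a (set v) i"
proof -
  have "(\<Prod>p<length v. if a \<le> i \<and> i < v ! p then - 1 else 1 :: int) = (\<Prod>x\<in>set v. if a \<le> i \<and> i < x then - 1 else 1)"
    by (rule prod.reindex_bij_betw[OF bij_betw_nth[OF assms refl refl]])
  also have "\<dots> = place_sign a (set v) i"
    unfolding place_sign_def by (cases "a \<le> i") (simp_all add: prod_sign)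
  finally have last: "(\<Prod>p<length v. if a \<le> i \<and> i < v ! p then - 1 else 1 :: int) = place_sign a (set v) i" .
  have "(\<Prod>q<length v. \<Prod>p<q. if a \<le> (v @ [i]) ! q \<and> (v @ [i]) ! q < (v @ [i]) ! p then - 1 else 1 :: int) = order_sign a v"
    unfolding order_sign_def by (intro prod.cong refl) (auto simp: nth_append)
  moreover have "(\<Prod>p<length v. if a \<le> i \<and> i < (v @ [i]) ! p then - 1 else 1 :: int)
      = (\<Prod>p<length v. if a \<le> i \<and> i < v ! p then - 1 else 1)"
    by (intro prod.cong refl) (auto simp: nth_append)
  ultimately show ?thesis using last unfolding order_sign_def[of a "v @ [i]"] by simp
qed

definition unit_at_empty :: "nat set \<Rightarrow> 'a::ring_1" where
  "unit_at_empty U = (if U = {} then 1 else 0)"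

lemma place_sign_remove: "place_sign a (U - {i}) i = place_sign a U i"
proof -
  have "{j \<in> U - {i}. i < j} = {j \<in> U. i < j}" by auto
  then show ?thesis by (simp add: place_sign_def)
qed

text \<open>The coefficient of \<open>t\<^sub>U\<close> for the full set \<open>U\<close> of indices collects the products in which every index of \<open>U\<close>
  is used once, with the sign of the order of the odd ones.\<close>

lemma act_expand:
  assumes "finite U"
  shows "act a \<phi> unit_at_empty w U
    = (\<Sum>v | (distinct v \<and> set v = U) \<and> kind a v = w. of_int (order_sign a v) * prod_list (map \<phi> v))"
  using assms
proof (induction w arbitrary: U rule: rev_induct)
  case Nil
  have "{v. (distinct v \<and> set v = U) \<and> kind a v = []} = (if U = {} then {[]} else {})" by auto
  then show ?case by (simp add: unit_at_empty_def order_sign_def)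
next
  case (snoc l w)
  define V where "V U = {v. (distinct v \<and> set v = U) \<and> kind a v = w}" for U
  have finV: "finite (V U)" if "finite U" for U
    using finite_subset[OF _ finite_distinct_words[OF that], of "V U"] by (auto simp: V_def)
  have "act a \<phi> unit_at_empty (w @ [l]) U = (\<Sum>i\<in>{i \<in> U. (i < a) = l}. \<Sum>v\<in>V (U - {i}).
      of_int (place_sign a U i) * (of_int (order_sign a v) * prod_list (map \<phi> v)) * \<phi> i)"
    unfolding act_snoc letter_def V_def
    using snoc by (simp add: sum_distrib_left sum_distrib_right)
  also have "\<dots> = (\<Sum>(i, v)\<in>(SIGMA i:{i \<in> U. (i < a) = l}. V (U - {i})).
      of_int (place_sign a U i) * (of_int (order_sign a v) * prod_list (map \<phi> v)) * \<phi> i)"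
    by (rule sum.Sigma) (use snoc(2) finV in auto)
  also have "\<dots> = (\<Sum>v | (distinct v \<and> set v = U) \<and> kind a v = w @ [l]. of_int (order_sign a v) * prod_list (map \<phi> v))"
  proof (rule sum.reindex_bij_witness[where j = "\<lambda>(i, v). v @ [i]" and i = "\<lambda>v. (last v, butlast v)"])
    fix v assume v: "v \<in> {v. (distinct v \<and> set v = U) \<and> kind a v = w @ [l]}"
    then have ne: "v \<noteq> []" by auto
    then obtain u i where u: "v = u @ [i]" by (metis append_butlast_last_id)
    show "(case (last v, butlast v) of (i, v) \<Rightarrow> v @ [i]) = v" using ne by simp
    show "(last v, butlast v) \<in> (SIGMA i:{i \<in> U. (i < a) = l}. V (U - {i}))"
      using v unfolding u V_def by auto
  next
    fix p assume "p \<in> (SIGMA i:{i \<in> U. (i < a) = l}. V (U - {i}))"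
    then obtain i v where p: "p = (i, v)" "i \<in> U" "(i < a) = l" "v \<in> V (U - {i})" by auto
    show "(\<lambda>v. (last v, butlast v)) (case p of (i, v) \<Rightarrow> v @ [i]) = p" using p by simp
    show "(case p of (i, v) \<Rightarrow> v @ [i]) \<in> {v. (distinct v \<and> set v = U) \<and> kind a v = w @ [l]}"
      using p unfolding V_def by auto
    have "order_sign a (v @ [i]) = order_sign a v * place_sign a U i"
      using p order_sign_snoc[of v a i] place_sign_remove[of a U i] unfolding V_def by simp
    then show "of_int (order_sign a (case p of (i, v) \<Rightarrow> v @ [i])) * prod_list (map \<phi> (case p of (i, v) \<Rightarrow> v @ [i]))
        = (case p of (i, v) \<Rightarrow> of_int (place_sign a U i) * (of_int (order_sign a v) * prod_list (map \<phi> v)) * \<phi> i)"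
      using p by (simp add: mult.assoc mult.commute[of "order_sign a v"])
  qed
  finally show ?case .
qed

text \<open>The sum of the multilinear words that become \<open>w\<close> when their variables are replaced by \<open>x\<close> and \<open>y\<close>; the
  signs make it alternating in the odd variables.\<close>

definition polarize :: "nat \<Rightarrow> nat \<Rightarrow> bool list \<Rightarrow> nat list \<Rightarrow> 'k::field_char_0" where
  "polarize a n w v = (if v \<in> mwords n \<and> kind a v = w then of_int (order_sign a v) else 0)"

lemma polarize_multilinear: "polarize a n w \<in> multilinear n"
  by (auto simp: multilinear_iff polarize_def)

lemma evaluate_polarize:
  fixes \<phi> :: "nat \<Rightarrow> ('k::field_char_0 grassmann, 'n::{finite,linorder}) ut"
  shows "evaluate ut_gscale \<phi> (polarize a n w) = act a \<phi> unit_at_empty w {..<n}"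
proof -
  have "evaluate ut_gscale \<phi> (polarize a n w) = (\<Sum>v\<in>mwords n. if kind a v = w then of_int (order_sign a v) * prod_list (map \<phi> v) else 0)"
    unfolding evaluate_multilinear[OF polarize_multilinear]
    by (rule sum.cong) (auto simp: polarize_def ut_gscale_simps)
  also have "\<dots> = (\<Sum>v\<in>{v \<in> mwords n. kind a v = w}. of_int (order_sign a v) * prod_list (map \<phi> v))"
    by (rule sum.inter_filter[symmetric]) simp
  finally show ?thesis by (simp add: act_expand mwords_def conj_assoc)
qed

lemma order_sign_even:
  assumes r: "\<rho> \<in> Perms {..<a}"
  shows "order_sign a (map \<rho> v) = order_sign a v"
proof -
  have c: "(a \<le> \<rho> x \<and> \<rho> x < \<rho> y) = (a \<le> x \<and> x < y)" for x y
  proof -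
    have 1: "\<rho> z < a \<longleftrightarrow> z < a" for z using Perms_in[OF r, of z] by simp
    have 2: "\<rho> z = z" if "a \<le> z" for z using Perms_not_in[OF r, of z] that by simp
    show ?thesis
    proof (cases "a \<le> x")
      case True
      then show ?thesis using 1[of y] 2[of x] 2[of y] by (cases "a \<le> y") auto
    next
      case False
      then show ?thesis using 1[of x] by auto
    qed
  qed
  show ?thesis unfolding order_sign_def length_map
    by (intro prod.cong refl) (simp add: c)
qed

lemma order_sign_adjacent:
  assumes v: "distinct v" and j: "a \<le> j" "j \<in> set v" "Suc j \<in> set v"
  shows "order_sign a (map (Transposition.transpose j (Suc j)) v) = - order_sign a v"
proof -
  let ?t = "Transposition.transpose j (Suc j)"
  define T where "T = (SIGMA q:{..<length v}. {..<q})"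
  define f where "f v = (\<lambda>(q, p). if a \<le> v ! q \<and> v ! q < v ! p then - 1 else 1 :: int)" for v :: "nat list"
  have sgn: "order_sign a u = (\<Prod>x\<in>T. f u x)" if "length u = length v" for u
    unfolding order_sign_def T_def f_def that by (rule prod.Sigma) auto
  obtain k l where kl: "k < length v" "v ! k = j" "l < length v" "v ! l = Suc j" using j by (metis in_set_conv_nth)
  have kl_ne: "k \<noteq> l" using kl by auto
  define z where "z = (max k l, min k l)"
  have zT: "z \<in> T" using kl kl_ne unfolding z_def T_def by auto
  have finT: "finite T" unfolding T_def by auto
  have rest: "f (map ?t v) x = f v x" if x: "x \<in> T - {z}" for x
  proof -
    obtain q p where x': "x = (q, p)" "p < q" "q < length v" using x unfolding T_def by auto
    define c d where "c = v ! q" and "d = v ! p"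
    have pos: "i = k" if "i < length v" "v ! i = j" for i using that kl v nth_eq_iff_index_eq by metis
    have pos': "i = l" if "i < length v" "v ! i = Suc j" for i using that kl v nth_eq_iff_index_eq by metis
    have "p < length v" using x' by simp
    have "\<not> (c = j \<and> d = Suc j)"
    proof
      assume "c = j \<and> d = Suc j"
      then have "q = k" "p = l" using pos[OF x'(3)] pos'[OF \<open>p < length v\<close>] unfolding c_def d_def by auto
      then show False using x x' unfolding z_def by (simp add: max_def min_def)
    qed
    moreover have "\<not> (c = Suc j \<and> d = j)"
    proof
      assume "c = Suc j \<and> d = j"
      then have "q = l" "p = k" using pos'[OF x'(3)] pos[OF \<open>p < length v\<close>] unfolding c_def d_def by auto
      then show False using x x' unfolding z_def by (simp add: max_def min_def)
    qed
    moreover have "c \<noteq> d" using x' v unfolding c_def d_def by (simp add: nth_eq_iff_index_eq)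
    ultimately have "(a \<le> ?t c \<and> ?t c < ?t d) = (a \<le> c \<and> c < d)"
      using j(1) by (auto simp: Transposition.transpose_def)
    then show ?thesis using x' unfolding f_def c_def d_def by simp
  qed
  have flip: "f (map ?t v) z = - f v z"
    using kl kl_ne j(1) unfolding f_def z_def by (cases "k < l") (auto simp: max_def min_def)
  have "order_sign a (map ?t v) = f (map ?t v) z * (\<Prod>x\<in>T - {z}. f (map ?t v) x)"
    unfolding sgn[OF length_map] by (rule prod.remove[OF finT zT])
  also have "\<dots> = - (f v z * (\<Prod>x\<in>T - {z}. f v x))" using rest flip by simp
  also have "\<dots> = - order_sign a v" unfolding sgn[OF refl] by (subst prod.remove[OF finT zT]) simp
  finally show ?thesis .
qed

text \<open>The general case follows from adjacent transpositions, each of which exchanges two neighbouring odd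
  values and hence reverses the order of exactly one pair of positions.\<close>

lemma order_sign_odd:
  assumes g: "\<gamma> \<in> Perms {a..<n}" and v: "v \<in> mwords n"
  shows "order_sign a (map \<gamma> v) = sign \<gamma> * order_sign a v"
proof -
  define Q where "Q \<sigma> \<longleftrightarrow> (\<forall>v\<in>mwords n. order_sign a (map \<sigma> v) = sign \<sigma> * order_sign a v)" for \<sigma>
  have comp: "Q (\<sigma> \<circ> \<tau>)" if "\<sigma> \<in> Sym n" "\<tau> \<in> Sym n" "Q \<sigma>" "Q \<tau>" for \<sigma> \<tau>
    unfolding Q_def
  proof
    fix v assume v: "v \<in> mwords n"
    have "order_sign a (map (\<sigma> \<circ> \<tau>) v) = order_sign a (map \<sigma> (map \<tau> v))" by simp
    also have "\<dots> = sign \<sigma> * order_sign a (map \<tau> v)"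
      using that(3) mwords_map[OF that(2) v] unfolding Q_def by blast
    also have "order_sign a (map \<tau> v) = sign \<tau> * order_sign a v" using that(4) v unfolding Q_def by blast
    finally have e: "order_sign a (map (\<sigma> \<circ> \<tau>) v) = sign \<sigma> * (sign \<tau> * order_sign a v)" .
    show "order_sign a (map (\<sigma> \<circ> \<tau>) v) = sign (\<sigma> \<circ> \<tau>) * order_sign a v"
      unfolding Sym_sign_comp[OF that(1,2)] e by (simp only: mult.assoc)
  qed
  have adj: "Q (Transposition.transpose k (Suc k))" if "a \<le> k" "Suc k < n" for k
    unfolding Q_def
  proof
    fix v assume "v \<in> mwords n"
    then show "order_sign a (map (Transposition.transpose k (Suc k)) v) = sign (Transposition.transpose k (Suc k)) * order_sign a v"
      using order_sign_adjacent[of v a k] that unfolding mwords_def by (simp add: sign_swap_id)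
  qed
  have trans: "Q (Transposition.transpose i (i + Suc d))" if "a \<le> i" "i + Suc d < n" for i d
    using that
  proof (induction d)
    case 0
    then show ?case using adj[of i] by simp
  next
    case (Suc d)
    let ?k = "i + Suc d"
    have e: "Transposition.transpose i (i + Suc (Suc d))
        = Transposition.transpose ?k (Suc ?k) \<circ> (Transposition.transpose i ?k \<circ> Transposition.transpose ?k (Suc ?k))"
      by (auto simp: fun_eq_iff Transposition.transpose_def)
    show ?case unfolding e
      by (intro comp comp_Sym transpose_Sym adj Suc.IH) (use Suc.prems in auto)
  qed
  have "\<gamma> \<in> Sym n \<and> Q \<gamma>"
    using g[unfolded Perms_def mem_Collect_eq] finite_atLeastLessThan[of a n]
  proof (induction rule: permutes_induct)
    case id
    show ?case by (intro conjI id_Sym) (simp add: Q_def)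
  next
    case (swap i j p)
    have t: "Q (Transposition.transpose i j)"
    proof (cases "i < j")
      case True
      then show ?thesis using trans[of i "j - Suc i"] swap by simp
    next
      case False
      then have "j < i" using swap by simp
      then have "Q (Transposition.transpose j i)" using trans[of j "i - Suc j"] swap by simp
      then show ?thesis by (simp only: Transposition.transpose_commute)
    qed
    have ts: "Transposition.transpose i j \<in> Sym n" by (rule transpose_Sym) (use swap in auto)
    show ?case using comp[OF ts _ t] comp_Sym[OF ts] swap by blast
  qed
  then show ?thesis using v unfolding Q_def by blast
qed

fun standard_word :: "nat \<Rightarrow> nat \<Rightarrow> bool list \<Rightarrow> nat list" where
  "standard_word i j [] = []"
| "standard_word i j (True # w) = i # standard_word (Suc i) j w"
| "standard_word i j (False # w) = j # standard_word i (Suc j) w"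

lemma standard_word:
  assumes "i + nx w \<le> a" "a \<le> j"
  shows "kind a (standard_word i j w) = w" "set (standard_word i j w) = {i..<i + nx w} \<union> {j..<j + ny w}"
    "distinct (standard_word i j w)"
proof -
  have "kind a (standard_word i j w) = w \<and> set (standard_word i j w) = {i..<i + nx w} \<union> {j..<j + ny w}
      \<and> distinct (standard_word i j w)"
    using assms
  proof (induction i j w rule: standard_word.induct)
    case (2 i j w)
    have e: "{i..<i + nx (True # w)} = insert i {Suc i..<Suc i + nx w}" by auto
    have "i \<notin> {Suc i..<Suc i + nx w} \<union> {j..<j + ny w}" "i < a" using 2 by auto
    moreover have "ny (True # w) = ny w" by simp
    moreover have IH: "kind a (standard_word (Suc i) j w) = w \<and> set (standard_word (Suc i) j w) = {Suc i..<Suc i + nx w} \<union> {j..<j + ny w}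
      \<and> distinct (standard_word (Suc i) j w)" by (rule 2(1)) (use 2 in auto)
    ultimately show ?case unfolding e by (simp only: standard_word.simps list.set list.map distinct.simps Un_insert_left) simp
  next
    case (3 i j w)
    have e: "{j..<j + ny (False # w)} = insert j {Suc j..<Suc j + ny w}" by auto
    have "j \<notin> {i..<i + nx w} \<union> {Suc j..<Suc j + ny w}" "\<not> j < a" using 3 by auto
    moreover have "nx (False # w) = nx w" by simp
    moreover have IH: "kind a (standard_word i (Suc j) w) = w \<and> set (standard_word i (Suc j) w) = {i..<i + nx w} \<union> {Suc j..<Suc j + ny w}
      \<and> distinct (standard_word i (Suc j) w)" by (rule 3(1)) (use 3 in auto)
    ultimately show ?case unfolding e by (simp only: standard_word.simps list.set list.map distinct.simps Un_insert_right) simp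
  qed simp
  then show "kind a (standard_word i j w) = w" "set (standard_word i j w) = {i..<i + nx w} \<union> {j..<j + ny w}"
    "distinct (standard_word i j w)" by auto
qed

lemma length_counts: "length w = nx w + ny w"
  by (induction w) auto

text \<open>Polynomials that are symmetric in the variables of index below \<open>a\<close> and alternating in the other \<open>b\<close>
  variables correspond to polynomials of degree \<open>(a, b)\<close> in an even and an odd variable.\<close>

locale superization =
  fixes a b n :: nat
  assumes n: "n = a + b"
begin

definition types :: "bool list set" where "types = {w. nx w = a \<and> ny w = b}"

lemma finite_types: "finite types"
  by (rule finite_subset[OF _ finite_lists_length_eq[of "UNIV :: bool set" n]])
     (auto simp: types_def n length_counts)

lemma kind_types:
  assumes v: "v \<in> mwords n"
  shows "kind a v \<in> types"
proof -
  have c: "count_list (kind a v) l = card {i \<in> set v. (i < a) = l}" for l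
    using v unfolding mwords_def
    by (simp add: count_list_eq_length_filter filter_map comp_def distinct_length_filter eq_commute[of l] conj_commute Int_def)
  have "{i \<in> {..<n}. (i < a) = True} = {..<a}" "{i \<in> {..<n}. (i < a) = False} = {a..<n}" using n by auto
  then show ?thesis using c[of True] c[of False] v unfolding types_def mwords_def by (simp add: n)
qed

lemma standard_mwords:
  shows "w \<in> types \<Longrightarrow> standard_word 0 a w \<in> mwords n" "w \<in> types \<Longrightarrow> kind a (standard_word 0 a w) = w"
proof -
  assume w: "w \<in> types"
  from w have c: "nx w = a" "ny w = b" by (simp_all add: types_def)
  note s = standard_word[of 0 w a a, unfolded c add_0, OF order_refl order_refl]
  have "{0..<a} \<union> {a..<a + b} = {..<n}" unfolding n by auto
  then show "standard_word 0 a w \<in> mwords n" "kind a (standard_word 0 a w) = w"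
    using s unfolding mwords_def by simp_all
qed

lemma sub: "{..<a} \<subseteq> {..<n}" "{a..<n} \<subseteq> {..<n}" "{..<a} \<inter> {a..<n} = {}"
  using n by auto

lemma Perms_S: "\<rho> \<in> Perms {..<a} \<Longrightarrow> \<rho> \<in> Sym n" "\<gamma> \<in> Perms {a..<n} \<Longrightarrow> \<gamma> \<in> Sym n"
  using Perms_Sym sub by blast+

lemma kind_map:
  assumes "\<rho> \<in> Perms {..<a}" "\<gamma> \<in> Perms {a..<n}"
  shows "kind a (map (\<rho> \<circ> \<gamma>) v) = kind a v"
proof -
  have "\<gamma> x < a \<longleftrightarrow> x < a" for x
    using Perms_in[OF assms(2), of x] Perms_not_in[OF assms(2), of x] by (cases "x \<in> {a..<n}") auto
  moreover have "\<rho> x < a \<longleftrightarrow> x < a" for x using Perms_in[OF assms(1), of x] by simp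
  ultimately show ?thesis by simp
qed

lemma order_sign_map:
  assumes "\<rho> \<in> Perms {..<a}" "\<gamma> \<in> Perms {a..<n}" "v \<in> mwords n"
  shows "order_sign a (map (\<rho> \<circ> \<gamma>) v) = sign \<gamma> * order_sign a v"
  using order_sign_even[OF assms(1), of "map \<gamma> v"] order_sign_odd[OF assms(2,3)] by simp

lemma same_kind:
  assumes u: "u \<in> mwords n" and v: "v \<in> mwords n" and k: "kind a u = kind a v"
  shows "\<exists>\<rho>\<in>Perms {..<a}. \<exists>\<gamma>\<in>Perms {a..<n}. v = map (\<rho> \<circ> \<gamma>) u"
proof -
  have len: "length u = n" "length v = n" using u v length_mwords by auto
  have bu: "bij_betw ((!) u) {..<n} {..<n}" and bv: "bij_betw ((!) v) {..<n} {..<n}"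
    by (rule bij_betw_nth; use u v len in \<open>simp add: mwords_def\<close>)+
  define \<pi> where "\<pi> = (!) v \<circ> inv_into {..<n} ((!) u)"
  have bp: "bij_betw \<pi> {..<n} {..<n}" unfolding \<pi>_def by (rule bij_betw_trans[OF bij_betw_inv_into[OF bu] bv])
  have pu: "\<pi> (u ! i) = v ! i" if "i < n" for i
    using that bu unfolding \<pi>_def bij_betw_def by simp
  have pa: "\<pi> x < a \<longleftrightarrow> x < a" if "x < n" for x
  proof -
    have "x \<in> (!) u ` {..<n}" using that bu unfolding bij_betw_def by simp
    then obtain i where i: "i < n" "x = u ! i" by auto
    have "(kind a u) ! i = (kind a v) ! i" using k by simp
    then show ?thesis using i pu len by simp
  qed
  define \<rho> where "\<rho> x = (if x < a then \<pi> x else x)" for x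
  define \<gamma> where "\<gamma> x = (if a \<le> x \<and> x < n then \<pi> x else x)" for x
  have pn: "\<pi> x < n" if "x < n" for x using bp that unfolding bij_betw_def by auto
  have inj: "inj_on \<pi> {..<n}" using bp unfolding bij_betw_def by simp
  have perm: "p permutes S" if "finite S" "\<And>x. x \<in> S \<Longrightarrow> p x = \<pi> x \<and> \<pi> x \<in> S" "\<And>x. x \<notin> S \<Longrightarrow> p x = x" "S \<subseteq> {..<n}"
    for p and S
  proof (rule bij_imp_permutes)
    have "inj_on p S"
    proof (rule inj_onI)
      fix x y assume xy: "x \<in> S" "y \<in> S" "p x = p y"
      then have "\<pi> x = \<pi> y" using that(2)[OF xy(1)] that(2)[OF xy(2)] by simp
      then show "x = y" using inj_onD[OF inj_on_subset[OF inj that(4)]] xy by blast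
    qed
    moreover have "p ` S \<subseteq> S"
    proof
      fix y assume "y \<in> p ` S"
      then obtain x where "x \<in> S" "y = p x" by blast
      then show "y \<in> S" using that(2)[of x] by simp
    qed
    ultimately show "bij_betw p S S" unfolding bij_betw_def using endo_inj_surj[OF that(1)] by blast
  qed (use that in auto)
  have r: "\<rho> \<in> Perms {..<a}" unfolding Perms_def mem_Collect_eq
    by (rule perm) (use pa n in \<open>auto simp: \<rho>_def\<close>)
  have g: "\<gamma> \<in> Perms {a..<n}" unfolding Perms_def mem_Collect_eq
  proof (rule perm)
    fix x assume "x \<in> {a..<n}"
    then show "\<gamma> x = \<pi> x \<and> \<pi> x \<in> {a..<n}" using pa[of x] pn[of x] by (auto simp: \<gamma>_def)
  qed (auto simp: \<gamma>_def)
  have "v = map (\<rho> \<circ> \<gamma>) u"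
  proof (rule nth_equalityI)
    fix i assume "i < length v"
    then have i: "i < n" using len by simp
    have un: "u ! i < n" using bu i unfolding bij_betw_def by auto
    show "v ! i = map (\<rho> \<circ> \<gamma>) u ! i"
      using pu[OF i] pa[OF un] un i len by (auto simp: \<rho>_def \<gamma>_def)
  qed (simp add: len)
  then show ?thesis using r g by blast
qed

definition equivariant :: "(nat list \<Rightarrow> 'k::field_char_0) \<Rightarrow> bool" where
  "equivariant f \<longleftrightarrow> (\<forall>\<rho>\<in>Perms {..<a}. \<forall>\<gamma>\<in>Perms {a..<n}. \<forall>v. f (map (\<rho> \<circ> \<gamma>) v) = of_int (sign \<gamma>) * f v)"

lemma polarize_equivariant: "equivariant (polarize a n w)"
  unfolding equivariant_def
proof (intro ballI allI)
  fix \<rho> \<gamma> v assume rg: "\<rho> \<in> Perms {..<a}" "\<gamma> \<in> Perms {a..<n}"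
  have "\<rho> \<circ> \<gamma> \<in> Sym n" using rg by (intro comp_Sym Perms_S)
  then show "polarize a n w (map (\<rho> \<circ> \<gamma>) v) = of_int (sign \<gamma>) * (polarize a n w v :: 'k::field_char_0)"
    unfolding polarize_def mwords_map_iff[OF \<open>\<rho> \<circ> \<gamma> \<in> Sym n\<close>] kind_map[OF rg]
    using order_sign_map[OF rg] by simp
qed

lemma order_sign_square: "order_sign a v * order_sign a v = 1"
proof -
  have "\<bar>order_sign a v\<bar> = 1" unfolding order_sign_def by (simp add: abs_prod if_distrib prod.neutral)
  then show ?thesis by (metis abs_mult_self_eq mult_1)
qed

text \<open>Two multilinear words of the same type differ by a permutation that preserves the kinds of the
  indices, so that an equivariant polynomial is determined by one coefficient of each type.\<close>

lemma equivariant_expand: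
  fixes h :: "nat list \<Rightarrow> 'k::field_char_0"
  assumes h: "h \<in> multilinear n" and e: "equivariant h"
  shows "h = (\<Sum>w\<in>types. fscale (h (standard_word 0 a w) * of_int (order_sign a (standard_word 0 a w))) (polarize a n w))"
proof
  fix v
  have "(\<Sum>w\<in>types. fscale (h (standard_word 0 a w) * of_int (order_sign a (standard_word 0 a w))) (polarize a n w)) v
      = (\<Sum>w\<in>types. if w = kind a v then if v \<in> mwords n
          then h (standard_word 0 a w) * of_int (order_sign a (standard_word 0 a w)) * of_int (order_sign a v) else 0 else 0)"
    unfolding sum_fun_apply by (rule sum.cong) (auto simp: pointwise polarize_def)
  also have "\<dots> = (if v \<in> mwords n then h (standard_word 0 a (kind a v)) * of_int (order_sign a (standard_word 0 a (kind a v)))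
      * of_int (order_sign a v) else 0)"
    using finite_types kind_types[of v] by auto
  also have "\<dots> = h v"
  proof (cases "v \<in> mwords n")
    case True
    define m where "m = standard_word 0 a (kind a v)"
    have m: "m \<in> mwords n" "kind a m = kind a v" unfolding m_def using standard_mwords kind_types[OF True] by auto
    obtain \<rho> \<gamma> where rg: "\<rho> \<in> Perms {..<a}" "\<gamma> \<in> Perms {a..<n}" "v = map (\<rho> \<circ> \<gamma>) m"
      using same_kind[OF m(1) True m(2)] by blast
    have "h v = of_int (sign \<gamma>) * h m" using e rg unfolding equivariant_def by blast
    moreover have "order_sign a v = sign \<gamma> * order_sign a m" unfolding rg(3) by (rule order_sign_map[OF rg(1,2) m(1)])
    moreover have "(of_int (order_sign a m) * of_int (order_sign a m) :: 'k) = 1"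
      using order_sign_square[of m] by (metis of_int_1 of_int_mult)
    ultimately show ?thesis using True unfolding m_def[symmetric] by (simp add: mult_ac)
  qed (use h multilinear_iff in auto)
  finally show "h v = (\<Sum>w\<in>types. fscale (h (standard_word 0 a w) * of_int (order_sign a (standard_word 0 a w))) (polarize a n w)) v" ..
qed

text \<open>The idempotent of the two symmetric groups projects onto the equivariant polynomials, so that its
  trace on the quotient is the dimension of the space of polarized words modulo identities.\<close>

lemma equivariant_dimension:
  fixes v :: "'i \<Rightarrow> nat list \<Rightarrow> 'k::field_char_0"
  defines "W \<equiv> identities TYPE('n::{finite,linorder}) n :: (nat list \<Rightarrow> 'k) set"
  assumes fin: "finite I" and v: "\<And>i. i \<in> I \<Longrightarrow> v i \<in> multilinear n" "\<And>i. i \<in> I \<Longrightarrow> equivariant (v i)"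
    and span: "\<And>w. w \<in> types \<Longrightarrow> \<exists>c. polarize a n w - (\<Sum>i\<in>I. fscale (c i) (v i)) \<in> W"
    and indep: "\<And>c i. (\<Sum>i\<in>I. fscale (c i) (v i)) \<in> W \<Longrightarrow> i \<in> I \<Longrightarrow> c i = 0"
  shows "sym_alt_value (cocharacter (ut_gscale :: 'k \<Rightarrow> ('k grassmann, 'n) ut \<Rightarrow> ('k grassmann, 'n) ut) n) {..<a} {a..<n}
    = of_nat (fact a * fact b * card I)"
proof -
  interpret R: sym_rep "multilinear n :: (nat list \<Rightarrow> 'k) set" "identities TYPE('n) n" n rename_vars
    by (rule multilinear_sym_rep)
  define N :: 'k where "N = of_nat (fact a * fact b)"
  have N0: "N \<noteq> 0" unfolding N_def by simp
  define G where "G = Perms {..<a} \<times> Perms {a..<n}"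
  define E :: "(nat list \<Rightarrow> 'k) \<Rightarrow> nat list \<Rightarrow> 'k" where
    "E u = (\<Sum>g\<in>G. fscale (of_int (sign (snd g)) / N) (rename_vars (fst g \<circ> snd g) u))" for u
  have gS: "fst g \<circ> snd g \<in> Sym n" if "g \<in> G" for g
  proof -
    have "fst g \<in> Perms {..<a}" "snd g \<in> Perms {a..<n}" using that unfolding G_def by auto
    then show ?thesis by (intro comp_Sym Perms_S)
  qed
  have cardG: "of_nat (card G) = N" unfolding G_def N_def card_cartesian_product n by (simp add: card_Perms)
  have EV: "E u \<in> multilinear n" if "u \<in> multilinear n" for u
    unfolding E_def using that gS
    by (intro fs.subspace_sum[OF subspace_multilinear] fs.subspace_scale[OF subspace_multilinear] rename_multilinear)
  have Elin: "lin_on (multilinear n) E"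
    unfolding lin_on_def E_def
    by (auto simp: fun_eq_iff pointwise sum_fun_apply rename_vars_def distrib_left sum.distrib sum_distrib_left mult_ac)
  have EW: "E u \<in> identities TYPE('n) n" if "u \<in> identities TYPE('n) n" for u
    unfolding E_def using that gS
    by (intro fs.subspace_sum[OF subspace_identities] fs.subspace_scale[OF subspace_identities] R.act_W)
  have "trace_mod (multilinear n) (identities TYPE('n) n) E
      = (\<Sum>g\<in>G. of_int (sign (snd g)) / N * trace_mod (multilinear n) (identities TYPE('n) n) (rename_vars (fst g \<circ> snd g)))"
    unfolding E_def by (rule R.trace_mod_sum) (rule rename_multilinear[OF gS])
  also have "\<dots> = (\<Sum>\<rho>\<in>Perms {..<a}. \<Sum>\<gamma>\<in>Perms {a..<n}. of_int (sign \<gamma>) / N * R.character (\<rho> \<circ> \<gamma>))"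
    unfolding G_def R.character_def sum.cartesian_product by (simp add: split_beta)
  also have "\<dots> = sym_alt_value R.character {..<a} {a..<n} / N"
    unfolding sym_alt_value_def by (simp add: sum_divide_distrib)
  finally have tr: "trace_mod (multilinear n) (identities TYPE('n) n) E = sym_alt_value R.character {..<a} {a..<n} / N" .
  have E_equi: "equivariant (E u)" for u
    unfolding equivariant_def
  proof (intro ballI allI)
    fix \<rho>0 \<gamma>0 w assume r0: "\<rho>0 \<in> Perms {..<a}" and g0: "\<gamma>0 \<in> Perms {a..<n}"
    note r0S = Perms_S(1)[OF r0] and g0S = Perms_S(2)[OF g0]
    have form: "E u w = (\<Sum>\<rho>\<in>Perms {..<a}. \<Sum>\<gamma>\<in>Perms {a..<n}. of_int (sign \<gamma>) / N * u (map (inv (\<rho> \<circ> \<gamma>)) w))" for w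
      unfolding E_def G_def sum_fun_apply pointwise rename_vars_def sum.cartesian_product by (simp add: split_beta)
    have "E u (map (\<rho>0 \<circ> \<gamma>0) w) = (\<Sum>\<rho>\<in>Perms {..<a}. \<Sum>\<gamma>\<in>Perms {a..<n}.
        of_int (sign \<gamma>) / N * u (map (inv ((\<rho>0 \<circ> \<rho>) \<circ> \<gamma>)) (map (\<rho>0 \<circ> \<gamma>0) w)))"
      unfolding form
      by (rule sum_group_left[OF perm_group_Perms[OF sub(1)] r0,
            of "\<lambda>\<rho>. \<Sum>\<gamma>\<in>Perms {a..<n}. of_int (sign \<gamma>) / N * u (map (inv (\<rho> \<circ> \<gamma>)) (map (\<rho>0 \<circ> \<gamma>0) w))", symmetric])
    also have "\<dots> = (\<Sum>\<rho>\<in>Perms {..<a}. \<Sum>\<gamma>\<in>Perms {a..<n}.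
        of_int (sign (\<gamma>0 \<circ> \<gamma>)) / N * u (map (inv ((\<rho>0 \<circ> \<rho>) \<circ> (\<gamma>0 \<circ> \<gamma>))) (map (\<rho>0 \<circ> \<gamma>0) w)))"
      by (rule sum.cong[OF refl], rule sum_group_left[OF perm_group_Perms[OF sub(2)] g0, symmetric])
    also have "\<dots> = (\<Sum>\<rho>\<in>Perms {..<a}. \<Sum>\<gamma>\<in>Perms {a..<n}.
        of_int (sign \<gamma>0) * (of_int (sign \<gamma>) / N * u (map (inv (\<rho> \<circ> \<gamma>)) w)))"
    proof (intro sum.cong refl)
      fix \<rho> \<gamma> assume r: "\<rho> \<in> Perms {..<a}" and g: "\<gamma> \<in> Perms {a..<n}"
      note rS = Perms_S(1)[OF r] and gS = Perms_S(2)[OF g]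
      have "(\<rho>0 \<circ> \<rho>) \<circ> (\<gamma>0 \<circ> \<gamma>) = (\<rho>0 \<circ> \<gamma>0) \<circ> (\<rho> \<circ> \<gamma>)"
        using Perms_commute[OF r g0 sub(3)] by (metis comp_assoc)
      then have "inv ((\<rho>0 \<circ> \<rho>) \<circ> (\<gamma>0 \<circ> \<gamma>)) = inv (\<rho> \<circ> \<gamma>) \<circ> inv (\<rho>0 \<circ> \<gamma>0)"
        using Sym_inv_comp[OF comp_Sym[OF r0S g0S] comp_Sym[OF rS gS]] by simp
      then have m: "map (inv ((\<rho>0 \<circ> \<rho>) \<circ> (\<gamma>0 \<circ> \<gamma>))) (map (\<rho>0 \<circ> \<gamma>0) w) = map (inv (\<rho> \<circ> \<gamma>)) w"
        using map_cancel(2)[OF comp_Sym[OF r0S g0S], of w] by (simp only: map_map[symmetric])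
      show "of_int (sign (\<gamma>0 \<circ> \<gamma>)) / N * u (map (inv ((\<rho>0 \<circ> \<rho>) \<circ> (\<gamma>0 \<circ> \<gamma>))) (map (\<rho>0 \<circ> \<gamma>0) w))
          = of_int (sign \<gamma>0) * (of_int (sign \<gamma>) / N * u (map (inv (\<rho> \<circ> \<gamma>)) w))"
        unfolding Sym_sign_comp[OF g0S gS] m by simp
    qed
    also have "\<dots> = of_int (sign \<gamma>0) * E u w" unfolding form sum_distrib_left ..
    finally show "E u (map (\<rho>0 \<circ> \<gamma>0) w) = of_int (sign \<gamma>0) * E u w" .
  qed
  have E_fix: "E u = u" if eu: "equivariant u" for u
  proof
    fix w
    have "fscale (of_int (sign (snd g)) / N) (rename_vars (fst g \<circ> snd g) u) w = u w / N" if g: "g \<in> G" for g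
    proof -
      obtain \<rho> \<gamma> where rg: "g = (\<rho>, \<gamma>)" "\<rho> \<in> Perms {..<a}" "\<gamma> \<in> Perms {a..<n}" using g unfolding G_def by auto
      have ir: "inv \<rho> \<in> Perms {..<a}" "inv \<gamma> \<in> Perms {a..<n}"
        using perm_groupD(4)[OF perm_group_Perms] rg sub by blast+
      have "inv (\<rho> \<circ> \<gamma>) = inv \<rho> \<circ> inv \<gamma>"
        using Sym_inv_comp[OF Perms_S(1)[OF rg(2)] Perms_S(2)[OF rg(3)]] Perms_commute[OF ir sub(3)] by simp
      then have "u (map (inv (\<rho> \<circ> \<gamma>)) w) = of_int (sign (inv \<gamma>)) * u w"
        using eu ir unfolding equivariant_def by simp
      then have "of_int (sign \<gamma>) * u (map (inv (\<rho> \<circ> \<gamma>)) w) = (of_int (sign \<gamma> * sign \<gamma>) * u w :: 'k)"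
        unfolding Sym_sign_inv[OF Perms_S(2)[OF rg(3)]] by (simp only: of_int_mult mult.assoc)
      then have "of_int (sign \<gamma>) * u (map (inv (\<rho> \<circ> \<gamma>)) w) = u w" by simp
      then show ?thesis unfolding rg(1) by (simp add: pointwise rename_vars_def)
    qed
    then have "E u w = (\<Sum>g\<in>G. u w / N)" unfolding E_def sum_fun_apply by simp
    then show "E u w = u w" using cardG N0 by simp
  qed
  have "trace_mod (multilinear n) (identities TYPE('n) n) E = of_nat (card I)"
  proof (rule R.trace_mod_projection[where v = v])
    show "E (v i) - v i \<in> identities TYPE('n) n" if "i \<in> I" for i
      unfolding E_fix[OF v(2)[OF that]] using fs.subspace_0[OF subspace_identities] by simp
    show "\<exists>c. E u - (\<Sum>i\<in>I. fscale (c i) (v i)) \<in> identities TYPE('n) n" if u: "u \<in> multilinear n" for u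
    proof -
      define d where "d w = E u (standard_word 0 a w) * of_int (order_sign a (standard_word 0 a w))" for w
      have Eu: "E u = (\<Sum>w\<in>types. fscale (d w) (polarize a n w))"
        unfolding d_def by (rule equivariant_expand[OF EV[OF u] E_equi])
      obtain c where c: "\<And>w. w \<in> types \<Longrightarrow> polarize a n w - (\<Sum>i\<in>I. fscale (c w i) (v i)) \<in> W"
        using span by metis
      have "(\<Sum>i\<in>I. fscale (\<Sum>w\<in>types. d w * c w i) (v i)) = (\<Sum>w\<in>types. fscale (d w) (\<Sum>i\<in>I. fscale (c w i) (v i)))"
        by (simp add: fs.scale_sum_left fs.scale_sum_right sum.swap[of _ types])
      then have "E u - (\<Sum>i\<in>I. fscale (\<Sum>w\<in>types. d w * c w i) (v i))
          = (\<Sum>w\<in>types. fscale (d w) (polarize a n w - (\<Sum>i\<in>I. fscale (c w i) (v i))))"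
        unfolding Eu by (simp add: fs.scale_right_diff_distrib sum_subtractf)
      moreover have "\<dots> \<in> W"
        unfolding W_def
        by (intro fs.subspace_sum[OF subspace_identities] fs.subspace_scale[OF subspace_identities])
           (use c in \<open>simp add: W_def\<close>)
      ultimately have "E u - (\<Sum>i\<in>I. fscale (\<Sum>w\<in>types. d w * c w i) (v i)) \<in> identities TYPE('n) n"
        unfolding W_def by (simp only:)
      then show ?thesis by (rule exI[where x = "\<lambda>i. \<Sum>w\<in>types. d w * c w i"])
    qed
    show "c i = 0" if "(\<Sum>i\<in>I. fscale (c i) (v i)) \<in> identities TYPE('n) n" "i \<in> I" for c i
      using indep[of c i] that unfolding W_def by blast
  qed (use fin v(1) Elin EW in auto)
  then have "sym_alt_value R.character {..<a} {a..<n} = N * of_nat (card I)" using tr N0 by (simp add: field_simps)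
  then show ?thesis unfolding cocharacter_character N_def by simp
qed

end

section \<open>Words modulo powers of the ideal of identities\<close>

text \<open>The words \<open>x\<^sup>iy\<^sup>j\<close> and \<open>yx\<^bsup>i+1\<^esup>y\<^sup>j\<close> form a basis of the relatively free superalgebra of \<open>E\<close>; it is closed
  under prefixes. The minimal words outside of it give free generators \<open>b\<^sub>p\<close> of the ideal of
  super-identities of \<open>E\<close> as a right ideal of the free algebra, where minimality refers to prefixes.\<close>

definition normal_words :: "bool list set" where
  "normal_words = {xy i j | i j. True} \<union> {False # xy (Suc i) j | i j. True}"

definition bad_words :: "bool list set" where
  "bad_words = {xy (Suc i) (Suc j) @ [True] | i j. True} \<union> {False # xy i (Suc j) @ [True] | i j. True}"

lemma xy_snoc: "xy i (Suc j) = xy i j @ [False]" "xy (Suc i) 0 = xy i 0 @ [True]" "xy (Suc i) j = True # xy i j"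
  "xy 0 (Suc j) = False # xy 0 j" "xy 0 0 = []"
  by (simp_all add: xy_def replicate_append_same)

lemma normal_snoc:
  assumes "u \<in> normal_words"
  shows "u @ [l] \<in> normal_words \<or> (l \<and> u @ [l] \<in> bad_words)"
proof -
  consider (1) i j where "u = xy i j" | (2) i j where "u = False # xy (Suc i) j"
    using assms unfolding normal_words_def by blast
  then show ?thesis
  proof cases
    case (1 i j)
    show ?thesis
    proof (cases l)
      case True
      consider (a) "j = 0" | (b) j' i' where "j = Suc j'" "i = Suc i'" | (c) "j = Suc 0" "i = 0" | (d) j' where "j = Suc (Suc j')" "i = 0"
        by (metis not0_implies_Suc)
      then show ?thesis
      proof cases
        case a
        then have "u @ [l] = xy (Suc i) 0" using 1 True by (simp add: xy_snoc(2))
        then show ?thesis unfolding normal_words_def by blast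
      next
        case b
        then have "u @ [l] = xy (Suc i') (Suc j') @ [True]" using 1 True by simp
        then show ?thesis using True unfolding bad_words_def by blast
      next
        case c
        then have "u @ [l] = False # xy (Suc 0) 0" using 1 True by (simp add: xy_def)
        then show ?thesis unfolding normal_words_def by blast
      next
        case d
        then have "u @ [l] = False # xy 0 (Suc j') @ [True]" using 1 True by (simp add: xy_def)
        then show ?thesis using True unfolding bad_words_def by blast
      qed
    next
      case False
      then have "u @ [l] = xy i (Suc j)" using 1 by (simp add: xy_snoc)
      then show ?thesis unfolding normal_words_def by blast
    qed
  next
    case (2 i j)
    show ?thesis
    proof (cases l)
      case True
      show ?thesis
      proof (cases j)
        case 0
        then have "u @ [l] = False # xy (Suc (Suc i)) 0" using 2 True xy_snoc(2)[of "Suc i"] by simp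
        then show ?thesis unfolding normal_words_def by blast
      next
        case (Suc j')
        then have "u @ [l] = False # xy (Suc i) (Suc j') @ [True]" using 2 True by simp
        then show ?thesis using True unfolding bad_words_def by blast
      qed
    next
      case False
      then have "u @ [l] = False # xy (Suc i) (Suc j)" using 2 by (simp add: xy_snoc(1))
      then show ?thesis unfolding normal_words_def by blast
    qed
  qed
qed

lemma bad_word:
  assumes "p \<in> bad_words"
  obtains u where "u \<in> normal_words" "p = u @ [True]"
proof -
  consider (1) i j where "p = xy (Suc i) (Suc j) @ [True]" | (2) i j where "p = False # xy i (Suc j) @ [True]"
    using assms unfolding bad_words_def by blast
  then show ?thesis
  proof cases
    case (1 i j)
    have "xy (Suc i) (Suc j) \<in> normal_words" unfolding normal_words_def by blast
    then show ?thesis using that 1 by blast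
  next
    case (2 i j)
    have "False # xy i (Suc j) \<in> normal_words"
    proof (cases i)
      case 0
      then have "False # xy i (Suc j) = xy 0 (Suc (Suc j))" by (simp add: xy_def)
      then show ?thesis unfolding normal_words_def by blast
    next
      case (Suc i')
      then show ?thesis unfolding normal_words_def by blast
    qed
    then show ?thesis using that 2 by simp
  qed
qed

lemma bad_counts: "p \<in> bad_words \<Longrightarrow> nx p \<ge> 1 \<and> ny p \<ge> 1"
  unfolding bad_words_def by auto

lemma bad_not_normal: "p \<in> bad_words \<Longrightarrow> p \<notin> normal_words"
proof
  assume p: "p \<in> bad_words" "p \<in> normal_words"
  have last: "last p = True" using p(1) unfolding bad_words_def by auto
  have ny: "ny p \<ge> 1" and nx: "nx p \<ge> 1" using bad_counts[OF p(1)] by auto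
  consider (1) i j where "p = xy i j" | (2) i j where "p = False # xy (Suc i) j"
    using p(2) unfolding normal_words_def by blast
  then show False
  proof cases
    case (1 i j)
    then obtain j' where "j = Suc j'" using ny by (cases j) auto
    then show ?thesis using last 1 by (simp add: xy_snoc(1))
  next
    case (2 i j)
    have "j = 0" using last 2 by (cases j) (auto simp: xy_snoc(1) split: if_splits)
    then have hd: "ny p = 1" "hd p = False" using 2 by auto
    consider (a) i' j' where "p = xy (Suc i') (Suc j') @ [True]" | (b) i' j' where "p = False # xy i' (Suc j') @ [True]"
      using p(1) unfolding bad_words_def by blast
    then show ?thesis
    proof cases
      case (a i' j')
      then show ?thesis using hd(2) by (simp add: xy_snoc(3))
    next
      case (b i' j')
      then show ?thesis using hd(1) by simp
    qed
  qed
qed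

lemma normal_prefix: "u @ v \<in> normal_words \<Longrightarrow> u \<in> normal_words"
proof (induction v rule: rev_induct)
  case (snoc l v)
  have "w \<in> normal_words" if wl: "w @ [l] \<in> normal_words" for w
  proof -
    consider (1) i j where "w @ [l] = xy i j" | (2) i j where "w @ [l] = False # xy (Suc i) j"
      using wl unfolding normal_words_def by blast
    then show ?thesis
    proof cases
      case (1 i j)
      consider (a) j' where "j = Suc j'" | (b) i' where "j = 0" "i = Suc i'"
        using 1 by (metis append_is_Nil_conv not0_implies_Suc not_Cons_self2 xy_snoc(5))
      then show ?thesis
      proof cases
        case a
        then have "w = xy i j'" using 1 by (simp add: xy_snoc(1))
        then show ?thesis unfolding normal_words_def by blast
      next
        case b
        then have "w = xy i' 0" using 1 by (simp add: xy_snoc(2))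
        then show ?thesis unfolding normal_words_def by blast
      qed
    next
      case (2 i j)
      show ?thesis
      proof (cases j)
        case 0
        then have "w @ [l] = (False # xy i 0) @ [True]" using 2 by (simp add: xy_snoc(2))
        then have w: "w = False # xy i 0" by blast
        show ?thesis
        proof (cases i)
          case 0
          then have "w = xy 0 (Suc 0)" using w by (simp add: xy_def)
          then show ?thesis unfolding normal_words_def by blast
        next
          case (Suc i')
          then show ?thesis using w unfolding normal_words_def by blast
        qed
      next
        case (Suc j')
        then have "w @ [l] = (False # xy (Suc i) j') @ [False]" using 2 by (simp add: xy_snoc(1))
        then have "w = False # xy (Suc i) j'" by blast
        then show ?thesis unfolding normal_words_def by blast
      qed
    qed
  qed
  then show ?case using snoc by (metis append_assoc)
qed simp

lemma normal_form:
  assumes "u \<in> normal_words"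
  shows "(mx u = 0 \<and> u = xy (nx u) (ny u)) \<or> (mx u = nx u \<and> 1 \<le> nx u \<and> 1 \<le> ny u \<and> u = False # xy (nx u) (ny u - 1))"
proof -
  consider (1) i j where "u = xy i j" | (2) i j where "u = False # xy (Suc i) j"
    using assms unfolding normal_words_def by blast
  then show ?thesis
  proof cases
    case (2 i j)
    then have "mx u = Suc i" "nx u = Suc i" "ny u = Suc j" using mx_yxy[of "Suc i" j] by simp_all
    then show ?thesis using 2 by simp
  qed simp
qed

lemma reduced_normal: "p \<in> bad_words \<Longrightarrow> xy (nx p) (ny p) \<in> normal_words \<and> False # xy (nx p) (ny p - 1) \<in> normal_words"
  using bad_counts[of p] unfolding normal_words_def by (cases "nx p") auto

lemma length_reduced: "ny p \<ge> 1 \<Longrightarrow> length (xy (nx p) (ny p)) = length p \<and> length (False # xy (nx p) (ny p - 1)) = length p"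
  by (simp add: length_counts)

subsection \<open>Spanning\<close>

text \<open>Rewriting a word from left to right: the first prefix that is not normal is a bad word \<open>p\<close>, and it is
  replaced by two normal words of the same degree at the cost of a multiple of \<open>b\<^sub>p\<close>.\<close>

lemma span_one_step:
  fixes S :: "('x \<Rightarrow> 'k::field_char_0) set"
  assumes S: "fs.subspace S" and nf: "\<And>u. u \<in> normal_words \<Longrightarrow> (\<lambda>v. H v u) \<in> S"
    and red: "\<And>p q. p \<in> bad_words \<Longrightarrow> (\<lambda>v. reduction p (H v) q) \<in> S"
  shows "(\<lambda>v. H v w) \<in> S"
proof -
  have "(\<lambda>v. H v (u @ q)) \<in> S" if "u \<in> normal_words" for u q
    using that
  proof (induction q arbitrary: u)
    case Nil
    then show ?case using nf by simp
  next
    case (Cons l q)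
    show ?case
    proof (cases "u @ [l] \<in> normal_words")
      case True
      then show ?thesis using Cons(1)[OF True] by simp
    next
      case False
      define p where "p = u @ [l]"
      have p: "p \<in> bad_words" using normal_snoc[OF Cons(2), of l] False unfolding p_def by blast
      \<comment> \<open>solve the definition of \<open>b\<^sub>p\<close> for \<open>p\<close>; bad words contain a letter \<open>x\<close>, so that its factor is invertible\<close>
      let ?F = "\<lambda>w v. H v (w @ q)"
      have "?F p = fscale (1 / of_nat (nx p)) ((\<lambda>v. reduction p (H v) q)
          + (fscale (of_nat (nx p - mx p)) (?F (xy (nx p) (ny p))) + fscale (of_nat (mx p)) (?F (False # xy (nx p) (ny p - 1)))))"
        using bad_counts[OF p] by (auto simp: fun_eq_iff pointwise reduction_def field_simps)
      moreover have "\<dots> \<in> S"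
      proof -
        have n1: "xy (nx p) (ny p) \<in> normal_words" and n2: "False # xy (nx p) (ny p - 1) \<in> normal_words"
          using reduced_normal[OF p] by blast+
        have F2: "?F (False # xy (nx p) (ny p - 1)) \<in> S" by (rule Cons(1)[OF n2])
        show ?thesis
          by (rule fs.subspace_scale[OF S] fs.subspace_add[OF S] red[OF p] Cons(1)[OF n1] F2)+
      qed
      ultimately have "?F p \<in> S" by (simp only:)
      then show ?thesis by (simp add: p_def)
    qed
  qed
  moreover have "[] \<in> normal_words" unfolding normal_words_def using xy_snoc(5) by (metis (mono_tags, lifting) UnI1 mem_Collect_eq)
  ultimately show ?thesis by (metis append_Nil)
qed

text \<open>Applying the same to the word behind \<open>b\<^sub>p\<close>, and so on, until \<open>k\<close> generators have been split off.\<close>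

lemma span_reductions:
  fixes S :: "('x \<Rightarrow> 'k::field_char_0) set"
  assumes S: "fs.subspace S"
    and nf: "\<And>ps u. set ps \<subseteq> bad_words \<Longrightarrow> length ps < k \<Longrightarrow> u \<in> normal_words \<Longrightarrow> (\<lambda>v. reductions ps (H v) u) \<in> S"
    and top: "\<And>ps q. set ps \<subseteq> bad_words \<Longrightarrow> length ps = k \<Longrightarrow> (\<lambda>v. reductions ps (H v) q) \<in> S"
  shows "(\<lambda>v. H v w) \<in> S"
  using nf top
proof (induction k arbitrary: H w)
  case 0
  then show ?case using 0(2)[of "[]" w] by simp
next
  case (Suc k)
  show ?case
  proof (rule span_one_step[OF S])
    show "(\<lambda>v. H v u) \<in> S" if "u \<in> normal_words" for u using Suc(2)[of "[]" u] that by simp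
    fix p q assume p: "p \<in> bad_words"
    show "(\<lambda>v. reduction p (H v) q) \<in> S"
    proof (rule Suc(1))
      fix ps u assume "set ps \<subseteq> bad_words" "length ps < k" "u \<in> normal_words"
      then show "(\<lambda>v. reductions ps (reduction p (H v)) u) \<in> S" using Suc(2)[of "p # ps" u] p by simp
    next
      fix ps q assume "set ps \<subseteq> bad_words" "length ps = k"
      then show "(\<lambda>v. reductions ps (reduction p (H v)) q) \<in> S" using Suc(3)[of "p # ps" q] p by simp
    qed
  qed
qed

subsection \<open>Independence\<close>

text \<open>The coordinate at the normal word \<open>u\<close> of a word modulo the identities of \<open>E\<close>.\<close>

definition coordinate :: "bool list \<Rightarrow> bool list \<Rightarrow> 'k::field_char_0" where
  "coordinate u w = (if nx w = nx u \<and> ny w = ny u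
     then if nx u = 0 then 1 else if mx u = 0 then 1 - of_nat (mx w) / of_nat (nx u) else of_nat (mx w) / of_nat (nx u)
     else 0)"

text \<open>The sum over the factorizations \<open>w = u x v\<close> of \<open>f(u) g(v)\<close>: these functionals are the off-diagonal entries
  of evaluations at triangular matrices, the letter \<open>x\<close> providing the off-diagonal factor.\<close>

definition split_at_x :: "(bool list \<Rightarrow> 'v::ring_1) \<Rightarrow> (bool list \<Rightarrow> 'v) \<Rightarrow> bool list \<Rightarrow> 'v" where
  "split_at_x f g w = (\<Sum>k<length w. if w ! k then f (take k w) * g (drop (Suc k) w) else 0)"

lemma coordinate_normal:
  assumes "u \<in> normal_words" "u' \<in> normal_words"
  shows "coordinate u u' = (if u = u' then 1 else 0 :: 'k::field_char_0)"
proof (cases "nx u' = nx u \<and> ny u' = ny u")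
  case True
  have same: "u = u' \<longleftrightarrow> mx u = mx u'"
  proof
    assume m: "mx u = mx u'"
    show "u = u'"
    proof (cases "mx u = 0")
      case zero: True
      have "u = xy (nx u) (ny u)" using normal_form[OF assms(1)] zero by linarith
      also have "\<dots> = xy (nx u') (ny u')" using True by simp
      also have "\<dots> = u'" by (rule sym) (use normal_form[OF assms(2)] zero m in linarith)
      finally show ?thesis .
    next
      case False
      have "u = False # xy (nx u) (ny u - 1)" using normal_form[OF assms(1)] False by linarith
      also have "\<dots> = False # xy (nx u') (ny u' - 1)" using True by simp
      also have "\<dots> = u'" by (rule sym) (use normal_form[OF assms(2)] False m in linarith)
      finally show ?thesis .
    qed
  qed simp
  have mu: "mx u = 0 \<or> mx u = nx u" "mx u' = 0 \<or> mx u' = nx u'"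
    using normal_form[OF assms(1)] normal_form[OF assms(2)] by blast+
  have val: "(if n = 0 then 1 else if m = 0 then 1 - of_nat m' / of_nat n else of_nat m' / of_nat n)
      = (if m = m' then 1 else 0 :: 'k)" if "m = 0 \<or> m = n" "m' = 0 \<or> m' = n" for m m' n :: nat
    using that by auto
  show ?thesis
    unfolding same coordinate_def val[OF mu(1) mu(2)[unfolded conjunct1[OF True]]] if_P[OF True] ..
next
  case False
  then have "u \<noteq> u'" by blast
  then show ?thesis unfolding coordinate_def if_not_P[OF False] by simp
qed

lemma coordinate_length: "coordinate u w \<noteq> 0 \<Longrightarrow> length w = length u"
proof -
  assume nz: "coordinate u w \<noteq> 0"
  have "nx w = nx u \<and> ny w = ny u"
  proof (rule ccontr)
    assume n: "\<not> (nx w = nx u \<and> ny w = ny u)"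
    show False using nz unfolding coordinate_def if_not_P[OF n] by simp
  qed
  then show "length w = length u" by (simp add: length_counts)
qed

text \<open>On words of a fixed degree the coordinate is an affine function of \<open>mx\<close>, and such functions are
  compatible with the interpolation that defines \<open>b\<^sub>p\<close>.\<close>

lemma reduction_coordinate:
  assumes "ny p \<ge> 1"
  shows "reduction p (coordinate u) q = (0 :: 'k::field_char_0)"
proof -
  define C :: 'k where "C = coordinate u (xy (nx p) (ny p) @ q)"
  define E :: 'k where "E = (if nx p + nx q = nx u \<and> ny p + ny q = ny u
     then if nx u = 0 then 0 else if mx u = 0 then - 1 / of_nat (nx u) else 1 / of_nat (nx u) else 0)"
  have aff: "coordinate u (p' @ q) = C + E * of_nat (mx p')" if "nx p' = nx p" "ny p' = ny p" for p'
  proof (cases "nx p + nx q = nx u \<and> ny p + ny q = ny u \<and> nx u \<noteq> 0")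
    case True
    then have "(of_nat (nx u) :: 'k) \<noteq> 0" by simp
    then show ?thesis
      unfolding C_def E_def coordinate_def using True that(2)
      by (cases "mx u = 0") (simp_all add: that odd_x_append divide_simps algebra_simps)
  next
    case False
    then consider (n) "\<not> (nx p + nx q = nx u \<and> ny p + ny q = ny u)" | (z) "nx u = 0" by blast
    then show ?thesis
    proof cases
      case n
      then have "\<not> (nx (p' @ q) = nx u \<and> ny (p' @ q) = ny u)"
        "\<not> (nx (xy (nx p) (ny p) @ q) = nx u \<and> ny (xy (nx p) (ny p) @ q) = ny u)" using that by simp_all
      then show ?thesis unfolding C_def E_def coordinate_def by (simp only: n if_False) simp
    next
      case z
      show ?thesis unfolding C_def E_def coordinate_def if_P[OF z] using that by simp
    qed
  qed
  have n: "nx (False # xy (nx p) (ny p - 1)) = nx p" "ny (False # xy (nx p) (ny p - 1)) = ny p"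
    using assms by simp_all
  have m: "(of_nat (nx p - mx p) :: 'k) = of_nat (nx p) - of_nat (mx p)" using mx_le by (simp add: of_nat_diff)
  have 2: "coordinate u ((False # xy (nx p) (ny p - 1)) @ q) = C + E * of_nat (nx p)"
    using aff[OF n] unfolding mx_yxy .
  have 1: "coordinate u (p @ q) = C + E * of_nat (mx p)" by (rule aff) simp_all
  have cons: "False # xy (nx p) (ny p - 1) @ q = (False # xy (nx p) (ny p - 1)) @ q" by simp
  show ?thesis
    unfolding reduction_def cons 1 2 C_def[symmetric] m by (simp only: algebra_simps) simp
qed

lemma split_at_x_append:
  "split_at_x f g (p @ q) = (\<Sum>k<length p. if p ! k then f (take k p) * g (drop (Suc k) p @ q) else 0)
     + (\<Sum>k<length q. if q ! k then f (p @ take k q) * g (drop (Suc k) q) else 0)"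
proof -
  let ?t = "\<lambda>k. if (p @ q) ! k then f (take k (p @ q)) * g (drop (Suc k) (p @ q)) else 0"
  have "split_at_x f g (p @ q) = (\<Sum>k<length p. ?t k) + (\<Sum>k = length p..<length p + length q. ?t k)"
    unfolding split_at_x_def length_append lessThan_atLeast0 by (rule sum.atLeastLessThan_concat[symmetric]) auto
  also have "(\<Sum>k = length p..<length p + length q. ?t k) = (\<Sum>k<length q. ?t (k + length p))"
    using sum.shift_bounds_nat_ivl[of ?t 0 "length p" "length q"] by (simp add: lessThan_atLeast0 add.commute)
  also have "\<dots> = (\<Sum>k<length q. if q ! k then f (p @ take k q) * g (drop (Suc k) q) else 0)"
    by (rule sum.cong) (auto simp: nth_append Suc_diff_le)
  also have "(\<Sum>k<length p. ?t k) = (\<Sum>k<length p. if p ! k then f (take k p) * g (drop (Suc k) p @ q) else 0)"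
    by (rule sum.cong) (auto simp: nth_append)
  finally show ?thesis .
qed

text \<open>Splitting off the coordinate at \<open>u\<close>, where \<open>ux\<close> is a bad word, is dual to the generator \<open>b\<^bsub>ux\<^esub>\<close>, up to
  generators of larger degree: the part of \<open>b\<^sub>p\<close> in front of the letter has to be a normal word.\<close>

lemma reduction_split:
  fixes g :: "bool list \<Rightarrow> 'k::field_char_0"
  assumes p: "p \<in> bad_words" and u: "u \<in> normal_words" "u @ [True] \<in> bad_words" and len: "length p \<le> Suc (length u)"
  shows "reduction p (split_at_x (coordinate u) g) q = (if p = u @ [True] then of_nat (nx p) * g q else 0)"
proof -
  define h where "h w = (\<Sum>k<length w. if w ! k then coordinate u (take k w) * g (drop (Suc k) w @ q) else 0)" for w
  have ny: "ny p \<ge> 1" using bad_counts[OF p] by simp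
  have hval: "h w = (if length w = Suc (length u) \<and> last w then coordinate u (butlast w) * g q else 0)"
    if lw: "length w = length p" for w
  proof -
    have "(if w ! k then coordinate u (take k w) * g (drop (Suc k) w @ q) else 0) = 0" if "k < length w" "k \<noteq> length u" for k
      using coordinate_length[of u "take k w"] that by (cases "coordinate u (take k w) = (0::'k)") auto
    then have "h w = (\<Sum>k<length w. if k = length u then if w ! k then coordinate u (take k w) * g (drop (Suc k) w @ q) else 0 else 0)"
      unfolding h_def by (intro sum.cong) auto
    also have "\<dots> = (if length u < length w \<and> w ! length u then coordinate u (take (length u) w) * g (drop (Suc (length u)) w @ q) else 0)"
      by simp
    finally have e: "h w = (if length u < length w \<and> w ! length u then coordinate u (take (length u) w) * g (drop (Suc (length u)) w @ q) else 0)" .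
    show ?thesis
    proof (cases "length w = Suc (length u)")
      case True
      then have "w \<noteq> []" by auto
      then have "last w = w ! length u" "butlast w = take (length u) w" using True by (simp_all add: last_conv_nth butlast_conv_take)
      then show ?thesis using e True by simp
    next
      case False
      then have "\<not> length u < length w" using len lw by simp
      then show ?thesis using e False by simp
    qed
  qed
  have hn: "h w = 0" if w: "w \<in> normal_words" "length w = length p" for w
  proof (rule ccontr)
    assume "h w \<noteq> 0"
    then have c: "length w = Suc (length u)" "last w" "coordinate u (butlast w) \<noteq> (0::'k)"
      unfolding hval[OF w(2)] by (auto split: if_splits)
    have wb: "w = butlast w @ [True]" using c(1,2) by (metis append_butlast_last_id length_0_conv nat.distinct(1))
    then have "butlast w \<in> normal_words" using w(1) normal_prefix by metis
    then have "u = butlast w" using c(3) coordinate_normal[OF u(1), of "butlast w", where 'k = 'k] by (cases "u = butlast w") auto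
    then have "u @ [True] = w" using wb by simp
    then show False using w(1) bad_not_normal[OF u(2)] by simp
  qed
  have "reduction p (split_at_x (coordinate u) g) q = of_nat (nx p) * h p - of_nat (nx p - mx p) * h (xy (nx p) (ny p))
      - of_nat (mx p) * h (False # xy (nx p) (ny p - 1))
      + (\<Sum>k<length q. if q ! k then reduction p (coordinate u) (take k q) * g (drop (Suc k) q) else 0)"
  proof -
    have cons: "False # xy (nx p) (ny p - 1) @ r = (False # xy (nx p) (ny p - 1)) @ r" for r by simp
    have "(\<Sum>k<length q. if q ! k then reduction p (coordinate u) (take k q) * g (drop (Suc k) q) else 0)
      = of_nat (nx p) * (\<Sum>k<length q. if q ! k then coordinate u (p @ take k q) * g (drop (Suc k) q) else 0)
       - of_nat (nx p - mx p) * (\<Sum>k<length q. if q ! k then coordinate u (xy (nx p) (ny p) @ take k q) * g (drop (Suc k) q) else 0)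
       - of_nat (mx p) * (\<Sum>k<length q. if q ! k then coordinate u ((False # xy (nx p) (ny p - 1)) @ take k q) * g (drop (Suc k) q) else 0)"
      unfolding sum_distrib_left sum_subtractf[symmetric]
      by (rule sum.cong) (auto simp: reduction_def algebra_simps)
    then show ?thesis
      unfolding reduction_def cons split_at_x_append h_def by (simp add: algebra_simps)
  qed
  also have "\<dots> = of_nat (nx p) * h p"
  proof -
    have "h (xy (nx p) (ny p)) = 0" "h (False # xy (nx p) (ny p - 1)) = 0"
      using hn reduced_normal[OF p] length_reduced[OF ny] by blast+
    moreover have "(\<Sum>k<length q. if q ! k then reduction p (coordinate u) (take k q) * g (drop (Suc k) q) else 0) = 0"
      by (rule sum.neutral) (simp add: reduction_coordinate[OF ny])
    ultimately show ?thesis by (simp del: One_nat_def)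
  qed
  also have "\<dots> = (if p = u @ [True] then of_nat (nx p) * g q else 0)"
  proof -
    obtain v where v: "v \<in> normal_words" "p = v @ [True]" using bad_word[OF p] .
    show ?thesis
      unfolding hval[OF refl] unfolding v(2) using coordinate_normal[OF u(1) v(1), where 'k = 'k]
      by (cases "u = v") (simp_all add: butlast_append)
  qed
  finally show ?thesis .
qed

inductive test_functional :: "nat \<Rightarrow> (bool list \<Rightarrow> 'k::field_char_0) \<Rightarrow> bool" where
  coordinate: "u \<in> normal_words \<Longrightarrow> test_functional (Suc k) (coordinate u)"
| split: "u \<in> normal_words \<Longrightarrow> u @ [True] \<in> bad_words \<Longrightarrow> test_functional k g
    \<Longrightarrow> test_functional (Suc k) (split_at_x (coordinate u) g)"

lemma reductions_zero: "reductions ps (\<lambda>_. 0) u = (0 :: 'a::ring_1)"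
proof (induction ps)
  case (Cons p ps)
  have "reduction p (\<lambda>_. 0 :: 'a) = (\<lambda>_. 0)" by (simp add: reduction_def fun_eq_iff)
  then show ?case using Cons by simp
qed simp

lemma reductions_scale: "reductions ps (\<lambda>q. c * h q) u = c * (reductions ps h u :: 'k::field)"
proof (induction ps arbitrary: h)
  case (Cons p ps)
  have "reduction p (\<lambda>q. c * h q) = (\<lambda>q. c * reduction p h q)"
    by (simp add: reduction_def fun_eq_iff algebra_simps)
  then show ?case using Cons by simp
qed simp

text \<open>Products \<open>b\<^bsub>p\<^sub>1\<^esub> \<cdots> b\<^bsub>p\<^sub>r\<^esub> u\<close> with \<open>r < k\<close> and \<open>u\<close> normal are separated by the functionals that split \<open>r\<close> times:
  consider the longest first factor that occurs.\<close>

lemma test_functionals_separate: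
  fixes c :: "bool list list \<times> bool list \<Rightarrow> 'k::field_char_0"
  assumes "finite I" "\<And>ps u. (ps, u) \<in> I \<Longrightarrow> set ps \<subseteq> bad_words \<and> u \<in> normal_words \<and> length ps < k"
    and "\<And>h. test_functional k h \<Longrightarrow> (\<Sum>x\<in>I. c x * reductions (fst x) h (snd x)) = 0"
    and "x \<in> I"
  shows "c x = 0"
  using assms
proof (induction k arbitrary: I c x)
  case 0
  then show ?case by (cases x) auto
next
  case (Suc k)
  note fin = Suc(2) and mem = Suc(3) and test = Suc(4)
  have nil: "c ([], u) = 0" if u: "([], u) \<in> I" for u
  proof -
    have un: "u \<in> normal_words" using mem[OF u] by blast
    have "c y * reductions (fst y) (coordinate u) (snd y) = (if y = ([], u) then c y else 0)" if y: "y \<in> I" for y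
    proof -
      obtain ps v where yv: "y = (ps, v)" by (cases y)
      have pv: "set ps \<subseteq> bad_words" "v \<in> normal_words" using mem y yv by auto
      show ?thesis
      proof (cases ps)
        case Nil
        then show ?thesis using yv coordinate_normal[OF un pv(2), where 'k = 'k] by auto
      next
        case (Cons p ps')
        then have "reduction p (coordinate u) = (\<lambda>_. 0 :: 'k)"
          using reduction_coordinate bad_counts[of p] pv(1) by (auto simp: fun_eq_iff)
        then show ?thesis using yv Cons by (simp add: reductions_zero)
      qed
    qed
    then have "(\<Sum>y\<in>I. c y * reductions (fst y) (coordinate u) (snd y)) = (\<Sum>y\<in>I. if y = ([], u) then c y else 0)"
      by (rule sum.cong[OF refl])
    then show ?thesis using test[OF test_functional.coordinate[OF un]] fin u by simp
  qed
  show ?case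
  proof (rule ccontr)
    assume nz: "c x \<noteq> 0"
    define A where "A = {y \<in> I. c y \<noteq> 0}"
    have A: "finite A" "x \<in> A" using fin Suc(5) nz by (auto simp: A_def)
    \<comment> \<open>a product with a longest first factor \<open>p\<close>: splitting at \<open>p\<close> annihilates all the products with another first
      factor\<close>
    have "A \<noteq> {}" using A(2) by blast
    from Max_in[OF finite_imageI[OF A(1)], of "\<lambda>z. length (hd (fst z))"] this
    obtain y where y0: "y \<in> A" "length (hd (fst y)) = Max ((\<lambda>z. length (hd (fst z))) ` A)" by force
    have y: "y \<in> A" "\<And>z. z \<in> A \<Longrightarrow> length (hd (fst z)) \<le> length (hd (fst y))"
      unfolding y0(2) using A(1) by (auto intro: y0(1) Max_ge)
    have A_cons: "\<exists>p ps v. z = (p # ps, v) \<and> p \<in> bad_words \<and> v \<in> normal_words" if z: "z \<in> A" for z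
    proof -
      obtain ps v where zv: "z = (ps, v)" by (cases z)
      then have "ps \<noteq> []" using nil z unfolding A_def by auto
      then show ?thesis using zv mem[of ps v] z unfolding A_def by (cases ps) auto
    qed
    obtain p ps v where yp: "y = (p # ps, v)" "p \<in> bad_words" using A_cons[OF y(1)] by blast
    obtain u where u: "u \<in> normal_words" "p = u @ [True]" using bad_word[OF yp(2)] .
    define J where "J = {z. (p # fst z, snd z) \<in> I}"
    define d where "d z = c (p # fst z, snd z) * of_nat (nx p)" for z
    have inj: "inj_on (\<lambda>z. (p # fst z, snd z)) J" by (auto simp: inj_on_def prod_eq_iff)
    have imJ: "(\<lambda>z. (p # fst z, snd z)) ` J \<subseteq> I" unfolding J_def by auto
    have finJ: "finite J" using finite_imageD[OF finite_subset[OF imJ fin] inj] .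
    have "d (ps, v) = 0"
    proof (rule Suc(1)[OF finJ])
      show "set qs \<subseteq> bad_words \<and> w \<in> normal_words \<and> length qs < k" if "(qs, w) \<in> J" for qs w
        using mem[of "p # qs" w] that unfolding J_def by auto
      show "(ps, v) \<in> J" using y(1) yp(1) unfolding J_def A_def by simp
      fix g :: "bool list \<Rightarrow> 'k" assume g: "test_functional k g"
      let ?h = "split_at_x (coordinate u) g"
      have t: "test_functional (Suc k) ?h" by (rule test_functional.split[OF u(1) _ g]) (use u yp in simp)
      have summand: "c z * reductions (fst z) ?h (snd z)
          = (if z \<in> (\<lambda>z. (p # fst z, snd z)) ` J then c z * of_nat (nx p) * reductions (tl (fst z)) g (snd z) else 0)"
        if z: "z \<in> I" for z
      proof (cases "c z = 0")
        case False
        then have zA: "z \<in> A" using z by (simp add: A_def)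
        obtain p' ps' v' where z': "z = (p' # ps', v')" "p' \<in> bad_words" using A_cons[OF zA] by blast
        have "length p' \<le> Suc (length u)" using y(2)[OF zA] z'(1) yp(1) u(2) by simp
        then have red: "reduction p' ?h = (\<lambda>q. if p' = p then of_nat (nx p) * g q else 0)"
          using reduction_split[OF z'(2) u(1), of g] u(2) yp(2) by (auto simp: fun_eq_iff)
        have img: "z \<in> (\<lambda>z. (p # fst z, snd z)) ` J \<longleftrightarrow> p' = p"
          using z z'(1) unfolding J_def by (auto simp: image_iff)
        show ?thesis
          unfolding img using red z'(1) by (simp add: reductions_zero reductions_scale)
      qed simp
      have "(\<Sum>z\<in>J. d z * reductions (fst z) g (snd z))
          = (\<Sum>z\<in>(\<lambda>z. (p # fst z, snd z)) ` J. c z * of_nat (nx p) * reductions (tl (fst z)) g (snd z))"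
        unfolding sum.reindex[OF inj] d_def by simp
      also have "\<dots> = (\<Sum>z\<in>I. if z \<in> (\<lambda>z. (p # fst z, snd z)) ` J then c z * of_nat (nx p) * reductions (tl (fst z)) g (snd z) else 0)"
        using imJ fin by (simp add: sum.inter_restrict[symmetric] Int_absorb1)
      also have "\<dots> = (\<Sum>z\<in>I. c z * reductions (fst z) ?h (snd z))" using summand by simp
      also have "\<dots> = 0" by (rule test[OF t])
      finally show "(\<Sum>z\<in>J. d z * reductions (fst z) g (snd z)) = 0" .
    qed
    then show False using y(1) yp bad_counts[OF yp(2)] unfolding d_def A_def by simp
  qed
qed

section \<open>Values on blocks of Grassmann monomials\<close>

lift_definition gmon :: "nat set \<Rightarrow> 'k::comm_ring_1 grassmann" is "\<lambda>S T. if T = S \<and> finite S then 1 else 0"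
  by auto

lemma gmon_mult:
  assumes "finite S" "finite T" "S \<inter> T = {}"
  shows "gmon S * gmon T = of_int ((- 1) ^ card {(s, t). s \<in> S \<and> t \<in> T \<and> t < s}) * (gmon (S \<union> T) :: 'k::comm_ring_1 grassmann)"
    (is "_ = of_int ?e * _")
proof (rule grassmann_eqI)
  fix U
  have e: "of_int ?e = (gsign S T :: 'k)" by (simp add: gsign_def)
  have t: "gsign R (U - R) * gcoeff (gmon S :: 'k grassmann) R * gcoeff (gmon T) (U - R)
      = (if R = S then if U = S \<union> T then gsign S T else 0 else 0)" if "R \<in> Pow U" for R
    using that assms by (auto simp: gmon.rep_eq)
  have "gcoeff (gmon S * gmon T :: 'k grassmann) U = (\<Sum>R\<in>Pow U. if R = S then if U = S \<union> T then gsign S T else 0 else 0)"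
    unfolding gcoeff_mult by (rule sum.cong[OF refl t])
  also have "\<dots> = (if U = S \<union> T then gsign S T else 0)"
    using assms by (cases "U = S \<union> T") simp_all
  also have "\<dots> = gcoeff (of_int ?e * gmon (S \<union> T)) U"
    unfolding gcoeff_of_int e using assms by (simp add: gmon.rep_eq)
  finally show "gcoeff (gmon S * gmon T) U = gcoeff (of_int ?e * gmon (S \<union> T) :: 'k grassmann) U" .
qed

lemma gmon_empty: "gmon {} = 1"
  by (rule grassmann_eqI) (simp add: gmon.rep_eq one_grassmann.rep_eq)

lemma gmon_insert:
  assumes "finite M" "i \<in> M"
  shows "gmon (M - {i}) * gmon {i} = of_int ((- 1) ^ card {s \<in> M. i < s}) * (gmon M :: 'k::comm_ring_1 grassmann)"
proof -
  have "{(s, t). s \<in> M - {i} \<and> t \<in> {i} \<and> t < s} = (\<lambda>s. (s, i)) ` {s \<in> M. i < s}" by auto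
  moreover have "card ((\<lambda>s. (s, i)) ` {s \<in> M. i < s}) = card {s \<in> M. i < s}" by (rule card_image) (simp add: inj_on_def)
  moreover have "M - {i} \<union> {i} = M" using assms(2) by auto
  ultimately show ?thesis using gmon_mult[of "M - {i}" "{i}"] assms(1) by simp
qed

text \<open>The number of letters \<open>x\<close> behind an even number of letters \<open>y\<close> minus the number of the other letters \<open>x\<close>.\<close>

definition imbalance :: "bool list \<Rightarrow> int" where
  "imbalance w = int (nx w) - 2 * int (mx w)"

lemma imbalance_snoc: "imbalance (w @ [True]) = imbalance w + (- 1) ^ ny w" "imbalance (w @ [False]) = imbalance w"
  by (simp_all add: imbalance_def mx_snoc)

lemma place_sign_square: "place_sign a U i * place_sign a U i = 1"
  by (simp add: place_sign_def flip: power_mult_distrib)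

lemma letter_empty_block:
  assumes "\<And>i. i \<in> U \<Longrightarrow> (i < a) = l \<Longrightarrow> F (U - {i}) = 0 \<or> c i = 0"
  shows "letter a c l F U = 0"
proof -
  have "of_int (place_sign a U i) * F (U - {i}) * c i = 0" if "i \<in> {i \<in> U. (i < a) = l}" for i
    using assms[of i] that by auto
  then have "(\<Sum>i\<in>{i \<in> U. (i < a) = l}. of_int (place_sign a U i) * F (U - {i}) * c i) = 0" by (intro sum.neutral ballI)
  then show ?thesis unfolding letter_def by simp
qed

lemma block_sum:
  assumes "c \<Longrightarrow> int (card B) * z = z'"
  shows "(\<Sum>i\<in>B. if c then of_int z * g else 0) = (if c then of_int z' * (g :: 'a::ring_1) else 0)"
proof (cases c)
  case True
  have "of_nat (card B) * (of_int z * g) = of_int (int (card B) * z) * g" by (simp add: mult.assoc)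
  then show ?thesis using True assms by simp
qed simp

text \<open>With scalars for the even and distinct Grassmann generators for the odd variables all orders of the
  variables give the same monomial, so that the value only sees the degree of the word.\<close>

lemma block_plain:
  fixes c :: "nat \<Rightarrow> 'k::comm_ring_1 grassmann"
  assumes "finite S" "\<And>i. i \<in> S \<Longrightarrow> c i = (if i < a then 1 else gmon {i})"
  shows "act a c unit_at_empty w S = (if nx w = card {i \<in> S. i < a} \<and> ny w = card {i \<in> S. a \<le> i}
    then of_int (fact (nx w) * fact (ny w)) * gmon {i \<in> S. a \<le> i} else 0)"
  using assms
proof (induction w arbitrary: S rule: rev_induct)
  case Nil
  have "card {i \<in> S. i < a} = 0 \<and> card {i \<in> S. a \<le> i} = 0 \<longleftrightarrow> S = {}"
  proof -
    have "{i \<in> S. i < a} \<union> {i \<in> S. a \<le> i} = S" by auto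
    then show ?thesis using Nil(1) by (auto simp: card_eq_0_iff)
  qed
  then show ?case by (auto simp: unit_at_empty_def gmon_empty)
next
  case (snoc l w)
  let ?x = "\<lambda>S. {i \<in> S. i < a}" and ?y = "\<lambda>S. {i \<in> S. a \<le> i}"
  have IH: "act a c unit_at_empty w (S - {i}) = (if nx w = card (?x (S - {i})) \<and> ny w = card (?y (S - {i}))
    then of_int (fact (nx w) * fact (ny w)) * gmon (?y (S - {i})) else 0)" for i
    by (rule snoc(1)) (use snoc(2,3) in auto)
  show ?case
  proof (cases l)
    case True
    have "of_int (place_sign a S i) * act a c unit_at_empty w (S - {i}) * c i
        = (if Suc (nx w) = card (?x S) \<and> ny w = card (?y S) then of_int (fact (nx w) * fact (ny w)) * gmon (?y S) else 0)"
      if i: "i \<in> {i \<in> S. (i < a) = l}" for i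
    proof -
      have "?x (S - {i}) = ?x S - {i}" "?y (S - {i}) = ?y S" using i True by auto
      moreover have "card (?x S) = Suc (card (?x S - {i}))" by (rule card.remove) (use i True snoc(2) in auto)
      ultimately show ?thesis unfolding IH using i True snoc(3)[of i] by (simp add: place_sign_def)
    qed
    then have "letter a c l (act a c unit_at_empty w) S = (\<Sum>i\<in>?x S.
        if Suc (nx w) = card (?x S) \<and> ny w = card (?y S) then of_int (fact (nx w) * fact (ny w)) * gmon (?y S) else 0)"
      unfolding letter_def using snoc(2) True by simp
    also have "\<dots> = (if Suc (nx w) = card (?x S) \<and> ny w = card (?y S)
        then of_int (fact (Suc (nx w)) * fact (ny w)) * gmon (?y S) else 0)"
    proof (rule block_sum)
      assume "Suc (nx w) = card (?x S) \<and> ny w = card (?y S)"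
      then have "card (?x S) = Suc (nx w)" by simp
      then show "int (card (?x S)) * (fact (nx w) * fact (ny w)) = fact (Suc (nx w)) * fact (ny w)" by (simp add: algebra_simps)
    qed
    finally show ?thesis using True by simp
  next
    case False
    have "of_int (place_sign a S i) * act a c unit_at_empty w (S - {i}) * c i
        = (if nx w = card (?x S) \<and> Suc (ny w) = card (?y S) then of_int (fact (nx w) * fact (ny w)) * gmon (?y S) else 0)"
      if i: "i \<in> {i \<in> S. (i < a) = l}" for i
    proof -
      have y: "i \<in> ?y S" "finite (?y S)" using i False snoc(2) by auto
      have 1: "?x (S - {i}) = ?x S" "?y (S - {i}) = ?y S - {i}" using y by auto
      have 2: "card (?y S) = Suc (card (?y S - {i}))" by (rule card.remove[OF y(2,1)])
      have "{s \<in> S. i < s} = {s \<in> ?y S. i < s}" using y by auto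
      then have ps: "place_sign a S i = (- 1) ^ card {s \<in> ?y S. i < s}" using y unfolding place_sign_def by simp
      have key: "of_int (place_sign a S i) * (of_int z * gmon (?y S - {i})) * gmon {i} = of_int z * (gmon (?y S) :: 'k grassmann)" for z
      proof -
        have "of_int (place_sign a S i) * (of_int z * gmon (?y S - {i})) * gmon {i}
            = of_int (place_sign a S i * z) * (gmon (?y S - {i}) * gmon {i} :: 'k grassmann)" by (simp add: mult.assoc)
        also have "\<dots> = of_int (place_sign a S i * z * (- 1) ^ card {s \<in> ?y S. i < s}) * gmon (?y S)"
          unfolding gmon_insert[OF y(2,1)] by (simp add: mult.assoc)
        also have "place_sign a S i * z * (- 1) ^ card {s \<in> ?y S. i < s} = z * (place_sign a S i * place_sign a S i)"
          unfolding ps by (simp add: mult_ac)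
        finally show ?thesis unfolding place_sign_square by simp
      qed
      have eqv: "ny w = card (?y S - {i}) \<longleftrightarrow> Suc (ny w) = card (?y S)" unfolding 2 by simp
      have ci: "c i = gmon {i}" using y(1) snoc(3)[of i] by simp
      show ?thesis
      proof (cases "nx w = card (?x S) \<and> Suc (ny w) = card (?y S)")
        case True
        show ?thesis unfolding IH 1 eqv ci if_P[OF True] by (rule key)
      next
        case False
        show ?thesis unfolding IH 1 eqv ci if_not_P[OF False] by simp
      qed
    qed
    then have "letter a c l (act a c unit_at_empty w) S = (\<Sum>i\<in>?y S.
        if nx w = card (?x S) \<and> Suc (ny w) = card (?y S) then of_int (fact (nx w) * fact (ny w)) * gmon (?y S) else 0)"
      unfolding letter_def using snoc(2) False by (simp add: not_less)
    also have "\<dots> = (if nx w = card (?x S) \<and> Suc (ny w) = card (?y S)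
        then of_int (fact (nx w) * fact (Suc (ny w))) * gmon (?y S) else 0)"
    proof (rule block_sum)
      assume "nx w = card (?x S) \<and> Suc (ny w) = card (?y S)"
      then have "card (?y S) = Suc (ny w)" by simp
      then show "int (card (?y S)) * (fact (nx w) * fact (ny w)) = fact (nx w) * fact (Suc (ny w))" by (simp add: algebra_simps)
    qed
    finally show ?thesis using False by simp
  qed
qed

text \<open>If one even variable is replaced by a product of an even element and an odd generator, then the value
  also records \<open>imbalance w\<close>: moving the odd generator past the letters \<open>y\<close> produces signs.\<close>

lemma block_marked:
  fixes c :: "nat \<Rightarrow> 'k::comm_ring_1 grassmann"
  assumes "finite S" "m \<in> S" "m < a" "\<And>i. i \<in> S \<Longrightarrow> c i = (if i < a \<and> i \<noteq> m then 1 else gmon {i})"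
  shows "act a c unit_at_empty w S = (if nx w = card {i \<in> S. i < a} \<and> ny w = card {i \<in> S. a \<le> i}
    then of_int (fact (nx w - 1) * fact (ny w) * imbalance w) * gmon (insert m {i \<in> S. a \<le> i}) else 0)"
  using assms
proof (induction w arbitrary: S rule: rev_induct)
  case Nil
  have "m \<in> {i \<in> S. i < a}" "finite {i \<in> S. i < a}" using Nil by auto
  then have "card {i \<in> S. i < a} \<noteq> 0" by (auto simp: card_eq_0_iff)
  then show ?case using Nil(2) by (auto simp: unit_at_empty_def)
next
  case (snoc l w)
  let ?x = "\<lambda>S. {i \<in> S. i < a}" and ?y = "\<lambda>S. {i \<in> S. a \<le> i}"
  let ?z = "of_int (fact (nx w - 1) * fact (ny w) * imbalance w) * gmon (insert m (?y S)) :: 'k grassmann"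
  have IH: "act a c unit_at_empty w (S - {i}) = (if nx w = card (?x (S - {i})) \<and> ny w = card (?y (S - {i}))
    then of_int (fact (nx w - 1) * fact (ny w) * imbalance w) * gmon (insert m (?y (S - {i}))) else 0)" if "i \<noteq> m" for i
    by (rule snoc(1)) (use snoc(2-5) that in auto)
  have finx: "finite (?x S)" "m \<in> ?x S" using snoc(2-4) by auto
  show ?case
  proof (cases l)
    case True
    let ?c = "Suc (nx w) = card (?x S) \<and> ny w = card (?y S)"
    have other: "of_int (place_sign a S i) * act a c unit_at_empty w (S - {i}) * c i = (if ?c then ?z else 0)"
      if i: "i \<in> ?x S - {m}" for i
    proof -
      have "?x (S - {i}) = ?x S - {i}" "?y (S - {i}) = ?y S" using i by auto
      moreover have "card (?x S) = Suc (card (?x S - {i}))" by (rule card.remove) (use i finx in auto)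
      moreover have "i \<noteq> m" "i < a" "i \<in> S" using i by auto
      ultimately show ?thesis using IH[of i] snoc(5)[of i] by (simp add: place_sign_def)
    qed
    have mark: "of_int (place_sign a S m) * act a c unit_at_empty w (S - {m}) * c m
        = (if ?c then of_int (fact (nx w) * fact (ny w) * (- 1) ^ ny w) * gmon (insert m (?y S)) else 0)"
    proof -
      have x: "?x (S - {m}) = ?x S - {m}" and y: "?y (S - {m}) = ?y S" using snoc(4) by auto
      have cx: "card (?x S) = Suc (card (?x S - {m}))" by (rule card.remove[OF finx])
      have v: "act a c unit_at_empty w (S - {m}) = (if nx w = card (?x (S - {m})) \<and> ny w = card (?y (S - {m}))
          then of_int (fact (nx w) * fact (ny w)) * gmon (?y (S - {m})) else 0)"
        by (rule block_plain) (use snoc(2,5) in auto)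
      have fin: "finite (insert m (?y S))" using snoc(2) by simp
      have ins: "insert m (?y S) - {m} = ?y S" using snoc(4) by auto
      have gt: "{s \<in> insert m (?y S). m < s} = ?y S" using snoc(4) by auto
      have "gmon (?y S) * gmon {m} = of_int ((- 1) ^ card (?y S)) * (gmon (insert m (?y S)) :: 'k grassmann)"
        using gmon_insert[OF fin, of m] unfolding ins gt by simp
      then have "of_int z * gmon (?y S) * gmon {m} = of_int (z * (- 1) ^ card (?y S)) * (gmon (insert m (?y S)) :: 'k grassmann)" for z
        by (simp add: mult.assoc)
      then have key: "of_int 1 * (of_int z * gmon (?y S)) * gmon {m} = of_int (z * (- 1) ^ card (?y S)) * (gmon (insert m (?y S)) :: 'k grassmann)" for z
        by simp
      have eqv: "nx w = card (?x S - {m}) \<longleftrightarrow> Suc (nx w) = card (?x S)" unfolding cx by simp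
      have cm: "c m = gmon {m}" "place_sign a S m = 1" using snoc(3,4) snoc(5)[of m] by (simp_all add: place_sign_def)
      show ?thesis
      proof (cases ?c)
        case True
        show ?thesis
          unfolding v x y eqv cm if_P[OF True] key using True by simp
      next
        case False
        show ?thesis unfolding v x y eqv cm if_not_P[OF False] by simp
      qed
    qed
    have "letter a c l (act a c unit_at_empty w) S = (\<Sum>i\<in>?x S. of_int (place_sign a S i) * act a c unit_at_empty w (S - {i}) * c i)"
      unfolding letter_def using snoc(2) True by simp
    also have "\<dots> = of_int (place_sign a S m) * act a c unit_at_empty w (S - {m}) * c m
        + (\<Sum>i\<in>?x S - {m}. of_int (place_sign a S i) * act a c unit_at_empty w (S - {i}) * c i)"
      by (rule sum.remove[OF finx])
    also have "(\<Sum>i\<in>?x S - {m}. of_int (place_sign a S i) * act a c unit_at_empty w (S - {i}) * c i)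
        = (\<Sum>i\<in>?x S - {m}. if ?c then ?z else 0)"
      by (rule sum.cong[OF refl other])
    also have "\<dots> = (if ?c then of_int (int (nx w) * (fact (nx w - 1) * fact (ny w) * imbalance w)) * gmon (insert m (?y S)) else 0)"
    proof (rule block_sum)
      assume c: ?c
      have "card (?x S - {m}) = nx w" using card.remove[OF finx] c by simp
      then show "int (card (?x S - {m})) * (fact (nx w - 1) * fact (ny w) * imbalance w)
          = int (nx w) * (fact (nx w - 1) * fact (ny w) * imbalance w)" by simp
    qed
    finally have val: "letter a c l (act a c unit_at_empty w) S = of_int (place_sign a S m) * act a c unit_at_empty w (S - {m}) * c m
        + (if ?c then of_int (int (nx w) * (fact (nx w - 1) * fact (ny w) * imbalance w)) * gmon (insert m (?y S)) else 0)" .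
    show ?thesis
    proof (cases ?c)
      case c: True
      have z: "int (nx w) * (fact (nx w - 1) * imbalance w) = fact (nx w) * imbalance w"
      proof (cases "nx w")
        case 0
        then show ?thesis using mx_le[of w] by (simp add: imbalance_def)
      qed (simp add: mult_ac)
      have "letter a c l (act a c unit_at_empty w) S
          = of_int (fact (nx w) * fact (ny w) * (- 1) ^ ny w + int (nx w) * (fact (nx w - 1) * imbalance w) * fact (ny w)) * gmon (insert m (?y S))"
        unfolding val mark if_P[OF c] distrib_right[symmetric] of_int_add[symmetric] by (simp only: mult_ac)
      also have "\<dots> = of_int (fact (nx w) * fact (ny w) * imbalance (w @ [True])) * gmon (insert m (?y S))"
        unfolding z imbalance_snoc by (simp add: algebra_simps)
      also have "fact (nx w) * fact (ny w) = (fact (nx (w @ [True]) - 1) * fact (ny (w @ [True])) :: int)" by simp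
      finally have e: "letter a c l (act a c unit_at_empty w) S
          = of_int (fact (nx (w @ [True]) - 1) * fact (ny (w @ [True])) * imbalance (w @ [True])) * gmon (insert m (?y S))" .
      have c': "nx (w @ [True]) = card (?x S) \<and> ny (w @ [True]) = card (?y S)" using c by simp
      have lT: "l = True" using True by simp
      show ?thesis using e unfolding act_snoc lT if_P[OF c'] .
    next
      case False
      have c': "\<not> (nx (w @ [True]) = card (?x S) \<and> ny (w @ [True]) = card (?y S))" using False by simp
      have lT: "l = True" using True by simp
      have "letter a c l (act a c unit_at_empty w) S = 0" unfolding val mark if_not_P[OF False] by simp
      then show ?thesis unfolding act_snoc lT if_not_P[OF c'] .
    qed
  next
    case False
    have "of_int (place_sign a S i) * act a c unit_at_empty w (S - {i}) * c i
        = (if nx w = card (?x S) \<and> Suc (ny w) = card (?y S) then ?z else 0)"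
      if i: "i \<in> {i \<in> S. (i < a) = l}" for i
    proof -
      let ?M = "insert m (?y S)"
      have y: "i \<in> ?y S" "finite (?y S)" using i False snoc(2) by auto
      have im: "i \<noteq> m" "\<not> i < m" using y snoc(4) by auto
      have 1: "?x (S - {i}) = ?x S" "?y (S - {i}) = ?y S - {i}" using y by auto
      have 2: "card (?y S) = Suc (card (?y S - {i}))" by (rule card.remove[OF y(2,1)])
      have 3: "insert m (?y S - {i}) = ?M - {i}" using im by auto
      have "{s \<in> S. i < s} = {s \<in> ?M. i < s}" using y im by auto
      then have ps: "place_sign a S i = (- 1) ^ card {s \<in> ?M. i < s}" using y unfolding place_sign_def by simp
      have iM: "finite ?M" "i \<in> ?M" using y by auto
      have key: "of_int (place_sign a S i) * (of_int z * gmon (?M - {i})) * gmon {i} = of_int z * (gmon ?M :: 'k grassmann)" for z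
      proof -
        have "of_int (place_sign a S i) * (of_int z * gmon (?M - {i})) * gmon {i}
            = of_int (place_sign a S i * z) * (gmon (?M - {i}) * gmon {i} :: 'k grassmann)" by (simp add: mult.assoc)
        also have "\<dots> = of_int (place_sign a S i * z * (- 1) ^ card {s \<in> ?M. i < s}) * gmon ?M"
          unfolding gmon_insert[OF iM] by (simp add: mult.assoc)
        also have "place_sign a S i * z * (- 1) ^ card {s \<in> ?M. i < s} = z * (place_sign a S i * place_sign a S i)"
          unfolding ps by (simp add: mult_ac)
        finally show ?thesis unfolding place_sign_square by simp
      qed
      have eqv: "ny w = card (?y S - {i}) \<longleftrightarrow> Suc (ny w) = card (?y S)" unfolding 2 by simp
      have ci: "c i = gmon {i}" using y(1) snoc(5)[of i] by simp
      show ?thesis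
      proof (cases "nx w = card (?x S) \<and> Suc (ny w) = card (?y S)")
        case True
        show ?thesis unfolding IH[OF im(1)] 1 3 eqv ci if_P[OF True] by (rule key)
      next
        case False
        show ?thesis unfolding IH[OF im(1)] 1 3 eqv ci if_not_P[OF False] by simp
      qed
    qed
    then have "letter a c l (act a c unit_at_empty w) S = (\<Sum>i\<in>?y S.
        if nx w = card (?x S) \<and> Suc (ny w) = card (?y S) then ?z else 0)"
      unfolding letter_def using snoc(2) False by (simp add: not_less)
    also have "\<dots> = (if nx w = card (?x S) \<and> Suc (ny w) = card (?y S)
        then of_int (fact (nx w - 1) * fact (Suc (ny w)) * imbalance w) * gmon (insert m (?y S)) else 0)"
    proof (rule block_sum)
      assume "nx w = card (?x S) \<and> Suc (ny w) = card (?y S)"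
      then have "card (?y S) = Suc (ny w)" by simp
      then show "int (card (?y S)) * (fact (nx w - 1) * fact (ny w) * imbalance w) = fact (nx w - 1) * fact (Suc (ny w)) * imbalance w"
        by (simp add: algebra_simps)
    qed
    finally show ?thesis using False by (simp add: imbalance_snoc)
  qed
qed

section \<open>Splitting words by triangular substitutions\<close>

text \<open>An index is either consumed by \<open>H\<close> or by one of the letters.\<close>

lemma act_support:
  fixes c :: "nat \<Rightarrow> 'a::ring_1"
  assumes "\<And>U. \<not> U \<subseteq> D \<Longrightarrow> H U = 0" "\<And>i. i \<notin> D' \<Longrightarrow> c i = 0" "\<not> U \<subseteq> D \<union> D'"
  shows "act a c H w U = 0"
  using assms(3)
proof (induction w arbitrary: U rule: rev_induct)
  case Nil
  then have "\<not> U \<subseteq> D" by auto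
  then have "H U = 0" by (rule assms(1))
  then show ?case by simp
next
  case (snoc l w)
  have "act a c H w (U - {i}) = 0 \<or> c i = 0" if "i \<in> U" for i
  proof (cases "i \<in> D'")
    case True
    then have "\<not> U - {i} \<subseteq> D \<union> D'" using snoc(2) by auto
    then have "act a c H w (U - {i}) = 0" by (rule snoc(1))
    then show ?thesis by (rule disjI1)
  next
    case False
    then have "c i = 0" by (rule assms(2))
    then show ?thesis by (rule disjI2)
  qed
  then show ?case unfolding act_snoc by (rule letter_empty_block)
qed

text \<open>If the part \<open>D\<close> of the indices is used up first, the rest of the word is evaluated independently.\<close>

lemma act_factor:
  fixes c :: "nat \<Rightarrow> 'a::ring_1"
  assumes H: "\<And>U. \<not> U \<subseteq> D \<Longrightarrow> H U = 0" and D: "finite D" "\<And>i. i \<in> D \<Longrightarrow> c i = 0"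
    and S: "finite S" "S \<inter> D = {}" "\<And>i j. i \<in> S \<Longrightarrow> a \<le> i \<Longrightarrow> j \<in> D \<Longrightarrow> j < i"
  shows "act a c H w (D \<union> S) = H D * act a c unit_at_empty w S"
  using S
proof (induction w arbitrary: S rule: rev_induct)
  case Nil
  show ?case
  proof (cases "S = {}")
    case False
    then have "\<not> D \<union> S \<subseteq> D" using Nil(2) by auto
    then show ?thesis using H False by (simp add: unit_at_empty_def)
  qed (simp add: unit_at_empty_def)
next
  case (snoc l w)
  let ?t = "\<lambda>i. of_int (place_sign a (D \<union> S) i) * act a c H w (D \<union> S - {i}) * c i"
  have "letter a c l (act a c H w) (D \<union> S) = (\<Sum>i\<in>{i \<in> D \<union> S. (i < a) = l}. ?t i)"
    unfolding letter_def using D(1) snoc(2) by simp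
  also have "\<dots> = (\<Sum>i\<in>{i \<in> S. (i < a) = l}. ?t i)"
  proof (rule sum.mono_neutral_right)
    show "\<forall>i\<in>{i \<in> D \<union> S. (i < a) = l} - {i \<in> S. (i < a) = l}. ?t i = 0"
    proof
      fix i assume "i \<in> {i \<in> D \<union> S. (i < a) = l} - {i \<in> S. (i < a) = l}"
      then have "c i = 0" by (intro D(2)) auto
      then show "?t i = 0" by simp
    qed
  qed (use D(1) snoc(2) in auto)
  also have "\<dots> = (\<Sum>i\<in>{i \<in> S. (i < a) = l}. H D * (of_int (place_sign a S i) * act a c unit_at_empty w (S - {i}) * c i))"
  proof (rule sum.cong[OF refl])
    fix i assume i: "i \<in> {i \<in> S. (i < a) = l}"
    have "{j \<in> D \<union> S. i < j} = {j \<in> S. i < j}" if "a \<le> i" using snoc(4)[of i] that i by fastforce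
    then have ps: "place_sign a (D \<union> S) i = place_sign a S i" unfolding place_sign_def by simp
    have DS: "D \<union> S - {i} = D \<union> (S - {i})" using i snoc(3) by auto
    have "act a c H w (D \<union> (S - {i})) = H D * act a c unit_at_empty w (S - {i})"
      by (rule snoc(1)) (use snoc(2-4) in auto)
    then show "?t i = H D * (of_int (place_sign a S i) * act a c unit_at_empty w (S - {i}) * c i)"
      unfolding ps DS by (simp add: mult.assoc of_int_left)
  qed
  also have "\<dots> = H D * letter a c l (act a c unit_at_empty w) S"
    unfolding letter_def using snoc(2) by (simp add: sum_distrib_left)
  finally show ?case by simp
qed

text \<open>Splitting arises from the off-diagonal entries of the matrices: the even variable \<open>v\<close> is the only one with
  a nonzero entry there, so that it is substituted for the letter at which the word is split.\<close>

lemma split_values: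
  fixes c :: "nat \<Rightarrow> 'a::ring_1"
  assumes G: "\<And>w U. \<not> U \<subseteq> D \<Longrightarrow> G w U = 0" and fin: "finite D" and v: "v < a" "v \<notin> D"
    and c: "\<And>i. i \<notin> D' \<Longrightarrow> c i = 0"
    and D': "finite D'" "D' \<inter> insert v D = {}" "\<And>i j. i \<in> D' \<Longrightarrow> a \<le> i \<Longrightarrow> j \<in> D \<Longrightarrow> j < i"
    and rec: "\<And>w l. G' (w @ [l]) = (\<lambda>U. letter a (\<lambda>i. if i = v then 1 else 0) l (G w) U + letter a c l (G' w) U)"
    and Nil: "G' [] = (\<lambda>_. 0)"
  shows "G' w (insert v D \<union> D') = split_at_x (\<lambda>w. G w D) (\<lambda>w. act a c unit_at_empty w D') w"
    and "\<not> U \<subseteq> insert v D \<union> D' \<Longrightarrow> G' w U = 0"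
proof -
  define H where "H u U = letter a (\<lambda>i. if i = v then 1 else 0) True (G u) U" for u U
  have one: "letter a (\<lambda>i. if i = v then 1 else 0) l (G u) = (if l then H u else (\<lambda>_. 0))" for l u
  proof (cases l)
    case False
    have "letter a (\<lambda>i. if i = v then 1 else 0) l (G u) U = 0" for U
      by (rule letter_empty_block) (use v(1) False in auto)
    then show ?thesis using False by (simp add: fun_eq_iff)
  qed (simp add: H_def fun_eq_iff)
  have Hval: "H u U = (if finite U \<and> v \<in> U then G u (U - {v}) else 0)" for u U
  proof (cases "finite U")
    case True
    have "H u U = (\<Sum>i\<in>{i \<in> U. (i < a) = True}. of_int (place_sign a U i) * G u (U - {i}) * (if i = v then 1 else 0))"
      unfolding H_def letter_def using True by simp
    also have "\<dots> = (\<Sum>i\<in>{i \<in> U. (i < a) = True}. if i = v then G u (U - {v}) else 0)"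
      by (rule sum.cong[OF refl]) (auto simp: place_sign_def)
    finally show ?thesis using True v(1) by simp
  qed (simp add: H_def letter_def)
  have Hsup: "H u U = 0" if "\<not> U \<subseteq> insert v D" for u U
  proof -
    have "\<not> U - {v} \<subseteq> D" using that by auto
    then have "G u (U - {v}) = 0" by (rule G)
    then show ?thesis unfolding Hval by simp
  qed
  have run: "G' w U = (\<Sum>k<length w. if w ! k then act a c (H (take k w)) (drop (Suc k) w) U else 0)" for U
  proof (induction w arbitrary: U rule: rev_induct)
    case (snoc l w)
    have "letter a c l (G' w) U = (\<Sum>k<length w. if w ! k then act a c (H (take k w)) (drop (Suc k) w @ [l]) U else 0)"
    proof -
      have lz: "letter a c l (\<lambda>U. \<Sum>k\<in>K. if P k then F k U else 0) U = (\<Sum>k\<in>K. if P k then letter a c l (F k) U else 0)"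
        if "finite K" for K :: "nat set" and P F
        using that
      proof (induction K)
        case empty
        then show ?case by (simp add: letter_zero)
      next
        case (insert k K)
        then show ?case
          using letter_add[of a c l "\<lambda>U. F k U" "\<lambda>U. \<Sum>k\<in>K. if P k then F k U else 0"] by (cases "P k") simp_all
      qed
      have "letter a c l (G' w) U = letter a c l (\<lambda>U. \<Sum>k<length w. if w ! k then act a c (H (take k w)) (drop (Suc k) w) U else 0) U"
        unfolding snoc[abs_def] ..
      also have "\<dots> = (\<Sum>k<length w. if w ! k then letter a c l (act a c (H (take k w)) (drop (Suc k) w)) U else 0)"
        by (rule lz) simp
      finally show ?thesis by (simp cong: if_cong)
    qed
    moreover have "letter a (\<lambda>i. if i = v then 1 else 0) l (G w) U = (if l then act a c (H w) [] U else 0)"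
      unfolding one by simp
    moreover have "(\<Sum>k<length w. if (w @ [l]) ! k then act a c (H (take k (w @ [l]))) (drop (Suc k) (w @ [l])) U else 0)
        = (\<Sum>k<length w. if w ! k then act a c (H (take k w)) (drop (Suc k) w @ [l]) U else 0)"
      by (rule sum.cong[OF refl]) (auto simp: nth_append Suc_diff_le simp del: act_snoc)
    ultimately show ?case unfolding rec by simp
  qed (simp add: Nil)
  have fac: "act a c (H u) q (insert v D \<union> D') = H u (insert v D) * act a c unit_at_empty q D'" for u q
  proof (rule act_factor)
    show "c i = 0" if "i \<in> insert v D" for i
    proof (rule c)
      show "i \<notin> D'" using that D'(2) by auto
    qed
    show "j < i" if "i \<in> D'" "a \<le> i" "j \<in> insert v D" for i j
      using D'(3)[OF that(1,2), of j] that(2,3) v(1) by (cases "j = v") auto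
    show "H u U = 0" if "\<not> U \<subseteq> insert v D" for U using that by (rule Hsup)
    show "finite (insert v D)" "finite D'" "D' \<inter> insert v D = {}" using fin D'(1,2) by auto
  qed
  have Hv: "H u (insert v D) = G u D" for u
    unfolding Hval using fin v(2) by simp
  show "G' w (insert v D \<union> D') = split_at_x (\<lambda>w. G w D) (\<lambda>w. act a c unit_at_empty w D') w"
    unfolding run fac Hv split_at_x_def ..
  show "G' w U = 0" if "\<not> U \<subseteq> insert v D \<union> D'" for U
    unfolding run by (rule sum.neutral) (simp add: act_support[of "insert v D" _ D' c U a, OF Hsup c that])
qed

section \<open>Splitting functionals are realized by triangular matrices of size three\<close>

lemma split_Cons:
  "split_at_x f g (l # w) = (if l then f [] * g w else 0) + split_at_x (\<lambda>u. f (l # u)) g w"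
  unfolding split_at_x_def length_Cons sum.lessThan_Suc_shift by (simp cong: if_cong)

lemma split_Nil [simp]: "split_at_x f g [] = 0"
  by (simp add: split_at_x_def)

lemma split_linear_left: "split_at_x (\<lambda>u. c * f u + f' u) g w = c * split_at_x f g w + split_at_x f' g (w :: bool list)"
  unfolding split_at_x_def sum_distrib_left sum.distrib[symmetric] by (rule sum.cong) (simp_all add: algebra_simps)

text \<open>Both sides sum \<open>f(u) g(v) h(z)\<close> over the factorizations \<open>w = u x v x z\<close>.\<close>

lemma split_assoc: "split_at_x f (split_at_x g h) w = split_at_x (split_at_x f g) h w"
proof (induction w arbitrary: f)
  case (Cons l w)
  show ?case
  proof (cases l)
    case True
    have "split_at_x f g (l # u) = f [] * g u + split_at_x (\<lambda>u. f (l # u)) g u" for u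
      unfolding split_Cons using True by simp
    then have e: "split_at_x (split_at_x f g) h (l # w) = split_at_x (\<lambda>u. f [] * g u + split_at_x (\<lambda>u. f (l # u)) g u) h w"
      unfolding split_Cons[of "split_at_x f g"] by simp
    show ?thesis unfolding e split_linear_left split_Cons[of f] Cons using True by simp
  next
    case False
    have "split_at_x f g (l # u) = split_at_x (\<lambda>u. f (l # u)) g u" for u
      unfolding split_Cons using False by simp
    then have e: "split_at_x (split_at_x f g) h (l # w) = split_at_x (split_at_x (\<lambda>u. f (l # u)) g) h w"
      unfolding split_Cons[of "split_at_x f g"] by simp
    show ?thesis unfolding e split_Cons[of f] Cons using False by simp
  qed
qed simp

lemma split_zero:
  assumes "\<And>u v. w = u @ True # v \<Longrightarrow> f u * g v = 0"
  shows "split_at_x f g w = 0"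
  unfolding split_at_x_def
proof (rule sum.neutral, rule ballI)
  fix k assume k: "k \<in> {..<length w}"
  have "f (take k w) * g (drop (Suc k) w) = 0" if "w ! k"
  proof (rule assms)
    have t: "w ! k = True" using that by simp
    show "w = take k w @ True # drop (Suc k) w"
      by (subst t[symmetric]) (rule id_take_nth_drop, use k in simp)
  qed
  then show "(if w ! k then f (take k w) * g (drop (Suc k) w) else 0) = 0" by simp
qed

lemma split_of_int:
  "split_at_x (\<lambda>w. of_int (f w) * x) (\<lambda>w. of_int (g w) * y) w = of_int (split_at_x f g w) * (x * y :: 'a::ring_1)"
  unfolding split_at_x_def of_int_sum sum_distrib_right
proof (rule sum.cong[OF refl])
  fix k
  have key: "of_int p * x * (of_int q * y) = of_int (p * q) * (x * y)" for p q
    by (simp only: mult.assoc of_int_left[of x q] of_int_mult)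
  show "(if w ! k then of_int (f (take k w)) * x * (of_int (g (drop (Suc k) w)) * y) else 0)
      = of_int (if w ! k then f (take k w) * g (drop (Suc k) w) else 0) * (x * y)"
    by (cases "w ! k") (simp_all only: key if_True if_False of_int_0 mult_zero_left)
qed

text \<open>Up to a constant and a monomial, these are the possible values of a word on a block: they depend on whether
  the block contains a marked even variable.\<close>

definition graded :: "nat \<Rightarrow> nat \<Rightarrow> bool \<Rightarrow> bool list \<Rightarrow> int" where
  "graded i j e w = (if nx w = i \<and> ny w = j then if e then imbalance w else 1 else 0)"

lemma graded_zero: "e \<Longrightarrow> graded 0 j e w = 0"
  using mx_le[of w] by (simp add: graded_def imbalance_def)

lemma block_value:
  fixes S :: "nat set"
  assumes S: "finite S" and e: "e \<Longrightarrow> {i \<in> S. i < a} \<noteq> {}"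
  obtains c :: "nat \<Rightarrow> 'k::comm_ring_1 grassmann" and K M where "\<And>i. i \<notin> S \<Longrightarrow> c i = 0" "K \<noteq> 0" "M \<subseteq> S"
    "\<And>w. act a c unit_at_empty w S = of_int (K * graded (card {i \<in> S. i < a}) (card {i \<in> S. a \<le> i}) e w) * gmon M"
proof (cases e)
  case True
  then obtain m where m: "m \<in> S" "m < a" using e by blast
  let ?c = "\<lambda>i. if i \<in> S then if i < a \<and> i \<noteq> m then 1 else gmon {i} else 0 :: 'k grassmann"
  let ?K = "fact (card {i \<in> S. i < a} - 1) * fact (card {i \<in> S. a \<le> i}) :: int"
  show ?thesis
  proof (rule that[of ?c ?K "insert m {i \<in> S. a \<le> i}"])
    show "act a ?c unit_at_empty w S = of_int (?K * graded (card {i \<in> S. i < a}) (card {i \<in> S. a \<le> i}) e w) * gmon (insert m {i \<in> S. a \<le> i})" for w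
      using block_marked[OF S m, of ?c w] True by (simp add: graded_def)
  qed (use m in auto)
next
  case False
  let ?c = "\<lambda>i. if i \<in> S then if i < a then 1 else gmon {i} else 0 :: 'k grassmann"
  let ?K = "fact (card {i \<in> S. i < a}) * fact (card {i \<in> S. a \<le> i}) :: int"
  show ?thesis
  proof (rule that[of ?c ?K "{i \<in> S. a \<le> i}"])
    show "act a ?c unit_at_empty w S = of_int (?K * graded (card {i \<in> S. i < a}) (card {i \<in> S. a \<le> i}) e w) * gmon {i \<in> S. a \<le> i}" for w
      using block_plain[OF S, of ?c a w] False by (simp add: graded_def)
  qed auto
qed

lemma interval_block_value:
  assumes "p \<le> q" "q \<le> a" "a \<le> r" "e \<Longrightarrow> p < q"
  obtains c :: "nat \<Rightarrow> 'k::comm_ring_1 grassmann" and K M where "\<And>i. i \<notin> {p..<q} \<union> {r..<s} \<Longrightarrow> c i = 0" "K \<noteq> 0" "M \<subseteq> {p..<q} \<union> {r..<s}"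
    "\<And>w. act a c unit_at_empty w ({p..<q} \<union> {r..<s}) = of_int (K * graded (q - p) (s - r) e w) * gmon M"
proof -
  have x: "{i \<in> {p..<q} \<union> {r..<s}. i < a} = {p..<q}" and y: "{i \<in> {p..<q} \<union> {r..<s}. a \<le> i} = {r..<s}"
    using assms(2,3) by auto
  have ne: "{i \<in> {p..<q} \<union> {r..<s}. i < a} \<noteq> {}" if e using assms(4)[OF that] unfolding x by simp
  have fin: "finite ({p..<q} \<union> {r..<s})" by simp
  obtain c :: "nat \<Rightarrow> 'k grassmann" and K M where c: "\<And>i. i \<notin> {p..<q} \<union> {r..<s} \<Longrightarrow> c i = 0" "K \<noteq> 0" "M \<subseteq> {p..<q} \<union> {r..<s}"
    "\<And>w. act a c unit_at_empty w ({p..<q} \<union> {r..<s}) = of_int (K * graded (card {p..<q}) (card {r..<s}) e w) * gmon M"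
    by (rule block_value[where e = e, OF fin ne, unfolded x y], assumption) (rule that)
  show ?thesis by (rule that[OF c(1-3)]) (use c(4) in \<open>simp_all only: card_atLeastLessThan\<close>)
qed

definition matrix_of :: "('n::{finite,linorder} \<Rightarrow> 'n \<Rightarrow> 'a::ring_1) \<Rightarrow> ('a, 'n) ut" where
  "matrix_of f = Abs_ut (\<chi> i j. if i \<le> j then f i j else 0)"

lemma entry_matrix_of: "entry i j (matrix_of f) = (if i \<le> j then f i j else 0)"
  unfolding matrix_of_def by (subst Abs_ut_inverse) auto

lemma less_3: "(0::3) < 1" "(1::3) < 2" "(0::3) < 2"
  by (simp_all add: less_bit1_def bit1.Rep_0 bit1.Rep_1 bit1.Rep_numeral)

lemma neq_3: "(0::3) \<noteq> 1" "(1::3) \<noteq> 2" "(0::3) \<noteq> 2" "(1::3) \<noteq> 0" "(2::3) \<noteq> 1" "(2::3) \<noteq> 0"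
  using less_3 by auto

lemma sum_UNIV_3: "(\<Sum>q\<in>(UNIV::3 set). f q) = f 0 + f 1 + f 2"
proof -
  have three: "(3::3) = 0" by simp
  show ?thesis unfolding sum_3 three by (simp add: ac_simps)
qed

text \<open>The three diagonal entries carry three independent blocks of variables, and each of the two even variables
  \<open>v\<close> and \<open>v'\<close> passes from one block to the next.\<close>

definition bidiagonal :: "(nat \<Rightarrow> 'a::ring_1) \<Rightarrow> nat \<Rightarrow> (nat \<Rightarrow> 'a) \<Rightarrow> nat \<Rightarrow> (nat \<Rightarrow> 'a) \<Rightarrow> nat \<Rightarrow> ('a, 3) ut" where
  "bidiagonal c1 v c2 v' c3 i = matrix_of (\<lambda>r s. if r = s then if r = 0 then c1 i else if r = 1 then c2 i else c3 i
     else if r = 0 \<and> s = 1 then if i = v then 1 else 0 else if r = 1 \<and> s = 2 then if i = v' then 1 else 0 else 0)"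

lemma entry_bidiagonal:
  "entry 0 0 (bidiagonal c1 v c2 v' c3 i) = c1 i" "entry 0 1 (bidiagonal c1 v c2 v' c3 i) = (if i = v then 1 else 0)"
  "entry 0 2 (bidiagonal c1 v c2 v' c3 i) = 0" "entry 1 0 (bidiagonal c1 v c2 v' c3 i) = 0"
  "entry 1 1 (bidiagonal c1 v c2 v' c3 i) = c2 i" "entry 1 2 (bidiagonal c1 v c2 v' c3 i) = (if i = v' then 1 else 0)"
  "entry 2 0 (bidiagonal c1 v c2 v' c3 i) = 0" "entry 2 1 (bidiagonal c1 v c2 v' c3 i) = 0"
  "entry 2 2 (bidiagonal c1 v c2 v' c3 i) = c3 i"
  using less_3 neq_3 unfolding bidiagonal_def entry_matrix_of by (auto simp: not_le dest: leD)

lemma entry_letter: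
  fixes \<phi> :: "nat \<Rightarrow> ('a::ring_1, 'n::{finite,linorder}) ut"
  shows "entry r s (letter a \<phi> l F U) = (\<Sum>q\<in>UNIV. letter a (\<lambda>i. entry q s (\<phi> i)) l (\<lambda>U. entry r q (F U)) U)"
proof (cases "finite U")
  case True
  have "entry r s (of_int z * A * B) = (\<Sum>q\<in>UNIV. of_int z * entry r q A * entry q s B)" for z and A B :: "('a, 'n) ut"
    unfolding entry_simps(5)[where i = r and j = s and A = "of_int z * A" and B = B] entry_of_int ..
  then show ?thesis
    unfolding letter_def using True by (simp add: entry_sum) (rule sum.swap)
qed (simp add: letter_def entry_simps)

lemma letter_zero_coeff: "letter a (\<lambda>_. 0) l F U = 0"
  by (simp add: letter_def)

context
  fixes a :: nat and c1 c2 c3 :: "nat \<Rightarrow> 'a::ring_1" and v v' :: nat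
begin

abbreviation corner :: "3 \<Rightarrow> bool list \<Rightarrow> nat set \<Rightarrow> 'a" where
  "corner s w U \<equiv> entry 0 s (act a (bidiagonal c1 v c2 v' c3) unit_at_empty w U)"

lemma corner_0: "corner 0 w U = act a c1 unit_at_empty w U"
proof (induction w arbitrary: U rule: rev_induct)
  case Nil
  then show ?case by (simp add: unit_at_empty_def entry_simps)
next
  case (snoc l w)
  show ?case
    unfolding act_snoc entry_letter sum_UNIV_3 entry_bidiagonal letter_zero_coeff snoc by simp
qed

lemma corner_1: "corner 1 (w @ [l]) U = letter a (\<lambda>i. if i = v then 1 else 0) l (corner 0 w) U + letter a c2 l (corner 1 w) U"
  and corner_2: "corner 2 (w @ [l]) U = letter a (\<lambda>i. if i = v' then 1 else 0) l (corner 1 w) U + letter a c3 l (corner 2 w) U"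
  unfolding act_snoc entry_letter sum_UNIV_3 entry_bidiagonal letter_zero_coeff by simp_all

lemma corner_Nil: "corner 1 [] U = 0" "corner 2 [] U = 0"
  using neq_3 by (auto simp: unit_at_empty_def entry_simps)

context
  fixes D1 D2 :: "nat set"
  assumes c1: "\<And>i. i \<notin> D1 \<Longrightarrow> c1 i = 0" and c2: "\<And>i. i \<notin> D2 \<Longrightarrow> c2 i = 0" and fin: "finite D1" "finite D2"
    and v: "v < a" "v \<notin> D1" and D2: "D2 \<inter> insert v D1 = {}" "\<And>i j. i \<in> D2 \<Longrightarrow> a \<le> i \<Longrightarrow> j \<in> D1 \<Longrightarrow> j < i"
begin

lemma corner_0_support: "\<not> U \<subseteq> D1 \<Longrightarrow> corner 0 w U = 0"
  unfolding corner_0 by (rule act_support[of "{}" _ D1]) (use c1 in \<open>simp_all add: unit_at_empty_def\<close>)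

lemma corner_1_value:
  "corner 1 w (insert v D1 \<union> D2) = split_at_x (\<lambda>w. act a c1 unit_at_empty w D1) (\<lambda>w. act a c2 unit_at_empty w D2) w"
  "\<not> U \<subseteq> insert v D1 \<union> D2 \<Longrightarrow> corner 1 w U = 0"
proof -
  have rec: "corner 1 (w @ [l]) = (\<lambda>U. letter a (\<lambda>i. if i = v then 1 else 0) l (corner 0 w) U + letter a c2 l (corner 1 w) U)" for w l
    by (rule ext) (rule corner_1)
  have nil: "corner 1 [] = (\<lambda>_. 0)" by (rule ext) (rule corner_Nil)
  show "corner 1 w (insert v D1 \<union> D2) = split_at_x (\<lambda>w. act a c1 unit_at_empty w D1) (\<lambda>w. act a c2 unit_at_empty w D2) w"
    unfolding corner_0[symmetric]
    by (rule split_values(1)[where G = "corner 0" and G' = "corner 1", OF corner_0_support fin(1) v c2 fin(2) D2 rec nil])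
  show "corner 1 w U = 0" if "\<not> U \<subseteq> insert v D1 \<union> D2"
    by (rule split_values(2)[where G = "corner 0" and G' = "corner 1", OF corner_0_support fin(1) v c2 fin(2) D2 rec nil that])
qed

lemma corner_2_value:
  assumes "\<And>i. i \<notin> D3 \<Longrightarrow> c3 i = 0" "finite D3" "v' < a" "v' \<notin> insert v D1 \<union> D2" "D3 \<inter> insert v' (insert v D1 \<union> D2) = {}"
    "\<And>i j. i \<in> D3 \<Longrightarrow> a \<le> i \<Longrightarrow> j \<in> insert v D1 \<union> D2 \<Longrightarrow> j < i"
  shows "corner 2 w (insert v' (insert v D1 \<union> D2) \<union> D3)
    = split_at_x (\<lambda>w. act a c1 unit_at_empty w D1) (split_at_x (\<lambda>w. act a c2 unit_at_empty w D2) (\<lambda>w. act a c3 unit_at_empty w D3)) w"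
proof -
  have fin': "finite (insert v D1 \<union> D2)" using fin by simp
  have rec: "corner 2 (w @ [l]) = (\<lambda>U. letter a (\<lambda>i. if i = v' then 1 else 0) l (corner 1 w) U + letter a c3 l (corner 2 w) U)" for w l
    by (rule ext) (rule corner_2)
  have nil: "corner 2 [] = (\<lambda>_. 0)" by (rule ext) (rule corner_Nil)
  have e: "split_at_x (\<lambda>w. act a c1 unit_at_empty w D1) (\<lambda>w. act a c2 unit_at_empty w D2) = (\<lambda>w. corner 1 w (insert v D1 \<union> D2))"
    by (rule ext) (rule corner_1_value(1)[symmetric])
  show ?thesis
    unfolding split_assoc e
    by (rule split_values(1)[where G = "corner 1" and G' = "corner 2", OF corner_1_value(2) fin' assms(3,4,1,2,5,6) rec nil])
qed

end

end

lemma gmon_product_nonzero: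
  assumes "finite M" "finite M'" "M \<inter> M' = {}"
  obtains z where "z \<noteq> 0" "gmon M * gmon M' = of_int z * (gmon (M \<union> M') :: 'k::comm_ring_1 grassmann)"
  by (rule that[OF _ gmon_mult[OF assms]]) simp

lemma of_int_gmon_nonzero: "finite M \<Longrightarrow> z \<noteq> 0 \<Longrightarrow> of_int z * gmon M \<noteq> (0 :: 'k::field_char_0 grassmann)"
proof
  assume M: "finite M" "z \<noteq> 0" "of_int z * gmon M = (0 :: 'k grassmann)"
  have "gcoeff (of_int z * gmon M :: 'k grassmann) M = of_int z" unfolding gcoeff_of_int using M(1) by (simp add: gmon.rep_eq)
  then show False using M(2,3) by (simp add: gcoeff_simps)
qed

lemma ut_gscale_sum_left: "ut_gscale (\<Sum>i\<in>I. c i) A = (\<Sum>i\<in>I. ut_gscale (c i) A)"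
  by (induction I rule: infinite_finite_induct) (simp_all add: ut_gscale_simps)

lemma sum_scale_multilinear: "(\<Sum>w\<in>W. fscale (U w) (polarize a n w)) \<in> multilinear n"
  by (intro fs.subspace_sum[OF subspace_multilinear] fs.subspace_scale[OF subspace_multilinear] polarize_multilinear)

lemma evaluate_polarized_sum:
  fixes \<phi> :: "nat \<Rightarrow> ('k::field_char_0 grassmann, 'n::{finite,linorder}) ut"
  shows "evaluate ut_gscale \<phi> (\<Sum>w\<in>W. fscale (U w) (polarize a n w)) = (\<Sum>w\<in>W. ut_gscale (U w) (act a \<phi> unit_at_empty w {..<n}))"
proof -
  have "evaluate ut_gscale \<phi> (\<Sum>w\<in>W. fscale (U w) (polarize a n w))
      = (\<Sum>v\<in>mwords n. \<Sum>w\<in>W. ut_gscale (U w) (ut_gscale (polarize a n w v) (prod_list (map \<phi> v))))"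
    unfolding evaluate_multilinear[OF sum_scale_multilinear]
    by (simp add: sum_fun_apply pointwise ut_gscale_sum_left ut_gscale_simps(4))
  also have "\<dots> = (\<Sum>w\<in>W. ut_gscale (U w) (evaluate ut_gscale \<phi> (polarize a n w)))"
    unfolding evaluate_multilinear[OF polarize_multilinear] ut_gscale_sum by (rule sum.swap)
  finally show ?thesis unfolding evaluate_polarize .
qed

lemma gcoeff_sum: "gcoeff (\<Sum>i\<in>I. x i) T = (\<Sum>i\<in>I. gcoeff (x i) T)"
  by (induction I rule: infinite_finite_induct) (simp_all add: gcoeff_simps)

lemma coefficient_of_identity:
  fixes \<phi> :: "nat \<Rightarrow> ('k::field_char_0 grassmann, 'n::{finite,linorder}) ut" and U :: "bool list \<Rightarrow> 'k"
  assumes "(\<Sum>w\<in>W. fscale (U w) (polarize a n w)) \<in> identities TYPE('n) n"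
  shows "(\<Sum>w\<in>W. U w * gcoeff (entry r s (act a \<phi> unit_at_empty w {..<n})) T) = 0"
proof -
  have "(\<Sum>w\<in>W. ut_gscale (U w) (act a \<phi> unit_at_empty w {..<n})) = 0"
    using assms unfolding identities_iff evaluate_polarized_sum by blast
  then have "gcoeff (entry r s (\<Sum>w\<in>W. ut_gscale (U w) (act a \<phi> unit_at_empty w {..<n}))) T = 0"
    by (simp add: entry_simps gcoeff_simps)
  then show ?thesis by (simp add: entry_sum gcoeff_sum entry_ut_gscale gcoeff_simps)
qed

text \<open>A functional that occurs as a matrix entry up to a nonzero Grassmann factor vanishes on identities.\<close>

lemma functional_of_identity:
  fixes \<phi> :: "nat \<Rightarrow> ('k::field_char_0 grassmann, 'n::{finite,linorder}) ut" and U :: "bool list \<Rightarrow> 'k"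
  assumes id: "(\<Sum>w\<in>W. fscale (U w) (polarize a n w)) \<in> identities TYPE('n) n"
    and val: "\<And>w. entry r s (act a \<phi> unit_at_empty w {..<n}) = of_int (f w) * x" and x: "x \<noteq> 0"
  shows "(\<Sum>w\<in>W. U w * of_int (f w)) = 0"
proof -
  obtain T where T: "gcoeff x T \<noteq> 0" using x grassmann_eqI[of x 0] by (auto simp: gcoeff_simps)
  have "(\<Sum>w\<in>W. U w * of_int (f w)) * gcoeff x T = 0"
    using coefficient_of_identity[OF id, where r = r and s = s and \<phi> = \<phi> and T = T] unfolding val gcoeff_of_int sum_distrib_right by (simp add: mult.assoc)
  then show ?thesis using T by simp
qed

context superization
begin

context
  fixes U :: "bool list \<Rightarrow> 'k::field_char_0"
  assumes identity: "(\<Sum>w\<in>types. fscale (U w) (polarize a n w)) \<in> identities TYPE(3) n"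
begin

text \<open>One block with all the variables. If the degree does not fit, or if there is no even variable to mark,
  then the functional is zero on the words in question.\<close>

lemma graded_vanishes: "(\<Sum>w\<in>types. U w * of_int (graded i j e w)) = 0"
proof (cases "i = a \<and> j = b \<and> (e \<longrightarrow> 0 < i)")
  case True
  then have "e \<Longrightarrow> 0 < a" by simp
  obtain c :: "nat \<Rightarrow> 'k grassmann" and K M where c: "\<And>i. i \<notin> {0..<a} \<union> {a..<n} \<Longrightarrow> c i = 0" "K \<noteq> 0" "M \<subseteq> {0..<a} \<union> {a..<n}"
    "\<And>w. act a c unit_at_empty w ({0..<a} \<union> {a..<n}) = of_int (K * graded (a - 0) (n - a) e w) * gmon M"
  proof -
    have h: "0 \<le> a" "a \<le> a" "a \<le> a" "e \<Longrightarrow> 0 < a" using True by auto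
    show thesis by (rule interval_block_value[where e = "e" and s = "n", OF h], assumption) (rule that)
  qed
  have s: "{0..<a} \<union> {a..<n} = {..<n}" using n by auto
  have "a - 0 = i" "n - a = j" using True n by auto
  then have val: "entry 0 0 (act a (bidiagonal c 0 c 0 c) unit_at_empty w {..<n}) = of_int (graded i j e w) * (of_int K * gmon M)" for w
    using c(4)[of w] \<open>a - 0 = i\<close> \<open>n - a = j\<close> unfolding corner_0 s mult.commute[of K] by (simp add: mult.assoc)
  have "finite M" by (rule finite_subset[OF c(3)]) simp
  then show ?thesis using functional_of_identity[OF identity val] of_int_gmon_nonzero[OF _ c(2)] by blast
next
  case False
  have "graded i j e w = 0" if "w \<in> types" for w
    using False that graded_zero[of e j w] unfolding types_def by (cases "i = 0") (auto simp: graded_def)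
  then show ?thesis by simp
qed

text \<open>Two blocks with disjoint intervals of even and of odd variables, the even variable in between being
  placed off the diagonal. The odd variables of the second block follow those of the first, as the
  independence of the blocks requires.\<close>

lemma split_graded_vanishes: "(\<Sum>w\<in>types. U w * of_int (split_at_x (graded i j e) (graded i' j' e') w)) = 0"
proof (cases "i + 1 + i' = a \<and> j + j' = b \<and> (e \<longrightarrow> 0 < i) \<and> (e' \<longrightarrow> 0 < i')")
  case True
  let ?D1 = "{0..<i} \<union> {a..<a + j}" and ?D2 = "{Suc i..<a} \<union> {a + j..<n}"
  obtain c1 :: "nat \<Rightarrow> 'k grassmann" and K1 M1 where c1: "\<And>i. i \<notin> ?D1 \<Longrightarrow> c1 i = 0" "K1 \<noteq> 0" "M1 \<subseteq> ?D1"
    "\<And>w. act a c1 unit_at_empty w ?D1 = of_int (K1 * graded (i - 0) (a + j - a) e w) * gmon M1"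
  proof -
    have h: "0 \<le> i" "i \<le> a" "a \<le> a" "e \<Longrightarrow> 0 < i" using True by auto
    show thesis by (rule interval_block_value[where e = "e" and s = "a + j", OF h], assumption) (rule that)
  qed
  obtain c2 :: "nat \<Rightarrow> 'k grassmann" and K2 M2 where c2: "\<And>i. i \<notin> ?D2 \<Longrightarrow> c2 i = 0" "K2 \<noteq> 0" "M2 \<subseteq> ?D2"
    "\<And>w. act a c2 unit_at_empty w ?D2 = of_int (K2 * graded (a - Suc i) (n - (a + j)) e' w) * gmon M2"
  proof -
    have h: "Suc i \<le> a" "a \<le> a" "a \<le> a + j" "e' \<Longrightarrow> Suc i < a" using True by auto
    show thesis by (rule interval_block_value[where e = "e'" and s = "n", OF h], assumption) (rule that)
  qed
  have "corner a c1 c2 c2 i i 1 w (insert i ?D1 \<union> ?D2)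
      = split_at_x (\<lambda>w. act a c1 unit_at_empty w ?D1) (\<lambda>w. act a c2 unit_at_empty w ?D2) w" for w
    by (rule corner_1_value(1)[OF c1(1) c2(1)]) (use True in auto)
  moreover have "insert i ?D1 \<union> ?D2 = {..<n}" using True n by auto
  moreover have "i - 0 = i" "a + j - a = j" "a - Suc i = i'" "n - (a + j) = j'" using True n by auto
  ultimately have "corner a c1 c2 c2 i i 1 w {..<n}
      = of_int (split_at_x (\<lambda>w. K1 * graded i j e w) (\<lambda>w. K2 * graded i' j' e' w) w) * (gmon M1 * gmon M2)" for w
    unfolding c1(4) c2(4) split_of_int by simp
  moreover have "split_at_x (\<lambda>w. K1 * graded i j e w) (\<lambda>w. K2 * graded i' j' e' w) w
      = split_at_x (graded i j e) (graded i' j' e') w * (K1 * K2)" for w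
    using split_of_int[of "graded i j e" K1 "graded i' j' e'" K2 w] by (simp add: mult.commute)
  ultimately have val: "corner a c1 c2 c2 i i 1 w {..<n}
      = of_int (split_at_x (graded i j e) (graded i' j' e') w) * (of_int (K1 * K2) * (gmon M1 * gmon M2))" for w
    by (simp add: mult.assoc)
  have fin: "finite M1" "finite M2" by (rule finite_subset[OF c1(3)], simp, rule finite_subset[OF c2(3)], simp)
  have "?D1 \<inter> ?D2 = {}" using True by auto
  then have "M1 \<inter> M2 = {}" using c1(3) c2(3) by blast
  then obtain z where z: "z \<noteq> 0" "gmon M1 * gmon M2 = of_int z * (gmon (M1 \<union> M2) :: 'k grassmann)"
    using gmon_product_nonzero[OF fin] by blast
  have "of_int (K1 * K2) * (gmon M1 * gmon M2) = of_int (K1 * K2 * z) * (gmon (M1 \<union> M2) :: 'k grassmann)"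
    unfolding z(2) by (simp add: mult.assoc)
  moreover have "of_int (K1 * K2 * z) * gmon (M1 \<union> M2) \<noteq> (0 :: 'k grassmann)"
    by (rule of_int_gmon_nonzero) (use fin c1(2) c2(2) z(1) in simp_all)
  ultimately have "of_int (K1 * K2) * (gmon M1 * gmon M2) \<noteq> (0 :: 'k grassmann)" by (rule ssubst)
  then show ?thesis by (rule functional_of_identity[OF identity val])
next
  case False
  have "split_at_x (graded i j e) (graded i' j' e') w = 0" if w: "w \<in> types" for w
  proof (rule split_zero)
    fix u v assume uv: "w = u @ True # v"
    show "graded i j e u * graded i' j' e' v = 0"
    proof (rule ccontr)
      assume "graded i j e u * graded i' j' e' v \<noteq> 0"
      then have g: "graded i j e u \<noteq> 0" "graded i' j' e' v \<noteq> 0" by auto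
      have "nx u = i" "ny u = j" "nx v = i'" "ny v = j'" using g by (auto simp: graded_def split: if_splits)
      moreover have "e \<longrightarrow> 0 < i" using g(1) graded_zero[of e j u] by (cases i) auto
      moreover have "e' \<longrightarrow> 0 < i'" using g(2) graded_zero[of e' j' v] by (cases i') auto
      ultimately show False using False w uv unfolding types_def by simp
    qed
  qed
  then show ?thesis by simp
qed

lemma split_split_graded_vanishes:
  "(\<Sum>w\<in>types. U w * of_int (split_at_x (graded i j e) (split_at_x (graded i' j' e') (graded i'' j'' e'')) w)) = 0"
proof (cases "i + 1 + i' + 1 + i'' = a \<and> j + j' + j'' = b \<and> (e \<longrightarrow> 0 < i) \<and> (e' \<longrightarrow> 0 < i') \<and> (e'' \<longrightarrow> 0 < i'')")
  case True
  let ?v' = "i + 1 + i'"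
  let ?D1 = "{0..<i} \<union> {a..<a + j}" and ?D2 = "{Suc i..<?v'} \<union> {a + j..<a + j + j'}" and ?D3 = "{Suc ?v'..<a} \<union> {a + j + j'..<n}"
  obtain c1 :: "nat \<Rightarrow> 'k grassmann" and K1 M1 where c1: "\<And>i. i \<notin> ?D1 \<Longrightarrow> c1 i = 0" "K1 \<noteq> 0" "M1 \<subseteq> ?D1"
    "\<And>w. act a c1 unit_at_empty w ?D1 = of_int (K1 * graded (i - 0) (a + j - a) e w) * gmon M1"
  proof -
    have h: "0 \<le> i" "i \<le> a" "a \<le> a" "e \<Longrightarrow> 0 < i" using True by auto
    show thesis by (rule interval_block_value[where e = "e" and s = "a + j", OF h], assumption) (rule that)
  qed
  obtain c2 :: "nat \<Rightarrow> 'k grassmann" and K2 M2 where c2: "\<And>i. i \<notin> ?D2 \<Longrightarrow> c2 i = 0" "K2 \<noteq> 0" "M2 \<subseteq> ?D2"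
    "\<And>w. act a c2 unit_at_empty w ?D2 = of_int (K2 * graded (?v' - Suc i) (a + j + j' - (a + j)) e' w) * gmon M2"
  proof -
    have h: "Suc i \<le> ?v'" "?v' \<le> a" "a \<le> a + j" "e' \<Longrightarrow> Suc i < ?v'" using True by auto
    show thesis by (rule interval_block_value[where e = "e'" and s = "a + j + j'", OF h], assumption) (rule that)
  qed
  obtain c3 :: "nat \<Rightarrow> 'k grassmann" and K3 M3 where c3: "\<And>i. i \<notin> ?D3 \<Longrightarrow> c3 i = 0" "K3 \<noteq> 0" "M3 \<subseteq> ?D3"
    "\<And>w. act a c3 unit_at_empty w ?D3 = of_int (K3 * graded (a - Suc ?v') (n - (a + j + j')) e'' w) * gmon M3"
  proof -
    have h: "Suc ?v' \<le> a" "a \<le> a" "a \<le> a + j + j'" "e'' \<Longrightarrow> Suc ?v' < a" using True by auto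
    show thesis by (rule interval_block_value[where e = "e''" and s = "n", OF h], assumption) (rule that)
  qed
  have "corner a c1 c2 c3 i ?v' 2 w (insert ?v' (insert i ?D1 \<union> ?D2) \<union> ?D3)
      = split_at_x (\<lambda>w. act a c1 unit_at_empty w ?D1) (split_at_x (\<lambda>w. act a c2 unit_at_empty w ?D2) (\<lambda>w. act a c3 unit_at_empty w ?D3)) w" for w
    by (rule corner_2_value[OF c1(1) c2(1) _ _ _ _ _ _ c3(1)]) (use True in auto)
  moreover have "insert ?v' (insert i ?D1 \<union> ?D2) \<union> ?D3 = {..<n}" using True n by auto
  moreover have "i - 0 = i" "a + j - a = j" "?v' - Suc i = i'" "a + j + j' - (a + j) = j'" "a - Suc ?v' = i''" "n - (a + j + j') = j''"
    using True n by auto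
  ultimately have "corner a c1 c2 c3 i ?v' 2 w {..<n}
      = of_int (split_at_x (\<lambda>w. K1 * graded i j e w) (split_at_x (\<lambda>w. K2 * graded i' j' e' w) (\<lambda>w. K3 * graded i'' j'' e'' w)) w)
        * (gmon M1 * (gmon M2 * gmon M3))" for w
    unfolding c1(4) c2(4) c3(4) split_of_int by simp
  moreover have "split_at_x (\<lambda>w. K1 * graded i j e w) (split_at_x (\<lambda>w. K2 * graded i' j' e' w) (\<lambda>w. K3 * graded i'' j'' e'' w)) w
      = split_at_x (graded i j e) (split_at_x (graded i' j' e') (graded i'' j'' e'')) w * (K1 * (K2 * K3))" for w
  proof -
    have 1: "split_at_x (\<lambda>w. K2 * graded i' j' e' w) (\<lambda>w. K3 * graded i'' j'' e'' w)
        = (\<lambda>w. split_at_x (graded i' j' e') (graded i'' j'' e'') w * (K2 * K3))"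
      using split_of_int[of "graded i' j' e'" K2 "graded i'' j'' e''" K3] by (simp add: mult.commute fun_eq_iff)
    show ?thesis unfolding 1
      using split_of_int[of "graded i j e" K1 "split_at_x (graded i' j' e') (graded i'' j'' e'')" "K2 * K3" w] by (simp add: mult.commute)
  qed
  ultimately have val: "corner a c1 c2 c3 i ?v' 2 w {..<n}
      = of_int (split_at_x (graded i j e) (split_at_x (graded i' j' e') (graded i'' j'' e'')) w)
        * (of_int (K1 * (K2 * K3)) * (gmon M1 * (gmon M2 * gmon M3)))" for w
    by (simp add: mult.assoc)
  have fin: "finite M1" "finite M2" "finite M3"
    by (rule finite_subset[OF c1(3)], simp, rule finite_subset[OF c2(3)], simp, rule finite_subset[OF c3(3)], simp)
  have "?D2 \<inter> ?D3 = {}" "?D1 \<inter> (?D2 \<union> ?D3) = {}" using True by auto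
  then have dis: "M2 \<inter> M3 = {}" "M1 \<inter> (M2 \<union> M3) = {}" using c1(3) c2(3) c3(3) by blast+
  obtain z where z: "z \<noteq> 0" "gmon M2 * gmon M3 = of_int z * (gmon (M2 \<union> M3) :: 'k grassmann)"
    using gmon_product_nonzero[OF fin(2,3) dis(1)] by blast
  obtain z' where z': "z' \<noteq> 0" "gmon M1 * gmon (M2 \<union> M3) = of_int z' * (gmon (M1 \<union> (M2 \<union> M3)) :: 'k grassmann)"
    using gmon_product_nonzero[OF fin(1) _ dis(2)] fin by blast
  have "of_int (K1 * (K2 * K3)) * (gmon M1 * (gmon M2 * gmon M3)) = of_int (K1 * (K2 * K3) * z * z') * (gmon (M1 \<union> (M2 \<union> M3)) :: 'k grassmann)"
    unfolding z(2) of_int_left[of "gmon M1"] z'(2) by (simp add: mult.assoc)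
  moreover have "of_int (K1 * (K2 * K3) * z * z') * gmon (M1 \<union> (M2 \<union> M3)) \<noteq> (0 :: 'k grassmann)"
    by (rule of_int_gmon_nonzero) (use fin c1(2) c2(2) c3(2) z(1) z'(1) in simp_all)
  ultimately have "of_int (K1 * (K2 * K3)) * (gmon M1 * (gmon M2 * gmon M3)) \<noteq> (0 :: 'k grassmann)" by (rule ssubst)
  then show ?thesis by (rule functional_of_identity[OF identity val])
next
  case False
  have "split_at_x (graded i j e) (split_at_x (graded i' j' e') (graded i'' j'' e'')) w = 0" if w: "w \<in> types" for w
  proof (rule split_zero)
    fix u q assume uq: "w = u @ True # q"
    show "graded i j e u * split_at_x (graded i' j' e') (graded i'' j'' e'') q = 0"
    proof (cases "graded i j e u = 0")
      case g: False
      have "split_at_x (graded i' j' e') (graded i'' j'' e'') q = 0"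
      proof (rule split_zero, rule ccontr)
        fix u' v assume uv: "q = u' @ True # v"
        assume "graded i' j' e' u' * graded i'' j'' e'' v \<noteq> 0"
        then have g': "graded i' j' e' u' \<noteq> 0" "graded i'' j'' e'' v \<noteq> 0" by auto
        have "nx u = i" "ny u = j" "nx u' = i'" "ny u' = j'" "nx v = i''" "ny v = j''"
          using g g' by (auto simp: graded_def split: if_splits)
        moreover have "e \<longrightarrow> 0 < i" using g graded_zero[of e j u] by (cases i) auto
        moreover have "e' \<longrightarrow> 0 < i'" using g'(1) graded_zero[of e' j' u'] by (cases i') auto
        moreover have "e'' \<longrightarrow> 0 < i''" using g'(2) graded_zero[of e'' j'' v] by (cases i'') auto
        ultimately show False using False w uv uq unfolding types_def by simp
      qed
      then show ?thesis by simp
    qed simp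
  qed
  then show ?thesis by simp
qed

end

end

section \<open>The dimension of the super-polynomials modulo the identities\<close>

lemma split_combination:
  fixes f f' g g' :: "bool list \<Rightarrow> 'k::comm_ring_1"
  shows "split_at_x (\<lambda>w. p * f w + q * f' w) g w = p * split_at_x f g w + q * split_at_x f' g w"
    "split_at_x f (\<lambda>w. p * g w + q * g' w) w = p * split_at_x f g w + q * split_at_x f g' w"
  unfolding split_at_x_def sum_distrib_left sum.distrib[symmetric] by (rule sum.cong; simp add: algebra_simps)+

lemma split_of_int_plain: "split_at_x (\<lambda>w. of_int (f w)) (\<lambda>w. of_int (g w)) w = (of_int (split_at_x f g w) :: 'a::ring_1)"
  using split_of_int[of f 1 g 1 w] by simp

text \<open>For a word with \<open>i > 0\<close> letters \<open>x\<close> the imbalance is \<open>i - 2 mx\<close>; so the coordinates are combinations of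
  the constant and of the imbalance.\<close>

lemma coordinate_graded:
  obtains p q where "coordinate u = (\<lambda>w. p * of_int (graded (nx u) (ny u) False w) + q * of_int (graded (nx u) (ny u) True w) :: 'k::field_char_0)"
proof (cases "nx u = 0")
  case True
  show ?thesis
    by (rule that[of 1 0]) (simp add: fun_eq_iff coordinate_def graded_def True)
next
  case False
  then have nz: "(of_nat (nx u) :: 'k) \<noteq> 0" by simp
  show ?thesis
  proof (rule that[of "1 / 2" "(if mx u = 0 then 1 else - 1) / (2 * of_nat (nx u))"], rule ext)
    fix w
    show "(coordinate u w :: 'k) = 1 / 2 * of_int (graded (nx u) (ny u) False w)
        + (if mx u = 0 then 1 else - 1) / (2 * of_nat (nx u)) * of_int (graded (nx u) (ny u) True w)"
    proof (cases "nx w = nx u \<and> ny w = ny u")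
      case True
      have i: "of_int (imbalance w) = (of_nat (nx u) - 2 * of_nat (mx w) :: 'k)" using True by (simp add: imbalance_def)
      show ?thesis
        unfolding coordinate_def graded_def if_P[OF True] if_not_P[OF False] i using nz
        by (cases "mx u = 0") (simp_all add: field_simps i)
    next
      case c: False
      show ?thesis unfolding coordinate_def graded_def if_not_P[OF c] by simp
    qed
  qed
qed

lemma test_functional_cases:
  "test_functional (Suc k) h \<Longrightarrow> (\<exists>u. h = coordinate u) \<or> (\<exists>u g. h = split_at_x (coordinate u) g \<and> test_functional k g)"
  by (erule test_functional.cases) auto

lemma test_functional_0: "\<not> test_functional 0 h"
  by (auto elim: test_functional.cases)

context superization
begin

text \<open>Splitting at most twice yields at most three coordinates, one for each diagonal entry.\<close>

lemma test_functional_vanishes: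
  fixes U :: "bool list \<Rightarrow> 'k::field_char_0"
  assumes identity: "(\<Sum>w\<in>types. fscale (U w) (polarize a n w)) \<in> identities TYPE(3) n"
    and h: "test_functional 3 h"
  shows "(\<Sum>w\<in>types. U w * h w) = 0"
proof -
  have comb: "(\<Sum>w\<in>types. U w * (p * f w + q * g w)) = 0"
    if "(\<Sum>w\<in>types. U w * f w) = 0" "(\<Sum>w\<in>types. U w * g w) = 0" for p q f g
  proof -
    have "(\<Sum>w\<in>types. U w * (p * f w + q * g w)) = p * (\<Sum>w\<in>types. U w * f w) + q * (\<Sum>w\<in>types. U w * g w)"
      by (simp add: sum_distrib_left sum.distrib[symmetric] algebra_simps)
    then show ?thesis using that by simp
  qed
  from test_functional_cases[OF h[unfolded numeral_3_eq_3]] show ?thesis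
  proof (elim disjE exE conjE)
    fix u assume u: "h = coordinate u"
    obtain p q where c: "coordinate u = (\<lambda>w. p * of_int (graded (nx u) (ny u) False w) + q * of_int (graded (nx u) (ny u) True w) :: 'k)"
      by (rule coordinate_graded)
    show ?thesis unfolding u c by (rule comb graded_vanishes[OF identity])+
  next
    fix u g assume u: "h = split_at_x (coordinate u) g" "test_functional (Suc (Suc 0)) g"
    obtain p q where c: "coordinate u = (\<lambda>w. p * of_int (graded (nx u) (ny u) False w) + q * of_int (graded (nx u) (ny u) True w) :: 'k)"
      by (rule coordinate_graded)
    from test_functional_cases[OF u(2)] show ?thesis
    proof (elim disjE exE conjE)
      fix u' assume u': "g = coordinate u'"
      obtain p' q' where c': "coordinate u' = (\<lambda>w. p' * of_int (graded (nx u') (ny u') False w) + q' * of_int (graded (nx u') (ny u') True w) :: 'k)"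
        by (rule coordinate_graded)
      show ?thesis
        unfolding u(1) u' c c' split_combination split_of_int_plain by (rule comb split_graded_vanishes[OF identity])+
    next
      fix u' g' assume u': "g = split_at_x (coordinate u') g'" "test_functional (Suc 0) g'"
      obtain p' q' where c': "coordinate u' = (\<lambda>w. p' * of_int (graded (nx u') (ny u') False w) + q' * of_int (graded (nx u') (ny u') True w) :: 'k)"
        by (rule coordinate_graded)
      obtain u'' where u'': "g' = coordinate u''"
        using test_functional_cases[OF u'(2)] test_functional_0 by blast
      obtain p'' q'' where c'': "coordinate u'' = (\<lambda>w. p'' * of_int (graded (nx u'') (ny u'') False w) + q'' * of_int (graded (nx u'') (ny u'') True w) :: 'k)"
        by (rule coordinate_graded)
      have inner: "split_at_x (coordinate u') (coordinate u'') = (\<lambda>w.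
          p' * (p'' * of_int (split_at_x (graded (nx u') (ny u') False) (graded (nx u'') (ny u'') False) w)
             + q'' * of_int (split_at_x (graded (nx u') (ny u') False) (graded (nx u'') (ny u'') True) w))
         + q' * (p'' * of_int (split_at_x (graded (nx u') (ny u') True) (graded (nx u'') (ny u'') False) w)
             + q'' * of_int (split_at_x (graded (nx u') (ny u') True) (graded (nx u'') (ny u'') True) w)) :: 'k)"
        unfolding c' c'' split_combination split_of_int_plain ..
      show ?thesis
        unfolding u(1) u'(1) u'' inner c split_combination split_of_int_plain
        by (rule comb split_split_graded_vanishes[OF identity])+
    qed
  qed
qed

end

text \<open>Combinations of values on \<open>T\<close> with fixed coefficients. For \<open>\<Phi> h = reductions ps h u\<close> the
  coefficients are those of the product of the \<open>b\<^sub>p\<close> with \<open>u\<close> as an element of the free algebra.\<close>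

definition supported :: "bool list set \<Rightarrow> ((bool list \<Rightarrow> 'k::field) \<Rightarrow> 'k) \<Rightarrow> bool" where
  "supported T \<Phi> \<longleftrightarrow> (\<exists>\<kappa>. \<forall>h. \<Phi> h = (\<Sum>w\<in>T. \<kappa> w * h w))"

lemma supported_point: "finite T \<Longrightarrow> w \<in> T \<Longrightarrow> supported T (\<lambda>h :: bool list \<Rightarrow> 'k::field. h w)"
proof -
  assume T: "finite T" "w \<in> T"
  have "h w = (\<Sum>v\<in>T. (if v = w then 1 else 0) * h v)" for h :: "bool list \<Rightarrow> 'k"
    using T by (simp add: if_distrib[of "\<lambda>x. x * _"] cong: if_cong)
  then show ?thesis unfolding supported_def by (intro exI[of _ "\<lambda>v. if v = w then 1 else 0"] allI)
qed

lemma supported_combination: "supported T \<Phi> \<Longrightarrow> supported T \<Psi> \<Longrightarrow> supported T (\<lambda>h. p * \<Phi> h + q * \<Psi> h)"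
proof -
  assume "supported T \<Phi>" "supported T \<Psi>"
  then obtain \<kappa> \<nu> where k: "\<And>h. \<Phi> h = (\<Sum>w\<in>T. \<kappa> w * h w)" "\<And>h. \<Psi> h = (\<Sum>w\<in>T. \<nu> w * h w)"
    unfolding supported_def by auto
  show ?thesis
    unfolding supported_def k
    by (rule exI[of _ "\<lambda>w. p * \<kappa> w + q * \<nu> w"]) (simp add: sum_distrib_left sum.distrib[symmetric] algebra_simps)
qed

lemma supported_sum: "finite J \<Longrightarrow> (\<And>j. j \<in> J \<Longrightarrow> supported T (\<Phi> j)) \<Longrightarrow> supported T (\<lambda>h. \<Sum>j\<in>J. c j * \<Phi> j h)"
proof (induction J rule: finite_induct)
  case empty
  show ?case unfolding supported_def by (rule exI[of _ "\<lambda>_. 0"]) simp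
next
  case (insert j J)
  have "supported T (\<lambda>h. c j * \<Phi> j h + 1 * (\<Sum>j\<in>J. c j * \<Phi> j h))"
    by (rule supported_combination) (use insert in auto)
  then show ?case using insert(1,2) by simp
qed

lemma finite_degree: "finite {w :: bool list. nx w = i \<and> ny w = j}"
  by (rule finite_subset[OF _ finite_lists_length_eq[of UNIV "i + j"]]) (auto simp: length_counts)

lemma reductions_supported:
  assumes "\<And>p. p \<in> set ps \<Longrightarrow> ny p \<ge> 1" "nx (concat ps @ q) = i" "ny (concat ps @ q) = j"
  shows "supported {w. nx w = i \<and> ny w = j} (\<lambda>h :: bool list \<Rightarrow> 'k::field. reductions ps h q)"
  using assms
proof (induction ps arbitrary: i j)
  case Nil
  then show ?case using supported_point[OF finite_degree, of q] by simp
next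
  case (Cons p ps)
  let ?T = "{w. nx w = i \<and> ny w = j}" and ?T' = "{w. nx w = nx (concat ps @ q) \<and> ny w = ny (concat ps @ q)}"
  have "supported ?T' (\<lambda>h :: bool list \<Rightarrow> 'k. reductions ps h q)"
    by (rule Cons(1)) (use Cons(2) in simp_all)
  then obtain \<kappa> where k: "\<And>h. reductions ps h q = (\<Sum>w\<in>?T'. \<kappa> w * (h w :: 'k))" unfolding supported_def by blast
  have ny: "ny p \<ge> 1" using Cons(2) by simp
  have "supported ?T (\<lambda>h :: bool list \<Rightarrow> 'k. reduction p h w)" if w: "w \<in> ?T'" for w
  proof -
    have mem: "p @ w \<in> ?T" "xy (nx p) (ny p) @ w \<in> ?T" "False # xy (nx p) (ny p - 1) @ w \<in> ?T"
      using w Cons(3,4) ny by auto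
    have "supported ?T (\<lambda>h :: bool list \<Rightarrow> 'k. 1 * (of_nat (nx p) * h (p @ w) + (- of_nat (nx p - mx p)) * h (xy (nx p) (ny p) @ w))
        + (- of_nat (mx p)) * h (False # xy (nx p) (ny p - 1) @ w))"
      by (intro supported_combination supported_point finite_degree mem)
    then show ?thesis by (simp add: reduction_def)
  qed
  then show ?case unfolding reductions.simps k by (rule supported_sum[OF finite_degree])
qed

lemma reductions_coefficient:
  "gcoeff (entry r s (reductions ps A q)) T = reductions ps (\<lambda>w. gcoeff (entry r s (A w :: ('k::comm_ring_1 grassmann, 'n::{finite,linorder}) ut)) T) q"
proof (induction ps arbitrary: A)
  case (Cons p ps)
  have n: "gcoeff (of_nat m * x) T = of_nat m * gcoeff x T" for m and x :: "'k grassmann"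
    by (induction m) (simp_all add: gcoeff_simps distrib_right)
  have "(\<lambda>w. gcoeff (entry r s (reduction p A w)) T) = reduction p (\<lambda>w. gcoeff (entry r s (A w)) T)"
    unfolding reduction_def by (rule ext) (simp only: entry_simps(2) entry_of_nat gcoeff_simps(3) n)
  then show ?case using Cons[of "reduction p A"] by simp
qed simp

text \<open>Indices of the products \<open>b\<^bsub>p\<^sub>1\<^esub> \<cdots> b\<^bsub>p\<^sub>r\<^esub> u\<close> of degree \<open>(a, b)\<close> with \<open>r < 3\<close> and \<open>u\<close> normal.\<close>

definition product_words :: "nat \<Rightarrow> nat \<Rightarrow> (bool list list \<times> bool list) set" where
  "product_words a b = {(ps, u). set ps \<subseteq> bad_words \<and> length ps < 3 \<and> u \<in> normal_words
     \<and> nx (concat ps @ u) = a \<and> ny (concat ps @ u) = b}"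

lemma finite_product_words: "finite (product_words a b)"
proof -
  let ?L = "{w :: bool list. set w \<subseteq> UNIV \<and> length w \<le> a + b}"
  have "length p \<le> length (concat ps)" if "p \<in> set ps" for p and ps :: "bool list list"
    using that by (induction ps) auto
  then have len: "length p \<le> length (concat ps @ u)" if "p \<in> insert u (set ps)" for p u and ps :: "bool list list"
    using that by fastforce
  have "product_words a b \<subseteq> {ps. set ps \<subseteq> ?L \<and> length ps \<le> 3} \<times> ?L"
  proof
    fix t assume t: "t \<in> product_words a b"
    obtain ps u where tp: "t = (ps, u)" by (cases t)
    have d: "length ps < 3" "nx (concat ps @ u) = a" "ny (concat ps @ u) = b" using t unfolding tp product_words_def by blast+
    have "length (concat ps @ u) = a + b" unfolding length_counts[of "concat ps @ u"] d ..
    then have "length p \<le> a + b" if "p \<in> insert u (set ps)" for p using len[OF that] by simp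
    then show "t \<in> {ps. set ps \<subseteq> ?L \<and> length ps \<le> 3} \<times> ?L" unfolding tp using d(1) by auto
  qed
  moreover have fin: "finite ?L" by (rule finite_lists_length_le) simp
  have "finite ({ps. set ps \<subseteq> ?L \<and> length ps \<le> 3} \<times> ?L)"
    by (rule finite_cartesian_product[OF finite_lists_length_le[OF fin] fin])
  ultimately show ?thesis by (rule finite_subset)
qed

text \<open>These products form a basis of the polynomials of degree \<open>(a, b)\<close> in \<open>x\<close> and \<open>y\<close> modulo the identities: they
  span because products of three generators are identities, and they are independent because the
  functionals that separate them vanish on identities.\<close>

lemma (in superization) alternating_value:
  "sym_alt_value (cocharacter (ut_gscale :: 'k::field_char_0 \<Rightarrow> ('k grassmann, 3) ut \<Rightarrow> ('k grassmann, 3) ut) n) {..<a} {a..<n}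
    = of_nat (fact a * fact b * card (product_words a b))"
proof -
  define v :: "bool list list \<times> bool list \<Rightarrow> nat list \<Rightarrow> 'k" where
    "v t x = reductions (fst t) (\<lambda>w. polarize a n w x) (snd t)" for t x
  let ?W = "identities TYPE(3) n :: (nat list \<Rightarrow> 'k) set"
  have ny: "ny p \<ge> 1" if "set ps \<subseteq> bad_words" "p \<in> set ps" for p ps using that bad_counts[of p] by auto
  have sup: "\<exists>\<kappa>. \<forall>h :: bool list \<Rightarrow> 'k. reductions ps h q = (\<Sum>w\<in>types. \<kappa> w * h w)"
    if "set ps \<subseteq> bad_words" "concat ps @ q \<in> types" for ps q
    using reductions_supported[OF ny[OF that(1)], of ps q a b] that(2) unfolding supported_def types_def by simp
  have expand: "(\<lambda>x. reductions ps (\<lambda>w. polarize a n w x) q) = (\<Sum>w\<in>types. fscale (\<kappa> w) (polarize a n w))"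
    if "\<And>h :: bool list \<Rightarrow> 'k. reductions ps h q = (\<Sum>w\<in>types. \<kappa> w * h w)" for ps q \<kappa>
    unfolding that by (simp add: fun_eq_iff sum_fun_apply pointwise)
  have other: "(\<lambda>x. reductions ps (\<lambda>w. polarize a n w x) q :: 'k) = 0"
    if ps: "set ps \<subseteq> bad_words" and t: "concat ps @ q \<notin> types" for ps q
  proof
    fix x
    obtain \<kappa> where k: "\<And>h :: bool list \<Rightarrow> 'k. reductions ps h q
        = (\<Sum>w\<in>{w. nx w = nx (concat ps @ q) \<and> ny w = ny (concat ps @ q)}. \<kappa> w * h w)"
      using reductions_supported[OF ny[OF ps] refl refl, of ps q] unfolding supported_def by blast
    have "polarize a n w x = (0 :: 'k)" if "nx w = nx (concat ps @ q) \<and> ny w = ny (concat ps @ q)" for w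
      using that t kind_types[of x] unfolding polarize_def types_def by auto
    then show "reductions ps (\<lambda>w. polarize a n w x) q = (0 :: nat list \<Rightarrow> 'k) x"
      unfolding k by (simp add: pointwise)
  qed
  have ex: "\<exists>\<kappa>. \<forall>h :: bool list \<Rightarrow> 'k. reductions (fst t) h (snd t) = (\<Sum>w\<in>types. \<kappa> w * h w)" if "t \<in> product_words a b" for t
    by (rule sup) (use that in \<open>auto simp: product_words_def types_def\<close>)
  define \<kappa> where "\<kappa> t = (SOME \<kappa>. \<forall>h :: bool list \<Rightarrow> 'k. reductions (fst t) h (snd t) = (\<Sum>w\<in>types. \<kappa> w * h w))" for t
  have \<kappa>: "reductions (fst t) h (snd t) = (\<Sum>w\<in>types. \<kappa> t w * (h w :: 'k))" if "t \<in> product_words a b" for t h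
    using someI_ex[OF ex[OF that]] unfolding \<kappa>_def by (rule spec)
  have v: "v t = (\<Sum>w\<in>types. fscale (\<kappa> t w) (polarize a n w))" if "t \<in> product_words a b" for t
    using expand[OF \<kappa>[OF that]] unfolding v_def[abs_def] .
  show ?thesis
  proof (rule equivariant_dimension[OF finite_product_words])
    fix t assume t: "t \<in> product_words a b"
    show "v t \<in> multilinear n" unfolding v[OF t] by (rule sum_scale_multilinear)
    have "equivariant (\<Sum>w\<in>types. fscale (\<kappa> t w) (polarize a n w))"
      unfolding equivariant_def
    proof (intro ballI allI)
      fix \<rho> \<gamma> x assume "\<rho> \<in> Perms {..<a}" "\<gamma> \<in> Perms {a..<n}"
      then have pe: "polarize a n w (map (\<rho> \<circ> \<gamma>) x) = of_int (sign \<gamma>) * (polarize a n w x :: 'k)" for w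
      proof -
        have "equivariant (polarize a n w :: nat list \<Rightarrow> 'k)" by (rule polarize_equivariant)
        then show ?thesis using \<open>\<rho> \<in> _\<close> \<open>\<gamma> \<in> _\<close> unfolding equivariant_def by simp
      qed
      show "(\<Sum>w\<in>types. fscale (\<kappa> t w) (polarize a n w)) (map (\<rho> \<circ> \<gamma>) x)
          = of_int (sign \<gamma>) * (\<Sum>w\<in>types. fscale (\<kappa> t w) (polarize a n w)) x"
        unfolding sum_fun_apply fscale_apply pe sum_distrib_left by (rule sum.cong) (simp_all add: mult.left_commute)
    qed
    then show "equivariant (v t)" unfolding v[OF t] .
  next
    fix w
    \<comment> \<open>the span of the products modulo the identities\<close>
    let ?S = "{f. \<exists>c. f - (\<Sum>t\<in>product_words a b. fscale (c t) (v t)) \<in> ?W}"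
    have W: "fs.subspace ?W" by (rule subspace_identities)
    have S: "fs.subspace ?S"
    proof (rule fs.subspaceI)
      show "0 \<in> ?S" using fs.subspace_0[OF W] by (auto intro!: exI[of _ "\<lambda>_. 0"])
    next
      fix f g assume "f \<in> ?S" "g \<in> ?S"
      then obtain c d where cd: "f - (\<Sum>t\<in>product_words a b. fscale (c t) (v t)) \<in> ?W" "g - (\<Sum>t\<in>product_words a b. fscale (d t) (v t)) \<in> ?W"
        by blast
      have "f + g - (\<Sum>t\<in>product_words a b. fscale (c t + d t) (v t))
          = (f - (\<Sum>t\<in>product_words a b. fscale (c t) (v t))) + (g - (\<Sum>t\<in>product_words a b. fscale (d t) (v t)))"
        by (simp add: fs.scale_left_distrib sum.distrib algebra_simps)
      also have "\<dots> \<in> ?W" by (rule fs.subspace_add[OF W cd])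
      finally show "f + g \<in> ?S" by (intro CollectI exI[of _ "\<lambda>t. c t + d t"])
    next
      fix e f assume "f \<in> ?S"
      then obtain c where c: "f - (\<Sum>t\<in>product_words a b. fscale (c t) (v t)) \<in> ?W" by blast
      have "fscale e f - (\<Sum>t\<in>product_words a b. fscale (e * c t) (v t)) = fscale e (f - (\<Sum>t\<in>product_words a b. fscale (c t) (v t)))"
        by (simp add: fs.scale_right_diff_distrib fs.scale_sum_right)
      also have "\<dots> \<in> ?W" by (rule fs.subspace_scale[OF W c])
      finally show "fscale e f \<in> ?S" by (intro CollectI exI[of _ "\<lambda>t. e * c t"])
    qed
    have WS: "f \<in> ?S" if "f \<in> ?W" for f
      using that by (intro CollectI exI[of _ "\<lambda>_. 0"]) simp
    have "(\<lambda>x. polarize a n w x) \<in> ?S"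
    proof (rule span_reductions[where k = 3, OF S])
      fix ps u assume ps: "set ps \<subseteq> bad_words" "length ps < 3" "u \<in> normal_words"
      show "(\<lambda>x. reductions ps (\<lambda>w. polarize a n w x) u) \<in> ?S"
      proof (cases "concat ps @ u \<in> types")
        case True
        then have t: "(ps, u) \<in> product_words a b" using ps unfolding product_words_def types_def by simp
        have "(\<Sum>t\<in>product_words a b. fscale (if t = (ps, u) then 1 else 0) (v t)) = (\<Sum>t\<in>product_words a b. if t = (ps, u) then v t else 0)"
          by (rule sum.cong) auto
        also have "\<dots> = v (ps, u)" using t finite_product_words by simp
        also have "\<dots> = (\<lambda>x. reductions ps (\<lambda>w. polarize a n w x) u)" unfolding v_def[abs_def] by simp
        finally have e: "(\<Sum>t\<in>product_words a b. fscale (if t = (ps, u) then 1 else 0) (v t)) = (\<lambda>x. reductions ps (\<lambda>w. polarize a n w x) u)" .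
        show ?thesis
          by (intro CollectI exI[of _ "\<lambda>t. if t = (ps, u) then 1 else 0"]) (unfold e diff_self, rule fs.subspace_0[OF W])
      next
        case False
        show ?thesis unfolding other[OF ps(1) False] by (rule fs.subspace_0[OF S])
      qed
    next
      fix ps q assume ps: "set ps \<subseteq> bad_words" "length ps = 3"
      show "(\<lambda>x. reductions ps (\<lambda>w. polarize a n w x) q) \<in> ?S"
      proof (cases "concat ps @ q \<in> types")
        case True
        obtain \<kappa> where k: "\<And>h :: bool list \<Rightarrow> 'k. reductions ps h q = (\<Sum>w\<in>types. \<kappa> w * h w)"
          using sup[OF ps(1) True] by blast
        have "evaluate ut_gscale \<phi> (\<Sum>w\<in>types. fscale (\<kappa> w) (polarize a n w)) = 0" for \<phi> :: "nat \<Rightarrow> ('k grassmann, 3) ut"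
        proof (rule ut_eqI, rule grassmann_eqI)
          fix r s T
          have "gcoeff (entry r s (evaluate ut_gscale \<phi> (\<Sum>w\<in>types. fscale (\<kappa> w) (polarize a n w)))) T
              = (\<Sum>w\<in>types. \<kappa> w * gcoeff (entry r s (act a \<phi> unit_at_empty w {..<n})) T)"
            unfolding evaluate_polarized_sum by (simp add: entry_sum gcoeff_sum entry_ut_gscale gcoeff_simps)
          also have "\<dots> = gcoeff (entry r s (reductions ps (\<lambda>w. act a \<phi> unit_at_empty w {..<n}) q)) T"
            unfolding reductions_coefficient k ..
          also have "reductions ps (\<lambda>w. act a \<phi> unit_at_empty w {..<n}) q = 0"
            by (rule reductions_ut_zero[where m = 0])
              (use ps ny[OF ps(1)] rank_of_mono in \<open>auto simp: diag_order_def unit_at_empty_def entry_simps\<close>)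
          finally show "gcoeff (entry r s (evaluate ut_gscale \<phi> (\<Sum>w\<in>types. fscale (\<kappa> w) (polarize a n w)))) T = gcoeff (entry r s 0) T" .
        qed
        then have "(\<Sum>w\<in>types. fscale (\<kappa> w) (polarize a n w)) \<in> ?W"
          unfolding identities_iff using sum_scale_multilinear by blast
        then show ?thesis unfolding expand[OF k] by (rule WS)
      next
        case False
        show ?thesis unfolding other[OF ps(1) False] by (rule fs.subspace_0[OF S])
      qed
    qed
    then show "\<exists>c. polarize a n w - (\<Sum>t\<in>product_words a b. fscale (c t) (v t)) \<in> ?W" by simp
  next
    fix c t assume c: "(\<Sum>t\<in>product_words a b. fscale (c t) (v t)) \<in> ?W" and t: "t \<in> product_words a b"
    define U where "U w = (\<Sum>t\<in>product_words a b. c t * \<kappa> t w)" for w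
    have "(\<Sum>t\<in>product_words a b. fscale (c t) (v t)) = (\<Sum>t\<in>product_words a b. \<Sum>w\<in>types. fscale (c t * \<kappa> t w) (polarize a n w))"
      by (rule sum.cong[OF refl]) (simp add: v fs.scale_sum_right)
    also have "\<dots> = (\<Sum>w\<in>types. fscale (U w) (polarize a n w))"
      unfolding U_def fs.scale_sum_left by (rule sum.swap)
    finally have id: "(\<Sum>w\<in>types. fscale (U w) (polarize a n w)) \<in> ?W" using c by simp
    show "c t = 0"
    proof (rule test_functionals_separate[where k = 3, OF finite_product_words _ _ t])
      show "set ps \<subseteq> bad_words \<and> u \<in> normal_words \<and> length ps < 3" if "(ps, u) \<in> product_words a b" for ps u
        using that unfolding product_words_def by simp
      fix h :: "bool list \<Rightarrow> 'k" assume "test_functional 3 h"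
      then have "(\<Sum>w\<in>types. U w * h w) = 0" by (rule test_functional_vanishes[OF id])
      moreover have "(\<Sum>w\<in>types. U w * h w) = (\<Sum>t\<in>product_words a b. \<Sum>w\<in>types. c t * \<kappa> t w * h w)"
        unfolding U_def sum_distrib_right by (rule sum.swap)
      moreover have "\<dots> = (\<Sum>t\<in>product_words a b. c t * reductions (fst t) h (snd t))"
        by (rule sum.cong[OF refl]) (simp add: \<kappa> sum_distrib_left mult.assoc)
      ultimately show "(\<Sum>t\<in>product_words a b. c t * reductions (fst t) h (snd t)) = 0" by simp
    qed
  qed
qed

section \<open>Counting\<close>

definition bad_code :: "bool \<Rightarrow> nat \<Rightarrow> nat \<Rightarrow> bool list" where
  "bad_code e i j = (if e then xy (Suc i) (Suc j) @ [True] else False # xy i (Suc j) @ [True])"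

definition normal_code :: "bool \<Rightarrow> nat \<Rightarrow> nat \<Rightarrow> bool list" where
  "normal_code e i j = (if e then False # xy (Suc i) j else xy i j)"

lemma bad_code_degree:
  "nx (bad_code e i j) = i + (if e then 2 else 1)" "ny (bad_code e i j) = j + (if e then 1 else 2)"
  by (simp_all add: bad_code_def)

lemma normal_code_degree:
  "nx (normal_code e i j) = i + (if e then 1 else 0)" "ny (normal_code e i j) = j + (if e then 1 else 0)"
  by (simp_all add: normal_code_def)

lemma bad_code_inject: "bad_code e i j = bad_code e' i' j' \<longleftrightarrow> e = e' \<and> i = i' \<and> j = j'"
proof
  assume eq: "bad_code e i j = bad_code e' i' j'"
  have hd: "hd (bad_code e i j) = e" for e i j by (simp add: bad_code_def xy_snoc(3))
  have "e = e'" using arg_cong[OF eq, of hd] unfolding hd .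
  then show "e = e' \<and> i = i' \<and> j = j'"
    using arg_cong[OF eq, of nx] arg_cong[OF eq, of ny] unfolding bad_code_degree by simp
qed simp

lemma normal_code_inject: "normal_code e i j = normal_code e' i' j' \<longleftrightarrow> e = e' \<and> i = i' \<and> j = j'"
proof
  assume eq: "normal_code e i j = normal_code e' i' j'"
  have mx: "(mx (normal_code e i j) \<noteq> 0) = e" for e i j
    by (cases e) (simp_all only: normal_code_def if_True if_False mx_xy mx_yxy, simp_all)
  have "e = e'" using arg_cong[OF eq, of "\<lambda>w. mx w \<noteq> 0"] unfolding mx .
  then show "e = e' \<and> i = i' \<and> j = j'"
    using arg_cong[OF eq, of nx] arg_cong[OF eq, of ny] unfolding normal_code_degree by simp
qed simp

lemma bad_codes: "p \<in> bad_words \<longleftrightarrow> (\<exists>e i j. p = bad_code e i j)"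
proof
  assume "p \<in> bad_words"
  then consider i j where "p = bad_code True i j" | i j where "p = bad_code False i j"
    unfolding bad_words_def bad_code_def if_True if_False by blast
  then show "\<exists>e i j. p = bad_code e i j" by cases blast+
next
  assume "\<exists>e i j. p = bad_code e i j"
  then obtain e i j where p: "p = bad_code e i j" by blast
  show "p \<in> bad_words" unfolding p bad_words_def bad_code_def by (cases e) auto
qed

lemma normal_codes: "p \<in> normal_words \<longleftrightarrow> (\<exists>e i j. p = normal_code e i j)"
proof
  assume "p \<in> normal_words"
  then consider i j where "p = normal_code True i j" | i j where "p = normal_code False i j"
    unfolding normal_words_def normal_code_def if_True if_False by blast
  then show "\<exists>e i j. p = normal_code e i j" by cases blast+
next
  assume "\<exists>e i j. p = normal_code e i j"
  then obtain e i j where p: "p = normal_code e i j" by blast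
  show "p \<in> normal_words" unfolding p normal_words_def normal_code_def by (cases e) auto
qed

definition one_part :: "nat \<Rightarrow> nat \<Rightarrow> nat set" where "one_part a s = {i. i + s = a}"
definition two_parts :: "nat \<Rightarrow> nat \<Rightarrow> (nat \<times> nat) set" where "two_parts a s = {(i, k). i + k + s = a}"
definition three_parts :: "nat \<Rightarrow> nat \<Rightarrow> (nat \<times> nat \<times> nat) set" where "three_parts a s = {(i, i', k). i + i' + k + s = a}"

lemma one_part: "finite (one_part a s)" "card (one_part a s) = (if s \<le> a then 1 else 0)"
proof -
  have "one_part a s = (if s \<le> a then {a - s} else {})" unfolding one_part_def by auto
  then show "finite (one_part a s)" "card (one_part a s) = (if s \<le> a then 1 else 0)" by simp_all
qed

lemma two_parts: "finite (two_parts a s)" "card (two_parts a s) = a + 1 - s"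
proof -
  have e: "two_parts a s = (\<lambda>i. (i, a - s - i)) ` {..<a + 1 - s}"
    unfolding two_parts_def by (auto simp: image_iff)
  have "inj_on (\<lambda>i. (i, a - s - i)) {..<a + 1 - s}" by (simp add: inj_on_def)
  then show "finite (two_parts a s)" "card (two_parts a s) = a + 1 - s" unfolding e by (simp_all add: card_image)
qed

lemma three_parts: "finite (three_parts a s)" "card (three_parts a s) = (a + 2 - s) choose 2"
proof -
  have e: "three_parts a s = (SIGMA i:{..<a + 1 - s}. two_parts a (s + i))"
    unfolding three_parts_def two_parts_def by auto
  have tri: "(\<Sum>i<m. m - i) = Suc m choose 2" for m :: nat
  proof (induction m)
    case (Suc m)
    have "(\<Sum>i<Suc m. Suc m - i) = Suc m + (\<Sum>i<m. m - i)" unfolding sum.lessThan_Suc_shift by simp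
    then show ?case unfolding Suc by (simp add: numeral_2_eq_2)
  qed simp
  show "finite (three_parts a s)" unfolding e using two_parts(1) by simp
  have "card (three_parts a s) = (\<Sum>i<a + 1 - s. a + 1 - s - i)"
    unfolding e using two_parts by simp
  also have "\<dots> = Suc (a + 1 - s) choose 2" by (rule tri)
  also have "\<dots> = (a + 2 - s) choose 2"
  proof (cases "s \<le> a + 1")
    case False
    then show ?thesis by (simp add: numeral_2_eq_2)
  qed (simp add: Suc_diff_le)
  finally show "card (three_parts a s) = (a + 2 - s) choose 2" .
qed

text \<open>The degrees of the words with code \<open>e 0 0\<close>: in \<open>x\<close> and in \<open>y\<close> of a bad word, in either variable of a normal word.\<close>

abbreviation bx :: "bool \<Rightarrow> nat" where "bx e \<equiv> (if e then 2 else 1)"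
abbreviation bY :: "bool \<Rightarrow> nat" where "bY e \<equiv> (if e then 1 else 2)"
abbreviation nd :: "bool \<Rightarrow> nat" where "nd e \<equiv> (if e then 1 else 0)"

text \<open>The degrees of the factors are free apart from the total degree; the choices in \<open>x\<close> and in \<open>y\<close> are
  independent once the flags of the factors are fixed.\<close>

lemma card_product_words:
  "card (product_words a b) = (\<Sum>d\<in>UNIV. card (one_part a (nd d)) * card (one_part b (nd d)))
    + (\<Sum>e\<in>UNIV. \<Sum>d\<in>UNIV. card (two_parts a (bx e + nd d)) * card (two_parts b (bY e + nd d)))
    + (\<Sum>e\<in>UNIV. \<Sum>e'\<in>UNIV. \<Sum>d\<in>UNIV. card (three_parts a (bx e + bx e' + nd d)) * card (three_parts b (bY e + bY e' + nd d)))"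
proof -
  define S0 where "S0 = (SIGMA d:(UNIV :: bool set). one_part a (nd d) \<times> one_part b (nd d))"
  define S1 where "S1 = (SIGMA e:(UNIV :: bool set). SIGMA d:(UNIV :: bool set). two_parts a (bx e + nd d) \<times> two_parts b (bY e + nd d))"
  define S2 where "S2 = (SIGMA e:(UNIV :: bool set). SIGMA e':(UNIV :: bool set). SIGMA d:(UNIV :: bool set).
     three_parts a (bx e + bx e' + nd d) \<times> three_parts b (bY e + bY e' + nd d))"
  define g0 :: "bool \<times> nat \<times> nat \<Rightarrow> bool list list \<times> bool list" where "g0 = (\<lambda>(d, k, l). ([], normal_code d k l))"
  define g1 :: "bool \<times> bool \<times> (nat \<times> nat) \<times> nat \<times> nat \<Rightarrow> bool list list \<times> bool list" where
    "g1 = (\<lambda>(e, d, (i, k), j, l). ([bad_code e i j], normal_code d k l))"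
  define g2 :: "bool \<times> bool \<times> bool \<times> (nat \<times> nat \<times> nat) \<times> nat \<times> nat \<times> nat \<Rightarrow> bool list list \<times> bool list" where
    "g2 = (\<lambda>(e, e', d, (i, i', k), j, j', l). ([bad_code e i j, bad_code e' i' j'], normal_code d k l))"
  have inj: "inj g0" "inj g1" "inj g2"
    unfolding g0_def g1_def g2_def inj_def by (auto simp: bad_code_inject normal_code_inject)
  have eq: "product_words a b = g0 ` S0 \<union> g1 ` S1 \<union> g2 ` S2"
  proof
    show "product_words a b \<subseteq> g0 ` S0 \<union> g1 ` S1 \<union> g2 ` S2"
    proof
      fix t assume t: "t \<in> product_words a b"
      obtain ps u where tp: "t = (ps, u)" by (cases t)
      have p: "set ps \<subseteq> bad_words" "length ps < 3" "u \<in> normal_words" "nx (concat ps @ u) = a" "ny (concat ps @ u) = b"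
        using t unfolding tp product_words_def by blast+
      obtain d k l where u: "u = normal_code d k l" using p(3) unfolding normal_codes by blast
      consider "ps = []" | q where "ps = [q]" | q q' where "ps = [q, q']"
        using p(2) by (cases ps; cases "tl ps"; cases "tl (tl ps)") auto
      then show "t \<in> g0 ` S0 \<union> g1 ` S1 \<union> g2 ` S2"
      proof cases
        case 1
        have "t = g0 (d, k, l)" unfolding g0_def tp 1 u by simp
        moreover have "(d, k, l) \<in> S0" using p(4,5) unfolding S0_def one_part_def 1 u by (simp add: normal_code_degree)
        ultimately show ?thesis by blast
      next
        case (2 q)
        obtain e i j where q: "q = bad_code e i j" using p(1) unfolding 2 by (auto simp: bad_codes)
        have "t = g1 (e, d, (i, k), j, l)" unfolding g1_def tp 2 u q by simp
        moreover have "(e, d, (i, k), j, l) \<in> S1"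
          using p(4,5) unfolding S1_def two_parts_def 2 u q by (simp add: normal_code_degree bad_code_degree)
        ultimately show ?thesis by blast
      next
        case (3 q q')
        obtain e i j where q: "q = bad_code e i j" using p(1) unfolding 3 by (auto simp: bad_codes)
        obtain e' i' j' where q': "q' = bad_code e' i' j'" using p(1) unfolding 3 by (auto simp: bad_codes)
        have "t = g2 (e, e', d, (i, i', k), j, j', l)" unfolding g2_def tp 3 u q q' by simp
        moreover have "(e, e', d, (i, i', k), j, j', l) \<in> S2"
          using p(4,5) unfolding S2_def three_parts_def 3 u q q' by (simp add: normal_code_degree bad_code_degree)
        ultimately show ?thesis by blast
      qed
    qed
    have bad: "bad_code e i j \<in> bad_words" and nor: "normal_code e i j \<in> normal_words" for e i j
      unfolding bad_codes normal_codes by blast+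
    show "g0 ` S0 \<union> g1 ` S1 \<union> g2 ` S2 \<subseteq> product_words a b"
      unfolding g0_def g1_def g2_def S0_def S1_def S2_def one_part_def two_parts_def three_parts_def product_words_def
      by (auto simp: bad nor normal_code_degree bad_code_degree simp del: One_nat_def)
  qed
  have fin: "finite S0" "finite S1" "finite S2"
    unfolding S0_def S1_def S2_def using one_part(1) two_parts(1) three_parts(1) by simp_all
  have len: "length (fst (g0 x)) = 0" "length (fst (g1 y)) = 1" "length (fst (g2 z)) = 2" for x y z
    unfolding g0_def g1_def g2_def by (simp_all split: prod.splits)
  have ne: "g0 x \<noteq> g1 y" "g0 x \<noteq> g2 z" "g1 y \<noteq> g2 z" for x y z
    using len(1)[of x] len(2)[of y] len(3)[of z] by auto
  have "g0 ` S0 \<inter> g1 ` S1 = {}" "(g0 ` S0 \<union> g1 ` S1) \<inter> g2 ` S2 = {}" using ne by (blast, blast)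
  then have "card (product_words a b) = card (g0 ` S0) + card (g1 ` S1) + card (g2 ` S2)"
    unfolding eq using fin by (simp add: card_Un_disjoint)
  also have "\<dots> = card S0 + card S1 + card S2"
    using inj by (simp add: card_image inj_on_subset[OF _ subset_UNIV])
  finally show ?thesis
    unfolding S0_def S1_def S2_def using one_part(1) two_parts(1) three_parts(1) by (simp add: card_cartesian_product)
qed

text \<open>The multiplicity of the hook with arm \<open>p\<close> and leg \<open>q\<close>. With truncated subtraction the formula also covers the
  small cases.\<close>

definition hook_multiplicity :: "nat \<Rightarrow> nat \<Rightarrow> nat" where
  "hook_multiplicity p q = 1 + p * q + (p - 1) * (q - 1) + (p - 1 choose 2) * (q choose 2) + (p choose 2) * (q - 1 choose 2)
     + (p - 2 choose 2) * (q - 1 choose 2) + (p - 1 choose 2) * (q - 2 choose 2)"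

text \<open>The terms with \<open>a - 1\<close> and \<open>b\<close> and those with \<open>a\<close> and \<open>b - 1\<close> are the contributions of the two hooks of
  Pieri's rule.\<close>

lemma card_product_words_hook:
  assumes a: "1 \<le> a"
  shows "card (product_words a b) = hook_multiplicity (a - 1) b + (if b = 0 then 0 else hook_multiplicity a (b - 1))"
proof -
  have card: "card (product_words a b) = 1 + (if 1 \<le> b then 1 else 0)
    + (((a + 1 - 3) * (b + 1 - 2) + (a + 1 - 2) * (b + 1 - 1)) + ((a + 1 - 2) * (b + 1 - 3) + (a + 1 - 1) * (b + 1 - 2)))
    + (((a + 2 - 5 choose 2) * (b + 2 - 3 choose 2) + (a + 2 - 4 choose 2) * (b + 2 - 2 choose 2))
     + 2 * ((a + 2 - 4 choose 2) * (b + 2 - 4 choose 2) + (a + 2 - 3 choose 2) * (b + 2 - 3 choose 2))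
     + ((a + 2 - 3 choose 2) * (b + 2 - 5 choose 2) + (a + 2 - 2 choose 2) * (b + 2 - 4 choose 2)))"
    unfolding card_product_words one_part(2) two_parts(2) three_parts(2) UNIV_bool using a by (simp add: eval_nat_numeral)
  have d: "a + 1 - 3 = a - 2" "a + 1 - 2 = a - 1" "a + 1 - 1 = a" "b + 1 - 2 = b - 1" "b + 1 - 1 = b" "b + 1 - 3 = b - 2"
    "a + 2 - 5 = a - 3" "a + 2 - 4 = a - 2" "a + 2 - 3 = a - 1" "a + 2 - 2 = a"
    "b + 2 - 5 = b - 3" "b + 2 - 4 = b - 2" "b + 2 - 3 = b - 1" "b + 2 - 2 = b" by simp_all
  have e: "a - 1 - 1 = a - 2" "a - 1 - 2 = a - 3" "b - 1 - 1 = b - 2" "b - 1 - 2 = b - 3" by simp_all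
  show ?thesis
  proof (cases "b = 0")
    case True
    then show ?thesis unfolding card hook_multiplicity_def by (simp add: numeral_2_eq_2)
  next
    case False
    then have b: "1 \<le> b" by simp
    show ?thesis unfolding card d hook_multiplicity_def e if_P[OF b] if_not_P[OF False] by (simp only: distrib_left mult_2 ac_simps)
  qed
qed

section \<open>The multiplicities\<close>

text \<open>Pieri's rule determines the multiplicity of a hook from that of the hook with a shorter leg.\<close>

lemma hook_cocharacter_multiplicity:
  assumes "1 \<le> a"
  shows "cocharacter_multiplicity (ut_gscale :: 'k::field_char_0 \<Rightarrow> ('k grassmann, 3) ut \<Rightarrow> ('k grassmann, 3) ut) (a # replicate b 1)
    = hook_multiplicity (a - 1) b"
  using assms
proof (induction b arbitrary: a)
  case (0 a)
  define n where "n = a + 0"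
  interpret superization a 0 n by unfold_locales (simp add: n_def)
  interpret R: sym_rep "multilinear n :: (nat list \<Rightarrow> 'k) set" "identities TYPE(3) n" n rename_vars
    by (rule multilinear_sym_rep)
  have n: "n = a + 0" by (simp add: n_def)
  have ch: "cocharacter (ut_gscale :: 'k \<Rightarrow> ('k grassmann, 3) ut \<Rightarrow> ('k grassmann, 3) ut) n = R.character"
    by (rule cocharacter_character)
  have "(of_nat (fact a * fact 0 * (char_multiplicity n R.character (a # replicate 0 1)
       + (if (0::nat) = 0 then 0 else char_multiplicity n R.character (Suc a # replicate (0 - 1) 1)))) :: 'k)
    = of_nat (fact a * fact 0 * card (product_words a 0))"
    using R.hook_multiplicities[OF 0 n] alternating_value[where 'k = 'k] unfolding ch n[symmetric] by simp
  then have "fact a * fact 0 * char_multiplicity n R.character [a] = fact a * fact 0 * card (product_words a 0)"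
    unfolding of_nat_eq_iff by simp
  then have "char_multiplicity n R.character [a] = card (product_words a 0)" by simp
  moreover have "sum_list [a] = n" by (simp add: n_def)
  ultimately show ?case
    unfolding cocharacter_multiplicity_def card_product_words_hook[OF 0] ch[symmetric] by simp
next
  case (Suc b a)
  define n where "n = a + Suc b"
  interpret superization a "Suc b" n by unfold_locales (simp add: n_def)
  interpret R: sym_rep "multilinear n :: (nat list \<Rightarrow> 'k) set" "identities TYPE(3) n" n rename_vars
    by (rule multilinear_sym_rep)
  have n: "n = a + Suc b" by (simp add: n_def)
  have ch: "cocharacter (ut_gscale :: 'k \<Rightarrow> ('k grassmann, 3) ut \<Rightarrow> ('k grassmann, 3) ut) n = R.character"
    by (rule cocharacter_character)
  have s: "sum_list (a # replicate (Suc b) 1) = n" "sum_list (Suc a # replicate b 1) = n"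
    by (simp_all add: n_def sum_list_replicate)
  have next_mult: "char_multiplicity n R.character (Suc a # replicate b 1) = hook_multiplicity a b"
    using Suc(1)[of "Suc a"] unfolding cocharacter_multiplicity_def s ch by simp
  have "(of_nat (fact a * fact (Suc b) * (char_multiplicity n R.character (a # replicate (Suc b) 1) + hook_multiplicity a b)) :: 'k)
    = of_nat (fact a * fact (Suc b) * card (product_words a (Suc b)))"
    using R.hook_multiplicities[OF Suc(2) n] alternating_value[where 'k = 'k]
    unfolding ch n[symmetric] next_mult[symmetric] by (simp only: diff_Suc_1 nat.distinct if_False)
  then have "fact a * fact (Suc b) * (char_multiplicity n R.character (a # replicate (Suc b) 1) + hook_multiplicity a b)
    = fact a * fact (Suc b) * card (product_words a (Suc b))" by (simp only: of_nat_eq_iff)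
  moreover have "fact a * fact (Suc b) \<noteq> (0 :: nat)" by (simp only: mult_eq_0_iff fact_nonzero) simp
  ultimately have "char_multiplicity n R.character (a # replicate (Suc b) 1) + hook_multiplicity a b = card (product_words a (Suc b))"
    by (simp only: mult_cancel_left simp_thms)
  then have "char_multiplicity n R.character (a # replicate (Suc b) 1) = hook_multiplicity (a - 1) (Suc b)"
    unfolding card_product_words_hook[OF Suc(2)] by simp
  then show ?case unfolding cocharacter_multiplicity_def s ch .
qed

lemma Sym_0: "Sym 0 = {id}"
  by (simp add: Sym_def)

lemma empty_cocharacter_multiplicity:
  "cocharacter_multiplicity (ut_gscale :: 'k::field_char_0 \<Rightarrow> ('k grassmann, 3) ut \<Rightarrow> ('k grassmann, 3) ut) [] = 1"
proof -
  interpret superization 0 0 0 by unfold_locales simp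
  interpret R: sym_rep "multilinear 0 :: (nat list \<Rightarrow> 'k) set" "identities TYPE(3) 0" 0 rename_vars
    by (rule multilinear_sym_rep)
  have ch: "cocharacter (ut_gscale :: 'k \<Rightarrow> ('k grassmann, 3) ut \<Rightarrow> ('k grassmann, 3) ut) 0 = R.character"
    by (rule cocharacter_character)
  have p: "[] \<in> partitions_of 0" by (simp add: partitions_of_def)
  have stab: "row_stabilizer [] = {id}" "column_stabilizer [] = {id}"
    unfolding row_stabilizer_def column_stabilizer_def by (simp_all add: Sym_0)
  have y: "young_symmetrizer [] id = (1 :: 'k)" unfolding young_symmetrizer_def stab by (simp add: sign_id)
  have h: "hook_factor [] = (1 :: 'k)"
    unfolding hook_factor_def group_algebra_mult_def by (simp add: Sym_0 y inv_id)
  have "young_value 0 R.character [] = R.character id" unfolding young_value_def by (simp add: Sym_0 y)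
  moreover have "R.character id = (1 :: 'k)"
  proof -
    have "sym_alt_value R.character {..<0} {0..<0} = R.character id"
      unfolding sym_alt_value_def Perms_def by (simp add: sign_id)
    moreover have "card (product_words 0 0) = 1"
      unfolding card_product_words one_part(2) two_parts(2) three_parts(2) UNIV_bool by (simp add: numeral_2_eq_2)
    ultimately show ?thesis using alternating_value[where 'k = 'k] unfolding ch by simp
  qed
  ultimately have "(1 :: 'k) = of_nat (char_multiplicity 0 R.character [])"
    using R.multiplicity_young_value[OF p] h by simp
  then have "char_multiplicity 0 R.character [] = 1" by (metis of_nat_1 of_nat_eq_iff)
  then show ?thesis unfolding cocharacter_multiplicity_def by (simp add: ch)
qed

lemma choose_two_rat: "(of_nat (m choose 2) :: rat) = of_nat m * (of_nat m - 1) / 2"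
proof (induction m)
  case (Suc m)
  have "Suc m choose 2 = m + (m choose 2)" by (simp add: numeral_2_eq_2)
  then show ?case using Suc by (simp add: field_simps)
qed (simp add: numeral_2_eq_2)

lemma hook_multiplicity_polynomial:
  assumes "3 \<le> n" "2 \<le> m"
  shows "rat_of_nat (hook_multiplicity (n - 1) m) = 1 / 4 *
      (76 - 90 * of_nat m + 26 * of_nat m ^ 2 - 54 * of_nat n + 68 * of_nat m * of_nat n
       - 20 * of_nat m ^ 2 * of_nat n + 10 * of_nat n ^ 2 - 12 * of_nat m * of_nat n ^ 2
       + 4 * of_nat m ^ 2 * of_nat n ^ 2)"
proof -
  obtain k l where k: "n = k + 3" "m = l + 2" using assms by (metis add.commute le_Suc_ex)
  have e: "k + 3 - 1 = k + 2" "k + 2 - 1 = k + 1" "k + 2 - 2 = k" "l + 2 - 1 = l + 1" "l + 2 - 2 = l" by simp_all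
  show ?thesis
    unfolding k e hook_multiplicity_def of_nat_add of_nat_mult choose_two_rat
    by (simp add: field_simps power2_eq_square)
qed

theorem theorem9p5:
  fixes \<alpha> :: "nat list" and mu :: nat
  assumes "\<alpha> \<in> H11"
    and "mu = cocharacter_multiplicity
      (ut_scale gscale :: 'k::field_char_0 \<Rightarrow> ('k grassmann, 3) ut \<Rightarrow> ('k grassmann, 3) ut) \<alpha>"
  shows "(\<alpha> = [] \<or> (\<exists>n\<ge>1. \<alpha> = [n]) \<longrightarrow> mu = 1)
    \<and> (\<forall>m>1. \<alpha> = replicate m 1 \<longrightarrow> mu = 1)
    \<and> (\<forall>n\<ge>2. \<alpha> = [n, 1] \<longrightarrow> mu = n)
    \<and> (\<forall>m\<ge>2. \<alpha> = 2 # replicate m 1 \<longrightarrow> mu = m + 1)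
    \<and> (\<forall>n m :: nat. n \<ge> 3 \<and> m \<ge> 2 \<and> \<alpha> = n # replicate m 1 \<longrightarrow>
        rat_of_nat mu = 1 / 4 *
          (76 - 90 * of_nat m + 26 * of_nat m ^ 2 - 54 * of_nat n + 68 * of_nat m * of_nat n
           - 20 * of_nat m ^ 2 * of_nat n + 10 * of_nat n ^ 2 - 12 * of_nat m * of_nat n ^ 2
           + 4 * of_nat m ^ 2 * of_nat n ^ 2))"
proof -
  have hook: "mu = hook_multiplicity (a - 1) b" if "1 \<le> a" "\<alpha> = a # replicate b 1" for a b
    using hook_cocharacter_multiplicity[OF that(1), where 'k = 'k] assms(2) unfolding that(2) by simp
  have c2: "(0 choose 2) = (0::nat)" "(1 choose 2) = (0::nat)" by (simp_all add: numeral_2_eq_2)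
  show ?thesis
  proof (intro conjI allI impI)
    assume "\<alpha> = [] \<or> (\<exists>n\<ge>1. \<alpha> = [n])"
    then show "mu = 1"
    proof (elim disjE exE conjE)
      assume "\<alpha> = []"
      then show ?thesis using empty_cocharacter_multiplicity[where 'k = 'k] assms(2) by simp
    next
      fix n assume n: "1 \<le> n" "\<alpha> = [n]"
      have "mu = hook_multiplicity (n - 1) 0" by (rule hook) (use n in simp_all)
      then show ?thesis by (simp add: hook_multiplicity_def c2)
    qed
  next
    fix m :: nat assume m: "1 < m" "\<alpha> = replicate m 1"
    have "mu = hook_multiplicity (1 - 1) (m - 1)" by (rule hook) (use m in \<open>simp_all add: replicate_Suc[symmetric]\<close>)
    then show "mu = 1" by (simp add: hook_multiplicity_def c2)
  next
    fix n :: nat assume n: "2 \<le> n" "\<alpha> = [n, 1]"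
    have "mu = hook_multiplicity (n - 1) 1" by (rule hook) (use n in simp_all)
    then show "mu = n" using n(1) by (simp add: hook_multiplicity_def c2)
  next
    fix m :: nat assume m: "2 \<le> m" "\<alpha> = 2 # replicate m 1"
    have "mu = hook_multiplicity (2 - 1) m" by (rule hook) (use m in simp_all)
    then show "mu = m + 1" by (simp add: hook_multiplicity_def c2)
  next
    fix n m :: nat assume nm: "n \<ge> 3 \<and> m \<ge> 2 \<and> \<alpha> = n # replicate m 1"
    have "mu = hook_multiplicity (n - 1) m" by (rule hook) (use nm in simp_all)
    then show "rat_of_nat mu = 1 / 4 *
          (76 - 90 * of_nat m + 26 * of_nat m ^ 2 - 54 * of_nat n + 68 * of_nat m * of_nat n
           - 20 * of_nat m ^ 2 * of_nat n + 10 * of_nat n ^ 2 - 12 * of_nat m * of_nat n ^ 2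
           + 4 * of_nat m ^ 2 * of_nat n ^ 2)"
      using hook_multiplicity_polynomial[of n m] nm by simp
  qed
qed

end
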